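(* Let $M$ be a Riemann surface and let $\varphi:M\to G_2/\mathrm{SO}(4)$ be a harmonic map of finite uniton number. Let $\Phi:M\to\Omega G_2$ be a (polynomial) extended solution for $\varphi$ (with $\Phi_{-1}=\varphi$), and let $s\in\{1,2,3\}$ be the least integer such that $\mathcal W=\Phi\mathcal H_+$ satisfies $\lambda^s\mathcal H_+\subset\mathcal W\subset\lambda^{-s}\mathcal H_+$. Then the canonical lift $\psi$ of $\varphi$ defined by $\Phi$ gives a $J_2$-holomorphic lift of $\varphi$ into $\mathcal T_s$. In particular, $\varphi$ is nilconformal with $s(\varphi)\le s$.
   Context: **Octonions and $G_2$.** $\mathbb{O}$ is the algebra of octonions, $\mathrm{Im}\,\mathbb{O}\cong\mathbb{R}^7$ its imaginary part with the standard Euclidean inner product $(\cdot,\cdot)$ and vector product $v\times w=$ imaginary part of $v\cdot w$; both are extended complex-bilinearly to $\mathbb{C}^7=\mathrm{Im}\,\mathbb{O}\otimes\mathbb{C}$. $\perp$ denotes orthogonal complement for the Hermitian inner product $(v,\overline w)$; $A\ominus B=A\cap B^\perp$ for $B\subset A$. $G_2=\mathrm{Aut}(\mathbb{O})\subset\mathrm{SO}(7)\subset \mathrm U(7)$. A real 3-dimensional subspace of $\mathrm{Im}\,\mathbb{O}$ is associative if it is the imaginary part of a subalgebra isomorphic to the quaternions $\mathbb{H}$; $G_2/\mathrm{SO}(4)$ is the symmetric space of all associative 3-dimensional subspaces (identified with their complexifications). **Flags.** For $s=1,2,3$, $F_s$ is the set of tuples $\psi=(\psi_{-s},\dots,\psi_s)$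 of mutually orthogonal complex subspaces (legs) with $\bigoplus\psi_i=\mathbb{C}^7$, $\psi_{-i}=\overline\psi_i$, and $(\dim\psi_0,\dim\psi_1,\dots,\dim\psi_s)=(3,2)$, $(1,2,1)$, $(1,1,1,1)$ respectively. $\mathcal T_s\subset F_s$ is the set of $G_2$-flags: $\psi_i\times\psi_j\subset\psi_{i+j}$ for all $i,j\in\mathbb{Z}$ (with $\psi_i=0$ for $|i|>s$). On the complex flag manifold containing $F_s$, with complexified tangent space $\bigoplus_{i\ne j}\mathrm{Hom}(\psi_i,\psi_j)$ at $\psi$, the almost complex structure $J_2$ has $(1,0)$-space $\bigoplus_{i<j,\ j-i\text{ odd}}\mathrm{Hom}(\psi_i,\psi_j)\oplus\bigoplus_{j<i,\ i-j\text{ even}}\mathrm{Hom}(\psi_i,\psi_j)$; it restricts to $F_s$ and to $\mathcal T_s$. The projection $\mathcal T_s\to G_2/\mathrm{SO}(4)$ is $\psi\mapsto\bigoplus_{i\text{ even}}\psi_i$. A $J_2$-holomorphic lift of $\varphi$ into $\mathcal T_s$ is a $J_2$-holomorphic map $M\to\mathcal T_s$ projecting to $\varphi$. **Maps.** A Riemann surface is a connected (not necessarily compact) one-dimensional complex manifold. A map $\varphi:M\to G_2/\mathrm{SO}(4)$ is identified with a rank 3 subbundle of $\underline{\mathbb{C}}^7=M\times\mathbb{C}^7$, and with the map $\pi_\varphi-\pi_{\varphi^\perp}$ into $G_2\subset\mathrm U(7)$ ($\pi_V$ = orthogonal projection onto $V$). In a local complex coordinate $z$, $A^\varphi_z=\frac12\varphi^{-1}\varphi_z$,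 $A^\varphi_{\bar z}=\frac12\varphi^{-1}\varphi_{\bar z}$. $\varphi$ is nilconformal if $(A^\varphi_z)^r=0$ for some $r\in\mathbb N$; then $s(\varphi)$ is the least positive integer $s$ with $(A^\varphi_z)^{2s}\bigl((-1)^{s-1}\varphi\bigr)=0$, where $-\varphi$ denotes $\varphi^\perp$. **Extended solutions.** $\Omega G_2$ is the group of loops $\gamma:S^1\to G_2$ with $\gamma(1)=e$. An extended solution for $\varphi$ is a smooth map $\Phi:M\to\Omega G_2$ with $\Phi_\lambda^{-1}\partial_z\Phi_\lambda=(1-\lambda^{-1})A^\varphi_z$, $\Phi_\lambda^{-1}\partial_{\bar z}\Phi_\lambda=(1-\lambda)A^\varphi_{\bar z}$; polynomial means that it is a Laurent polynomial in $\lambda$. $\varphi$ is of finite uniton number if it has a polynomial extended solution with $\Phi_{-1}=g\varphi$ for some $g\in G_2$; replacing $\varphi$ by $g\varphi$ one normalizes $\Phi_{-1}=\varphi$. $\mathcal H_+=\{\sum_{i\ge0}\lambda^iv_i\}\subset L^2(S^1,\mathbb{C}^7)$, and $\mathcal W=\Phi\mathcal H_+$. **Canonical lift.** $\Phi$ gives an isomorphism $\underline{\mathbb{C}}^7\cong\mathcal H_+/\lambda\mathcal H_+\to\mathcal W/\lambda\mathcal W$. The filtration of $\mathcal W$ by the $\mathcal W\cap\lambda^i\mathcal H_+$, $i=-s,\dots,s+1$, descends to a filtration of $\mathcal W/\lambda\mathcal W$, and hence gives one of $\underline{\mathbb{C}}^7$. Explicitly, let $P_0:\mathcal H_+\to\underline{\mathbb{C}}^7$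 take the coefficient of $\lambda^0$ and put $Z_i=P_0\Phi^{-1}(\mathcal W\cap\lambda^i\mathcal H_+)$ (extended as subbundles over isolated points where the rank drops), $i=-s,\dots,s+1$; this is a decreasing filtration from $Z_{-s}=\underline{\mathbb{C}}^7$ to $Z_{s+1}=0$. The canonical lift of $\varphi$ defined by $\Phi$ is $\psi=(\psi_{-s},\dots,\psi_s)$ with legs $\psi_i=Z_i\ominus Z_{i+1}$.
   Formalization: Two hypotheses are added, since the claim fails without them even for constant maps: Φ is symmetric, Φ_{-λ} = Φ_λ Φ_{-1} (automatic if s=1), and, when s=3, Z_2 ≠ Z_3 away from isolated points (otherwise the legs have dimensions (3,0,0,2), not a flag in F_3). *)

theory Defs
  imports "HOL-Analysis.Analysis"
begin

section \<open>Octonions, quaternions and the group of automorphisms of the octonions\<close>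

text \<open>
  The imaginary units are indexed by the integers modulo 7 (the index type 7, in which
  7 = 0), with multiplication table \<open>e\<^sub>i e\<^sub>i\<^sub>+\<^sub>1 = e\<^sub>i\<^sub>+\<^sub>3\<close> together with its
  cyclic permutations.  The formula makes sense over any commutative ring; over \<^typ>\<open>complex\<close> it
  is the complex-bilinear extension of the real vector product.
\<close>

definition cross7 :: "('a::comm_ring_1)^7 \<Rightarrow> 'a^7 \<Rightarrow> 'a^7" where
  "cross7 v w = (\<chi> k.
       (v $ (k+1) * w $ (k+3) - v $ (k+3) * w $ (k+1))
     + (v $ (k+2) * w $ (k+6) - v $ (k+6) * w $ (k+2))
     + (v $ (k+4) * w $ (k+5) - v $ (k+5) * w $ (k+4)))"

text \<open>An octonion is a pair (real part, imaginary part).\<close>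

definition oct_mult :: "real \<times> (real^7) \<Rightarrow> real \<times> (real^7) \<Rightarrow> real \<times> (real^7)" where
  "oct_mult x y = (fst x * fst y - snd x \<bullet> snd y,
                   fst x *\<^sub>R snd y + fst y *\<^sub>R snd x + cross7 (snd x) (snd y))"

lemma cross7_eq_Im_oct_mult: "cross7 v w = snd (oct_mult (0, v) (0, w))"
  by (simp add: oct_mult_def)

lemma UNIV_7: "(UNIV :: 7 set) = {0, 1, 2, 3, 4, 5, 6}"
proof -
  have "card {0, 1, 2, 3, 4, 5, 6 :: 7} = CARD(7)"
    by simp
  then show ?thesis
    by (metis card_subset_eq finite_class.finite_UNIV subset_UNIV)
qed

text \<open>The norm is multiplicative, so this is the 8-dimensional normed division algebra.\<close>

lemma norm_oct_mult: "norm (oct_mult x y) = norm x * norm y"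
proof -
  have red7: "7 = (0::7)" "8 = (1::7)" "9 = (2::7)" "10 = (3::7)" "11 = (4::7)" "12 = (5::7)"
    by simp_all
  have "(norm (oct_mult x y))\<^sup>2 = (norm x * norm y)\<^sup>2"
    unfolding power_mult_distrib norm_prod_def norm_vec_def L2_set_def oct_mult_def cross7_def inner_vec_def UNIV_7
    by (simp add: sum_nonneg red7) algebra
  then show ?thesis
    by (simp add: power2_eq_iff_nonneg)
qed

text \<open>A quaternion is a pair (real part, imaginary part) as well.\<close>

definition quat_mult :: "real \<times> (real^3) \<Rightarrow> real \<times> (real^3) \<Rightarrow> real \<times> (real^3)" where
  "quat_mult x y = (fst x * fst y - snd x \<bullet> snd y,
                    fst x *\<^sub>R snd y + fst y *\<^sub>R snd x + cross3 (snd x) (snd y))"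

definition oct_automorphism :: "(real \<times> (real^7) \<Rightarrow> real \<times> (real^7)) \<Rightarrow> bool" where
  "oct_automorphism f \<longleftrightarrow>
     linear f \<and> bij f \<and> (\<forall>x y. f (oct_mult x y) = oct_mult (f x) (f y))"

text \<open>The automorphism group of the octonions, acting on \<open>\<complex>\<^sup>7\<close> by complexification of
  its action on the imaginary octonions.\<close>

definition G2 :: "(complex^7^7) set" where
  "G2 = {map_matrix complex_of_real R |R.
           \<exists>f. oct_automorphism f \<and> (\<forall>v. f (0, v) = (0, R *v v))}"

definition quaternion_subalgebra :: "(real \<times> (real^7)) set \<Rightarrow> bool" where
  "quaternion_subalgebra B \<longleftrightarrow>
     (\<exists>f. linear f \<and> inj f \<and> (\<forall>x y. f (quat_mult x y) = oct_mult (f x) (f y)) \<and> B = range f)"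

definition associative_subspace :: "(real^7) set \<Rightarrow> bool" where
  "associative_subspace V \<longleftrightarrow>
     subspace V \<and> dim V = 3 \<and> (\<exists>B. quaternion_subalgebra B \<and> V = snd ` B)"

definition complexification :: "(real^7) set \<Rightarrow> (complex^7) set" where
  "complexification V = {(\<chi> i. Complex (x $ i) (y $ i)) |x y. x \<in> V \<and> y \<in> V}"

definition G2_SO4 :: "(complex^7) set set" where
  "G2_SO4 = complexification ` {V. associative_subspace V}"


section \<open>Linear algebra in complex 7-space\<close>

definition vcnj :: "complex^7 \<Rightarrow> complex^7" where
  "vcnj v = (\<chi> i. cnj (v $ i))"

text \<open>The bilinear extension of the Euclidean inner product; the Hermitian inner product
  of v and w is \<open>cdot v (vcnj w)\<close>.\<close>

definition cdot :: "complex^7 \<Rightarrow> complex^7 \<Rightarrow> complex" where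
  "cdot v w = (\<Sum>i\<in>UNIV. v $ i * w $ i)"

definition perp :: "(complex^7) set \<Rightarrow> (complex^7) set" where
  "perp V = {v. \<forall>w\<in>V. cdot v (vcnj w) = 0}"

definition ominus :: "(complex^7) set \<Rightarrow> (complex^7) set \<Rightarrow> (complex^7) set" where
  "ominus V W = V \<inter> perp W"

definition proj :: "(complex^7) set \<Rightarrow> complex^7^7" where
  "proj V = (THE P. \<forall>v. P *v v \<in> V \<and> v - P *v v \<in> perp V)"

text \<open>The Cartan embedding: the map with which a subbundle is identified.\<close>

definition cartan :: "(complex^7) set \<Rightarrow> complex^7^7" where
  "cartan V = proj V - proj (perp V)"


section \<open>Flags\<close>

definition flags :: "int \<Rightarrow> (int \<Rightarrow> (complex^7) set) set" where
  "flags s = {\<psi>.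
     (\<forall>i. vec.subspace (\<psi> i)) \<and>
     (\<forall>i. \<bar>i\<bar> > s \<longrightarrow> \<psi> i = {0}) \<and>
     (\<forall>i j. i \<noteq> j \<longrightarrow> \<psi> i \<subseteq> perp (\<psi> j)) \<and>
     vec.span (\<Union>i. \<psi> i) = UNIV \<and>
     (\<forall>i. \<psi> (-i) = vcnj ` \<psi> i) \<and>
     (s = 1 \<and> vec.dim (\<psi> 0) = 3 \<and> vec.dim (\<psi> 1) = 2 \<or>
      s = 2 \<and> vec.dim (\<psi> 0) = 1 \<and> vec.dim (\<psi> 1) = 2 \<and> vec.dim (\<psi> 2) = 1 \<or>
      s = 3 \<and> vec.dim (\<psi> 0) = 1 \<and> vec.dim (\<psi> 1) = 1 \<and> vec.dim (\<psi> 2) = 1 \<and> vec.dim (\<psi> 3) = 1)}"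

definition G2_flags :: "int \<Rightarrow> (int \<Rightarrow> (complex^7) set) set" where
  "G2_flags s = {\<psi> \<in> flags s. \<forall>i j. \<forall>v\<in>\<psi> i. \<forall>w\<in>\<psi> j. cross7 v w \<in> \<psi> (i + j)}"

text \<open>\<open>J2_type10 i j\<close> (for \<open>i \<noteq> j\<close>): \<open>Hom(\<psi>\<^sub>i, \<psi>\<^sub>j)\<close> is a summand of the (1,0)-space
  of \<open>J\<^sub>2\<close>.\<close>

definition J2_type10 :: "int \<Rightarrow> int \<Rightarrow> bool" where
  "J2_type10 i j \<longleftrightarrow> i < j \<and> odd (j - i) \<or> j < i \<and> even (i - j)"


section \<open>Smooth maps on Riemann surfaces\<close>

fun Ck_on :: "nat \<Rightarrow> ('a::real_normed_vector \<Rightarrow> 'b::real_normed_vector) \<Rightarrow> 'a set \<Rightarrow> bool" where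
  "Ck_on 0 f S \<longleftrightarrow> continuous_on S f"
| "Ck_on (Suc k) f S \<longleftrightarrow> (\<forall>x\<in>S. f differentiable (at x)) \<and>
     (\<forall>v. Ck_on k (\<lambda>x. frechet_derivative f (at x) v) S)"

text \<open>Used for open sets \<open>S\<close> only.\<close>

definition smooth_on :: "'a::real_normed_vector set \<Rightarrow> ('a \<Rightarrow> 'b::real_normed_vector) \<Rightarrow> bool" where
  "smooth_on S f \<longleftrightarrow> (\<forall>k. Ck_on k f S)"

type_synonym 'm chart = "'m set \<times> ('m \<Rightarrow> complex)"

text \<open>\<open>atlas\<close> makes the whole type \<open>'m\<close> a Riemann surface.  A chart \<open>(U, z)\<close> is a local complex
  coordinate; only the values of \<open>z\<close> on \<open>U\<close> matter.\<close>

definition riemann_surface ::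
    "'m::{t2_space,second_countable_topology} chart set \<Rightarrow> bool" where
  "riemann_surface atlas \<longleftrightarrow>
     connected (UNIV :: 'm set) \<and>
     (\<Union>(U, z)\<in>atlas. U) = UNIV \<and>
     (\<forall>(U, z)\<in>atlas. open U \<and> open (z ` U) \<and> homeomorphism U (z ` U) z (inv_into U z)) \<and>
     (\<forall>(U, z)\<in>atlas. \<forall>(V, w)\<in>atlas. (w \<circ> inv_into U z) holomorphic_on z ` (U \<inter> V))"

definition smooth_map ::
    "'m chart set \<Rightarrow> ('m \<Rightarrow> 'b::real_normed_vector) \<Rightarrow> bool" where
  "smooth_map atlas F \<longleftrightarrow> (\<forall>(U, z)\<in>atlas. smooth_on (z ` U) (F \<circ> inv_into U z))"

definition wirtinger_dz :: "(complex \<Rightarrow> complex) \<Rightarrow> complex \<Rightarrow> complex" where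
  "wirtinger_dz g w = (frechet_derivative g (at w) 1 - \<i> * frechet_derivative g (at w) \<i>) / 2"

definition wirtinger_dzbar :: "(complex \<Rightarrow> complex) \<Rightarrow> complex \<Rightarrow> complex" where
  "wirtinger_dzbar g w = (frechet_derivative g (at w) 1 + \<i> * frechet_derivative g (at w) \<i>) / 2"

definition dz :: "'m chart \<Rightarrow> ('m \<Rightarrow> complex^7^7) \<Rightarrow> 'm \<Rightarrow> complex^7^7" where
  "dz c F p = (case c of (U, z) \<Rightarrow>
     \<chi> i j. wirtinger_dz (\<lambda>w. F (inv_into U z w) $ i $ j) (z p))"

definition dzbar :: "'m chart \<Rightarrow> ('m \<Rightarrow> complex^7^7) \<Rightarrow> 'm \<Rightarrow> complex^7^7" where
  "dzbar c F p = (case c of (U, z) \<Rightarrow>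
     \<chi> i j. wirtinger_dzbar (\<lambda>w. F (inv_into U z w) $ i $ j) (z p))"

definition except_isolated :: "('m::topological_space \<Rightarrow> bool) \<Rightarrow> bool" where
  "except_isolated P \<longleftrightarrow> (\<forall>p. \<not> p islimpt {q. \<not> P q})"

definition smooth_subbundle :: "'m chart set \<Rightarrow> ('m \<Rightarrow> (complex^7) set) \<Rightarrow> bool" where
  "smooth_subbundle atlas V \<longleftrightarrow>
     (\<forall>p. vec.subspace (V p)) \<and> (\<exists>k. \<forall>p. vec.dim (V p) = k) \<and> smooth_map atlas (\<lambda>p. proj (V p))"


section \<open>Harmonic maps into the space of associative subspaces\<close>

text \<open>
  Harmonic maps are the critical points of the energy with respect to compactly supported smooth
  variations.  Since the Euler--Lagrange equation is local, it suffices to consider variations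
  supported in a coordinate domain; there, by conformal invariance, the energy is computed with
  the flat metric of the coordinate.  The \<open>G\<^sub>2\<close>-invariant metric on the irreducible symmetric space
  \<open>G\<^sub>2/SO(4)\<close> is unique up to a constant factor, and is induced by the Frobenius norm on matrices
  (the norm of the type \<^typ>\<open>complex^7^7\<close>) under the equivariant embedding \<^const>\<open>cartan\<close>.
\<close>

definition chart_energy :: "'m chart \<Rightarrow> 'm set \<Rightarrow> ('m \<Rightarrow> complex^7^7) \<Rightarrow> real" where
  "chart_energy c K F = (case c of (U, z) \<Rightarrow>
     (1/2) * integral (z ` K) (\<lambda>w.
        (norm (frechet_derivative (F \<circ> inv_into U z) (at w) 1))\<^sup>2
      + (norm (frechet_derivative (F \<circ> inv_into U z) (at w) \<i>))\<^sup>2))"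

definition smooth_variation ::
    "'m::topological_space chart \<Rightarrow> 'm set \<Rightarrow> ('m \<Rightarrow> (complex^7) set) \<Rightarrow>
     (real \<Rightarrow> 'm \<Rightarrow> (complex^7) set) \<Rightarrow> bool" where
  "smooth_variation c K \<phi> F \<longleftrightarrow> (case c of (U, z) \<Rightarrow>
     compact K \<and> K \<subseteq> U \<and> (\<forall>t p. F t p \<in> G2_SO4) \<and> F 0 = \<phi> \<and> (\<forall>t. \<forall>p. p \<notin> K \<longrightarrow> F t p = \<phi> p) \<and>
     smooth_on (UNIV \<times> z ` U) (\<lambda>(t, w). cartan (F t (inv_into U z w))))"

definition harmonic_map ::
    "'m::topological_space chart set \<Rightarrow> ('m \<Rightarrow> (complex^7) set) \<Rightarrow> bool" where
  "harmonic_map atlas \<phi> \<longleftrightarrow>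
     (\<forall>p. \<phi> p \<in> G2_SO4) \<and> smooth_map atlas (\<lambda>p. cartan (\<phi> p)) \<and>
     (\<forall>c\<in>atlas. \<forall>K F. smooth_variation c K \<phi> F \<longrightarrow>
        ((\<lambda>t. chart_energy c K (\<lambda>p. cartan (F t p))) has_real_derivative 0) (at 0))"

definition A_z :: "'m chart \<Rightarrow> ('m \<Rightarrow> (complex^7) set) \<Rightarrow> 'm \<Rightarrow> complex^7^7" where
  "A_z c \<phi> p = (1/2) *\<^sub>R (matrix_inv (cartan (\<phi> p)) ** dz c (\<lambda>q. cartan (\<phi> q)) p)"

definition A_zbar :: "'m chart \<Rightarrow> ('m \<Rightarrow> (complex^7) set) \<Rightarrow> 'm \<Rightarrow> complex^7^7" where
  "A_zbar c \<phi> p = (1/2) *\<^sub>R (matrix_inv (cartan (\<phi> p)) ** dzbar c (\<lambda>q. cartan (\<phi> q)) p)"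

definition nilconformal :: "'m chart set \<Rightarrow> ('m \<Rightarrow> (complex^7) set) \<Rightarrow> bool" where
  "nilconformal atlas \<phi> \<longleftrightarrow>
     (\<exists>r. \<forall>(U, z)\<in>atlas. \<forall>p\<in>U. \<forall>v. (((*v) (A_z (U, z) \<phi> p)) ^^ r) v = 0)"

text \<open>\<open>(-1)\<^sup>s\<^sup>-\<^sup>1\<phi>\<close> is \<open>\<phi>\<close> for odd \<open>s\<close>, and its orthogonal complement for even \<open>s\<close>.\<close>

definition s_number :: "'m chart set \<Rightarrow> ('m \<Rightarrow> (complex^7) set) \<Rightarrow> nat" where
  "s_number atlas \<phi> = (LEAST s. s > 0 \<and>
     (\<forall>(U, z)\<in>atlas. \<forall>p\<in>U. \<forall>v \<in> (if odd s then \<phi> p else perp (\<phi> p)).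
        (((*v) (A_z (U, z) \<phi> p)) ^^ (2 * s)) v = 0))"


section \<open>Extended solutions\<close>

text \<open>
  Loops are functions on \<^typ>\<open>complex\<close> of which only the values on the unit circle matter.
  Smoothness of a map \<open>\<Phi>\<close> into the loop group is joint smoothness in the point and the loop
  parameter \<open>\<lambda> = cis t\<close>.
\<close>

definition based_loop :: "(complex \<Rightarrow> complex^7^7) \<Rightarrow> bool" where
  "based_loop \<gamma> \<longleftrightarrow> (\<forall>l\<in>sphere 0 1. \<gamma> l \<in> G2) \<and> \<gamma> 1 = mat 1"

definition smooth_loop_map :: "'m chart set \<Rightarrow> ('m \<Rightarrow> complex \<Rightarrow> complex^7^7) \<Rightarrow> bool" where
  "smooth_loop_map atlas \<Phi> \<longleftrightarrow> (\<forall>p. based_loop (\<Phi> p)) \<and>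
     (\<forall>(U, z)\<in>atlas. smooth_on (z ` U \<times> (UNIV :: real set))
        (\<lambda>(w, t). \<Phi> (inv_into U z w) (cis t)))"

definition cscale :: "complex \<Rightarrow> complex^7^7 \<Rightarrow> complex^7^7" where
  "cscale a = map_matrix ((*) a)"

definition extended_solution ::
    "'m chart set \<Rightarrow> ('m \<Rightarrow> (complex^7) set) \<Rightarrow> ('m \<Rightarrow> complex \<Rightarrow> complex^7^7) \<Rightarrow> bool" where
  "extended_solution atlas \<phi> \<Phi> \<longleftrightarrow> smooth_loop_map atlas \<Phi> \<and>
     (\<forall>(U, z)\<in>atlas. \<forall>p\<in>U. \<forall>l\<in>sphere 0 1.
        matrix_inv (\<Phi> p l) ** dz (U, z) (\<lambda>q. \<Phi> q l) p = cscale (1 - inverse l) (A_z (U, z) \<phi> p) \<and>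
        matrix_inv (\<Phi> p l) ** dzbar (U, z) (\<lambda>q. \<Phi> q l) p = cscale (1 - l) (A_zbar (U, z) \<phi> p))"

definition polynomial_loops :: "('m \<Rightarrow> complex \<Rightarrow> complex^7^7) \<Rightarrow> bool" where
  "polynomial_loops \<Phi> \<longleftrightarrow>
     (\<exists>r T. \<forall>p. \<forall>l\<in>sphere 0 1. \<Phi> p l = (\<Sum>k\<in>{-int r..int r}. cscale (l powi k) (T k p)))"

definition finite_uniton_number :: "'m chart set \<Rightarrow> ('m \<Rightarrow> (complex^7) set) \<Rightarrow> bool" where
  "finite_uniton_number atlas \<phi> \<longleftrightarrow>
     (\<exists>\<Phi>. extended_solution atlas \<phi> \<Phi> \<and> polynomial_loops \<Phi> \<and>
        (\<exists>g\<in>G2. \<forall>p. \<Phi> p (-1) = g ** cartan (\<phi> p)))"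

text \<open>
  For a map into the symmetric space, embedded in \<open>G\<^sub>2\<close> as involutions, invariance under
  \<open>\<gamma>(\<lambda>) \<mapsto> \<gamma>(-\<lambda>) \<gamma>(-1)\<^sup>-\<^sup>1\<close>; as \<open>\<Phi>\<^sub>-\<^sub>1 = \<phi>\<close> squares to the identity, this
  reads as follows.  It says that \<open>\<W>\<close> is closed under \<open>\<lambda> \<mapsto> -\<lambda>\<close>, and it is not implied
  by \<open>\<Phi>\<^sub>-\<^sub>1 = \<phi>\<close>, which is unaffected by left multiplication of \<open>\<Phi>\<close> by a constant loop that is
  trivial at \<open>\<lambda> = -1\<close>.
\<close>

definition symmetric_loops :: "('m \<Rightarrow> complex \<Rightarrow> complex^7^7) \<Rightarrow> bool" where
  "symmetric_loops \<Phi> \<longleftrightarrow> (\<forall>p. \<forall>l\<in>sphere 0 1. \<Phi> p (-l) = \<Phi> p l ** \<Phi> p (-1))"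


section \<open>The Grassmannian model and the canonical lift\<close>

text \<open>
  Elements of \<open>L\<^sup>2\<close> of the circle are represented by functions on \<^typ>\<open>complex\<close> of which only the
  values on the unit circle matter.  All sets below contain, with one representative of an
  \<open>L\<^sup>2\<close>-class, all of them, so their inclusions are those of the subspaces of \<open>L\<^sup>2\<close>.
\<close>

definition L2_circle :: "(complex \<Rightarrow> complex^7) set" where
  "L2_circle = {f. (\<lambda>t. f (cis t)) \<in> borel_measurable (lebesgue_on {0..2*pi}) \<and>
                   integrable (lebesgue_on {0..2*pi}) (\<lambda>t. (norm (f (cis t)))\<^sup>2)}"

text \<open>\<open>f = \<Sum>\<^sub>i \<lambda>\<^sup>i v\<^sub>i\<close> with convergence in \<open>L\<^sup>2\<close>.\<close>

definition L2_power_series :: "(complex \<Rightarrow> complex^7) \<Rightarrow> (nat \<Rightarrow> complex^7) \<Rightarrow> bool" where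
  "L2_power_series f v \<longleftrightarrow> f \<in> L2_circle \<and>
     (\<lambda>n. LINT t|lebesgue_on {0..2*pi}. (norm (f (cis t) - (\<Sum>i<n. cis t ^ i *s v i)))\<^sup>2)
        \<longlonglongrightarrow> 0"

definition H_plus :: "(complex \<Rightarrow> complex^7) set" where
  "H_plus = {f. \<exists>v. L2_power_series f v}"

definition P0 :: "(complex \<Rightarrow> complex^7) \<Rightarrow> complex^7" where
  "P0 f = (THE v. L2_power_series f v) 0"

definition shift_H_plus :: "int \<Rightarrow> (complex \<Rightarrow> complex^7) set" where
  "shift_H_plus i = {g. \<exists>f\<in>H_plus. \<forall>l\<in>sphere 0 1. g l = (l powi i) *s f l}"

definition loop_H_plus :: "(complex \<Rightarrow> complex^7^7) \<Rightarrow> (complex \<Rightarrow> complex^7) set" where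
  "loop_H_plus \<gamma> = {g. \<exists>f\<in>H_plus. \<forall>l\<in>sphere 0 1. g l = \<gamma> l *v f l}"

definition W_between :: "('m \<Rightarrow> complex \<Rightarrow> complex^7^7) \<Rightarrow> int \<Rightarrow> bool" where
  "W_between \<Phi> s \<longleftrightarrow>
     (\<forall>p. shift_H_plus s \<subseteq> loop_H_plus (\<Phi> p) \<and> loop_H_plus (\<Phi> p) \<subseteq> shift_H_plus (-s))"

definition Z_fibre :: "('m \<Rightarrow> complex \<Rightarrow> complex^7^7) \<Rightarrow> int \<Rightarrow> 'm \<Rightarrow> (complex^7) set" where
  "Z_fibre \<Phi> i p =
     (\<lambda>g. P0 (\<lambda>l. matrix_inv (\<Phi> p l) *v g l)) ` (loop_H_plus (\<Phi> p) \<inter> shift_H_plus i)"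

text \<open>The legs of the canonical lift are formed from the subbundles that agree with the family
  \<^const>\<open>Z_fibre\<close> except at isolated points.\<close>

text \<open>
  For \<open>s = 3\<close> the constant loops \<open>diag(1, \<lambda>\<^sup>3, \<lambda>\<^sup>-\<^sup>3)\<close> in \<open>SU(3)\<close>, a subgroup of \<open>G\<^sub>2\<close>,
  have legs of dimensions (3,0,0,2), which are not those of a flag in \<open>F\<^sub>3\<close>; such loops are excluded
  by requiring the second and third term of the filtration to differ except at isolated points.
\<close>

definition canonical_lift ::
    "'m::topological_space chart set \<Rightarrow> ('m \<Rightarrow> complex \<Rightarrow> complex^7^7) \<Rightarrow> int \<Rightarrow>
     (int \<Rightarrow> 'm \<Rightarrow> (complex^7) set) \<Rightarrow> bool" where
  "canonical_lift atlas \<Phi> s \<psi> \<longleftrightarrow>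
     (\<exists>Z. (\<forall>i\<in>{-s..s+1}. smooth_subbundle atlas (Z i) \<and>
                         except_isolated (\<lambda>p. Z i p = Z_fibre \<Phi> i p)) \<and>
          (\<forall>i p. \<psi> i p = (if \<bar>i\<bar> \<le> s then ominus (Z i p) (Z (i + 1) p) else {0})))"

text \<open>
  The \<open>Hom(\<psi>\<^sub>i, \<psi>\<^sub>j)\<close>-component of the derivative of \<open>\<psi>\<close> along \<open>\<partial>/\<partial>z\<close> sends a section
  \<open>v\<close> of \<open>\<psi>\<^sub>i\<close> to the component in \<open>\<psi>\<^sub>j\<close> of its derivative; differentiating \<open>v = \<pi>\<^sub>i v\<close>, where \<open>\<pi>\<^sub>i\<close>
  is the projection onto \<open>\<psi>\<^sub>i\<close>, this is \<open>\<pi>\<^sub>j (\<partial>\<^sub>z \<pi>\<^sub>i) \<pi>\<^sub>i\<close>.  Holomorphicity means that the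
  derivative along \<open>\<partial>/\<partial>z\<close> is of type (1,0).
\<close>

definition J2_holomorphic ::
    "'m chart set \<Rightarrow> (int \<Rightarrow> 'm \<Rightarrow> (complex^7) set) \<Rightarrow> bool" where
  "J2_holomorphic atlas \<psi> \<longleftrightarrow> (\<forall>i. smooth_map atlas (\<lambda>p. proj (\<psi> i p))) \<and>
     (\<forall>(U, z)\<in>atlas. \<forall>p\<in>U. \<forall>i j. i \<noteq> j \<and> \<not> J2_type10 i j \<longrightarrow>
        proj (\<psi> j p) ** dz (U, z) (\<lambda>q. proj (\<psi> i q)) p ** proj (\<psi> i p) = 0)"

definition J2_holomorphic_lift ::
    "'m chart set \<Rightarrow> int \<Rightarrow> ('m \<Rightarrow> (complex^7) set) \<Rightarrow> (int \<Rightarrow> 'm \<Rightarrow> (complex^7) set) \<Rightarrow> bool" where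
  "J2_holomorphic_lift atlas s \<phi> \<psi> \<longleftrightarrow>
     (\<forall>p. (\<lambda>i. \<psi> i p) \<in> G2_flags s) \<and> J2_holomorphic atlas \<psi> \<and>
     (\<forall>p. vec.span (\<Union>i\<in>{i. even i}. \<psi> i p) = \<phi> p)"

end

theory Submission
  imports Defs "HOL-Complex_Analysis.Complex_Singularities"
begin

text \<open>
  Since \<open>\<Phi>\<close> is a Laurent polynomial in \<open>\<lambda>\<close>, the fibres \<open>Z\<^sub>i\<close> are given by finitely many linear conditions on
  Fourier coefficients.  The extended solution equation makes \<open>\<W>\<close> closed under \<open>\<partial>\<^bsub>zbar\<^esub>\<close> and \<open>\<lambda>\<partial>\<^sub>z\<close>.  By the
  former, \<open>Z\<^sub>i\<close> is spanned, in a local frame parallel for \<open>\<partial>\<^bsub>zbar\<^esub> + A\<^bsub>zbar\<^esub>\<close>, by holomorphic sections, so that it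
  extends over the isolated points where its rank drops, to a smooth subbundle closed under this
  operator; by the latter, \<open>A\<^sub>z Z\<^sub>i \<subseteq> Z\<^sub>i\<^sub>+\<^sub>1\<close>.

  Reality of \<open>\<Phi>\<close> identifies \<open>Z\<^sub>1\<^sub>-\<^sub>i\<close> with the annihilator of \<open>Z\<^sub>i\<close>, the automorphism property gives
  \<open>Z\<^sub>i \<times> Z\<^sub>j \<subseteq> Z\<^sub>i\<^sub>+\<^sub>j\<close>, and the symmetry \<open>\<lambda> \<mapsto> -\<lambda>\<close> shows that the Cartan involution acts on
  \<open>Z\<^sub>i / Z\<^sub>i\<^sub>+\<^sub>1\<close> by \<open>(-1)\<^sup>i\<close>; hence the legs form a flag whose even part is \<open>\<phi>\<close>.  Their dimensions follow from
  \<open>dim \<phi> = 3\<close> and the minimality of \<open>s\<close>; for \<open>s = 3\<close> the vector product with a nonzero real vector in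
  \<open>\<psi>\<^sub>3 \<oplus> \<psi>\<^sub>-\<^sub>3\<close> embeds \<open>\<psi>\<^sub>2\<close> into \<open>\<psi>\<^sub>-\<^sub>1\<close>.
\<close>

section \<open>Hermitian linear algebra\<close>

text \<open>Since s is at most 3, the exponents of \<open>\<Phi>\<close> lie in -3..3, and W is
  described by a window of seven blocks of seven coordinates. There the idempotent
  \<open>prW\<close> with range W satisfies P (dbar P) = dbar P, so a holomorphic frame of W arises
  by inverting a matrix close to the identity. The constant coefficient of \<Phi>^-1 applied to it
  contains the parallel frame; no dbar-equation has to be solved.

  The obstacle to extending Z_i is that it is the image of a kernel, and both steps may drop rank. A
  kernel of holomorphic functionals extends by elimination with a pivot of least vanishing order. An
  image is replaced by its annihilator, which is again a kernel; as the annihilator of Z_i is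
  Z_(1-i), this reaches every term of the filtration.

  Inclusions, parity, vector products and the shift by A_z are first known for the fibres, hence for
  the extended bundles only off isolated points. They pass to all points as limits of identities
  between orthogonal projections, which is why subspaces are treated as matrices.\<close>

definition mcnj :: "complex^'n^'m \<Rightarrow> complex^'n^'m" where
  "mcnj M = map_matrix cnj M"

definition adj :: "complex^'n^'m \<Rightarrow> complex^'m^'n" where
  "adj M = mcnj (transpose M)"

lemma mcnj_nth [simp]: "mcnj M $ i $ j = cnj (M $ i $ j)"
  by (simp add: mcnj_def map_matrix_def)

lemma adj_nth [simp]: "adj M $ i $ j = cnj (M $ j $ i)"
  by (simp add: adj_def transpose_def)

lemma vcnj_nth [simp]: "vcnj v $ i = cnj (v $ i)"
  by (simp add: vcnj_def)

lemma adj_adj [simp]: "adj (adj M) = M"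
  by (simp add: vec_eq_iff)

lemma mcnj_mcnj [simp]: "mcnj (mcnj M) = M"
  by (simp add: vec_eq_iff)

lemma vcnj_vcnj [simp]: "vcnj (vcnj v) = v"
  by (simp add: vec_eq_iff)

lemma vcnj_0 [simp]: "vcnj 0 = 0"
  by (simp add: vec_eq_iff)

lemma matrix_diff_left_distrib: "(A - B) ** C = A ** C - B ** (C::'a::comm_ring_1^'n^'m)"
  and matrix_diff_right_distrib: "C ** (D - E) = C ** D - C ** (E::'a::comm_ring_1^'k^'n)"
  by (simp_all add: vec_eq_iff matrix_matrix_mult_def sum_subtractf algebra_simps)

lemma adj_mult: "adj (A ** B) = adj B ** adj A"
  by (simp add: vec_eq_iff matrix_matrix_mult_def mult.commute)

lemma mcnj_mult: "mcnj (A ** B) = mcnj A ** mcnj B"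
  by (simp add: vec_eq_iff matrix_matrix_mult_def)

lemma vcnj_mult: "vcnj (A *v x) = mcnj A *v vcnj x"
  by (simp add: vec_eq_iff matrix_vector_mult_def)

lemma adj_add: "adj (A + B) = adj A + adj B" and adj_diff: "adj (A - B) = adj A - adj B"
  by (simp_all add: vec_eq_iff)

lemma adj_mat_1 [simp]: "adj (mat 1) = mat 1"
  by (simp add: vec_eq_iff mat_def)

lemma mcnj_mat_1 [simp]: "mcnj (mat 1) = mat 1"
  by (simp add: vec_eq_iff mat_def)

lemma mcnj_diff: "mcnj (A - B) = mcnj A - mcnj B"
  by (simp add: vec_eq_iff)

lemma adj_eq_mcnj_transpose: "adj M = mcnj (transpose M)" "adj M = transpose (mcnj M)"
  by (simp_all add: vec_eq_iff transpose_def)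

lemma cdot_simps:
  "cdot (u + v) w = cdot u w + cdot v w" "cdot (u - v) w = cdot u w - cdot v w"
  "cdot w (u + v) = cdot w u + cdot w v" "cdot w (u - v) = cdot w u - cdot w v"
  "cdot (c *s u) w = c * cdot u w" "cdot u (c *s w) = c * cdot u w"
  "cdot 0 w = 0" "cdot w 0 = 0"
  by (simp_all add: cdot_def sum.distrib sum_subtractf sum_distrib_left algebra_simps)

lemma vcnj_simps:
  "vcnj (u + v) = vcnj u + vcnj v" "vcnj (u - v) = vcnj u - vcnj v" "vcnj (c *s u) = cnj c *s vcnj u"
  by (simp_all add: vec_eq_iff)

lemma cdot_commute: "cdot v w = cdot w v"
  by (simp add: cdot_def mult.commute)

lemma cdot_vcnj: "cdot (vcnj v) (vcnj w) = cnj (cdot v w)"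
  by (simp add: cdot_def)

lemma cdot_mult_left: "cdot (A *v v) w = cdot v (transpose A *v w)"
  unfolding cdot_def matrix_vector_mult_def transpose_def
  by (simp add: sum_distrib_left sum_distrib_right mult.commute mult.left_commute) (rule sum.swap)

lemma herm_mult_left: "cdot (A *v v) (vcnj w) = cdot v (vcnj (adj A *v w))"
  by (simp add: cdot_mult_left vcnj_mult adj_def)

lemma cdot_vcnj_self: "cdot v (vcnj v) = complex_of_real ((norm v)\<^sup>2)"
proof -
  have "cdot v (vcnj v) = (\<Sum>i\<in>UNIV. complex_of_real ((norm (v $ i))\<^sup>2))"
    by (simp add: cdot_def complex_norm_square del: of_real_power)
  also have "\<dots> = complex_of_real ((norm v)\<^sup>2)"
    by (simp add: norm_vec_def L2_set_def sum_nonneg)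
  finally show ?thesis .
qed

lemma cdot_vcnj_self_eq_0 [simp]: "cdot v (vcnj v) = 0 \<longleftrightarrow> v = 0"
  by (simp add: cdot_vcnj_self)

lemma cdot_all_eq_0: "(\<And>w. cdot v w = 0) \<Longrightarrow> v = 0"
  using cdot_vcnj_self_eq_0 by blast

text \<open>The real inner product is the real part of the Hermitian one, so the real orthogonal
  decomposition kills the real part of the pairing with \<open>w\<close>. Pairing with
  \<open>\<i> *s w\<close>, which lies in the same complex subspace, kills the imaginary
  part.\<close>

lemma hermitian_decomposition:
  fixes S :: "(complex^'n) set"
  assumes S: "vec.subspace S"
  obtains y where "y \<in> S" "\<And>w. w \<in> S \<Longrightarrow> (\<Sum>i\<in>UNIV. (x - y) $ i * cnj (w $ i)) = 0"
proof -
  have scale: "c *\<^sub>R w = complex_of_real c *s w" for c and w :: "complex^'n"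
    by (simp add: vec_eq_iff) (simp add: scaleR_conv_of_real)
  have sub: "subspace S"
    using S unfolding vec.subspace_def subspace_def scale by auto
  obtain y z where y: "y \<in> span S" and z: "\<And>w. w \<in> span S \<Longrightarrow> orthogonal z w" and x: "x = y + z"
    using orthogonal_subspace_decomp_exists[of S x] by blast
  have span: "span S = S" using sub by (simp add: span_eq_iff)
  have re: "Re (\<Sum>i\<in>UNIV. z $ i * cnj (w $ i)) = 0" if "w \<in> S" for w
    using z[of w] that span by (simp add: orthogonal_def inner_vec_def inner_complex_def)
  have "(\<Sum>i\<in>UNIV. z $ i * cnj (w $ i)) = 0" if w: "w \<in> S" for w
  proof -
    have "\<i> *s w \<in> S" using S w by (simp add: vec.subspace_def)
    from re[OF this] have "Im (\<Sum>i\<in>UNIV. z $ i * cnj (w $ i)) = 0"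
      by simp
    with re[OF w] show ?thesis by (simp add: complex_eq_iff)
  qed
  then show thesis using that[of y] y span x by auto
qed

text \<open>The functional is pairing with the conjugate of the component of \<open>x\<close>
  orthogonal to \<open>S\<close>. It drives the completeness half of the duality between the terms
  of the filtration.\<close>

lemma separating_functional:
  fixes S :: "(complex^'n) set"
  assumes S: "vec.subspace S" and x: "x \<notin> S"
  obtains g where "\<And>y. y \<in> S \<Longrightarrow> (\<Sum>i\<in>UNIV. g $ i * y $ i) = 0" "(\<Sum>i\<in>UNIV. g $ i * x $ i) \<noteq> 0"
proof -
  obtain y where y: "y \<in> S" and orth: "\<And>w. w \<in> S \<Longrightarrow> (\<Sum>i\<in>UNIV. (x - y) $ i * cnj (w $ i)) = 0"
    using hermitian_decomposition[OF S, of x] by blast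
  define g :: "complex^'n" where "g = (\<chi> i. cnj ((x - y) $ i))"
  have g0: "(\<Sum>i\<in>UNIV. g $ i * w $ i) = 0" if "w \<in> S" for w
  proof -
    have "(\<Sum>i\<in>UNIV. g $ i * w $ i) = cnj (\<Sum>i\<in>UNIV. (x - y) $ i * cnj (w $ i))"
      by (simp add: g_def)
    also have "\<dots> = 0" by (simp only: orth[OF that] complex_cnj_zero)
    finally show ?thesis .
  qed
  have "(\<Sum>i\<in>UNIV. g $ i * (x - y) $ i) \<noteq> 0"
  proof
    assume "(\<Sum>i\<in>UNIV. g $ i * (x - y) $ i) = 0"
    then have "complex_of_real (\<Sum>i\<in>UNIV. (norm ((x - y) $ i))\<^sup>2) = 0"
      by (simp add: g_def complex_norm_square mult.commute del: of_real_power)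
    then have "(\<Sum>i\<in>UNIV. (norm ((x - y) $ i))\<^sup>2) = 0"
      using of_real_eq_0_iff by blast
    then have "x - y = 0"
      by (simp add: sum_nonneg_eq_0_iff vec_eq_iff)
    with x y show False by simp
  qed
  then have "(\<Sum>i\<in>UNIV. g $ i * x $ i) \<noteq> 0"
    using g0[OF y] by (simp add: algebra_simps sum_subtractf)
  with g0 show thesis by (rule that)
qed

section \<open>Orthogonal projections as matrices\<close>

lemma subspace_perp: "vec.subspace (perp V)"
  by (auto simp: vec.subspace_def perp_def cdot_simps)

lemma perp_unique:
  assumes "vec.subspace V" "a \<in> V" "b \<in> V" "v - a \<in> perp V" "v - b \<in> perp V"
  shows "a = b"
proof -
  have "a - b \<in> V" using assms by (simp add: vec.subspace_diff)
  moreover have "a - b \<in> perp V"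
    using vec.subspace_diff[OF subspace_perp assms(5,4)] by simp
  ultimately have "cdot (a - b) (vcnj (a - b)) = 0" by (auto simp: perp_def)
  then show ?thesis by simp
qed

text \<open>Only the values of the choice \<open>p\<close> on basis vectors enter, as columns. Both
  membership properties then extend to all vectors by linearity, so \<open>p\<close> itself need not
  be shown linear.\<close>

lemma proj_exists:
  assumes V: "vec.subspace V"
  shows "\<exists>P. \<forall>v. P *v v \<in> V \<and> v - P *v v \<in> perp V"
proof -
  have "\<exists>y. y \<in> V \<and> v - y \<in> perp V" for v
  proof -
    obtain y where "y \<in> V" "\<And>w. w \<in> V \<Longrightarrow> (\<Sum>i\<in>UNIV. (v - y) $ i * cnj (w $ i)) = 0"
      using hermitian_decomposition[OF V, of v] by blast
    then have "y \<in> V \<and> v - y \<in> perp V"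
      unfolding perp_def cdot_def vcnj_nth by blast
    then show ?thesis ..
  qed
  then obtain p where p: "\<And>v. p v \<in> V" "\<And>v. v - p v \<in> perp V" by metis
  define P :: "complex^7^7" where "P = (\<chi> i j. p (axis j 1) $ i)"
  have Pv: "P *v v = (\<Sum>j\<in>UNIV. v $ j *s p (axis j 1))" for v
    by (simp add: vec_eq_iff P_def matrix_vector_mult_def mult.commute)
  have vP: "v - P *v v = (\<Sum>j\<in>UNIV. v $ j *s (axis j 1 - p (axis j 1)))" for v
  proof -
    have "v - P *v v = (\<Sum>j\<in>UNIV. v $ j *s axis j 1) - (\<Sum>j\<in>UNIV. v $ j *s p (axis j 1))"
      by (simp only: Pv basis_expansion)
    then show ?thesis by (simp add: sum_subtractf vector_ssub_ldistrib)
  qed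
  then have "v - P *v v \<in> perp V" for v
    unfolding vP by (intro vec.subspace_sum vec.subspace_scale subspace_perp p(2))
  moreover have "P *v v \<in> V" for v
    unfolding Pv by (intro vec.subspace_sum vec.subspace_scale V p(1))
  ultimately show ?thesis by blast
qed

lemma projI:
  assumes V: "vec.subspace V" and "\<And>v. P *v v \<in> V" "\<And>v. v - P *v v \<in> perp V"
  shows "proj V = P"
  unfolding proj_def
proof (rule the_equality)
  fix Q assume Q: "\<forall>v. Q *v v \<in> V \<and> v - Q *v v \<in> perp V"
  have "Q *v v = P *v v" for v
    using perp_unique[OF V, of "Q *v v" "P *v v" v] Q assms by blast
  then show "Q = P" by (simp add: matrix_eq)
qed (use assms in auto)

lemma
  assumes "vec.subspace V"
  shows proj_in: "proj V *v v \<in> V" and proj_perp: "v - proj V *v v \<in> perp V"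
proof -
  obtain P where P: "\<And>v. P *v v \<in> V" "\<And>v. v - P *v v \<in> perp V"
    using proj_exists[OF assms] by blast
  have "proj V = P" by (rule projI[OF assms P])
  with P show "proj V *v v \<in> V" "v - proj V *v v \<in> perp V" by simp_all
qed

lemma proj_id:
  assumes "vec.subspace V" "v \<in> V"
  shows "proj V *v v = v"
proof (rule perp_unique[OF assms(1) proj_in[OF assms(1)] assms(2) proj_perp[OF assms(1)]])
  show "v - v \<in> perp V" using vec.subspace_0[OF subspace_perp, of V] by simp
qed

lemma proj_zero:
  assumes "vec.subspace V" "v \<in> perp V"
  shows "proj V *v v = 0"
proof (rule perp_unique[OF assms(1) proj_in[OF assms(1)] _ proj_perp[OF assms(1)]])
  show "0 \<in> V" using vec.subspace_0[OF assms(1)] .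
  show "v - 0 \<in> perp V" using assms by simp
qed

lemma mem_proj_iff:
  assumes "vec.subspace V"
  shows "v \<in> V \<longleftrightarrow> proj V *v v = v"
  using proj_id[OF assms, of v] proj_in[OF assms, of v] by auto

lemma proj_idem: "vec.subspace V \<Longrightarrow> proj V ** proj V = proj V"
  by (simp add: matrix_eq proj_id proj_in flip: matrix_vector_mul_assoc)

text \<open>The ranges of \<open>P\<close> and \<open>1 - P\<close> are orthogonal, whence
  \<open>adj P = adj P ** P\<close>. The right side is self-adjoint, hence so is
  \<open>P\<close>.\<close>

lemma proj_adj:
  assumes V: "vec.subspace V"
  shows "adj (proj V) = proj V"
proof -
  let ?P = "proj V"
  have "cdot (?P *v v) (vcnj (w - ?P *v w)) = 0" for v w
  proof -
    have "cdot (w - ?P *v w) (vcnj (?P *v v)) = 0"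
      using proj_in[OF V] proj_perp[OF V] by (auto simp: perp_def)
    then have "cnj (cdot (vcnj (w - ?P *v w)) (?P *v v)) = 0"
      by (simp flip: cdot_vcnj)
    then show ?thesis by (simp add: cdot_commute)
  qed
  then have "cdot v (vcnj (adj ?P *v (w - ?P *v w))) = 0" for v w
    by (simp add: herm_mult_left)
  then have "adj ?P *v (w - ?P *v w) = 0" for w
    using cdot_vcnj_self_eq_0 by blast
  then have *: "adj ?P = adj ?P ** ?P"
    by (simp add: matrix_eq matrix_vector_mult_diff_distrib flip: matrix_vector_mul_assoc)
  then have "?P = adj (adj ?P ** ?P)" by (metis adj_adj)
  also have "\<dots> = adj ?P ** ?P" by (simp add: adj_mult)
  finally show ?thesis using * by simp
qed

lemma subspace_range: "vec.subspace (range ((*v) (A::complex^'n^'m)))"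
  by (rule vec.subspace_image[OF vec.subspace_UNIV])

lemma proj_range:
  assumes "P ** P = P" "adj P = P"
  shows "proj (range ((*v) P)) = P"
proof (rule projI[OF subspace_range])
  fix v
  have "cdot (v - P *v v) (vcnj (P *v w)) = 0" for w
  proof -
    have "cdot (v - P *v v) (vcnj (P *v w)) = cdot (P *v (v - P *v v)) (vcnj w)"
      by (simp add: herm_mult_left assms)
    also have "P *v (v - P *v v) = 0"
      by (simp add: matrix_vector_mult_diff_distrib matrix_vector_mul_assoc assms)
    finally show ?thesis by (simp add: cdot_simps)
  qed
  then show "v - P *v v \<in> perp (range ((*v) P))" by (auto simp: perp_def)
qed auto

lemma range_proj:
  assumes "vec.subspace V"
  shows "range ((*v) (proj V)) = V"
proof
  show "range ((*v) (proj V)) \<subseteq> V" using proj_in[OF assms] by blast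
  show "V \<subseteq> range ((*v) (proj V))"
    by (metis assms proj_id rangeI subsetI)
qed

lemma proj_inject: "vec.subspace V \<Longrightarrow> vec.subspace W \<Longrightarrow> proj V = proj W \<longleftrightarrow> V = W"
  by (metis range_proj)

lemma proj_eqI:
  assumes "P ** P = P" "adj P = P" "\<And>v. v \<in> V \<longleftrightarrow> P *v v = v"
  shows "vec.subspace V" "proj V = P"
proof -
  have "P *v (P *v v) = P *v v" for v
    by (simp add: matrix_vector_mul_assoc assms)
  then have "V = range ((*v) P)"
    using assms(3) by (auto simp: image_iff intro: sym)
  then show "vec.subspace V" "proj V = P"
    using proj_range[OF assms(1,2)] subspace_range by simp_all
qed

lemma perp_iff:
  assumes "vec.subspace V"
  shows "v \<in> perp V \<longleftrightarrow> proj V *v v = 0"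
  using proj_zero[OF assms, of v] proj_perp[OF assms, of v] by auto

lemma proj_perp_eq:
  assumes "vec.subspace V"
  shows "proj (perp V) = mat 1 - proj V"
  by (rule proj_eqI)
    (simp_all add: perp_iff[OF assms] proj_idem proj_adj assms adj_diff matrix_vector_mult_diff_rdistrib
      matrix_diff_left_distrib matrix_diff_right_distrib)

lemma cartan_eq: "vec.subspace V \<Longrightarrow> cartan V = proj V + proj V - mat 1"
  by (simp add: cartan_def proj_perp_eq)

lemma proj_subset:
  assumes "vec.subspace V" "vec.subspace W"
  shows "V \<subseteq> W \<longleftrightarrow> proj W ** proj V = proj V"
proof
  assume "V \<subseteq> W"
  then show "proj W ** proj V = proj V"
    using assms proj_in[of V] by (auto simp: matrix_eq proj_id subsetD simp flip: matrix_vector_mul_assoc)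
next
  assume *: "proj W ** proj V = proj V"
  show "V \<subseteq> W"
  proof
    fix v assume "v \<in> V"
    then have "proj W *v v = v"
      using * assms(1) by (metis matrix_vector_mul_assoc proj_id)
    then show "v \<in> W" using assms(2) proj_in by metis
  qed
qed

lemma proj_subset':
  assumes "vec.subspace V" "vec.subspace W"
  shows "V \<subseteq> W \<longleftrightarrow> proj V ** proj W = proj V"
  by (metis assms proj_subset adj_mult proj_adj)

lemma subspace_ominus: "vec.subspace V \<Longrightarrow> vec.subspace (ominus V W)"
  by (simp add: ominus_def vec.subspace_inter subspace_perp)

lemma proj_ominus:
  assumes V: "vec.subspace V" and W: "vec.subspace W" and "W \<subseteq> V"
  shows "proj (ominus V W) = proj V - proj W"
proof (rule proj_eqI)
  have VW: "proj V ** proj W = proj W" "proj W ** proj V = proj W"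
    using assms proj_subset proj_subset' by blast+
  show "(proj V - proj W) ** (proj V - proj W) = proj V - proj W"
    by (simp add: matrix_diff_left_distrib matrix_diff_right_distrib VW proj_idem V W)
  show "adj (proj V - proj W) = proj V - proj W"
    by (simp add: adj_diff proj_adj V W)
  show "v \<in> ominus V W \<longleftrightarrow> (proj V - proj W) *v v = v" for v
  proof
    assume "v \<in> ominus V W"
    then show "(proj V - proj W) *v v = v"
      by (simp add: ominus_def perp_iff W mem_proj_iff[OF V] matrix_vector_mult_diff_rdistrib)
  next
    assume *: "(proj V - proj W) *v v = v"
    have "proj W *v ((proj V - proj W) *v v) = 0"
      by (simp add: matrix_vector_mul_assoc matrix_diff_right_distrib VW proj_idem W)
    moreover have "proj V *v ((proj V - proj W) *v v) = (proj V - proj W) *v v"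
      by (simp add: matrix_vector_mul_assoc matrix_diff_right_distrib VW proj_idem V)
    ultimately show "v \<in> ominus V W"
      unfolding * by (simp add: ominus_def perp_iff W mem_proj_iff[OF V])
  qed
qed

lemma mem_vcnj_image: "v \<in> vcnj ` V \<longleftrightarrow> vcnj v \<in> V"
  by (metis image_iff vcnj_vcnj)

lemma subspace_vcnj: "vec.subspace V \<Longrightarrow> vec.subspace (vcnj ` V)"
  by (auto simp: vec.subspace_def mem_vcnj_image vcnj_simps)

lemma proj_vcnj:
  assumes V: "vec.subspace V"
  shows "proj (vcnj ` V) = mcnj (proj V)"
proof (rule proj_eqI)
  show "mcnj (proj V) ** mcnj (proj V) = mcnj (proj V)"
    by (simp add: proj_idem V flip: mcnj_mult)
  have "adj (mcnj (proj V)) = mcnj (adj (proj V))" by (simp add: vec_eq_iff)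
  then show "adj (mcnj (proj V)) = mcnj (proj V)" by (simp add: proj_adj V)
  show "v \<in> vcnj ` V \<longleftrightarrow> mcnj (proj V) *v v = v" for v
    unfolding mem_vcnj_image mem_proj_iff[OF V] by (metis vcnj_mult vcnj_vcnj mcnj_mcnj)
qed

lemma dim_ominus:
  assumes V: "vec.subspace V" and W: "vec.subspace W" and "W \<subseteq> V"
  shows "vec.dim (ominus V W) + vec.dim W = vec.dim V"
proof -
  have "{x + y |x y. x \<in> ominus V W \<and> y \<in> W} = V"
  proof safe
    fix x y assume "x \<in> ominus V W" "y \<in> W"
    then show "x + y \<in> V" using assms vec.subspace_add[OF V] by (auto simp: ominus_def)
  next
    fix v assume "v \<in> V"
    then have "v - proj W *v v \<in> ominus V W"
      using assms(3) proj_in[OF W, of v] proj_perp[OF W, of v] vec.subspace_diff[OF V]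
      unfolding ominus_def by blast
    then show "\<exists>x y. v = x + y \<and> x \<in> ominus V W \<and> y \<in> W"
      using proj_in[OF W, of v] by (metis diff_add_cancel)
  qed
  moreover have "ominus V W \<inter> W = {0}"
    using vec.subspace_0[OF V] vec.subspace_0[OF W] vec.subspace_0[OF subspace_perp]
      cdot_vcnj_self_eq_0 by (auto simp: ominus_def perp_def)
  ultimately show ?thesis
    using vec.dim_sums_Int[OF subspace_ominus[OF V, of W] W] by simp
qed

text \<open>Conjugation is antilinear, so dimension lemmas for linear maps do not apply. It carries
  spanning sets to spanning sets, which bounds the dimension from above; applying the bound twice to
  an involution gives equality.\<close>

lemma dim_vcnj:
  shows "vec.dim (vcnj ` V) = vec.dim V"
proof -
  have le: "vec.dim (vcnj ` V) \<le> vec.dim V" for V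
  proof -
    obtain B where B: "B \<subseteq> V" "vec.independent B" "V \<subseteq> vec.span B" "card B = vec.dim V"
      using vec.basis_exists by blast
    have "vcnj ` V \<subseteq> vcnj ` vec.span B" using B by blast
    also have "\<dots> \<subseteq> vec.span (vcnj ` B)"
    proof -
      have "vec.span B \<subseteq> vcnj ` vec.span (vcnj ` B)"
        by (rule vec.span_minimal)
          (auto simp: mem_vcnj_image subspace_vcnj intro!: vec.span_base)
      then show ?thesis using mem_vcnj_image by auto
    qed
    finally have "vec.dim (vcnj ` V) \<le> card (vcnj ` B)"
      using vec.dim_le_card B(2) vec.finiteI_independent by blast
    also have "\<dots> \<le> card B" using B(2) vec.finiteI_independent card_image_le by blast
    finally show ?thesis using B by simp
  qed
  have "vcnj ` vcnj ` V = V" by (simp add: image_image)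
  then show ?thesis using le[of V] le[of "vcnj ` V"] by simp
qed

section \<open>Smooth functions\<close>

lemma frechet_derivative_cong:
  assumes "open S" "x \<in> S" "\<And>y. y \<in> S \<Longrightarrow> f y = g y"
  shows "frechet_derivative f (at x) = frechet_derivative g (at x)"
proof -
  have "(f has_derivative D) (at x) \<longleftrightarrow> (g has_derivative D) (at x)" for D
    using has_derivative_transform_within_open[OF _ assms(1,2)] assms(3) by metis
  then show ?thesis by (simp add: frechet_derivative_def)
qed

lemma differentiable_cong_open:
  assumes "open S" "x \<in> S" "\<And>y. y \<in> S \<Longrightarrow> f y = g y"
  shows "f differentiable (at x) \<longleftrightarrow> g differentiable (at x)"
  unfolding differentiable_def
  using has_derivative_transform_within_open[OF _ assms(1,2)] assms(3) by metis

lemma Ck_on_cong: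
  assumes "open S" "\<And>y. y \<in> S \<Longrightarrow> f y = g y"
  shows "Ck_on k f S \<longleftrightarrow> Ck_on k g S"
  using assms(2)
proof (induction k arbitrary: f g)
  case 0
  then show ?case by (simp cong: continuous_on_cong)
next
  case (Suc k)
  have "Ck_on k (\<lambda>x. frechet_derivative f (at x) v) S \<longleftrightarrow> Ck_on k (\<lambda>x. frechet_derivative g (at x) v) S" for v
    by (rule Suc.IH) (simp add: frechet_derivative_cong[OF assms(1) _ Suc.prems])
  then show ?case
    using differentiable_cong_open[OF assms(1) _ Suc.prems] by simp
qed

text \<open>The recursion speaks of the chosen \<open>frechet_derivative\<close>. This form accepts
  whatever explicit derivative \<open>D\<close> the differentiation rules deliver, and the closure
  properties below rest on it.\<close>

lemma Ck_on_SucI: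
  assumes "open S" "\<And>x. x \<in> S \<Longrightarrow> (f has_derivative D x) (at x)" "\<And>v. Ck_on k (\<lambda>x. D x v) S"
  shows "Ck_on (Suc k) f S"
proof -
  have "Ck_on k (\<lambda>x. frechet_derivative f (at x) v) S" for v
    using assms(3)[of v] Ck_on_cong[OF assms(1), of "\<lambda>x. frechet_derivative f (at x) v" "\<lambda>x. D x v"]
      frechet_derivative_at[OF assms(2)] by auto
  then show ?thesis using assms(2) by (auto simp: differentiable_def)
qed

lemma Ck_on_SucD:
  assumes "Ck_on (Suc k) f S"
  shows "x \<in> S \<Longrightarrow> (f has_derivative frechet_derivative f (at x)) (at x)"
    "Ck_on k (\<lambda>x. frechet_derivative f (at x) v) S"
  using assms frechet_derivative_works by auto

lemma Ck_on_Suc_imp: "Ck_on (Suc k) f S \<Longrightarrow> Ck_on k f S"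
proof (induction k arbitrary: f)
  case 0
  then show ?case
    by (auto intro!: continuous_at_imp_continuous_on differentiable_imp_continuous_within)
next
  case (Suc k)
  then show ?case by (metis Ck_on.simps(2))
qed

lemma Ck_on_subset: "Ck_on k f S \<Longrightarrow> T \<subseteq> S \<Longrightarrow> Ck_on k f T"
  by (induction k arbitrary: f) (auto intro: continuous_on_subset)

lemma Ck_on_local:
  assumes "\<And>x. x \<in> S \<Longrightarrow> \<exists>T. open T \<and> x \<in> T \<and> Ck_on k f T"
  shows "Ck_on k f S"
  using assms
proof (induction k arbitrary: f)
  case 0
  have "isCont f x" if "x \<in> S" for x
    using 0[OF that] by (auto simp: continuous_on_eq_continuous_at)
  then show ?case by (simp add: continuous_at_imp_continuous_on)
next
  case (Suc k)
  have "Ck_on k (\<lambda>x. frechet_derivative f (at x) v) S" for v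
    by (rule Suc.IH) (use Suc.prems in \<open>fastforce\<close>)
  then show ?case using Suc.prems by fastforce
qed

lemma Ck_on_const: "open S \<Longrightarrow> Ck_on k (\<lambda>x. c) S"
  by (induction k arbitrary: c)
    (auto intro!: Ck_on_SucI[OF _ has_derivative_const] simp del: Ck_on.simps(2))

lemma Ck_on_bounded_linear:
  assumes "bounded_linear L" "open S"
  shows "Ck_on k f S \<Longrightarrow> Ck_on k (\<lambda>x. L (f x)) S"
proof (induction k arbitrary: f)
  case 0
  then show ?case
    by (auto intro: bounded_linear.continuous_on[OF assms(1)])
next
  case (Suc k)
  show ?case
    by (rule Ck_on_SucI[OF assms(2) bounded_linear.has_derivative[OF assms(1)]])
      (use Ck_on_SucD[OF Suc.prems] Suc.IH in auto)
qed

lemma Ck_on_add: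
  assumes "open S"
  shows "Ck_on k f S \<Longrightarrow> Ck_on k g S \<Longrightarrow> Ck_on k (\<lambda>x. f x + g x) S"
proof (induction k arbitrary: f g)
  case 0
  then show ?case by (auto intro: continuous_on_add)
next
  case (Suc k)
  show ?case
    by (rule Ck_on_SucI[OF assms has_derivative_add])
      (use Ck_on_SucD[OF Suc.prems(1)] Ck_on_SucD[OF Suc.prems(2)] Suc.IH in auto)
qed

lemma Ck_on_bilinear:
  assumes "bounded_bilinear B" "open S"
  shows "Ck_on k f S \<Longrightarrow> Ck_on k g S \<Longrightarrow> Ck_on k (\<lambda>x. B (f x) (g x)) S"
proof (induction k arbitrary: f g)
  case 0
  then show ?case by (auto intro: bounded_bilinear.continuous_on[OF assms(1)])
next
  case (Suc k)
  show ?case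
  proof (rule Ck_on_SucI[OF assms(2)])
    show "((\<lambda>x. B (f x) (g x)) has_derivative (\<lambda>v. B (f x) (frechet_derivative g (at x) v) +
        B (frechet_derivative f (at x) v) (g x))) (at x)" if "x \<in> S" for x
      by (rule bounded_bilinear.FDERIV[OF assms(1) Ck_on_SucD(1)[OF Suc.prems(1) that]
            Ck_on_SucD(1)[OF Suc.prems(2) that]])
    show "Ck_on k (\<lambda>x. B (f x) (frechet_derivative g (at x) v) +
        B (frechet_derivative f (at x) v) (g x)) S" for v
      by (rule Ck_on_add[OF assms(2) Suc.IH Suc.IH])
        (rule Ck_on_Suc_imp[OF Suc.prems(1)] Ck_on_Suc_imp[OF Suc.prems(2)]
          Ck_on_SucD(2)[OF Suc.prems(1)] Ck_on_SucD(2)[OF Suc.prems(2)])+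
  qed
qed

lemma Ck_on_inverse:
  fixes f :: "'a::real_normed_vector \<Rightarrow> complex"
  assumes "open S" "\<And>x. x \<in> S \<Longrightarrow> f x \<noteq> 0"
  shows "Ck_on k f S \<Longrightarrow> Ck_on k (\<lambda>x. inverse (f x)) S"
  using assms(2)
proof (induction k arbitrary: f)
  case 0
  then show ?case by (auto intro: continuous_on_inverse)
next
  case (Suc k)
  have inv: "Ck_on k (\<lambda>x. inverse (f x)) S"
    using Suc.IH Ck_on_Suc_imp[OF Suc.prems(1)] Suc.prems(2) by blast
  show ?case
  proof (rule Ck_on_SucI[OF assms(1)])
    show "((\<lambda>x. inverse (f x)) has_derivative
        (\<lambda>v. - (inverse (f x) * frechet_derivative f (at x) v * inverse (f x)))) (at x)" if "x \<in> S" for x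
      using Deriv.has_derivative_inverse[OF Suc.prems(2)[OF that] Ck_on_SucD(1)[OF Suc.prems(1) that]] .
    show "Ck_on k (\<lambda>x. - (inverse (f x) * frechet_derivative f (at x) v * inverse (f x))) S" for v
      by (rule Ck_on_bounded_linear[OF bounded_linear_minus[OF bounded_linear_ident] assms(1)
            Ck_on_bilinear[OF bounded_bilinear_mult assms(1)
              Ck_on_bilinear[OF bounded_bilinear_mult assms(1) inv Ck_on_SucD(2)[OF Suc.prems(1)]] inv]])
  qed
qed

lemma Ck_on_holomorphic: "open S \<Longrightarrow> f holomorphic_on S \<Longrightarrow> Ck_on k f S"
proof (induction k arbitrary: f)
  case 0
  then show ?case by (simp add: holomorphic_on_imp_continuous_on)
next
  case (Suc k)
  show ?case
  proof (rule Ck_on_SucI[OF Suc.prems(1)])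
    show "(f has_derivative (\<lambda>v. deriv f x * v)) (at x)" if "x \<in> S" for x
      using holomorphic_derivI[OF Suc.prems(2,1) that, of UNIV] by (simp add: has_field_derivative_def)
    show "Ck_on k (\<lambda>x. deriv f x * v) S" for v
      by (rule Ck_on_bounded_linear[OF bounded_linear_mult_left Suc.prems(1)
            Suc.IH[OF Suc.prems(1) holomorphic_deriv[OF Suc.prems(2,1)]]])
  qed
qed

text \<open>Freezes the loop parameter: a loop map is jointly smooth in the point and the angle,
  whereas \<open>\<Phi>\<close> is later differentiated at a fixed \<lambda>.\<close>

lemma Ck_on_slice:
  assumes "open S"
  shows "Ck_on k f (S \<times> UNIV) \<Longrightarrow> Ck_on k (\<lambda>w. f (w, t)) S"
proof (induction k arbitrary: f)
  case 0
  then have f: "continuous_on (S \<times> UNIV) f" by simp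
  have pair: "continuous_on S (\<lambda>w. (w, t))"
    by (rule continuous_on_Pair[OF continuous_on_id continuous_on_const])
  have "(\<lambda>w. (w, t)) ` S \<subseteq> S \<times> UNIV" by auto
  from continuous_on_compose2[OF f pair this] show ?case by simp
next
  case (Suc k)
  have "((\<lambda>w. f (w, t)) has_derivative (\<lambda>v. frechet_derivative f (at (x, t)) (v, 0))) (at x)"
    if "x \<in> S" for x
  proof (rule has_derivative_compose[where f = "\<lambda>w. (w, t)" and g = f])
    show "((\<lambda>w. (w, t)) has_derivative (\<lambda>v. (v, 0))) (at x)"
      by (intro has_derivative_Pair has_derivative_ident has_derivative_const)
    show "(f has_derivative frechet_derivative f (at (x, t))) (at (x, t))"
      by (rule Ck_on_SucD(1)[OF Suc.prems]) (use that in auto)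
  qed
  moreover have "Ck_on k (\<lambda>w. frechet_derivative f (at (w, t)) (v, 0)) S" for v
    using Suc.IH[OF Ck_on_SucD(2)[OF Suc.prems]] .
  ultimately show ?case by (rule Ck_on_SucI[OF assms])
qed

lemma smooth_on_const: "open S \<Longrightarrow> smooth_on S (\<lambda>x. c)"
  and smooth_on_add: "open S \<Longrightarrow> smooth_on S f \<Longrightarrow> smooth_on S g \<Longrightarrow> smooth_on S (\<lambda>x. f x + g x)"
  and smooth_on_bounded_linear:
    "bounded_linear L \<Longrightarrow> open S \<Longrightarrow> smooth_on S f \<Longrightarrow> smooth_on S (\<lambda>x. L (f x))"
  by (simp_all add: smooth_on_def Ck_on_const Ck_on_add Ck_on_bounded_linear)

lemma smooth_on_subset: "smooth_on S f \<Longrightarrow> T \<subseteq> S \<Longrightarrow> smooth_on T f"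
  unfolding smooth_on_def using Ck_on_subset by blast

lemma smooth_on_cong:
  "open S \<Longrightarrow> (\<And>y. y \<in> S \<Longrightarrow> f y = g y) \<Longrightarrow> smooth_on S f \<longleftrightarrow> smooth_on S g"
  unfolding smooth_on_def using Ck_on_cong[of S f g] by blast

lemma smooth_on_local:
  assumes "\<And>x. x \<in> S \<Longrightarrow> \<exists>T. open T \<and> x \<in> T \<and> smooth_on T f"
  shows "smooth_on S f"
  using Ck_on_local[of S] assms unfolding smooth_on_def by metis

lemma smooth_on_slice: "open S \<Longrightarrow> smooth_on (S \<times> UNIV) f \<Longrightarrow> smooth_on S (\<lambda>w. f (w, t))"
  by (simp add: smooth_on_def Ck_on_slice)

lemma smooth_on_holomorphic: "open S \<Longrightarrow> f holomorphic_on S \<Longrightarrow> smooth_on S f"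
  by (simp add: smooth_on_def Ck_on_holomorphic)

lemma smooth_on_imp_continuous_on: "smooth_on S f \<Longrightarrow> continuous_on S f"
  unfolding smooth_on_def by (metis Ck_on.simps(1))

lemma smooth_on_imp_differentiable: "smooth_on S f \<Longrightarrow> x \<in> S \<Longrightarrow> f differentiable (at x)"
  unfolding smooth_on_def by (metis Ck_on.simps(2))

lemma smooth_on_frechet_derivative: "smooth_on S f \<Longrightarrow> smooth_on S (\<lambda>x. frechet_derivative f (at x) v)"
  unfolding smooth_on_def by (metis Ck_on.simps(2))

lemma smooth_on_mult:
  fixes f g :: "'a::real_normed_vector \<Rightarrow> complex"
  shows "open S \<Longrightarrow> smooth_on S f \<Longrightarrow> smooth_on S g \<Longrightarrow> smooth_on S (\<lambda>x. f x * g x)"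
  by (simp add: smooth_on_def Ck_on_bilinear[OF bounded_bilinear_mult])

lemma smooth_on_divide:
  fixes f g :: "'a::real_normed_vector \<Rightarrow> complex"
  shows "open S \<Longrightarrow> smooth_on S f \<Longrightarrow> smooth_on S g \<Longrightarrow> (\<And>x. x \<in> S \<Longrightarrow> g x \<noteq> 0) \<Longrightarrow>
    smooth_on S (\<lambda>x. f x / g x)"
  by (simp add: smooth_on_def Ck_on_bilinear[OF bounded_bilinear_mult] Ck_on_inverse divide_inverse)

lemma smooth_on_sum:
  "open S \<Longrightarrow> (\<And>i. i \<in> I \<Longrightarrow> smooth_on S (f i)) \<Longrightarrow> smooth_on S (\<lambda>x. \<Sum>i\<in>I. f i x)"
  by (induction I rule: infinite_finite_induct) (auto intro: smooth_on_const smooth_on_add)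

lemma smooth_on_prod:
  fixes f :: "'i \<Rightarrow> 'a::real_normed_vector \<Rightarrow> complex"
  shows "open S \<Longrightarrow> (\<And>i. i \<in> I \<Longrightarrow> smooth_on S (f i)) \<Longrightarrow> smooth_on S (\<lambda>x. \<Prod>i\<in>I. f i x)"
  by (induction I rule: infinite_finite_induct) (auto intro: smooth_on_const smooth_on_mult)

lemma smooth_on_minus: "open S \<Longrightarrow> smooth_on S f \<Longrightarrow> smooth_on S (\<lambda>x. - f x)"
  by (rule smooth_on_bounded_linear) (auto intro: bounded_linear_minus bounded_linear_ident)

lemma smooth_on_diff:
  "open S \<Longrightarrow> smooth_on S f \<Longrightarrow> smooth_on S g \<Longrightarrow> smooth_on S (\<lambda>x. f x - g x)"
  using smooth_on_add[OF _ _ smooth_on_minus] by fastforce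

lemma smooth_on_matrix_iff:
  fixes F :: "'a::real_normed_vector \<Rightarrow> complex^'n^'m"
  assumes "open S"
  shows "smooth_on S F \<longleftrightarrow> (\<forall>i j. smooth_on S (\<lambda>x. F x $ i $ j))"
proof (intro iffI allI)
  fix i j assume "smooth_on S F"
  then show "smooth_on S (\<lambda>x. F x $ i $ j)"
    by (intro smooth_on_bounded_linear[OF bounded_linear_compose[OF bounded_linear_vec_nth bounded_linear_vec_nth]] assms)
next
  assume *: "\<forall>i j. smooth_on S (\<lambda>x. F x $ i $ j)"
  define E :: "'m \<Rightarrow> 'n \<Rightarrow> complex \<Rightarrow> complex^'n^'m"
    where "E i j c = (\<chi> a b. if a = i \<and> b = j then c else 0)" for i j c
  have "linear (E i j)" for i j
    by (rule linearI) (auto simp: E_def vec_eq_iff)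
  then have E: "bounded_linear (E i j)" for i j
    by (simp add: linear_conv_bounded_linear)
  have "F x = (\<Sum>i\<in>UNIV. \<Sum>j\<in>UNIV. E i j (F x $ i $ j))" for x
  proof -
    have "(\<Sum>i\<in>UNIV. \<Sum>j\<in>UNIV. E i j (F x $ i $ j)) $ a $ b = F x $ a $ b" for a b
    proof -
      have "(\<Sum>i\<in>UNIV. \<Sum>j\<in>UNIV. E i j (F x $ i $ j)) $ a $ b
          = (\<Sum>i\<in>UNIV. \<Sum>j\<in>UNIV. if i = a then if j = b then F x $ i $ j else 0 else 0)"
        by (simp add: E_def) (intro sum.cong; auto)
      also have "\<dots> = (\<Sum>i\<in>UNIV. if i = a then (\<Sum>j\<in>UNIV. if j = b then F x $ i $ j else 0) else 0)"
        by (intro sum.cong) auto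
      also have "\<dots> = F x $ a $ b" by simp
      finally show ?thesis .
    qed
    then show ?thesis by (simp add: vec_eq_iff)
  qed
  moreover have "smooth_on S (\<lambda>x. \<Sum>i\<in>UNIV. \<Sum>j\<in>UNIV. E i j (F x $ i $ j))"
    using * by (intro smooth_on_sum smooth_on_bounded_linear[OF E] assms) auto
  ultimately show "smooth_on S F" by simp
qed

lemma smooth_on_matrix_mult:
  fixes F :: "'a::real_normed_vector \<Rightarrow> complex^'n^'m" and G :: "'a \<Rightarrow> complex^'k^'n"
  shows "open S \<Longrightarrow> smooth_on S F \<Longrightarrow> smooth_on S G \<Longrightarrow> smooth_on S (\<lambda>x. F x ** G x)"
  by (simp add: smooth_on_matrix_iff matrix_matrix_mult_def smooth_on_sum smooth_on_mult)

lemma smooth_on_cnj: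
  fixes f :: "'a::real_normed_vector \<Rightarrow> complex"
  shows "open S \<Longrightarrow> smooth_on S f \<Longrightarrow> smooth_on S (\<lambda>x. cnj (f x))"
  by (rule smooth_on_bounded_linear[OF bounded_linear_cnj])

lemma smooth_on_transpose:
  fixes F :: "'a::real_normed_vector \<Rightarrow> complex^'n^'m"
  shows "open S \<Longrightarrow> smooth_on S F \<Longrightarrow> smooth_on S (\<lambda>x. transpose (F x))"
  by (simp add: smooth_on_matrix_iff transpose_def)

lemma smooth_on_adj:
  fixes F :: "'a::real_normed_vector \<Rightarrow> complex^'n^'m"
  shows "open S \<Longrightarrow> smooth_on S F \<Longrightarrow> smooth_on S (\<lambda>x. adj (F x))"
  by (simp add: smooth_on_matrix_iff smooth_on_cnj)

lemma smooth_on_det: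
  fixes F :: "'a::real_normed_vector \<Rightarrow> complex^'n^'n"
  shows "open S \<Longrightarrow> smooth_on S F \<Longrightarrow> smooth_on S (\<lambda>x. det (F x))"
  unfolding det_def
  by (intro smooth_on_sum smooth_on_mult smooth_on_const smooth_on_prod) (auto simp: smooth_on_matrix_iff)

section \<open>Inverse matrices and their smooth dependence\<close>

lemma matrix_inv_mult:
  fixes A :: "complex^'n^'n"
  assumes "det A \<noteq> 0"
  shows "matrix_inv A ** A = mat 1" "A ** matrix_inv A = mat 1"
proof -
  have "invertible A" using assms by (simp add: invertible_det_nz)
  then have "A ** matrix_inv A = mat 1 \<and> matrix_inv A ** A = mat 1"
    unfolding invertible_def matrix_inv_def by (rule someI_ex)
  then show "matrix_inv A ** A = mat 1" "A ** matrix_inv A = mat 1" by auto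
qed

lemma matrix_inv_unique:
  fixes A :: "complex^'n^'n"
  assumes "A ** B = mat 1"
  shows "matrix_inv A = B" "det A \<noteq> 0"
proof -
  have "invertible A" using assms by (auto simp: invertible_right_inverse)
  then show "det A \<noteq> 0" by (simp add: invertible_det_nz)
  then have "matrix_inv A ** A ** B = B" by (simp add: matrix_inv_mult)
  then show "matrix_inv A = B" by (simp add: assms flip: matrix_mul_assoc)
qed

text \<open>Cramer's rule for the columns of the identity. It reduces smoothness of the inverse to
  that of determinants and quotients.\<close>

lemma matrix_inv_nth:
  fixes A :: "complex^'n^'n"
  assumes "det A \<noteq> 0"
  shows "matrix_inv A $ k $ l = det (\<chi> i j. if j = k then axis l 1 $ i else A $ i $ j) / det A"
proof -
  have "A *v (matrix_inv A *v axis l 1) = axis l 1"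
    by (simp add: matrix_vector_mul_assoc matrix_inv_mult assms)
  then have "matrix_inv A *v axis l 1 = (\<chi> k. det (\<chi> i j. if j = k then axis l 1 $ i else A $ i $ j) / det A)"
    using cramer[OF assms] by blast
  moreover have "(matrix_inv A *v axis l 1) $ k = matrix_inv A $ k $ l"
    by (simp add: matrix_vector_mult_def axis_def if_distrib cong: if_cong)
  ultimately show ?thesis by simp
qed

lemma smooth_on_matrix_inv:
  fixes F :: "'a::real_normed_vector \<Rightarrow> complex^'n^'n"
  assumes "open S" "smooth_on S F" "\<And>x. x \<in> S \<Longrightarrow> det (F x) \<noteq> 0"
  shows "smooth_on S (\<lambda>x. matrix_inv (F x))"
proof -
  have "smooth_on S (\<lambda>x. det (\<chi> i j. if j = k then axis l 1 $ i else F x $ i $ j) / det (F x))" for k l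
  proof (intro smooth_on_divide smooth_on_det assms)
    show "smooth_on S (\<lambda>x. \<chi> i j. if j = k then axis l 1 $ i else F x $ i $ j)"
      unfolding smooth_on_matrix_iff[OF assms(1)]
    proof (intro allI)
      fix i j
      have "smooth_on S (\<lambda>x. F x $ i $ j)" using assms by (simp add: smooth_on_matrix_iff)
      then show "smooth_on S (\<lambda>x. (\<chi> i j. if j = k then axis l 1 $ i else F x $ i $ j) $ i $ j)"
        by (cases "j = k") (simp_all add: smooth_on_const assms(1))
    qed
  qed
  then have "smooth_on S (\<lambda>x. matrix_inv (F x) $ k $ l)" for k l
    by (subst smooth_on_cong[OF assms(1) matrix_inv_nth[OF assms(3)]])
  then show ?thesis
    unfolding smooth_on_matrix_iff[OF assms(1)] by blast
qed

section \<open>Wirtinger derivatives of matrix-valued functions\<close>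

definition mz :: "(complex \<Rightarrow> complex^'n^'m) \<Rightarrow> complex \<Rightarrow> complex^'n^'m" where
  "mz F w = (\<chi> i j. wirtinger_dz (\<lambda>w. F w $ i $ j) w)"

definition mzb :: "(complex \<Rightarrow> complex^'n^'m) \<Rightarrow> complex \<Rightarrow> complex^'n^'m" where
  "mzb F w = (\<chi> i j. wirtinger_dzbar (\<lambda>w. F w $ i $ j) w)"

lemma dz_eq_mz: "dz (U, z) F p = mz (\<lambda>w. F (inv_into U z w)) (z p)"
  and dzbar_eq_mzb: "dzbar (U, z) F p = mzb (\<lambda>w. F (inv_into U z w)) (z p)"
  by (simp_all add: dz_def dzbar_def mz_def mzb_def)

lemma wirtinger_eqI:
  assumes "(f has_derivative D) (at w)"
  shows "wirtinger_dz f w = (D 1 - \<i> * D \<i>) / 2" "wirtinger_dzbar f w = (D 1 + \<i> * D \<i>) / 2"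
  using frechet_derivative_at[OF assms] by (simp_all add: wirtinger_dz_def wirtinger_dzbar_def)

lemma wirtinger_rules:
  fixes f g :: "complex \<Rightarrow> complex"
  assumes "f differentiable (at w)" "g differentiable (at w)"
  shows "wirtinger_dz (\<lambda>w. f w + g w) w = wirtinger_dz f w + wirtinger_dz g w"
    "wirtinger_dzbar (\<lambda>w. f w + g w) w = wirtinger_dzbar f w + wirtinger_dzbar g w"
    "wirtinger_dz (\<lambda>w. f w - g w) w = wirtinger_dz f w - wirtinger_dz g w"
    "wirtinger_dzbar (\<lambda>w. f w - g w) w = wirtinger_dzbar f w - wirtinger_dzbar g w"
    "wirtinger_dz (\<lambda>w. f w * g w) w = wirtinger_dz f w * g w + f w * wirtinger_dz g w"
    "wirtinger_dzbar (\<lambda>w. f w * g w) w = wirtinger_dzbar f w * g w + f w * wirtinger_dzbar g w"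
    "wirtinger_dz (\<lambda>w. cnj (f w)) w = cnj (wirtinger_dzbar f w)"
    "wirtinger_dzbar (\<lambda>w. cnj (f w)) w = cnj (wirtinger_dz f w)"
proof -
  obtain D E where D: "(f has_derivative D) (at w)" and E: "(g has_derivative E) (at w)"
    using assms by (auto simp: differentiable_def)
  note a = has_derivative_add[OF D E] has_derivative_diff[OF D E] has_derivative_mult[OF D E]
    bounded_linear.has_derivative[OF bounded_linear_cnj D]
  note simps = wirtinger_eqI[OF D] wirtinger_eqI[OF E]
  show "wirtinger_dz (\<lambda>w. f w + g w) w = wirtinger_dz f w + wirtinger_dz g w"
    "wirtinger_dzbar (\<lambda>w. f w + g w) w = wirtinger_dzbar f w + wirtinger_dzbar g w"
    unfolding wirtinger_eqI[OF a(1)] simps by (simp_all add: field_simps)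
  show "wirtinger_dz (\<lambda>w. f w - g w) w = wirtinger_dz f w - wirtinger_dz g w"
    "wirtinger_dzbar (\<lambda>w. f w - g w) w = wirtinger_dzbar f w - wirtinger_dzbar g w"
    unfolding wirtinger_eqI[OF a(2)] simps by (simp_all add: field_simps)
  show "wirtinger_dz (\<lambda>w. f w * g w) w = wirtinger_dz f w * g w + f w * wirtinger_dz g w"
    "wirtinger_dzbar (\<lambda>w. f w * g w) w = wirtinger_dzbar f w * g w + f w * wirtinger_dzbar g w"
    unfolding wirtinger_eqI[OF a(3)] simps by (simp_all add: field_simps)
  show "wirtinger_dz (\<lambda>w. cnj (f w)) w = cnj (wirtinger_dzbar f w)"
    "wirtinger_dzbar (\<lambda>w. cnj (f w)) w = cnj (wirtinger_dz f w)"
    unfolding wirtinger_eqI[OF a(4)] simps by simp_all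
qed

lemma wirtinger_const: "wirtinger_dz (\<lambda>w. c) w = 0" "wirtinger_dzbar (\<lambda>w. c) w = 0"
  using wirtinger_eqI[OF has_derivative_const[of c]] by auto

lemma wirtinger_sum:
  fixes f :: "'i \<Rightarrow> complex \<Rightarrow> complex"
  assumes "\<And>i. i \<in> I \<Longrightarrow> f i differentiable (at w)"
  shows "wirtinger_dz (\<lambda>w. \<Sum>i\<in>I. f i w) w = (\<Sum>i\<in>I. wirtinger_dz (f i) w)"
    "wirtinger_dzbar (\<lambda>w. \<Sum>i\<in>I. f i w) w = (\<Sum>i\<in>I. wirtinger_dzbar (f i) w)"
  using assms
  by (induction I rule: infinite_finite_induct)
    (simp_all add: wirtinger_const wirtinger_rules differentiable_sum)

definition mdiff :: "(complex \<Rightarrow> complex^'n^'m) \<Rightarrow> complex \<Rightarrow> bool" where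
  "mdiff F w \<longleftrightarrow> (\<forall>i j. (\<lambda>w. F w $ i $ j) differentiable (at w))"

lemma smooth_on_imp_mdiff: "open S \<Longrightarrow> smooth_on S F \<Longrightarrow> w \<in> S \<Longrightarrow> mdiff F w"
  unfolding mdiff_def smooth_on_matrix_iff by (blast intro: smooth_on_imp_differentiable)

lemma mdiff_const [simp]: "mdiff (\<lambda>w. C) w"
  by (simp add: mdiff_def)

lemma mdiff_mult: "mdiff F w \<Longrightarrow> mdiff G w \<Longrightarrow> mdiff (\<lambda>w. F w ** G w) w"
  by (simp add: mdiff_def matrix_matrix_mult_def differentiable_sum differentiable_mult)

lemma mdiff_add: "mdiff F w \<Longrightarrow> mdiff G w \<Longrightarrow> mdiff (\<lambda>w. F w + G w) w"
  and mdiff_transpose: "mdiff F w \<Longrightarrow> mdiff (\<lambda>w. transpose (F w)) w"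
  by (simp_all add: mdiff_def differentiable_add transpose_def)

lemma mdiff_sum: "(\<And>i. i \<in> I \<Longrightarrow> mdiff (F i) w) \<Longrightarrow> mdiff (\<lambda>w. \<Sum>i\<in>I. F i w) w"
  by (induction I rule: infinite_finite_induct) (simp_all add: mdiff_add)

lemma mz_const [simp]: "mz (\<lambda>w. C) w = 0" "mzb (\<lambda>w. C) w = 0"
  by (simp_all add: mz_def mzb_def wirtinger_const vec_eq_iff)

lemma mz_mult:
  assumes "mdiff F w" "mdiff G w"
  shows "mz (\<lambda>w. F w ** G w) w = mz F w ** G w + F w ** mz G w"
    "mzb (\<lambda>w. F w ** G w) w = mzb F w ** G w + F w ** mzb G w"
  using assms
  by (simp_all add: mdiff_def mz_def mzb_def vec_eq_iff matrix_matrix_mult_def wirtinger_sum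
      wirtinger_rules differentiable_mult sum.distrib)

lemma mz_add:
  assumes "mdiff F w" "mdiff G w"
  shows "mz (\<lambda>w. F w + G w) w = mz F w + mz G w" "mzb (\<lambda>w. F w + G w) w = mzb F w + mzb G w"
    "mz (\<lambda>w. F w - G w) w = mz F w - mz G w" "mzb (\<lambda>w. F w - G w) w = mzb F w - mzb G w"
  using assms by (simp_all add: mdiff_def mz_def mzb_def vec_eq_iff wirtinger_rules)

lemma mz_sum:
  assumes "\<And>i. i \<in> I \<Longrightarrow> mdiff (F i) w"
  shows "mz (\<lambda>w. \<Sum>i\<in>I. F i w) w = (\<Sum>i\<in>I. mz (F i) w)"
    "mzb (\<lambda>w. \<Sum>i\<in>I. F i w) w = (\<Sum>i\<in>I. mzb (F i) w)"
  using assms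
  by (induction I rule: infinite_finite_induct) (simp_all add: mz_add mdiff_sum)

lemma mz_transpose: "mz (\<lambda>w. transpose (F w)) w = transpose (mz F w)"
  "mzb (\<lambda>w. transpose (F w)) w = transpose (mzb F w)"
  by (simp_all add: mz_def mzb_def vec_eq_iff transpose_def)

lemma mz_mcnj:
  assumes "mdiff F w"
  shows "mz (\<lambda>w. mcnj (F w)) w = mcnj (mzb F w)" "mzb (\<lambda>w. mcnj (F w)) w = mcnj (mz F w)"
  using assms wirtinger_rules(7,8)[of "\<lambda>w. F w $ _ $ _" w "\<lambda>w. F w $ _ $ _"]
  by (simp_all add: mdiff_def mz_def mzb_def vec_eq_iff)

lemma mz_cong:
  assumes "open S" "w \<in> S" "\<And>y. y \<in> S \<Longrightarrow> F y = G y"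
  shows "mz F w = mz G w" "mzb F w = mzb G w"
  using frechet_derivative_cong[OF assms(1,2), of "\<lambda>w. F w $ _ $ _" "\<lambda>w. G w $ _ $ _"] assms(3)
  by (simp_all add: mz_def mzb_def vec_eq_iff wirtinger_dz_def wirtinger_dzbar_def)

section \<open>Holomorphic matrix functions\<close>

definition mholo :: "complex set \<Rightarrow> (complex \<Rightarrow> complex^'n^'m) \<Rightarrow> bool" where
  "mholo S F \<longleftrightarrow> (\<forall>i j. (\<lambda>w. F w $ i $ j) holomorphic_on S)"

lemma mholo_const [simp]: "mholo S (\<lambda>w. C)"
  by (simp add: mholo_def)

lemma mholo_mult: "mholo S F \<Longrightarrow> mholo S G \<Longrightarrow> mholo S (\<lambda>w. F w ** G w)"
  by (auto simp: mholo_def matrix_matrix_mult_def intro!: holomorphic_intros)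

lemma mholo_subset: "mholo S F \<Longrightarrow> T \<subseteq> S \<Longrightarrow> mholo T F"
  unfolding mholo_def using holomorphic_on_subset by blast

lemma mholo_imp_smooth_on: "open S \<Longrightarrow> mholo S F \<Longrightarrow> smooth_on S F"
  by (simp add: mholo_def smooth_on_matrix_iff smooth_on_holomorphic)

lemma mholo_imp_mzb_0:
  assumes "open S" "mholo S F" "w \<in> S"
  shows "mzb F w = 0"
proof -
  have "wirtinger_dzbar f w = 0" if f: "f holomorphic_on S" for f
  proof -
    have "(f has_derivative (\<lambda>v. deriv f w * v)) (at w)"
      using holomorphic_derivI[OF f assms(1,3), of UNIV] by (simp add: has_field_derivative_def)
    from wirtinger_eqI(2)[OF this] show ?thesis by (simp add: algebra_simps)
  qed
  then show ?thesis using assms(2) by (simp add: mholo_def mzb_def vec_eq_iff)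
qed

text \<open>The Cauchy-Riemann equation: a vanishing dbar-derivative says D \<i> = \<i> D 1, so the
  real derivative is multiplication by the complex number D 1.\<close>

lemma mzb_0_imp_mholo:
  assumes "open S" "\<And>w. w \<in> S \<Longrightarrow> mdiff F w" "\<And>w. w \<in> S \<Longrightarrow> mzb F w = 0"
  shows "mholo S F"
proof -
  have "(\<lambda>w. F w $ i $ j) field_differentiable (at w)" if w: "w \<in> S" for i j w
  proof -
    obtain D where D: "((\<lambda>w. F w $ i $ j) has_derivative D) (at w)"
      using assms(2)[OF w] by (auto simp: mdiff_def differentiable_def)
    have "mzb F w $ i $ j = 0" using assms(3)[OF w] by simp
    then have "D 1 + \<i> * D \<i> = 0"
      using wirtinger_eqI(2)[OF D] by (simp add: mzb_def)
    then have "\<i> * (D 1 + \<i> * D \<i>) = 0" by simp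
    then have Di: "D \<i> = \<i> * D 1" by (simp add: algebra_simps)
    interpret D: bounded_linear D using D by (rule has_derivative_bounded_linear)
    have "D h = D 1 * h" for h
    proof -
      have h: "h = Re h *\<^sub>R 1 + Im h *\<^sub>R \<i>"
        by (simp add: complex_eq_iff)
      have "D h = D (Re h *\<^sub>R 1 + Im h *\<^sub>R \<i>)"
        using h by (rule arg_cong)
      also have "\<dots> = Re h *\<^sub>R D 1 + Im h *\<^sub>R (\<i> * D 1)"
        by (simp add: D.add D.scale Di)
      also have "\<dots> = D 1 * h"
        by (simp add: complex_eq_iff)
      finally show ?thesis .
    qed
    then have "D = (*) (D 1)" by (rule ext)
    with D have "((\<lambda>w. F w $ i $ j) has_field_derivative D 1) (at w)"
      unfolding has_field_derivative_def by metis
    then show ?thesis by (auto simp: field_differentiable_def)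
  qed
  then show ?thesis
    by (simp add: mholo_def holomorphic_on_def field_differentiable_at_within)
qed

section \<open>Kernels of holomorphic families of functionals\<close>

text \<open>Each function is a power of \<open>w - w0\<close> times a factor without zeros near
  \<open>w0\<close>. The function with the smaller exponent divides the other one, and its only
  possible zero in a small disc is the centre.\<close>

lemma holomorphic_comparable:
  assumes "r > 0" and f: "f holomorphic_on ball w0 r" and h: "h holomorphic_on ball w0 r"
    and f0: "\<exists>w\<in>ball w0 r. f w \<noteq> 0" and h0: "\<exists>w\<in>ball w0 r. h w \<noteq> 0"
  obtains \<rho> q where "0 < \<rho>" "\<rho> \<le> r" "q holomorphic_on ball w0 \<rho>"
    "\<And>w. w \<in> ball w0 \<rho> \<Longrightarrow> f w = q w * h w" "\<And>w. w \<in> ball w0 \<rho> - {w0} \<Longrightarrow> h w \<noteq> 0"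
  | \<rho> q where "0 < \<rho>" "\<rho> \<le> r" "q holomorphic_on ball w0 \<rho>"
    "\<And>w. w \<in> ball w0 \<rho> \<Longrightarrow> h w = q w * f w" "\<And>w. w \<in> ball w0 \<rho> - {w0} \<Longrightarrow> f w \<noteq> 0"
proof -
  have "w0 \<in> ball w0 r" using assms by simp
  from zorder_exist_zero[OF f open_ball connected_ball this f0]
  obtain r1 m g where r1: "r1 > 0" "cball w0 r1 \<subseteq> ball w0 r" and g: "g holomorphic_on cball w0 r1"
    and fg: "\<And>w. w \<in> cball w0 r1 \<Longrightarrow> f w = g w * (w - w0) ^ m \<and> g w \<noteq> 0"
    by blast
  from zorder_exist_zero[OF h open_ball connected_ball \<open>w0 \<in> ball w0 r\<close> h0]
  obtain r2 n k where r2: "r2 > 0" "cball w0 r2 \<subseteq> ball w0 r" and k: "k holomorphic_on cball w0 r2"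
    and hk: "\<And>w. w \<in> cball w0 r2 \<Longrightarrow> h w = k w * (w - w0) ^ n \<and> k w \<noteq> 0"
    by blast
  define \<rho> where "\<rho> = min r (min r1 r2)"
  have \<rho>: "0 < \<rho>" "\<rho> \<le> r" and sub: "ball w0 \<rho> \<subseteq> cball w0 r1" "ball w0 \<rho> \<subseteq> cball w0 r2"
    using assms r1 r2 by (auto simp: \<rho>_def)
  have g': "g holomorphic_on ball w0 \<rho>" and k': "k holomorphic_on ball w0 \<rho>"
    using g k sub holomorphic_on_subset by blast+
  show thesis
  proof (cases "n \<le> m")
    case True
    show thesis
    proof (rule that(1)[of \<rho> "\<lambda>w. g w / k w * (w - w0) ^ (m - n)"])
      show "(\<lambda>w. g w / k w * (w - w0) ^ (m - n)) holomorphic_on ball w0 \<rho>"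
        using g' k' hk sub by (intro holomorphic_intros) auto
      show "f w = g w / k w * (w - w0) ^ (m - n) * h w" if "w \<in> ball w0 \<rho>" for w
      proof -
        have "(w - w0) ^ m = (w - w0) ^ (m - n) * (w - w0) ^ n"
          using True by (simp flip: power_add)
        moreover have "f w = g w * (w - w0) ^ m" "h w = k w * (w - w0) ^ n" "k w \<noteq> 0"
          using fg[of w] hk[of w] that sub by blast+
        ultimately show ?thesis by (simp add: field_simps)
      qed
      show "h w \<noteq> 0" if "w \<in> ball w0 \<rho> - {w0}" for w
      proof -
        have "w \<in> cball w0 r2" "w \<noteq> w0" using that sub by blast+
        then show ?thesis using hk[of w] by simp
      qed
    qed (use \<rho> in auto)
  next
    case False
    show thesis
    proof (rule that(2)[of \<rho> "\<lambda>w. k w / g w * (w - w0) ^ (n - m)"])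
      show "(\<lambda>w. k w / g w * (w - w0) ^ (n - m)) holomorphic_on ball w0 \<rho>"
        using g' k' fg sub by (intro holomorphic_intros) auto
      show "h w = k w / g w * (w - w0) ^ (n - m) * f w" if "w \<in> ball w0 \<rho>" for w
      proof -
        have "(w - w0) ^ n = (w - w0) ^ (n - m) * (w - w0) ^ m"
          using False by (simp flip: power_add)
        moreover have "f w = g w * (w - w0) ^ m" "h w = k w * (w - w0) ^ n" "g w \<noteq> 0"
          using fg[of w] hk[of w] that sub by blast+
        ultimately show ?thesis by (simp add: field_simps)
      qed
      show "f w \<noteq> 0" if "w \<in> ball w0 \<rho> - {w0}" for w
      proof -
        have "w \<in> cball w0 r1" "w \<noteq> w0" using that sub by blast+
        then show ?thesis using fg[of w] by simp
      qed
    qed (use \<rho> in auto)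
  qed
qed

text \<open>Provides the pivot for elimination over the ring of germs: a member of least vanishing
  order divides all others with holomorphic quotients, including at the centre.\<close>

lemma holomorphic_family_min_order:
  assumes "finite I" "r > 0" "\<And>k. k \<in> I \<Longrightarrow> b k holomorphic_on ball w0 r"
  shows "\<exists>\<rho>. 0 < \<rho> \<and> \<rho> \<le> r \<and>
    ((\<forall>k\<in>I. \<forall>w\<in>ball w0 \<rho>. b k w = 0) \<or>
     (\<exists>k0\<in>I. \<exists>q. (\<forall>k\<in>I. q k holomorphic_on ball w0 \<rho> \<and> (\<forall>w\<in>ball w0 \<rho>. b k w = q k w * b k0 w)) \<and>
        (\<forall>w\<in>ball w0 \<rho> - {w0}. b k0 w \<noteq> 0)))"
  using assms(1,3)
proof (induction I rule: finite_induct)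
  case empty
  then show ?case using assms by auto
next
  case (insert j I)
  then obtain \<rho> where \<rho>: "0 < \<rho>" "\<rho> \<le> r" and alt:
    "(\<forall>k\<in>I. \<forall>w\<in>ball w0 \<rho>. b k w = 0) \<or>
     (\<exists>k0\<in>I. \<exists>q. (\<forall>k\<in>I. q k holomorphic_on ball w0 \<rho> \<and> (\<forall>w\<in>ball w0 \<rho>. b k w = q k w * b k0 w)) \<and>
        (\<forall>w\<in>ball w0 \<rho> - {w0}. b k0 w \<noteq> 0))"
    by auto
  have bj: "b j holomorphic_on ball w0 \<rho>"
    using insert.prems[of j] \<rho> by (auto intro: holomorphic_on_subset)
  show ?case
  proof (cases "\<forall>w\<in>ball w0 \<rho>. b j w = 0")
    case True
    from alt show ?thesis
    proof
      assume "\<forall>k\<in>I. \<forall>w\<in>ball w0 \<rho>. b k w = 0"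
      then show ?thesis using True \<rho> by auto
    next
      assume "\<exists>k0\<in>I. \<exists>q. (\<forall>k\<in>I. q k holomorphic_on ball w0 \<rho> \<and> (\<forall>w\<in>ball w0 \<rho>. b k w = q k w * b k0 w)) \<and>
        (\<forall>w\<in>ball w0 \<rho> - {w0}. b k0 w \<noteq> 0)"
      then obtain k0 q where k0: "k0 \<in> I" and q: "\<forall>k\<in>I. q k holomorphic_on ball w0 \<rho> \<and> (\<forall>w\<in>ball w0 \<rho>. b k w = q k w * b k0 w)"
        and nz: "\<forall>w\<in>ball w0 \<rho> - {w0}. b k0 w \<noteq> 0" by blast
      define q' where "q' k = (if k = j then (\<lambda>w::complex. 0::complex) else q k)" for k
      have "\<forall>k\<in>insert j I. q' k holomorphic_on ball w0 \<rho> \<and> (\<forall>w\<in>ball w0 \<rho>. b k w = q' k w * b k0 w)"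
        using q True by (auto simp: q'_def)
      then show ?thesis using k0 nz \<rho> by blast
    qed
  next
    case False
    from alt show ?thesis
    proof
      assume z: "\<forall>k\<in>I. \<forall>w\<in>ball w0 \<rho>. b k w = 0"
      from False have nzj: "\<exists>w\<in>ball w0 \<rho>. b j w \<noteq> 0" by blast
      \<comment> \<open>Comparing \<open>b j\<close> with itself only serves to find a disc on which
        it has no zero except possibly the centre.\<close>
      obtain \<rho>' q0 where \<rho>': "0 < \<rho>'" "\<rho>' \<le> \<rho>" and nz: "\<And>w. w \<in> ball w0 \<rho>' - {w0} \<Longrightarrow> b j w \<noteq> 0"
        by (rule holomorphic_comparable[OF \<rho>(1) bj bj nzj nzj]) (rule that; assumption)+
      define q' where "q' k = (if k = j then (\<lambda>w::complex. 1) else (\<lambda>w. 0::complex))" for k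
      have "\<forall>k\<in>insert j I. q' k holomorphic_on ball w0 \<rho>' \<and> (\<forall>w\<in>ball w0 \<rho>'. b k w = q' k w * b j w)"
        using z \<rho>' by (auto simp: q'_def)
      moreover have "\<forall>w\<in>ball w0 \<rho>' - {w0}. b j w \<noteq> 0" using nz by blast
      moreover have "\<rho>' \<le> r" using \<rho>' \<rho> by simp
      ultimately show ?thesis using \<rho>' by blast
    next
      assume "\<exists>k0\<in>I. \<exists>q. (\<forall>k\<in>I. q k holomorphic_on ball w0 \<rho> \<and> (\<forall>w\<in>ball w0 \<rho>. b k w = q k w * b k0 w)) \<and>
        (\<forall>w\<in>ball w0 \<rho> - {w0}. b k0 w \<noteq> 0)"
      then obtain k0 q where k0: "k0 \<in> I" and q: "\<forall>k\<in>I. q k holomorphic_on ball w0 \<rho> \<and> (\<forall>w\<in>ball w0 \<rho>. b k w = q k w * b k0 w)"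
        and nz: "\<forall>w\<in>ball w0 \<rho> - {w0}. b k0 w \<noteq> 0" by blast
      from False have nzj: "\<exists>w\<in>ball w0 \<rho>. b j w \<noteq> 0" by blast
      have bk0: "b k0 holomorphic_on ball w0 \<rho>"
        using insert.prems[of k0] k0 \<rho> by (auto intro: holomorphic_on_subset)
      have "w0 + of_real (\<rho> / 2) \<in> ball w0 \<rho> - {w0}" using \<rho> by (auto simp: dist_norm)
      then have nzk0: "\<exists>w\<in>ball w0 \<rho>. b k0 w \<noteq> 0" using nz by blast
      consider \<rho>' p where "0 < \<rho>'" "\<rho>' \<le> \<rho>" "p holomorphic_on ball w0 \<rho>'"
          "\<And>w. w \<in> ball w0 \<rho>' \<Longrightarrow> b j w = p w * b k0 w"
        | \<rho>' p where "0 < \<rho>'" "\<rho>' \<le> \<rho>" "p holomorphic_on ball w0 \<rho>'"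
          "\<And>w. w \<in> ball w0 \<rho>' \<Longrightarrow> b k0 w = p w * b j w" "\<And>w. w \<in> ball w0 \<rho>' - {w0} \<Longrightarrow> b j w \<noteq> 0"
        by (rule holomorphic_comparable[OF \<rho>(1) bj bk0 nzj nzk0])
          (rule that(1), assumption+, rule that(2), assumption+)
      then show ?thesis
      proof cases
        case 1
        define q' where "q' k = (if k = j then p else q k)" for k
        have sub: "ball w0 \<rho>' \<subseteq> ball w0 \<rho>" using 1 by auto
        have "\<forall>k\<in>insert j I. q' k holomorphic_on ball w0 \<rho>' \<and> (\<forall>w\<in>ball w0 \<rho>'. b k w = q' k w * b k0 w)"
        proof
          fix k assume "k \<in> insert j I"
          then show "q' k holomorphic_on ball w0 \<rho>' \<and> (\<forall>w\<in>ball w0 \<rho>'. b k w = q' k w * b k0 w)"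
            using 1 q holomorphic_on_subset[OF _ sub] sub insert.hyps by (cases "k = j") (auto simp: q'_def)
        qed
        moreover have "\<forall>w\<in>ball w0 \<rho>' - {w0}. b k0 w \<noteq> 0" using nz sub by blast
        moreover have "\<rho>' \<le> r" using 1 \<rho> by simp
        ultimately show ?thesis using k0 1 by blast
      next
        case 2
        define q' where "q' k = (if k = j then (\<lambda>w::complex. 1::complex) else (\<lambda>w. q k w * p w))" for k
        have sub: "ball w0 \<rho>' \<subseteq> ball w0 \<rho>" using 2 by auto
        have "\<forall>k\<in>insert j I. q' k holomorphic_on ball w0 \<rho>' \<and> (\<forall>w\<in>ball w0 \<rho>'. b k w = q' k w * b j w)"
        proof
          fix k assume k: "k \<in> insert j I"
          show "q' k holomorphic_on ball w0 \<rho>' \<and> (\<forall>w\<in>ball w0 \<rho>'. b k w = q' k w * b j w)"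
          proof (cases "k = j")
            case True
            then show ?thesis by (simp add: q'_def)
          next
            case False
            then have qk: "q k holomorphic_on ball w0 \<rho>'" "\<forall>w\<in>ball w0 \<rho>'. b k w = q k w * b k0 w"
              using k q holomorphic_on_subset[OF _ sub] sub by auto
            then show ?thesis
              using False 2 by (auto simp: q'_def intro: holomorphic_on_mult)
          qed
        qed
        moreover have "\<forall>w\<in>ball w0 \<rho>' - {w0}. b j w \<noteq> 0" using 2 by blast
        moreover have "\<rho>' \<le> r" using 2 \<rho> by simp
        ultimately show ?thesis using 2 by blast
      qed
    qed
  qed
qed

text \<open>In the frames below \<open>M\<close> is invertible on the whole disc, so the selected
  columns span a space of dimension \<open>card I\<close> at the centre as well. A subbundle and a
  complement are thus carried by one matrix.\<close>

definition cspan :: "complex^'n^'m \<Rightarrow> 'n set \<Rightarrow> (complex^'m) set" where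
  "cspan M I = {M *v x |x. \<forall>k. k \<notin> I \<longrightarrow> x $ k = 0}"

lemma det_nz_iff_ker:
  fixes A :: "complex^'n^'n"
  shows "det A \<noteq> 0 \<longleftrightarrow> (\<forall>x. A *v x = 0 \<longrightarrow> x = 0)"
  by (metis invertible_det_nz invertible_left_inverse matrix_left_invertible_ker)

text \<open>In the frame \<open>Q\<close> the functional has the components \<open>b k\<close>.
  Dividing by a pivot \<open>b k0\<close> of least order keeps the quotients holomorphic at
  \<open>w0\<close>, so a column operation removes all components but the pivot, and dropping
  \<open>k0\<close> from \<open>I\<close> leaves the kernel. At \<open>w0\<close> the pivot may
  vanish, and with it the equality.\<close>

lemma kernel_frame_step:
  fixes Q :: "complex \<Rightarrow> complex^'n^'n" and a :: "complex \<Rightarrow> complex^'n"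
  assumes "r > 0" and Q: "mholo (ball w0 r) Q" and detQ: "\<And>w. w \<in> ball w0 r \<Longrightarrow> det (Q w) \<noteq> 0"
    and a: "\<And>k. (\<lambda>w. a w $ k) holomorphic_on ball w0 r"
  obtains \<rho> Q' I' where "0 < \<rho>" "\<rho> \<le> r" "mholo (ball w0 \<rho>) Q'" "\<And>w. w \<in> ball w0 \<rho> \<Longrightarrow> det (Q' w) \<noteq> 0"
    "\<And>w. w \<in> ball w0 \<rho> - {w0} \<Longrightarrow> cspan (Q' w) I' = {v \<in> cspan (Q w) I. (\<Sum>k\<in>UNIV. a w $ k * v $ k) = 0}"
proof -
  define b where "b k w = (\<Sum>j\<in>UNIV. a w $ j * Q w $ j $ k)" for k w
  have pair: "(\<Sum>j\<in>UNIV. a w $ j * (Q w *v x) $ j) = (\<Sum>k\<in>UNIV. b k w * x $ k)" for w x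
    unfolding b_def matrix_vector_mult_def
    by (simp add: sum_distrib_left sum_distrib_right mult.assoc) (rule sum.swap)
  have "b k holomorphic_on ball w0 r" for k
    using Q a unfolding b_def mholo_def by (intro holomorphic_intros) auto
  then obtain \<rho> where \<rho>: "0 < \<rho>" "\<rho> \<le> r" and alt:
    "(\<forall>k\<in>I. \<forall>w\<in>ball w0 \<rho>. b k w = 0) \<or>
     (\<exists>k0\<in>I. \<exists>q. (\<forall>k\<in>I. q k holomorphic_on ball w0 \<rho> \<and> (\<forall>w\<in>ball w0 \<rho>. b k w = q k w * b k0 w)) \<and>
        (\<forall>w\<in>ball w0 \<rho> - {w0}. b k0 w \<noteq> 0))"
    using holomorphic_family_min_order[OF finite \<open>r > 0\<close>, of I b w0] by blast
  have sub: "ball w0 \<rho> \<subseteq> ball w0 r" using \<rho> by auto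
  from alt show thesis
  proof
    assume z: "\<forall>k\<in>I. \<forall>w\<in>ball w0 \<rho>. b k w = 0"
    have "{v \<in> cspan (Q w) I. (\<Sum>k\<in>UNIV. a w $ k * v $ k) = 0} = cspan (Q w) I" if w: "w \<in> ball w0 \<rho>" for w
    proof -
      have "(\<Sum>k\<in>UNIV. b k w * x $ k) = 0" if "\<forall>k. k \<notin> I \<longrightarrow> x $ k = 0" for x :: "complex^'n"
      proof (rule sum.neutral, safe)
        fix k show "b k w * x $ k = 0" using z w that by (cases "k \<in> I") simp_all
      qed
      then show ?thesis by (auto simp: cspan_def pair)
    qed
    then show thesis
      using that[of \<rho> Q I] \<rho> mholo_subset[OF Q sub] detQ sub by auto
  next
    assume "\<exists>k0\<in>I. \<exists>q. (\<forall>k\<in>I. q k holomorphic_on ball w0 \<rho> \<and> (\<forall>w\<in>ball w0 \<rho>. b k w = q k w * b k0 w)) \<and>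
        (\<forall>w\<in>ball w0 \<rho> - {w0}. b k0 w \<noteq> 0)"
    then obtain k0 q where k0: "k0 \<in> I" and q: "\<And>k. k \<in> I \<Longrightarrow> q k holomorphic_on ball w0 \<rho>"
      and bq: "\<And>k w. k \<in> I \<Longrightarrow> w \<in> ball w0 \<rho> \<Longrightarrow> b k w = q k w * b k0 w"
      and nz: "\<And>w. w \<in> ball w0 \<rho> - {w0} \<Longrightarrow> b k0 w \<noteq> 0" by blast
    define I' where "I' = I - {k0}"
    \<comment> \<open>Multiplication by \<open>E\<close> on the right subtracts \<open>q j\<close>
      times column \<open>k0\<close> from each other column \<open>j\<close> in \<open>I\<close>;
      the new columns pair to \<open>b j - q j * b k0\<close>, which is zero.\<close>
    define E :: "complex \<Rightarrow> complex^'n^'n"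
      where "E w = (\<chi> i j. if i = j then 1 else if i = k0 \<and> j \<in> I then - q j w else 0)" for w
    have E_other: "(E w *v x) $ i = x $ i" if "i \<noteq> k0" for w x i
    proof -
      have "(E w *v x) $ i = (\<Sum>j\<in>UNIV. if i = j then x $ j else 0)"
        unfolding matrix_vector_mult_def E_def vec_lambda_beta by (rule sum.cong) (auto simp: that)
      then show ?thesis by simp
    qed
    have E_k0: "(E w *v x) $ k0 = x $ k0 - (\<Sum>j\<in>I'. q j w * x $ j)" for w x
    proof -
      have "(E w *v x) $ k0 = (\<Sum>j\<in>UNIV. (if k0 = j then x $ j else 0) - (if j \<in> I' then q j w * x $ j else 0))"
        unfolding matrix_vector_mult_def E_def vec_lambda_beta I'_def by (rule sum.cong) auto
      also have "\<dots> = x $ k0 - (\<Sum>j\<in>UNIV. if j \<in> I' then q j w * x $ j else 0)"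
        by (simp add: sum_subtractf)
      also have "(\<Sum>j\<in>UNIV. if j \<in> I' then q j w * x $ j else 0) = (\<Sum>j\<in>I'. q j w * x $ j)"
        by (simp add: sum.If_cases)
      finally show ?thesis .
    qed
    have "x = 0" if "E w *v x = 0" for w x
    proof -
      have "x $ i = 0" if "i \<noteq> k0" for i
        using E_other[OF that, of w x] \<open>E w *v x = 0\<close> by simp
      moreover from this have "x $ k0 = 0"
        using E_k0[of w x] \<open>E w *v x = 0\<close> by (simp add: I'_def)
      ultimately have "x $ i = 0" for i by (cases "i = k0") auto
      then show "x = 0" by (simp add: vec_eq_iff)
    qed
    then have detE: "det (E w) \<noteq> 0" for w by (simp add: det_nz_iff_ker)
    have Eholo: "mholo (ball w0 \<rho>) E"
      unfolding mholo_def
    proof (intro allI)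
      fix i j
      show "(\<lambda>w. E w $ i $ j) holomorphic_on ball w0 \<rho>"
        using q[of j] by (cases "i = j"; cases "i = k0 \<and> j \<in> I") (auto simp: E_def intro: holomorphic_on_minus)
    qed
    have pairI: "(\<Sum>k\<in>UNIV. b k w * y $ k) = b k0 w * ((\<Sum>j\<in>I'. q j w * y $ j) + y $ k0)"
      if w: "w \<in> ball w0 \<rho>" and y: "\<forall>k. k \<notin> I \<longrightarrow> y $ k = 0" for w y
    proof -
      have "(\<Sum>k\<in>UNIV. b k w * y $ k) = (\<Sum>k\<in>I. b k w * y $ k)"
        by (rule sum.mono_neutral_right) (use y in auto)
      also have "\<dots> = (\<Sum>k\<in>I'. b k w * y $ k) + b k0 w * y $ k0"
        using k0 by (simp add: I'_def sum.remove[of I k0])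
      also have "(\<Sum>k\<in>I'. b k w * y $ k) = (\<Sum>k\<in>I'. b k0 w * (q k w * y $ k))"
        by (rule sum.cong[OF refl], subst bq[OF _ w]) (auto simp: I'_def)
      finally show ?thesis by (simp add: sum_distrib_left algebra_simps)
    qed
    have "cspan (Q w ** E w) I' = {v \<in> cspan (Q w) I. (\<Sum>k\<in>UNIV. a w $ k * v $ k) = 0}"
      if w: "w \<in> ball w0 \<rho> - {w0}" for w
    proof (intro equalityI subsetI)
      fix v assume "v \<in> cspan (Q w ** E w) I'"
      then obtain x where x: "\<forall>k. k \<notin> I' \<longrightarrow> x $ k = 0" and v: "v = Q w *v (E w *v x)"
        by (auto simp: cspan_def matrix_vector_mul_assoc)
      have xI: "\<forall>k. k \<notin> I \<longrightarrow> (E w *v x) $ k = 0"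
      proof (intro allI impI)
        fix k assume k: "k \<notin> I"
        then have "(E w *v x) $ k = x $ k" using k0 by (intro E_other) auto
        then show "(E w *v x) $ k = 0" using x k by (simp add: I'_def)
      qed
      have "x $ k0 = 0" using x by (simp add: I'_def)
      moreover have "(\<Sum>j\<in>I'. q j w * (E w *v x) $ j) = (\<Sum>j\<in>I'. q j w * x $ j)"
        by (rule sum.cong) (auto simp: I'_def E_other)
      ultimately have "(\<Sum>k\<in>UNIV. b k w * (E w *v x) $ k) = 0"
        using pairI[OF _ xI] w by (simp add: E_k0)
      then show "v \<in> {v \<in> cspan (Q w) I. (\<Sum>k\<in>UNIV. a w $ k * v $ k) = 0}"
        using xI v pair by (auto simp: cspan_def)
    next
      fix v assume "v \<in> {v \<in> cspan (Q w) I. (\<Sum>k\<in>UNIV. a w $ k * v $ k) = 0}"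
      then obtain y where y: "\<forall>k. k \<notin> I \<longrightarrow> y $ k = 0" and v: "v = Q w *v y"
        and 0: "(\<Sum>k\<in>UNIV. b k w * y $ k) = 0"
        by (auto simp: cspan_def pair)
      have yk0: "(\<Sum>j\<in>I'. q j w * y $ j) + y $ k0 = 0"
        using pairI[OF _ y] 0 nz[OF w] w by auto
      define x :: "complex^'n" where "x = (\<chi> i. if i = k0 then 0 else y $ i)"
      have "(E w *v x) $ i = y $ i" for i
      proof (cases "i = k0")
        case True
        have "(\<Sum>j\<in>I'. q j w * x $ j) = (\<Sum>j\<in>I'. q j w * y $ j)"
          by (rule sum.cong) (auto simp: I'_def x_def)
        then have "(E w *v x) $ k0 = - (\<Sum>j\<in>I'. q j w * y $ j)"
          by (simp add: E_k0) (simp add: x_def)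
        moreover have "y $ k0 = - (\<Sum>j\<in>I'. q j w * y $ j)"
          using yk0 by (simp add: eq_neg_iff_add_eq_0 add.commute)
        ultimately show ?thesis using True by simp
      qed (simp add: E_other x_def)
      then have "E w *v x = y" by (simp add: vec_eq_iff)
      moreover have "\<forall>k. k \<notin> I' \<longrightarrow> x $ k = 0" using y by (auto simp: x_def I'_def)
      ultimately show "v \<in> cspan (Q w ** E w) I'"
        unfolding cspan_def v by (auto simp flip: matrix_vector_mul_assoc)
    qed
    moreover have "mholo (ball w0 \<rho>) (\<lambda>w. Q w ** E w)"
      by (rule mholo_mult[OF mholo_subset[OF Q sub] Eholo])
    moreover have "det (Q w ** E w) \<noteq> 0" if "w \<in> ball w0 \<rho>" for w
      using detQ[of w] detE[of w] that sub by (auto simp: det_mul)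
    ultimately show thesis using that[of \<rho> "\<lambda>w. Q w ** E w" I'] \<rho> by blast
  qed
qed

lemma kernel_frame:
  fixes \<A> :: "(complex \<Rightarrow> complex^'n) set"
  assumes "finite \<A>" "r > 0" "\<And>a k. a \<in> \<A> \<Longrightarrow> (\<lambda>w. a w $ k) holomorphic_on ball w0 r"
  shows "\<exists>\<rho> Q I. 0 < \<rho> \<and> \<rho> \<le> r \<and> mholo (ball w0 \<rho>) Q \<and> (\<forall>w\<in>ball w0 \<rho>. det (Q w) \<noteq> 0) \<and>
    (\<forall>w\<in>ball w0 \<rho> - {w0}. cspan (Q w) I = {v. \<forall>a\<in>\<A>. (\<Sum>k\<in>UNIV. a w $ k * v $ k) = 0})"
  using assms(1,3)
proof (induction \<A> rule: finite_induct)
  case empty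
  have "cspan (mat 1 :: complex^'n^'n) UNIV = UNIV"
    by (auto simp: cspan_def)
  then show ?case
    using assms(2) by (intro exI[of _ r] exI[of _ "\<lambda>w. mat 1"] exI[of _ UNIV]) auto
next
  case (insert a \<A>)
  then obtain \<rho> Q I where \<rho>: "0 < \<rho>" "\<rho> \<le> r" and Q: "mholo (ball w0 \<rho>) Q"
    "\<And>w. w \<in> ball w0 \<rho> \<Longrightarrow> det (Q w) \<noteq> 0"
    and ker: "\<And>w. w \<in> ball w0 \<rho> - {w0} \<Longrightarrow> cspan (Q w) I = {v. \<forall>a\<in>\<A>. (\<Sum>k\<in>UNIV. a w $ k * v $ k) = 0}"
    using insert.IH[OF insert.prems] by blast
  have "(\<lambda>w. a w $ k) holomorphic_on ball w0 \<rho>" for k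
    using insert.prems[of a k] \<rho> by (auto intro: holomorphic_on_subset)
  from kernel_frame_step[OF \<rho>(1) Q this, of I]
  obtain \<rho>' Q' I' where *: "0 < \<rho>'" "\<rho>' \<le> \<rho>" "mholo (ball w0 \<rho>') Q'" "\<And>w. w \<in> ball w0 \<rho>' \<Longrightarrow> det (Q' w) \<noteq> 0"
    and ker': "\<And>w. w \<in> ball w0 \<rho>' - {w0} \<Longrightarrow> cspan (Q' w) I' = {v \<in> cspan (Q w) I. (\<Sum>k\<in>UNIV. a w $ k * v $ k) = 0}"
    by blast
  have "cspan (Q' w) I' = {v. \<forall>a\<in>insert a \<A>. (\<Sum>k\<in>UNIV. a w $ k * v $ k) = 0}"
    if "w \<in> ball w0 \<rho>' - {w0}" for w
  proof -
    have "w \<in> ball w0 \<rho> - {w0}" using that *(2) by auto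
    from ker[OF this] ker'[OF that] show ?thesis by auto
  qed
  moreover have "\<rho>' \<le> r" using * \<rho> by simp
  ultimately show ?case using * by blast
qed

section \<open>Dimension of and projection onto the span of selected columns\<close>

lemma subspace_cspan:
  fixes M :: "complex^'n^'m"
  shows "vec.subspace (cspan M I)"
proof -
  have "vec.subspace {x::complex^'n. \<forall>k. k \<notin> I \<longrightarrow> x $ k = 0}"
    by (auto simp: vec.subspace_def)
  then have "vec.subspace ((*v) M ` {x. \<forall>k. k \<notin> I \<longrightarrow> x $ k = 0})"
    by (rule vec.subspace_image)
  moreover have "cspan M I = (*v) M ` {x. \<forall>k. k \<notin> I \<longrightarrow> x $ k = 0}"
    by (auto simp: cspan_def)
  ultimately show ?thesis by simp
qed

lemma dim_cspan:
  fixes M :: "complex^'n^'n"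
  assumes "det M \<noteq> 0"
  shows "vec.dim (cspan M I) = card I"
proof -
  have "inj ((*v) M)"
    using assms by (metis invertible_det_nz invertible_left_inverse matrix_left_invertible_injective)
  then have "vec.dim ((*v) M ` {x. \<forall>k. k \<notin> I \<longrightarrow> x $ k = 0}) = vec.dim {x::complex^'n. \<forall>k. k \<notin> I \<longrightarrow> x $ k = 0}"
    by (intro vec.dim_image_eq) (auto intro: inj_on_subset)
  moreover have "cspan M I = (*v) M ` {x. \<forall>k. k \<notin> I \<longrightarrow> x $ k = 0}"
    by (auto simp: cspan_def)
  ultimately show ?thesis by (simp add: dim_substandard_cart)
qed

definition dmat :: "'n set \<Rightarrow> complex^'n^'n" where
  "dmat I = (\<chi> i j. if i = j \<and> i \<in> I then 1 else 0)"

lemma dmat_vec: "(dmat I *v x) $ k = (if k \<in> I then x $ k else 0)"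
proof -
  have "(dmat I *v x) $ k = (\<Sum>j\<in>UNIV. if k = j then (if k \<in> I then x $ j else 0) else 0)"
    unfolding matrix_vector_mult_def dmat_def vec_lambda_beta by (rule sum.cong) auto
  then show ?thesis by simp
qed

lemma dmat_idem: "dmat I ** dmat I = dmat I"
  unfolding matrix_eq by (simp add: vec_eq_iff dmat_vec flip: matrix_vector_mul_assoc)

lemma adj_dmat: "adj (dmat I) = dmat I"
  by (auto simp: vec_eq_iff dmat_def)

lemma cspan_eq_range: "cspan M I = range ((*v) (M ** dmat I))"
proof (intro equalityI subsetI)
  fix v assume "v \<in> cspan M I"
  then obtain x where x: "\<forall>k. k \<notin> I \<longrightarrow> x $ k = 0" and v: "v = M *v x" by (auto simp: cspan_def)
  have "dmat I *v x = x" using x by (auto simp: vec_eq_iff dmat_vec)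
  then have "v = (M ** dmat I) *v x" by (simp add: v flip: matrix_vector_mul_assoc)
  then show "v \<in> range ((*v) (M ** dmat I))" by blast
next
  fix v assume "v \<in> range ((*v) (M ** dmat I))"
  then obtain x where "v = M *v (dmat I *v x)" by (auto simp: matrix_vector_mul_assoc)
  moreover have "\<forall>k. k \<notin> I \<longrightarrow> (dmat I *v x) $ k = 0" by (simp add: dmat_vec)
  ultimately show "v \<in> cspan M I" unfolding cspan_def by blast
qed

text \<open>The Gram matrix of the selected columns, filled up by the identity on the other indices
  so that it stays square and invertible while \<open>I\<close> varies.\<close>

definition gram :: "complex^7^7 \<Rightarrow> 7 set \<Rightarrow> complex^7^7" where
  "gram M I = adj (M ** dmat I) ** (M ** dmat I) + (mat 1 - dmat I)"

text \<open>A kernel vector has no components outside \<open>I\<close> because there the matrix is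
  the identity. On \<open>I\<close> it satisfies |M x|^2 = 0, and \<open>M\<close> is
  injective.\<close>

lemma det_gram:
  assumes "det M \<noteq> 0"
  shows "det (gram M I) \<noteq> 0"
  unfolding det_nz_iff_ker
proof (intro allI impI)
  fix x assume 0: "gram M I *v x = 0"
  define N where "N = M ** dmat I"
  have N: "N ** dmat I = N" by (simp add: N_def dmat_idem flip: matrix_mul_assoc)
  then have aN: "dmat I ** adj N = adj N" by (metis adj_mult adj_dmat)
  have "(mat 1 - dmat I) ** gram M I = mat 1 - dmat I"
    unfolding gram_def N_def[symmetric]
    by (simp add: matrix_diff_left_distrib matrix_diff_right_distrib matrix_add_ldistrib
        matrix_mul_assoc aN dmat_idem)
  then have "(mat 1 - dmat I) *v x = 0"
    using 0 by (metis matrix_vector_mul_assoc matrix_vector_mult_0_right)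
  then have x: "dmat I *v x = x" by (simp add: matrix_vector_mult_diff_rdistrib)
  have "adj N *v (N *v x) = 0"
    using 0 x by (simp add: gram_def N_def matrix_vector_mult_add_rdistrib matrix_vector_mult_diff_rdistrib
        flip: matrix_vector_mul_assoc)
  then have "cdot (N *v x) (vcnj (N *v x)) = 0"
    by (simp only: herm_mult_left vcnj_0 cdot_simps)
  then have "M *v x = 0" by (simp add: N_def x flip: matrix_vector_mul_assoc)
  then show "x = 0" using assms by (simp add: det_nz_iff_ker)
qed

text \<open>The least-squares formula N (N^H N)^-1 N^H with \<open>N = M ** dmat I\<close>. Its
  explicit form gives smoothness in \<open>M\<close> and isolates \<open>M\<close> as the leftmost
  factor, which the flatness argument differentiates.\<close>

lemma proj_cspan:
  assumes "det M \<noteq> 0"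
  shows "proj (cspan M I) = M ** dmat I ** (matrix_inv (gram M I) ** adj (M ** dmat I))"
proof (rule projI[OF subspace_cspan])
  fix v
  define N where "N = M ** dmat I"
  define K where "K = gram M I"
  have N: "N ** dmat I = N" by (simp add: N_def dmat_idem flip: matrix_mul_assoc)
  then have aN: "dmat I ** adj N = adj N" by (metis adj_mult adj_dmat)
  have K: "K = adj N ** N + (mat 1 - dmat I)" by (simp add: K_def N_def gram_def)
  have JK: "dmat I ** K = adj N ** N"
    unfolding K by (simp add: matrix_diff_right_distrib matrix_add_ldistrib matrix_mul_assoc aN dmat_idem)
  have "adj N ** (N ** (matrix_inv K ** adj N)) = dmat I ** (K ** matrix_inv K) ** adj N"
    by (simp add: matrix_mul_assoc JK)
  also have "\<dots> = adj N"
    using matrix_inv_mult[OF det_gram[OF assms]] by (simp add: K_def aN)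
  finally have *: "adj N ** (N ** (matrix_inv K ** adj N)) = adj N" .
  let ?P = "M ** dmat I ** (matrix_inv (gram M I) ** adj (M ** dmat I))"
  have P: "?P = N ** (matrix_inv K ** adj N)" by (simp add: N_def K_def)
  show "?P *v v \<in> cspan M I"
    unfolding P cspan_eq_range N_def[symmetric] matrix_vector_mul_assoc[symmetric] by blast
  have "adj N *v (v - ?P *v v) = 0"
    by (simp add: P matrix_vector_mult_diff_distrib matrix_vector_mul_assoc *)
  then have "cdot (v - ?P *v v) (vcnj (N *v x)) = 0" for x
    by (metis adj_adj herm_mult_left cdot_simps(7) )
  then show "v - ?P *v v \<in> perp (cspan M I)"
    unfolding cspan_eq_range N_def[symmetric] perp_def by blast
qed

lemma smooth_on_proj_cspan:
  assumes "open S" "smooth_on S M" "\<And>w. w \<in> S \<Longrightarrow> det (M w) \<noteq> 0"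
  shows "smooth_on S (\<lambda>w. matrix_inv (gram (M w) I) ** adj (M w ** dmat I))"
    "smooth_on S (\<lambda>w. proj (cspan (M w) I))"
proof -
  have N: "smooth_on S (\<lambda>w. M w ** dmat I)"
    by (intro smooth_on_matrix_mult smooth_on_const assms)
  have "smooth_on S (\<lambda>w. gram (M w) I)"
    unfolding gram_def
    by (intro smooth_on_add smooth_on_matrix_mult[OF _ smooth_on_adj] smooth_on_const N assms)
  then show X: "smooth_on S (\<lambda>w. matrix_inv (gram (M w) I) ** adj (M w ** dmat I))"
    by (intro smooth_on_matrix_mult smooth_on_matrix_inv smooth_on_adj N assms det_gram)
  have "smooth_on S (\<lambda>w. M w ** dmat I ** (matrix_inv (gram (M w) I) ** adj (M w ** dmat I)))"
    by (intro smooth_on_matrix_mult[OF _ N X] assms)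
  then show "smooth_on S (\<lambda>w. proj (cspan (M w) I))"
    by (subst smooth_on_cong[OF assms(1)]) (auto simp: proj_cspan assms(3))
qed

text \<open>The conclusion says that the range of \<open>P\<close> is closed under \<open>\<partial>\<^bsub>zbar\<^esub> + B\<close>.\<close>

lemma flat_frame_proj:
  fixes I :: "7 set"
  assumes "open S" "smooth_on S M" "\<And>w. w \<in> S \<Longrightarrow> det (M w) \<noteq> 0"
    and flat: "\<And>w. w \<in> S \<Longrightarrow> mzb M w = - (B w ** M w)" and w: "w \<in> S"
  defines "P \<equiv> \<lambda>w. proj (cspan (M w) I)"
  shows "(mat 1 - P w) ** (mzb P w + B w ** P w) = 0"
proof -
  define X where "X w = matrix_inv (gram (M w) I) ** adj (M w ** dmat I)" for w
  have X: "smooth_on S X" unfolding X_def by (rule smooth_on_proj_cspan[OF assms(1-3)])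
  have P: "P w = M w ** (dmat I ** X w)" if "w \<in> S" for w
    by (simp add: P_def X_def proj_cspan assms(3) that matrix_mul_assoc)
  have "mzb P w = mzb (\<lambda>w. M w ** (dmat I ** X w)) w"
    by (rule mz_cong[OF assms(1) w P])
  also have "\<dots> = mzb M w ** (dmat I ** X w) + M w ** (dmat I ** mzb X w)"
    using smooth_on_imp_mdiff[OF assms(1,2) w] smooth_on_imp_mdiff[OF assms(1) X w]
    by (simp add: mz_mult mdiff_mult)
  also have "mzb M w ** (dmat I ** X w) = - (B w ** P w)"
    unfolding flat[OF w] P[OF w]
    by (simp add: vec_eq_iff matrix_mul_assoc) (simp add: matrix_matrix_mult_def sum_negf)
  \<comment> \<open>Parallelism of \<open>M\<close> cancels the term with \<open>B\<close>. What
    remains has its range in the span of the selected columns, and \<open>1 - P\<close> kills that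
    span.\<close>
  finally have *: "mzb P w + B w ** P w = M w ** dmat I ** mzb X w"
    by (simp add: matrix_mul_assoc)
  have "P w *v ((M w ** dmat I) *v x) = (M w ** dmat I) *v x" for x
    unfolding P_def by (rule proj_id[OF subspace_cspan]) (auto simp: cspan_eq_range)
  then have "P w ** (M w ** dmat I) = M w ** dmat I"
    by (simp add: matrix_eq flip: matrix_vector_mul_assoc)
  then show ?thesis
    unfolding * by (simp add: matrix_mul_assoc matrix_diff_left_distrib)
qed

section \<open>Laurent coefficients of a loop\<close>

declare transpose_matrix_vector [simp del] vector_transpose_matrix [simp del]

lemma matrix_add_rdistrib: "(B + C) ** A = B ** A + C ** (A::'a::semiring_1^'n^'m)"
  by (simp add: vec_eq_iff matrix_matrix_mult_def sum.distrib algebra_simps)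

text \<open>Both ranges need only contain the support, so shifted sums can be compared over
  convenient intervals without computing exact bounds.\<close>

lemma sum_int_shift:
  fixes g :: "int \<Rightarrow> 'a::comm_monoid_add"
  assumes "finite A" "finite B" "\<And>n. n \<notin> A \<Longrightarrow> g n = 0" "\<And>n. n - m \<notin> B \<Longrightarrow> g n = 0"
  shows "(\<Sum>n\<in>A. g n) = (\<Sum>k\<in>B. g (k + m))"
proof -
  let ?C = "(\<lambda>k. k + m) ` B"
  have "(\<Sum>k\<in>B. g (k + m)) = sum g ?C"
    by (subst sum.reindex) (auto simp: inj_on_def)
  also have "\<dots> = sum g (A \<union> ?C)"
  proof (rule sum.mono_neutral_left)
    have "g i = 0" if "i \<notin> ?C" for i
      using assms(4)[of i] that by (metis diff_add_cancel image_eqI)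
    then show "\<forall>i\<in>A \<union> ?C - ?C. g i = 0" by blast
  qed (use assms(1,2) in auto)
  also have "\<dots> = sum g A"
  proof (rule sum.mono_neutral_right)
    show "\<forall>i\<in>A \<union> ?C - A. g i = 0" using assms(3) by blast
  qed (use assms(1,2) in auto)
  finally show ?thesis by simp
qed

text \<open>Convolution: if \<open>f\<close> lists the coefficients of a series, this is the
  coefficient of \<lambda>^n in \<Phi> times that series. The fixed range -3..3 serves all three
  values of s at once.\<close>

definition cv :: "(int \<Rightarrow> complex^7^7) \<Rightarrow> (int \<Rightarrow> complex^7) \<Rightarrow> int \<Rightarrow> complex^7" where
  "cv T f n = (\<Sum>k\<in>{-3..3}. T k *v f (n - k))"

definition cm :: "(int \<Rightarrow> complex^7^7) \<Rightarrow> (int \<Rightarrow> complex^'m^7) \<Rightarrow> int \<Rightarrow> complex^'m^7" where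
  "cm T F n = (\<Sum>k\<in>{-3..3}. T k ** F (n - k))"

text \<open>Coefficients of the inverse loop. On the circle the loop is complex orthogonal, so its
  inverse is its transpose and the index is not reversed.\<close>

definition tp :: "(int \<Rightarrow> complex^7^7) \<Rightarrow> int \<Rightarrow> complex^7^7" where
  "tp T k = transpose (T k)"

definition plus_part :: "(int \<Rightarrow> 'a::zero) \<Rightarrow> int \<Rightarrow> 'a" where
  "plus_part f n = (if n < 0 then 0 else f n)"

text \<open>The space \<open>P\<^sub>0 \<Phi>\<inverse> (\<W> \<inter> \<lambda>\<^sup>i \<H>\<^sub>+)\<close> in terms of the Fourier coefficients \<open>T\<close> of \<open>\<Phi>\<close>; the sequence
  \<open>f\<close> consists of the coefficients of an element of \<open>\<H>\<^sub>+\<close>.\<close>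

definition Zs :: "(int \<Rightarrow> complex^7^7) \<Rightarrow> int \<Rightarrow> (complex^7) set" where
  "Zs T i = {f 0 |f. (\<forall>n<0. f n = 0) \<and> (\<forall>n<i. cv T f n = 0)}"

lemma sum_mv: "(\<Sum>k\<in>I. F k) *v x = (\<Sum>k\<in>I. F k *v x)"
  by (induction I rule: infinite_finite_induct) (simp_all add: matrix_vector_mult_add_rdistrib)

lemma mv_sum: "A *v (\<Sum>k\<in>I. f k) = (\<Sum>k\<in>I. A *v f k)"
  by (induction I rule: infinite_finite_induct) (simp_all add: matrix_vector_right_distrib)

lemma sum_mm: "(\<Sum>k\<in>I. F k) ** (C::complex^'n^'m) = (\<Sum>k\<in>I. F k ** C)"
  by (induction I rule: infinite_finite_induct) (simp_all add: matrix_add_rdistrib)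

lemma mm_sum: "(C::complex^'n^'m) ** (\<Sum>k\<in>I. F k) = (\<Sum>k\<in>I. C ** F k)"
  by (induction I rule: infinite_finite_induct) (simp_all add: matrix_add_ldistrib)

lemma cdot_sum: "cdot (\<Sum>k\<in>I. f k) x = (\<Sum>k\<in>I. cdot (f k) x)" "cdot x (\<Sum>k\<in>I. f k) = (\<Sum>k\<in>I. cdot x (f k))"
  by (induction I rule: infinite_finite_induct) (simp_all add: cdot_simps)

lemma cm_vec: "cm T F n *v x = cv T (\<lambda>n. F n *v x) n"
  by (simp add: cm_def cv_def sum_mv matrix_vector_mul_assoc)

lemma cm_mult: "cm T (\<lambda>n. F n ** C) n = cm T F n ** C"
  by (simp add: cm_def sum_mm matrix_mul_assoc)

lemma cv_add: "cv T (\<lambda>n. f n + g n) n = cv T f n + cv T g n"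
  and cv_diff: "cv T (\<lambda>n. f n - g n) n = cv T f n - cv T g n"
  and cv_zero [simp]: "cv T (\<lambda>n. 0) n = 0"
  by (simp_all add: cv_def sum.distrib sum_subtractf matrix_vector_right_distrib matrix_vector_mult_diff_distrib)

lemma mv_scale: "A *v (c *s x) = c *s (A *v (x::complex^'n))"
  by (simp add: vec_eq_iff matrix_vector_mult_def sum_distrib_left mult.left_commute)

lemma cv_scale: "cv T (\<lambda>n. c *s f n) n = c *s cv T f n"
  by (simp add: cv_def vec.scale_sum_right mv_scale)

lemma cv_lower: "(\<And>n. n < a \<Longrightarrow> f n = 0) \<Longrightarrow> n < a - 3 \<Longrightarrow> cv T f n = 0"
  by (auto simp: cv_def intro!: sum.neutral)

lemma cv_upper: "(\<And>n. n > a \<Longrightarrow> f n = 0) \<Longrightarrow> n > a + 3 \<Longrightarrow> cv T f n = 0"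
  by (auto simp: cv_def intro!: sum.neutral)

lemma Zs_mem: "(\<And>n. n < 0 \<Longrightarrow> f n = 0) \<Longrightarrow> (\<And>n. n < i \<Longrightarrow> cv T f n = 0) \<Longrightarrow> f 0 \<in> Zs T i"
  by (auto simp: Zs_def)

lemma subspace_Zs: "vec.subspace (Zs T i)"
  unfolding vec.subspace_def
proof (intro conjI ballI allI)
  show "0 \<in> Zs T i" using Zs_mem[of "\<lambda>n. 0"] by simp
next
  fix x y assume "x \<in> Zs T i" "y \<in> Zs T i"
  then obtain f g where "x = f 0" "\<forall>n<0. f n = 0" "\<forall>n<i. cv T f n = 0"
    "y = g 0" "\<forall>n<0. g n = 0" "\<forall>n<i. cv T g n = 0"
    by (auto simp: Zs_def)
  then show "x + y \<in> Zs T i" using Zs_mem[of "\<lambda>n. f n + g n" i T] by (simp add: cv_add)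
next
  fix c x assume "x \<in> Zs T i"
  then obtain f where "x = f 0" "\<forall>n<0. f n = 0" "\<forall>n<i. cv T f n = 0"
    by (auto simp: Zs_def)
  then show "c *s x \<in> Zs T i" using Zs_mem[of "\<lambda>n. c *s f n" i T] by (simp add: cv_scale)
qed

lemma Zs_antimono: "i \<le> j \<Longrightarrow> Zs T j \<subseteq> Zs T i"
  by (auto simp: Zs_def)

lemma Zs_UNIV:
  assumes "i \<le> -3"
  shows "Zs T i = UNIV"
proof -
  have "v \<in> Zs T i" for v
  proof -
    have "(\<lambda>n::int. if n = 0 then v else 0) 0 \<in> Zs T i"
    proof (rule Zs_mem[where f = "\<lambda>n. if n = 0 then v else 0"])
      show "cv T (\<lambda>n. if n = 0 then v else 0) n = 0" if "n < i" for n
        by (rule cv_lower[of 0]) (use that assms in auto)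
    qed simp
    then show ?thesis by simp
  qed
  then show ?thesis by auto
qed

text \<open>A selector \<open>\<iota> n\<close> of the \<open>n\<close>-th of seven blocks, numbered by \<open>-3, \<dots>, 3\<close>.\<close>

definition block_number :: "7 \<Rightarrow> int" where
  "block_number = (SOME \<beta>. bij_betw \<beta> UNIV {-3..3})"

lemma block_number: "bij_betw block_number UNIV {-3..3}"
proof -
  have "card (UNIV :: 7 set) = card {-3..3::int}" by simp
  then have "\<exists>\<beta> :: 7 \<Rightarrow> int. bij_betw \<beta> UNIV {-3..3}"
    by (intro finite_same_card_bij) auto
  then show ?thesis unfolding block_number_def by (rule someI_ex)
qed

definition \<iota> :: "int \<Rightarrow> complex^(7 \<times> 7)^7" where
  "\<iota> n = (\<chi> i p. if block_number (fst p) = n \<and> snd p = i then 1 else 0)"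

lemma \<iota>_outside: "n \<notin> {-3..3} \<Longrightarrow> \<iota> n = 0"
proof -
  assume n: "n \<notin> {-3..3}"
  have "block_number a \<in> {-3..3}" for a
    using block_number by (auto simp: bij_betw_def)
  then have "block_number a \<noteq> n" for a using n by metis
  then show ?thesis by (simp add: \<iota>_def vec_eq_iff)
qed

lemma \<iota>_transpose: "\<iota> m ** transpose (\<iota> n) = (if m = n \<and> n \<in> {-3..3} then mat 1 else 0)"
proof -
  have "(\<iota> m ** transpose (\<iota> n)) $ i $ j = (if m = n \<and> n \<in> {-3..3} then mat 1 else 0) $ i $ j" for i j
  proof (cases "m = n \<and> n \<in> {-3..3}")
    case True
    then have "n \<in> range block_number" using block_number by (auto simp: bij_betw_def)
    then obtain a where a: "block_number a = n" by blast
    have a': "block_number b = n \<longleftrightarrow> b = a" for b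
      using a block_number by (auto simp: bij_betw_def inj_on_def)
    have "(\<iota> m ** transpose (\<iota> n)) $ i $ j = (\<Sum>p\<in>UNIV. if p = (a, i) then (if i = j then 1 else 0) else 0)"
      unfolding matrix_matrix_mult_def \<iota>_def transpose_def vec_lambda_beta
      by (rule sum.cong) (use True a' in \<open>auto simp: prod_eq_iff\<close>)
    then show ?thesis using True by (simp add: mat_def)
  next
    case False
    have "(\<iota> m ** transpose (\<iota> n)) $ i $ j = 0"
    proof (cases "n \<in> {-3..3}")
      case True
      with False have "m \<noteq> n" by simp
      then show ?thesis
        unfolding matrix_matrix_mult_def \<iota>_def transpose_def vec_lambda_beta
        by (intro sum.neutral) auto
    next
      case False
      then have "\<iota> n = 0" by (rule \<iota>_outside)
      then show ?thesis by (simp add: transpose_def matrix_matrix_mult_def)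
    qed
    with False show ?thesis by auto
  qed
  then show ?thesis by (simp only: vec_eq_iff) blast
qed

lemma \<iota>_complete: "(\<Sum>n\<in>{-3..3}. transpose (\<iota> n) ** \<iota> n) = mat 1"
proof -
  have "(\<Sum>n\<in>{-3..3}. transpose (\<iota> n) ** \<iota> n) $ p $ q = mat 1 $ p $ q" for p q
  proof -
    have mem: "block_number (fst p) \<in> {-3..3}" using block_number by (auto simp: bij_betw_def)
    have inj: "block_number a = block_number b \<longleftrightarrow> a = b" for a b
      using block_number by (auto simp: bij_betw_def inj_on_def)
    have "(\<Sum>n\<in>{-3..3}. transpose (\<iota> n) ** \<iota> n) $ p $ q = (\<Sum>n\<in>{-3..3}. \<Sum>k\<in>UNIV. \<iota> n $ k $ p * \<iota> n $ k $ q)"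
      by (simp add: matrix_matrix_mult_def transpose_def)
    also have "\<dots> = (\<Sum>n\<in>{-3..3}. \<Sum>k\<in>UNIV. if k = snd p then (if n = block_number (fst p) then (if p = q then 1 else 0) else 0) else 0)"
      by (intro sum.cong refl) (auto simp: \<iota>_def prod_eq_iff inj)
    also have "\<dots> = (if p = q then 1 else 0)"
      using mem by simp
    finally show ?thesis by (simp add: mat_def)
  qed
  then show ?thesis by (simp add: vec_eq_iff)
qed

lemma \<iota>_eqI:
  assumes "\<And>n. \<iota> n ** X = \<iota> n ** Y"
  shows "X = Y"
proof -
  have "(\<Sum>n\<in>{-3..3}. transpose (\<iota> n) ** \<iota> n) ** X = (\<Sum>n\<in>{-3..3}. transpose (\<iota> n) ** \<iota> n) ** Y"
    unfolding sum_mm matrix_mul_assoc[symmetric] assms ..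
  then show ?thesis by (simp add: \<iota>_complete)
qed

lemma \<iota>_sum: "\<iota> m ** (\<Sum>n\<in>{-3..3}. transpose (\<iota> n) ** F n) = (if m \<in> {-3..3} then F m else 0)"
proof -
  have "\<iota> m ** (\<Sum>n\<in>{-3..3}. transpose (\<iota> n) ** F n) = (\<Sum>n\<in>{-3..3}. if n = m then F m else 0)"
    unfolding mm_sum by (intro sum.cong refl) (auto simp: matrix_mul_assoc \<iota>_transpose)
  then show ?thesis by simp
qed

section \<open>Duality of the filtration of a single orthogonal loop\<close>

locale loop_coeffs =
  fixes T :: "int \<Rightarrow> complex^7^7"
  assumes supp: "k \<notin> {-3..3} \<Longrightarrow> T k = 0"
    and right_inverse: "(\<Sum>k\<in>{-3..3}. T k ** transpose (T (c - k))) = (if c = 0 then mat 1 else 0)"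
    and left_inverse: "(\<Sum>k\<in>{-3..3}. transpose (T k) ** T (c - k)) = (if c = 0 then mat 1 else 0)"
begin

text \<open>Multiplication operators compose like the loops they come from; a product of two loops
  with exponents in -3..3 has exponents in -6..6, hence the intermediate range.\<close>

lemma cv_cv:
  assumes "\<And>k. k \<notin> {-3..3} \<Longrightarrow> R k = 0" "\<And>k. k \<notin> {-3..3} \<Longrightarrow> S k = 0"
    and "\<And>c. (\<Sum>k\<in>{-3..3}. R k ** S (c - k)) = (if c = 0 then mat 1 else 0)"
  shows "cv R (cv S f) n = f n"
proof -
  have inner: "(\<Sum>l\<in>{-3..3}. S l *v f (n - k - l)) = (\<Sum>c\<in>{-6..6}. S (c - k) *v f (n - c))"
    if k: "k \<in> {-3..3}" for k
  proof -
    have "(\<Sum>c\<in>{-6..6}. S (c - k) *v f (n - c)) = (\<Sum>l\<in>{-3..3}. S (l + k - k) *v f (n - (l + k)))"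
      by (rule sum_int_shift) (use k assms(2) in auto)
    then show ?thesis by (simp add: algebra_simps)
  qed
  have "cv R (cv S f) n = (\<Sum>k\<in>{-3..3}. R k *v (\<Sum>c\<in>{-6..6}. S (c - k) *v f (n - c)))"
    unfolding cv_def by (rule sum.cong[OF refl]) (simp only: inner)
  also have "\<dots> = (\<Sum>c\<in>{-6..6}. (\<Sum>k\<in>{-3..3}. R k ** S (c - k)) *v f (n - c))"
    unfolding mv_sum sum_mv matrix_vector_mul_assoc by (rule sum.swap)
  also have "\<dots> = (\<Sum>c\<in>{-6..6::int}. if c = 0 then f n else 0)"
    unfolding assms(3) by (intro sum.cong) auto
  finally show ?thesis by simp
qed

lemma tp_supp: "k \<notin> {-3..3} \<Longrightarrow> tp T k = 0"
  by (simp add: tp_def supp transpose_def vec_eq_iff)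

lemma cv_T_tp [simp]: "cv T (cv (tp T) f) n = f n"
  by (rule cv_cv[OF supp tp_supp]) (simp_all add: tp_def right_inverse)

lemma cv_tp_T [simp]: "cv (tp T) (cv T f) n = f n"
  by (rule cv_cv[OF tp_supp supp]) (simp_all add: tp_def left_inverse)

lemma cm_T_tp [simp]: "cm T (cm (tp T) F) n = F n"
  by (simp add: matrix_eq cm_vec)

lemma cm_tp_T [simp]: "cm (tp T) (cm T F) n = F n"
  by (simp add: matrix_eq cm_vec)

text \<open>The coefficient of \<lambda>^0 in the bilinear pairing of \<Phi> f with \<Phi> g is
  computed twice. It vanishes, since for every n either n < i or -n < 1 - i; and it equals
  \<open>cdot (f 0) (g 0)\<close>, since \<Phi> preserves the pairing and \<open>f\<close>,
  \<open>g\<close> have no negative exponents.\<close>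

lemma polar_orthogonal:
  assumes "v \<in> Zs T i" "w \<in> Zs T (1 - i)"
  shows "cdot v w = 0"
proof -
  obtain f where f: "v = f 0" "\<And>n. n < 0 \<Longrightarrow> f n = 0" "\<And>n. n < i \<Longrightarrow> cv T f n = 0"
    using assms(1) by (auto simp: Zs_def)
  obtain g where g: "w = g 0" "\<And>n. n < 0 \<Longrightarrow> g n = 0" "\<And>n. n < 1 - i \<Longrightarrow> cv T g n = 0"
    using assms(2) by (auto simp: Zs_def)
  have low: "cv T f n = 0" if "n < -3" for n
    using cv_lower[of 0 f n T] f(2) that by simp
  have "0 = (\<Sum>n\<in>{-3..3}. cdot (cv T f n) (cv T g (- n)))"
  proof (rule sum.neutral[symmetric], intro ballI)
    fix n :: int
    show "cdot (cv T f n) (cv T g (- n)) = 0"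
      using f(3)[of n] g(3)[of "- n"] by (cases "n < i") (simp_all add: cdot_simps)
  qed
  \<comment> \<open>With n in -3..3, an index m above 6 leaves the support of \<open>T\<close>, and
    \<open>g\<close> vanishes at negative m.\<close>
  also have "\<dots> = (\<Sum>n\<in>{-3..3}. \<Sum>m\<in>{0..6}. cdot (cv T f n) (T (- n - m) *v g m))"
  proof (intro sum.cong refl)
    fix n :: int assume n: "n \<in> {-3..3}"
    have "cv T g (- n) = (\<Sum>m\<in>{0..6}. T (- n - m) *v g m)"
    proof -
      have "cv T g (- n) = (\<Sum>l\<in>{-3..3}. T (- n - (- n - l)) *v g (- n - l))"
        by (simp add: cv_def)
      also have "\<dots> = (\<Sum>m\<in>(\<lambda>l. - n - l) ` {-3..3}. T (- n - m) *v g m)"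
        by (subst sum.reindex) (auto simp: inj_on_def)
      also have "\<dots> = (\<Sum>m\<in>(\<lambda>l. - n - l) ` {-3..3} \<union> {0..6}. T (- n - m) *v g m)"
      proof (rule sum.mono_neutral_left)
        show "\<forall>m\<in>(\<lambda>l. - n - l) ` {-3..3} \<union> {0..6} - (\<lambda>l. - n - l) ` {-3..3}. T (- n - m) *v g m = 0"
        proof
          fix m assume "m \<in> (\<lambda>l. - n - l) ` {-3..3} \<union> {0..6} - (\<lambda>l. - n - l) ` {-3..3}"
          then have "m \<notin> (\<lambda>l. - n - l) ` {-3..3}" by blast
          then have "- n - m \<notin> {-3..3}" by (metis diff_diff_eq2 add_diff_cancel_left' image_eqI)
          then have "T (- n - m) = 0" by (rule supp)
          then show "T (- n - m) *v g m = 0" by simp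
        qed
      qed auto
      also have "\<dots> = (\<Sum>m\<in>{0..6}. T (- n - m) *v g m)"
      proof (rule sum.mono_neutral_right)
        show "\<forall>m\<in>(\<lambda>l. - n - l) ` {-3..3} \<union> {0..6} - {0..6}. T (- n - m) *v g m = 0"
          using n g(2) by auto
      qed auto
      finally show ?thesis .
    qed
    then show "cdot (cv T f n) (cv T g (- n)) = (\<Sum>m\<in>{0..6}. cdot (cv T f n) (T (- n - m) *v g m))"
      by (simp add: cdot_sum)
  qed
  also have "\<dots> = (\<Sum>m\<in>{0..6}. \<Sum>n\<in>{-3..3}. cdot (tp T (- m - n) *v cv T f n) (g m))"
    by (subst sum.swap) (simp add: cdot_mult_left tp_def minus_diff_commute)
  also have "\<dots> = (\<Sum>m\<in>{0..6}. cdot (f (- m)) (g m))"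
  proof (intro sum.cong refl)
    fix m :: int assume m: "m \<in> {0..6}"
    have "f (- m) = cv (tp T) (cv T f) (- m)" by simp
    also have "\<dots> = (\<Sum>k\<in>{-3..3}. tp T k *v cv T f (- m - k))" by (simp add: cv_def[of "tp T"])
    also have "\<dots> = (\<Sum>n\<in>{-3..3}. tp T (- m - n) *v cv T f n)"
    proof -
      \<comment> \<open>The larger interval contains -m - n for all m in 0..6 and n in -3..3, so
        that the substitution k = -m - n can be made on it.\<close>
      have "(\<Sum>k\<in>{-3..3}. tp T k *v cv T f (- m - k)) = (\<Sum>k\<in>{-9..9}. tp T k *v cv T f (- m - k))"
        by (rule sum.mono_neutral_left) (use tp_supp in auto)
      also have "\<dots> = (\<Sum>n\<in>{-m-9..-m+9}. tp T (- m - n) *v cv T f n)"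
        by (rule sum.reindex_bij_witness[of _ "\<lambda>n. - m - n" "\<lambda>n. - m - n"]) auto
      also have "\<dots> = (\<Sum>n\<in>{-3..3}. tp T (- m - n) *v cv T f n)"
      proof (rule sum.mono_neutral_right)
        show "\<forall>n\<in>{- m - 9..- m + 9} - {- 3..3}. tp T (- m - n) *v cv T f n = 0"
        proof
          fix n assume n: "n \<in> {- m - 9..- m + 9} - {- 3..3}"
          show "tp T (- m - n) *v cv T f n = 0"
          proof (cases "n < -3")
            case False
            then have "- m - n \<notin> {-3..3}" using n m by auto
            then have "tp T (- m - n) = 0" by (rule tp_supp)
            then show ?thesis by simp
          qed (simp add: low)
        qed
      qed (use m in auto)
      finally show ?thesis .
    qed
    finally show "(\<Sum>n\<in>{-3..3}. cdot (tp T (- m - n) *v cv T f n) (g m)) = cdot (f (- m)) (g m)"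
      by (simp add: cdot_sum)
  qed
  also have "\<dots> = (\<Sum>m\<in>{0..6::int}. if m = 0 then cdot (f 0) (g 0) else 0)"
    by (intro sum.cong refl) (auto simp: f(2) cdot_simps)
  finally show ?thesis by (simp add: f g)
qed

text \<open>If \<open>v\<close> is not in \<open>Zs T j\<close>, then the coefficients of \<Phi> v
  below j cannot be cancelled by a series without constant term. A functional separating them from
  the space \<open>R\<close> of such corrections, pulled back by the transposed loop, is a series
  \<open>h\<close> whose constant term lies in \<open>Zs T (1 - j)\<close> and does not annihilate
  \<open>v\<close>. The bound on \<open>j\<close> keeps the exponents -3, ..., j - 1 inside the
  seven blocks.\<close>

lemma polar_complete:
  assumes orth: "\<And>h. h \<in> Zs T (1 - j) \<Longrightarrow> cdot h v = 0" and j: "j \<le> 4"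
  shows "v \<in> Zs T j"
proof (rule ccontr)
  assume v: "v \<notin> Zs T j"
  define u where "u f = (\<Sum>n\<in>{-3..<j}. transpose (\<iota> n) *v cv T f n)" for f
  define R where "R = {u f |f. (\<forall>n<0. f n = 0) \<and> f 0 = 0}"
  define \<delta> where "\<delta> m x n = (if n = m then x else 0)" for m n :: int and x :: "complex^7"
  have u_add: "u (\<lambda>n. f n + g n) = u f + u g"
    and u_scale: "u (\<lambda>n. c *s f n) = c *s u f" for f g c
    by (simp_all add: u_def cv_add cv_diff cv_scale matrix_vector_right_distrib matrix_vector_mult_diff_distrib
        mv_scale sum.distrib sum_subtractf vec.scale_sum_right)
  have R: "vec.subspace R"
    unfolding vec.subspace_def
  proof (intro conjI ballI allI)
    have "u (\<lambda>n. 0) = 0" by (simp add: u_def)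
    then show "0 \<in> R" unfolding R_def by (auto intro!: exI[of _ "\<lambda>n. 0"])
  next
    fix x y assume "x \<in> R" "y \<in> R"
    then obtain f g where "x = u f" "\<forall>n<0. f n = 0" "f 0 = 0" "y = u g" "\<forall>n<0. g n = 0" "g 0 = 0"
      by (auto simp: R_def)
    then show "x + y \<in> R" unfolding R_def by (auto simp: u_add intro!: exI[of _ "\<lambda>n. f n + g n"])
  next
    fix c x assume "x \<in> R"
    then obtain f where "x = u f" "\<forall>n<0. f n = 0" "f 0 = 0" by (auto simp: R_def)
    then show "c *s x \<in> R" unfolding R_def by (auto simp: u_scale intro!: exI[of _ "\<lambda>n. c *s f n"])
  qed
  have \<iota>u: "\<iota> n *v u f = cv T f n" if "n \<in> {-3..<j}" for n f
  proof -
    have "\<iota> n *v u f = (\<Sum>m\<in>{-3..<j}. if m = n then cv T f n else 0)"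
      unfolding u_def mv_sum using j
      by (intro sum.cong refl) (auto simp: matrix_vector_mul_assoc \<iota>_transpose)
    then show ?thesis using that by simp
  qed
  have "u (\<delta> 0 v) \<notin> R"
  proof
    assume "u (\<delta> 0 v) \<in> R"
    then obtain f where f: "u (\<delta> 0 v) = u f" "\<forall>n<0. f n = 0" "f 0 = 0" by (auto simp: R_def)
    have "\<delta> 0 v 0 - f 0 \<in> Zs T j"
    proof (rule Zs_mem[where f = "\<lambda>n. \<delta> 0 v n - f n"])
      show low: "\<delta> 0 v n - f n = 0" if "n < 0" for n using that f by (simp add: \<delta>_def)
      show "cv T (\<lambda>n. \<delta> 0 v n - f n) n = 0" if "n < j" for n
      proof (cases "n < -3")
        case True
        then show ?thesis using cv_lower[of 0 "\<lambda>n. \<delta> 0 v n - f n" n T] low by simp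
      next
        case False
        then have "n \<in> {-3..<j}" using that by simp
        then have "cv T (\<delta> 0 v) n = cv T f n" using \<iota>u f(1) by metis
        then show ?thesis by (simp add: cv_diff)
      qed
    qed
    then show False using v f by (simp add: \<delta>_def)
  qed
  from separating_functional[OF R this]
  obtain g where g: "\<And>y. y \<in> R \<Longrightarrow> (\<Sum>i\<in>UNIV. g $ i * y $ i) = 0"
    and gv: "(\<Sum>i\<in>UNIV. g $ i * u (\<delta> 0 v) $ i) \<noteq> 0" by blast
  define \<gamma> where "\<gamma> n = (if n \<in> {-3..<j} then \<iota> n *v g else 0)" for n
  have pair: "(\<Sum>i\<in>UNIV. g $ i * u f $ i) = (\<Sum>n\<in>{-3..<j}. cdot (\<gamma> n) (cv T f n))" for f
  proof -
    have "(\<Sum>i\<in>UNIV. g $ i * (transpose A *v x) $ i) = cdot (A *v g) x" for A :: "complex^(7 \<times> 7)^7" and x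
      unfolding cdot_def matrix_vector_mult_def transpose_def
      by (simp add: sum_distrib_left sum_distrib_right mult.commute mult.left_commute) (rule sum.swap)
    then have "(\<Sum>n\<in>{-3..<j}. cdot (\<gamma> n) (cv T f n)) =
        (\<Sum>n\<in>{-3..<j}. \<Sum>i\<in>UNIV. g $ i * (transpose (\<iota> n) *v cv T f n) $ i)"
      by (simp add: \<gamma>_def)
    also have "\<dots> = (\<Sum>i\<in>UNIV. g $ i * u f $ i)"
      by (subst sum.swap) (simp add: u_def sum_distrib_left)
    finally show ?thesis by simp
  qed
  \<comment> \<open>The index is reversed because the pairing matches exponent n with -n. As
    \<open>\<gamma>\<close> lives on n < j, the product \<Phi> h starts at exponent 1 - j; vanishing
    of the functional on \<open>R\<close> means that \<open>h\<close> has no negative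
    exponents.\<close>
  define h where "h = cv (tp T) (\<lambda>n. \<gamma> (- n))"
  have h: "(\<Sum>i\<in>UNIV. g $ i * u (\<delta> m x) $ i) = cdot (h (- m)) x" for m x
  proof -
    have \<delta>: "cv T (\<delta> m x) n = T (n - m) *v x" for n
    proof -
      have "cv T (\<delta> m x) n = (\<Sum>k\<in>{-3..3}. if k = n - m then T (n - m) *v x else 0)"
        unfolding cv_def \<delta>_def by (intro sum.cong refl) auto
      then show ?thesis using supp[of "n - m"] by auto
    qed
    have "(\<Sum>i\<in>UNIV. g $ i * u (\<delta> m x) $ i) = (\<Sum>n\<in>{-3..<j}. cdot (\<gamma> n) (T (n - m) *v x))"
      by (simp add: pair \<delta>)
    also have "\<dots> = (\<Sum>k\<in>{-3..3}. cdot (\<gamma> (k + m)) (T (k + m - m) *v x))"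
    proof (rule sum_int_shift)
      fix n :: int
      show "cdot (\<gamma> n) (T (n - m) *v x) = 0" if "n \<notin> {-3..<j}"
        using that by (simp only: \<gamma>_def if_False cdot_simps)
      show "cdot (\<gamma> n) (T (n - m) *v x) = 0" if "n - m \<notin> {-3..3}"
        using supp[OF that] by (simp add: cdot_simps)
    qed auto
    also have "\<dots> = cdot (h (- m)) x"
      by (simp add: h_def cv_def tp_def cdot_sum cdot_mult_left transpose_transpose algebra_simps)
    finally show ?thesis .
  qed
  have "h 0 \<in> Zs T (1 - j)"
  proof (rule Zs_mem)
    fix n :: int assume n: "n < 0"
    have "cdot (h n) x = 0" for x
    proof -
      have "u (\<delta> (- n) x) \<in> R" unfolding R_def using n by (auto simp: \<delta>_def intro!: exI[of _ "\<delta> (- n) x"])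
      then show ?thesis using g h[of "- n" x] by simp
    qed
    then show "h n = 0" by (rule cdot_all_eq_0)
  next
    fix n :: int assume "n < 1 - j"
    then show "cv T h n = 0" by (simp add: h_def \<gamma>_def)
  qed
  from orth[OF this] have "cdot (h 0) v = 0" .
  then show False using gv h[of 0 v] by simp
qed

lemma Zs_polar: "i \<le> 4 \<Longrightarrow> Zs T i = {v. \<forall>h\<in>Zs T (1 - i). cdot h v = 0}"
  using polar_complete[of i] polar_orthogonal[of _ i] by (auto simp: cdot_commute)

lemma Zs_zero:
  assumes "i \<ge> 4"
  shows "Zs T i = {0}"
proof -
  have "Zs T 4 = {v. \<forall>h. cdot h v = 0}"
    using Zs_polar[of 4] Zs_UNIV[of "-3" T] by simp
  then have "Zs T 4 \<subseteq> {0}" using cdot_all_eq_0 by (auto simp: cdot_commute)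
  then show ?thesis using Zs_antimono[OF assms] vec.subspace_0[OF subspace_Zs] by blast
qed

end

section \<open>Holomorphic structure of the filtration\<close>

lemma cm_lower: "(\<And>n. n < a \<Longrightarrow> F n = 0) \<Longrightarrow> n < a - 3 \<Longrightarrow> cm T F n = 0"
  by (auto simp: cm_def intro!: sum.neutral)

lemma cm_upper: "(\<And>n. n > a \<Longrightarrow> F n = 0) \<Longrightarrow> n > a + 3 \<Longrightarrow> cm T F n = 0"
  by (auto simp: cm_def intro!: sum.neutral)

lemma cm_diff: "cm T (\<lambda>n. F n - G n) n = cm T F n - cm T G n"
  by (simp add: cm_def matrix_diff_right_distrib sum_subtractf)

lemma cm_add: "cm T (\<lambda>n. F n + G n) n = cm T F n + cm T G n"
  by (simp add: cm_def matrix_add_ldistrib sum.distrib)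

lemma cm_zero [simp]: "cm T (\<lambda>n. 0) n = 0"
  by (simp add: cm_def)

lemma cm_shift: "cm T (\<lambda>n. F (n + m)) n = cm T F (n + m)"
  by (simp add: cm_def algebra_simps)

lemma plus_part_id: "(\<And>n. n < 0 \<Longrightarrow> F n = 0) \<Longrightarrow> plus_part F = F"
  by (auto simp: plus_part_def)

lemma plus_part_mult: "plus_part (\<lambda>n. F n ** C) = (\<lambda>n. plus_part F n ** C)"
  by (auto simp: plus_part_def)

text \<open>Moves the index shift from the coefficients of the loop to the sequence, so that the
  derivative of \<Phi> applied to \<open>F\<close> becomes \<Phi> applied to a new sequence. The
  range -5..5 contains the support of \<open>t\<close> and of its shift by one.\<close>

lemma coeff_derivative_sum:
  fixes F :: "int \<Rightarrow> complex^'m^7"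
  assumes t: "\<And>k. k \<notin> {-3..3} \<Longrightarrow> t k = 0" and D0: "\<And>k. k \<notin> {-3..3} \<Longrightarrow> D k = 0"
    and D: "\<And>k. D k = t k ** C - t (k - e) ** C" and e: "e \<in> {-1, 1}"
  shows "(\<Sum>k\<in>{-3..3}. D k ** F (n - k)) = cm t (\<lambda>n. C ** F n - C ** F (n - e)) n"
proof -
  have "(\<Sum>k\<in>{-3..3}. D k ** F (n - k)) = (\<Sum>k\<in>{-5..5}. D k ** F (n - k))"
    by (rule sum.mono_neutral_left) (use D0 in auto)
  also have "\<dots> = (\<Sum>k\<in>{-5..5}. t k ** C ** F (n - k)) - (\<Sum>k\<in>{-5..5}. t (k - e) ** C ** F (n - k))"
    by (simp add: D matrix_diff_left_distrib sum_subtractf)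
  also have "(\<Sum>k\<in>{-5..5}. t k ** C ** F (n - k)) = (\<Sum>k\<in>{-3..3}. t k ** C ** F (n - k))"
    by (rule sum.mono_neutral_right) (use t in auto)
  also have "(\<Sum>k\<in>{-5..5}. t (k - e) ** C ** F (n - k)) = (\<Sum>k\<in>{-3..3}. t (k + e - e) ** C ** F (n - (k + e)))"
  proof (rule sum_int_shift)
    show "t (k - e) ** C ** F (n - k) = 0" if "k \<notin> {-5..5}" for k
    proof -
      have "k - e \<notin> {-3..3}" using that e by auto
      then have "t (k - e) = 0" by (rule t)
      then show ?thesis by simp
    qed
    show "t (k - e) ** C ** F (n - k) = 0" if "k - e \<notin> {-3..3}" for k
      using t[OF that] by simp
  qed auto
  finally show ?thesis
    by (simp add: cm_def matrix_diff_right_distrib sum_subtractf matrix_mul_assoc diff_diff_eq)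
qed

lemma smooth_on_cm:
  assumes "open S" "\<And>k. smooth_on S (\<tau> k)" "\<And>n. smooth_on S (F n)"
  shows "smooth_on S (\<lambda>w. cm (\<lambda>k. \<tau> k w) (\<lambda>n. F n w) n)"
  unfolding cm_def by (intro smooth_on_sum smooth_on_matrix_mult assms)

lemma smooth_on_tp:
  assumes "open S" "\<And>k. smooth_on S (\<tau> k)"
  shows "smooth_on S (\<lambda>w. tp (\<lambda>k. \<tau> k w) k)"
  unfolding tp_def by (intro smooth_on_transpose assms)

lemma smooth_on_ball_det:
  fixes F :: "complex \<Rightarrow> complex^'n^'n"
  assumes "open S" "smooth_on S F" "w0 \<in> S" "det (F w0) \<noteq> 0"
  obtains r where "r > 0" "ball w0 r \<subseteq> S" "\<And>w. w \<in> ball w0 r \<Longrightarrow> det (F w) \<noteq> 0"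
proof -
  have "continuous_on S (\<lambda>w. det (F w))"
    by (intro smooth_on_imp_continuous_on smooth_on_det assms)
  then have "open (S \<inter> (\<lambda>w. det (F w)) -` (- {0}))"
    using assms(1) by (intro continuous_open_preimage) auto
  moreover have "w0 \<in> S \<inter> (\<lambda>w. det (F w)) -` (- {0})" using assms by simp
  ultimately obtain r where "r > 0" "ball w0 r \<subseteq> S \<inter> (\<lambda>w. det (F w)) -` (- {0})"
    using open_contains_ball by blast
  then show thesis using that[of r] by blast
qed

lemma kernel_frameE:
  fixes \<A> :: "(complex \<Rightarrow> complex^'n) set"
  assumes "finite \<A>" "r > 0" "\<And>a k. a \<in> \<A> \<Longrightarrow> (\<lambda>w. a w $ k) holomorphic_on ball w0 r"
  obtains \<rho> Q I where "0 < \<rho>" "\<rho> \<le> r" "mholo (ball w0 \<rho>) Q" "\<And>w. w \<in> ball w0 \<rho> \<Longrightarrow> det (Q w) \<noteq> 0"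
    "\<And>w. w \<in> ball w0 \<rho> - {w0} \<Longrightarrow> cspan (Q w) I = {v. \<forall>a\<in>\<A>. (\<Sum>k\<in>UNIV. a w $ k * v $ k) = 0}"
proof -
  have "\<exists>\<rho> Q I. 0 < \<rho> \<and> \<rho> \<le> r \<and> mholo (ball w0 \<rho>) Q \<and> (\<forall>w\<in>ball w0 \<rho>. det (Q w) \<noteq> 0) \<and>
      (\<forall>w\<in>ball w0 \<rho> - {w0}. cspan (Q w) I = {v. \<forall>a\<in>\<A>. (\<Sum>k\<in>UNIV. a w $ k * v $ k) = 0})"
    by (rule kernel_frame[OF assms(1,2)]) (rule assms(3))
  then show thesis
    by (elim exE conjE) (rule that; blast)
qed

lemma cspan_mult: "cspan (A ** M) I = (*v) A ` cspan M I"
  by (auto simp: cspan_def image_iff simp flip: matrix_vector_mul_assoc)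

lemma minus_mult: "(- A) ** B = - (A ** (B::complex^'n^'m))"
  and mult_minus: "C ** (- D) = - (C ** (D::complex^'k^'n))"
  by (simp_all add: vec_eq_iff matrix_matrix_mult_def sum_negf)

lemma minus_mv: "(- A) *v x = - (A *v (x::complex^'n))"
  by (simp add: vec_eq_iff matrix_vector_mult_def sum_negf)

lemma mult_left_cancel:
  fixes A :: "complex^'n^'n"
  assumes "det A \<noteq> 0" "A ** X = A ** Y"
  shows "X = Y"
proof -
  have "matrix_inv A ** (A ** X) = matrix_inv A ** (A ** Y)" using assms by simp
  then show ?thesis
    unfolding matrix_mul_assoc matrix_inv_mult[OF assms(1)] matrix_mul_lid .
qed

lemma matrix_inv_mat_1 [simp]: "matrix_inv (mat 1 :: complex^'n^'n) = mat 1"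
  by (rule matrix_inv_unique) simp

definition colm :: "complex^'n \<Rightarrow> complex^1^'n" where
  "colm x = (\<chi> i j. x $ i)"

lemma colm_mult: "A ** colm x = colm (A *v x)"
  by (simp add: vec_eq_iff colm_def matrix_matrix_mult_def matrix_vector_mult_def)

lemma colm_inject: "colm x = colm y \<longleftrightarrow> x = y"
  by (simp add: vec_eq_iff colm_def)

lemma colm_cv: "cm T (\<lambda>n. colm (f n)) n = colm (cv T f n)"
proof -
  have "colm (\<Sum>k\<in>I. g k) = (\<Sum>k\<in>I. colm (g k))" for I and g :: "int \<Rightarrow> complex^7"
    by (induction I rule: infinite_finite_induct) (simp_all add: vec_eq_iff colm_def)
  then show ?thesis by (simp add: cm_def cv_def colm_mult)
qed

lemma mv_nth: "(A *v x) $ a = (\<Sum>k\<in>UNIV. A $ a $ k * (x::complex^'n) $ k)"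
  by (simp add: matrix_vector_mult_def)

text \<open>The two derivative assumptions are the coefficients of \<lambda>^k in dz \<Phi> = \<Phi>
  (1 - \<lambda>^-1) A and dbar \<Phi> = \<Phi> (1 - \<lambda>) B. Skewness of \<open>B\<close> says
  that dbar + B respects the bilinear inner product, so it passes to annihilators.\<close>

locale loop_field =
  fixes \<Omega> :: "complex set" and \<tau> :: "int \<Rightarrow> complex \<Rightarrow> complex^7^7" and A B :: "complex \<Rightarrow> complex^7^7"
  assumes open_\<Omega>: "open \<Omega>"
    and coeffs: "w \<in> \<Omega> \<Longrightarrow> loop_coeffs (\<lambda>k. \<tau> k w)"
    and smooth: "smooth_on \<Omega> (\<tau> k)"
    and mz_\<tau>: "w \<in> \<Omega> \<Longrightarrow> mz (\<tau> k) w = \<tau> k w ** A w - \<tau> (k + 1) w ** A w"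
    and mzb_\<tau>: "w \<in> \<Omega> \<Longrightarrow> mzb (\<tau> k) w = \<tau> k w ** B w - \<tau> (k - 1) w ** B w"
    and skew: "w \<in> \<Omega> \<Longrightarrow> transpose (B w) = - B w"
begin

abbreviation tw :: "complex \<Rightarrow> int \<Rightarrow> complex^7^7" where
  "tw w \<equiv> \<lambda>k. \<tau> k w"

lemma mdiff_\<tau>: "w \<in> \<Omega> \<Longrightarrow> mdiff (\<tau> k) w"
  using smooth_on_imp_mdiff[OF open_\<Omega> smooth] .

lemma mz_outside:
  assumes "w \<in> \<Omega>" "k \<notin> {-3..3}"
  shows "mz (\<tau> k) w = 0" "mzb (\<tau> k) w = 0"
  using mz_cong[OF open_\<Omega> assms(1), of "\<tau> k" "\<lambda>w. 0"] loop_coeffs.supp[OF coeffs assms(2)] by auto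

text \<open>The product rule dbar (\<Phi> F) = \<Phi> (dbar F + (1 - \<lambda>) B F). The factor 1 -
  \<lambda> creates no negative exponents, so W is closed under dbar.\<close>

lemma mzb_cm:
  fixes F :: "int \<Rightarrow> complex \<Rightarrow> complex^'m^7"
  assumes w: "w \<in> \<Omega>" and F: "\<And>n. mdiff (F n) w"
  shows "mzb (\<lambda>w. cm (tw w) (\<lambda>n. F n w) n) w =
    cm (tw w) (\<lambda>n. mzb (F n) w + (B w ** F n w - B w ** F (n - 1) w)) n"
proof -
  have "mzb (\<lambda>w. cm (tw w) (\<lambda>n. F n w) n) w =
      (\<Sum>k\<in>{-3..3}. mzb (\<tau> k) w ** F (n - k) w) + (\<Sum>k\<in>{-3..3}. \<tau> k w ** mzb (F (n - k)) w)"
    unfolding cm_def by (simp add: mz_sum mz_mult mdiff_mult mdiff_\<tau>[OF w] F sum.distrib)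
  also have "(\<Sum>k\<in>{-3..3}. mzb (\<tau> k) w ** F (n - k) w) = cm (tw w) (\<lambda>n. B w ** F n w - B w ** F (n - 1) w) n"
    using loop_coeffs.supp[OF coeffs[OF w]] mz_outside[OF w] mzb_\<tau>[OF w]
    by (intro coeff_derivative_sum) auto
  finally show ?thesis
    unfolding cm_add by (simp add: cm_def)
qed

text \<open>The product rule dz (\<Phi> F) = \<Phi> (dz F + (1 - \<lambda>^-1) A F). Here the
  exponent -1 may appear, so only \<lambda> dz preserves W.\<close>

lemma mz_cm:
  fixes F :: "int \<Rightarrow> complex \<Rightarrow> complex^'m^7"
  assumes w: "w \<in> \<Omega>" and F: "\<And>n. mdiff (F n) w"
  shows "mz (\<lambda>w. cm (tw w) (\<lambda>n. F n w) n) w =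
    cm (tw w) (\<lambda>n. mz (F n) w + (A w ** F n w - A w ** F (n + 1) w)) n"
proof -
  have "mz (\<lambda>w. cm (tw w) (\<lambda>n. F n w) n) w =
      (\<Sum>k\<in>{-3..3}. mz (\<tau> k) w ** F (n - k) w) + (\<Sum>k\<in>{-3..3}. \<tau> k w ** mz (F (n - k)) w)"
    unfolding cm_def by (simp add: mz_sum mz_mult mdiff_mult mdiff_\<tau>[OF w] F sum.distrib)
  also have "(\<Sum>k\<in>{-3..3}. mz (\<tau> k) w ** F (n - k) w) = cm (tw w) (\<lambda>n. A w ** F n w - A w ** F (n - (-1)) w) n"
    using loop_coeffs.supp[OF coeffs[OF w]] mz_outside[OF w] mz_\<tau>[OF w]
    by (intro coeff_derivative_sum) auto
  finally show ?thesis
    unfolding cm_add by (simp add: cm_def)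
qed

text \<open>The idempotent \<open>\<Phi> \<pi>\<^sub>+ \<Phi>\<inverse>\<close> with range \<open>\<W>\<close>, restricted to the Laurent polynomials with exponents
  \<open>-3, \<dots>, 3\<close>.\<close>

definition prW :: "complex \<Rightarrow> complex^(7 \<times> 7)^(7 \<times> 7)" where
  "prW w = (\<Sum>n\<in>{-3..3}. transpose (\<iota> n) ** cm (tw w) (plus_part (cm (tp (tw w)) \<iota>)) n)"

text \<open>Truncation loses nothing on inputs from the window. The part removed by
  \<open>plus_part\<close> has exponents at most -1, so \<Phi> carries it to exponents at most 2,
  and above 3 the result agrees with \<open>\<iota>\<close>, which is zero there. Below -3 nothing
  can arise.\<close>

lemma \<iota>_prW:
  assumes w: "w \<in> \<Omega>"
  shows "\<iota> n ** prW w = cm (tw w) (plus_part (cm (tp (tw w)) \<iota>)) n"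
proof -
  interpret loop_coeffs "tw w" using coeffs[OF w] .
  define F where "F = cm (tp (tw w)) \<iota>"
  have "cm (tw w) (plus_part F) n = 0" if "n \<notin> {-3..3}"
  proof (cases "n < -3")
    case True
    then show ?thesis by (intro cm_lower[of 0]) (auto simp: plus_part_def)
  next
    case False
    then have n: "n > 3" using that by auto
    have "cm (tw w) (\<lambda>n. F n - plus_part F n) n = 0"
      by (rule cm_upper[of "-1"]) (use n in \<open>auto simp: plus_part_def\<close>)
    then have "cm (tw w) (plus_part F) n = cm (tw w) F n" by (simp add: cm_diff)
    then show ?thesis using \<iota>_outside[OF that] by (simp add: F_def)
  qed
  then show ?thesis
    unfolding prW_def \<iota>_sum F_def by auto
qed

lemma \<iota>_prW_mult:
  assumes "w \<in> \<Omega>"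
  shows "\<iota> n ** (prW w ** X) = cm (tw w) (plus_part (cm (tp (tw w)) (\<lambda>n. \<iota> n ** X))) n"
proof -
  have eq: "cm (tp (tw w)) (\<lambda>n. \<iota> n ** X) = (\<lambda>n. cm (tp (tw w)) \<iota> n ** X)"
    by (rule ext) (rule cm_mult)
  show ?thesis
    unfolding eq plus_part_mult cm_mult using assms by (simp add: matrix_mul_assoc \<iota>_prW)
qed

lemma prW_fixed:
  assumes w: "w \<in> \<Omega>" and X: "\<And>n. n < 0 \<Longrightarrow> cm (tp (tw w)) (\<lambda>n. \<iota> n ** X) n = 0"
  shows "prW w ** X = X"
proof (rule \<iota>_eqI)
  fix n
  interpret loop_coeffs "tw w" using coeffs[OF w] .
  have "plus_part (cm (tp (tw w)) (\<lambda>n. \<iota> n ** X)) = cm (tp (tw w)) (\<lambda>n. \<iota> n ** X)"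
    using X by (rule plus_part_id)
  then show "\<iota> n ** (prW w ** X) = \<iota> n ** X"
    by (simp add: \<iota>_prW_mult[OF w])
qed

lemma prW_range:
  assumes w: "w \<in> \<Omega>" and "prW w ** X = X" and "n < 0"
  shows "cm (tp (tw w)) (\<lambda>n. \<iota> n ** X) n = 0"
proof -
  interpret loop_coeffs "tw w" using coeffs[OF w] .
  have "\<iota> m ** X = cm (tw w) (plus_part (cm (tp (tw w)) (\<lambda>n. \<iota> n ** X))) m" for m
    using \<iota>_prW_mult[OF w, of m X] unfolding assms(2) .
  then have "(\<lambda>n. \<iota> n ** X) = cm (tw w) (plus_part (cm (tp (tw w)) (\<lambda>n. \<iota> n ** X)))"
    by (rule ext)
  then have "cm (tp (tw w)) (\<lambda>n. \<iota> n ** X) n =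
      cm (tp (tw w)) (cm (tw w) (plus_part (cm (tp (tw w)) (\<lambda>n. \<iota> n ** X)))) n"
    by (rule arg_cong)
  also have "\<dots> = plus_part (cm (tp (tw w)) (\<lambda>n. \<iota> n ** X)) n"
    by (rule cm_tp_T)
  also have "\<dots> = 0" using assms(3) by (simp add: plus_part_def)
  finally show ?thesis .
qed

lemma prW_idem:
  assumes w: "w \<in> \<Omega>"
  shows "prW w ** prW w = prW w"
proof (rule prW_fixed[OF w])
  interpret loop_coeffs "tw w" using coeffs[OF w] .
  fix n :: int assume "n < 0"
  have eq: "(\<lambda>n. \<iota> n ** prW w) = cm (tw w) (plus_part (cm (tp (tw w)) \<iota>))"
    by (rule ext) (rule \<iota>_prW[OF w])
  show "cm (tp (tw w)) (\<lambda>n. \<iota> n ** prW w) n = 0"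
    unfolding eq using \<open>n < 0\<close> by (simp add: plus_part_def)
qed

lemma smooth_plus_part: "smooth_on \<Omega> (\<lambda>w. plus_part (cm (tp (tw w)) \<iota>) n)"
proof (cases "n < 0")
  case True
  then show ?thesis using smooth_on_const[OF open_\<Omega>] by (simp add: plus_part_def)
next
  case False
  have "smooth_on \<Omega> (\<lambda>w. cm (tp (tw w)) \<iota> n)"
    using smooth_on_cm[of \<Omega> "\<lambda>k w. tp (tw w) k" "\<lambda>n w. \<iota> n" n]
    by (simp add: open_\<Omega> smooth_on_tp smooth smooth_on_const)
  then show ?thesis using False by (simp add: plus_part_def)
qed

lemma smooth_prW: "smooth_on \<Omega> prW"
  unfolding prW_def[abs_def]
  by (intro smooth_on_sum smooth_on_matrix_mult smooth_on_const smooth_on_cm smooth open_\<Omega> smooth_plus_part)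

text \<open>The columns of \<open>prW\<close> are sections of W, and dbar of such a section stays in
  W. This is the condition for the range of an idempotent to be a holomorphic subbundle.\<close>

lemma prW_mzb:
  assumes w: "w \<in> \<Omega>"
  shows "prW w ** mzb prW w = mzb prW w"
proof (rule prW_fixed[OF w])
  interpret loop_coeffs "tw w" using coeffs[OF w] .
  define F where "F n w = plus_part (cm (tp (tw w)) \<iota>) n" for n w
  have dF: "mdiff (F n) w" for n
    unfolding F_def by (rule smooth_on_imp_mdiff[OF open_\<Omega> smooth_plus_part w])
  have dP: "mdiff prW w" by (rule smooth_on_imp_mdiff[OF open_\<Omega> smooth_prW w])
  have "\<iota> n ** mzb prW w = cm (tw w) (\<lambda>n. mzb (F n) w + (B w ** F n w - B w ** F (n - 1) w)) n" for n
  proof -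
    have "\<iota> n ** mzb prW w = mzb (\<lambda>w. \<iota> n ** prW w) w"
      using dP by (simp add: mz_mult)
    also have "\<dots> = mzb (\<lambda>w. cm (tw w) (\<lambda>n. F n w) n) w"
      by (rule mz_cong[OF open_\<Omega> w]) (simp add: \<iota>_prW F_def)
    also have "\<dots> = cm (tw w) (\<lambda>n. mzb (F n) w + (B w ** F n w - B w ** F (n - 1) w)) n"
      by (rule mzb_cm[OF w dF])
    finally show ?thesis .
  qed
  then have eq: "(\<lambda>n. \<iota> n ** mzb prW w) = cm (tw w) (\<lambda>n. mzb (F n) w + (B w ** F n w - B w ** F (n - 1) w))"
    by (rule ext)
  fix n :: int assume n: "n < 0"
  then have "F n = (\<lambda>w. 0)" "F (n - 1) = (\<lambda>w. 0)" by (auto simp: F_def plus_part_def)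
  then show "cm (tp (tw w)) (\<lambda>n. \<iota> n ** mzb prW w) n = 0"
    unfolding eq by simp
qed

text \<open>Replaces the local solution of a dbar-equation. The frame \<open>\<sigma>\<close> of W
  is normalized along a fixed complement and is therefore holomorphic in the trivial bundle.
  Applying \<Phi>^-1 and taking the constant coefficient \<open>R\<close> turns dbar into dbar + B,
  so \<open>R\<close> is parallel; \<open>G\<close> is an invertible selection from it, and
  \<open>L = G^-1 R\<close> is holomorphic because both are parallel.\<close>

lemma flat_frame:
  assumes w0: "w0 \<in> \<Omega>"
  obtains r and \<sigma> :: "complex \<Rightarrow> complex^(7 \<times> 7)^(7 \<times> 7)" and G :: "complex \<Rightarrow> complex^7^7"
    and L :: "complex \<Rightarrow> complex^(7 \<times> 7)^7"
  where "r > 0" "ball w0 r \<subseteq> \<Omega>" "mholo (ball w0 r) \<sigma>"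
    "smooth_on (ball w0 r) G" "\<And>w. w \<in> ball w0 r \<Longrightarrow> det (G w) \<noteq> 0"
    "\<And>w. w \<in> ball w0 r \<Longrightarrow> mzb G w = - (B w ** G w)" "mholo (ball w0 r) L"
    "\<And>w n. w \<in> ball w0 r \<Longrightarrow> n < 0 \<Longrightarrow> cm (tp (tw w)) (\<lambda>n. \<iota> n ** \<sigma> w) n = 0"
    "\<And>w. w \<in> ball w0 r \<Longrightarrow> cm (tp (tw w)) (\<lambda>n. \<iota> n ** \<sigma> w) 0 = G w ** L w"
    "\<And>w x. w \<in> ball w0 r \<Longrightarrow> prW w *v x = x \<Longrightarrow> x = \<sigma> w *v x"
proof -
  define P0 where "P0 = prW w0"
  \<comment> \<open>The standard intertwiner of nearby idempotents: it is the identity at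
    \<open>w0\<close> and satisfies S P = P0 P = P0 S, so near \<open>w0\<close> it identifies the
    range of P with that of P0.\<close>
  define S where "S w = P0 ** prW w + (mat 1 - P0) ** (mat 1 - prW w)" for w
  have P0: "P0 ** P0 = P0" unfolding P0_def by (rule prW_idem[OF w0])
  have idem: "prW w ** prW w = prW w" if "w \<in> \<Omega>" for w by (rule prW_idem[OF that])
  have S_w0: "S w0 = mat 1"
    by (simp add: S_def matrix_diff_left_distrib matrix_diff_right_distrib P0 flip: P0_def)
  have S_smooth: "smooth_on \<Omega> S"
    unfolding S_def[abs_def]
    by (intro smooth_on_add smooth_on_diff smooth_on_matrix_mult smooth_on_const open_\<Omega> smooth_prW)
  obtain r1 where r1: "r1 > 0" "ball w0 r1 \<subseteq> \<Omega>" and detS: "\<And>w. w \<in> ball w0 r1 \<Longrightarrow> det (S w) \<noteq> 0"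
    using smooth_on_ball_det[OF open_\<Omega> S_smooth w0] by (auto simp: S_w0)
  define \<sigma> where "\<sigma> w = matrix_inv (S w) ** P0" for w
  have S\<sigma>: "S w ** \<sigma> w = P0" if "w \<in> ball w0 r1" for w
    by (simp add: \<sigma>_def matrix_mul_assoc matrix_inv_mult detS[OF that])
  have SP: "S w ** prW w = P0 ** prW w" if "w \<in> \<Omega>" for w
  proof -
    have "S w ** prW w = P0 ** (prW w ** prW w) + (mat 1 - P0) ** ((mat 1 - prW w) ** prW w)"
      unfolding S_def matrix_add_rdistrib matrix_mul_assoc ..
    also have "(mat 1 - prW w) ** prW w = 0"
      by (simp add: matrix_diff_left_distrib idem[OF that])
    finally show ?thesis by (simp add: idem[OF that])
  qed
  have PS: "P0 ** S w = P0 ** prW w" for w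
  proof -
    have "P0 ** S w = (P0 ** P0) ** prW w + (P0 ** (mat 1 - P0)) ** (mat 1 - prW w)"
      unfolding S_def matrix_add_ldistrib matrix_mul_assoc ..
    also have "P0 ** (mat 1 - P0) = 0"
      by (simp add: matrix_diff_right_distrib P0)
    finally show ?thesis by (simp add: P0)
  qed
  have P\<sigma>: "prW w ** \<sigma> w = \<sigma> w" if w: "w \<in> ball w0 r1" for w
  proof (rule mult_left_cancel[OF detS[OF w]])
    have wO: "w \<in> \<Omega>" using w r1 by blast
    have "S w ** (prW w ** \<sigma> w) = P0 ** (S w ** \<sigma> w)"
      by (simp add: matrix_mul_assoc SP[OF wO] PS)
    then show "S w ** (prW w ** \<sigma> w) = S w ** \<sigma> w" by (simp add: S\<sigma>[OF w] P0)
  qed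
  have S_fixed: "S w ** X = P0 ** X" if "prW w ** X = X" for w X
  proof -
    have "S w ** X = P0 ** (prW w ** X) + (mat 1 - P0) ** ((mat 1 - prW w) ** X)"
      unfolding S_def matrix_add_rdistrib matrix_mul_assoc ..
    also have "(mat 1 - prW w) ** X = 0"
      by (simp add: matrix_diff_left_distrib that)
    finally show ?thesis by (simp add: that)
  qed
  \<comment> \<open>The normalization of \<open>\<sigma>\<close>. Differentiating it gives P0 (dbar
    \<sigma>) = 0; since dbar \<sigma> has its columns in W, where S agrees with P0, invertibility
    of S yields dbar \<sigma> = 0.\<close>
  have P0\<sigma>: "P0 ** \<sigma> w = P0" if w: "w \<in> ball w0 r1" for w
    using S_fixed[OF P\<sigma>[OF w]] S\<sigma>[OF w] by simp
  have \<sigma>_smooth: "smooth_on (ball w0 r1) \<sigma>"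
    unfolding \<sigma>_def[abs_def]
    by (intro smooth_on_matrix_mult smooth_on_const smooth_on_matrix_inv detS smooth_on_subset[OF S_smooth] r1) auto
  have \<sigma>_diff: "mdiff \<sigma> w" if "w \<in> ball w0 r1" for w
    by (rule smooth_on_imp_mdiff[OF _ \<sigma>_smooth that]) simp
  have \<sigma>_mzb: "mzb \<sigma> w = 0" if w: "w \<in> ball w0 r1" for w
  proof (rule mult_left_cancel[OF detS[OF w]])
    have wO: "w \<in> \<Omega>" using w r1 by blast
    have dP: "mdiff prW w" by (rule smooth_on_imp_mdiff[OF open_\<Omega> smooth_prW wO])
    have "mzb (\<lambda>w. prW w ** \<sigma> w) w = mzb \<sigma> w"
      by (rule mz_cong[OF open_ball w P\<sigma>])
    then have 1: "mzb prW w ** \<sigma> w + prW w ** mzb \<sigma> w = mzb \<sigma> w"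
      using dP \<sigma>_diff[OF w] by (simp add: mz_mult)
    have "prW w ** (mzb prW w ** \<sigma> w + prW w ** mzb \<sigma> w) = mzb prW w ** \<sigma> w + prW w ** mzb \<sigma> w"
      by (simp add: matrix_add_ldistrib matrix_mul_assoc prW_mzb[OF wO] idem[OF wO])
    then have "prW w ** mzb \<sigma> w = mzb \<sigma> w" unfolding 1 .
    then have "S w ** mzb \<sigma> w = P0 ** mzb \<sigma> w" by (rule S_fixed)
    also have "\<dots> = mzb (\<lambda>w. P0 ** \<sigma> w) w" using \<sigma>_diff[OF w] by (simp add: mz_mult)
    also have "\<dots> = mzb (\<lambda>w. P0) w" by (rule mz_cong[OF open_ball w P0\<sigma>])
    finally show "S w ** mzb \<sigma> w = S w ** 0" by simp
  qed
  have \<sigma>_holo: "mholo (ball w0 r1) \<sigma>"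
    by (rule mzb_0_imp_mholo[OF open_ball \<sigma>_diff \<sigma>_mzb])
  define f where "f n w = cm (tp (tw w)) (\<lambda>n. \<iota> n ** \<sigma> w) n" for n w
  have f_neg: "f n w = 0" if "w \<in> ball w0 r1" "n < 0" for n w
    unfolding f_def using that r1 by (intro prW_range P\<sigma>) auto
  have f_smooth: "smooth_on (ball w0 r1) (f n)" for n
    unfolding f_def[abs_def]
    by (intro smooth_on_cm[of _ "\<lambda>k w. tp (tw w) k" "\<lambda>n w. \<iota> n ** \<sigma> w"] smooth_on_tp smooth_on_subset[OF smooth]
        smooth_on_matrix_mult smooth_on_const \<sigma>_smooth r1) auto
  have f_diff: "mdiff (f n) w" if "w \<in> ball w0 r1" for n w
    by (rule smooth_on_imp_mdiff[OF _ f_smooth that]) simp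
  define R where "R = f 0"
  have R_mzb: "mzb R w = - (B w ** R w)" if w: "w \<in> ball w0 r1" for w
  proof -
    have wO: "w \<in> \<Omega>" using w r1 by blast
    interpret loop_coeffs "tw w" using coeffs[OF wO] .
    \<comment> \<open>The sequence with \<Phi> h = dbar \<sigma>, hence zero as \<Phi> is
      invertible. Its constant term is the equation for \<open>R\<close>, because \<open>f\<close>
      vanishes at index -1.\<close>
    define h where "h n = mzb (f n) w + (B w ** f n w - B w ** f (n - 1) w)" for n
    have "cm (tw w) h n = 0" for n
    proof -
      have "cm (tw w) h n = mzb (\<lambda>w. cm (tw w) (\<lambda>n. f n w) n) w"
        unfolding h_def[abs_def] by (rule mzb_cm[OF wO f_diff[OF w], symmetric])
      also have "\<dots> = mzb (\<lambda>w. \<iota> n ** \<sigma> w) w"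
      proof (rule mz_cong[OF open_ball w])
        fix y assume "y \<in> ball w0 r1"
        then have "y \<in> \<Omega>" using r1 by blast
        then interpret y: loop_coeffs "tw y" by (rule coeffs)
        show "cm (tw y) (\<lambda>n. f n y) n = \<iota> n ** \<sigma> y" by (simp add: f_def)
      qed
      also have "\<dots> = 0" using \<sigma>_diff[OF w] by (simp add: mz_mult \<sigma>_mzb[OF w])
      finally show ?thesis .
    qed
    then have "cm (tw w) h = (\<lambda>n. 0)" by (rule ext)
    then have "h 0 = 0" using cm_tp_T[of h 0] by simp
    then show ?thesis
      using f_neg[OF w, of "-1"] by (simp add: h_def R_def eq_neg_iff_add_eq_0)
  qed
  \<comment> \<open>The columns are the coefficients of \<Phi>(w0) applied to the standard basis.
    These lie in W at \<open>w0\<close>, and \<Phi>(w0)^-1 returns the constants, so that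
    \<open>G\<close> starts at the identity.\<close>
  define Jm where "Jm = (\<Sum>n\<in>{-3..3}. transpose (\<iota> n) ** \<tau> n w0)"
  have Jm: "\<iota> n ** Jm = \<tau> n w0" for n
    unfolding Jm_def \<iota>_sum using loop_coeffs.supp[OF coeffs[OF w0], of n] by auto
  define G where "G w = R w ** Jm" for w
  have G_w0: "G w0 = mat 1"
  proof -
    interpret loop_coeffs "tw w0" using coeffs[OF w0] .
    have \<delta>: "cm (tp (tw w0)) (\<lambda>n. \<iota> n ** Jm) n = (if n = 0 then mat 1 else 0)" for n
      unfolding Jm using left_inverse[of n] by (simp add: cm_def tp_def)
    have "P0 ** Jm = Jm" unfolding P0_def by (rule prW_fixed[OF w0]) (simp add: \<delta>)
    moreover have "\<sigma> w0 = P0"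
      by (simp add: \<sigma>_def S_w0)
    ultimately have "G w0 = cm (tp (tw w0)) (\<lambda>n. \<iota> n ** Jm) 0"
      by (simp add: G_def R_def f_def flip: cm_mult matrix_mul_assoc)
    then show ?thesis by (simp add: \<delta>)
  qed
  have G_smooth: "smooth_on (ball w0 r1) G"
    unfolding G_def[abs_def] R_def by (intro smooth_on_matrix_mult smooth_on_const f_smooth) auto
  obtain r where r: "r > 0" "ball w0 r \<subseteq> ball w0 r1" and detG: "\<And>w. w \<in> ball w0 r \<Longrightarrow> det (G w) \<noteq> 0"
    using smooth_on_ball_det[OF _ G_smooth, of w0] r1 by (auto simp: G_w0)
  have G_diff: "mdiff G w" if "w \<in> ball w0 r1" for w
    by (rule smooth_on_imp_mdiff[OF _ G_smooth that]) simp
  have G_mzb: "mzb G w = - (B w ** G w)" if "w \<in> ball w0 r1" for w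
    unfolding G_def[abs_def] using f_diff[OF that, of 0] R_mzb[OF that]
    by (simp add: mz_mult minus_mult matrix_mul_assoc flip: R_def)
  define L where "L w = matrix_inv (G w) ** R w" for w
  have GL: "G w ** L w = R w" if "w \<in> ball w0 r" for w
    by (simp add: L_def matrix_mul_assoc matrix_inv_mult detG[OF that])
  have L_smooth: "smooth_on (ball w0 r) L"
    unfolding L_def[abs_def] R_def
    by (intro smooth_on_matrix_mult smooth_on_matrix_inv detG smooth_on_subset[OF G_smooth]
        smooth_on_subset[OF f_smooth] r) auto
  have L_diff: "mdiff L w" if "w \<in> ball w0 r" for w
    by (rule smooth_on_imp_mdiff[OF _ L_smooth that]) simp
  have "mzb L w = 0" if w: "w \<in> ball w0 r" for w
  proof (rule mult_left_cancel[OF detG[OF w]])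
    have w1: "w \<in> ball w0 r1" using w r by blast
    have "mzb (\<lambda>w. G w ** L w) w = mzb R w"
      by (rule mz_cong[OF open_ball w GL])
    then have "mzb G w ** L w + G w ** mzb L w = - (B w ** R w)"
      using G_diff[OF w1] L_diff[OF w] by (simp add: mz_mult R_mzb[OF w1])
    then have "- (B w ** (G w ** L w)) + G w ** mzb L w = - (B w ** R w)"
      by (simp add: G_mzb[OF w1] minus_mult matrix_mul_assoc)
    then show "G w ** mzb L w = G w ** 0" by (simp add: GL[OF w])
  qed
  then have L_holo: "mholo (ball w0 r) L"
    by (intro mzb_0_imp_mholo L_diff) auto
  show thesis
  proof (rule that[of r \<sigma> G L])
    show "ball w0 r \<subseteq> \<Omega>" using r r1 by blast
    show "x = \<sigma> w *v x" if w: "w \<in> ball w0 r" and x: "prW w *v x = x" for w x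
    proof -
      have w1: "w \<in> ball w0 r1" using w r by blast
      have "S w *v x = P0 *v (prW w *v x) + (mat 1 - P0) *v (x - prW w *v x)"
        unfolding S_def matrix_vector_mult_add_rdistrib
        by (simp add: matrix_vector_mult_diff_rdistrib flip: matrix_vector_mul_assoc)
      then have "S w *v x = P0 *v x" by (simp add: x)
      then have "matrix_inv (S w) *v (S w *v x) = \<sigma> w *v x"
        by (simp add: \<sigma>_def flip: matrix_vector_mul_assoc)
      then show ?thesis by (simp add: matrix_vector_mul_assoc matrix_inv_mult detS[OF w1])
    qed
    show "cm (tp (tw w)) (\<lambda>n. \<iota> n ** \<sigma> w) n = 0" if "w \<in> ball w0 r" "n < 0" for w n
      using f_neg[of w n] that r unfolding f_def by blast
    show "cm (tp (tw w)) (\<lambda>n. \<iota> n ** \<sigma> w) 0 = G w ** L w" if "w \<in> ball w0 r" for w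
      using GL[OF that] by (simp add: R_def f_def)
    show "mzb G w = - (B w ** G w)" if "w \<in> ball w0 r" for w
      using G_mzb that r by blast
  qed (use r mholo_subset[OF \<sigma>_holo] smooth_on_subset[OF G_smooth] detG L_holo in auto)
qed

lemma prW_fixed_vec:
  assumes w: "w \<in> \<Omega>" and x: "\<And>n. n < 0 \<Longrightarrow> cv (tp (tw w)) (\<lambda>n. \<iota> n *v x) n = 0"
  shows "prW w *v x = x"
proof -
  have "prW w ** colm x = colm x"
    by (rule prW_fixed[OF w]) (simp add: colm_mult colm_cv x, simp add: colm_def vec_eq_iff)
  then show ?thesis by (simp add: colm_mult colm_inject)
qed

text \<open>An element of W with its exponents cut off above 3 is fixed by \<open>prW\<close>, hence
  equals \<open>\<sigma>\<close> applied to itself, and the constant coefficient of its \<Phi>^-1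
  image is unaffected by the cut. The bound on \<open>i\<close> keeps the conditions n < i within
  the window.\<close>

lemma Zs_frame:
  fixes \<sigma> :: "complex^(7 \<times> 7)^(7 \<times> 7)"
  assumes w: "w \<in> \<Omega>" and neg: "\<And>n. n < 0 \<Longrightarrow> cm (tp (tw w)) (\<lambda>n. \<iota> n ** \<sigma>) n = 0"
    and fixed: "\<And>x. prW w *v x = x \<Longrightarrow> x = \<sigma> *v x" and i: "i \<le> 4"
  shows "Zs (tw w) i = (*v) (cm (tp (tw w)) (\<lambda>n. \<iota> n ** \<sigma>) 0) ` {x. \<forall>n<i. (\<iota> n ** \<sigma>) *v x = 0}"
proof (intro equalityI subsetI)
  interpret loop_coeffs "tw w" using coeffs[OF w] .
  fix v assume "v \<in> (*v) (cm (tp (tw w)) (\<lambda>n. \<iota> n ** \<sigma>) 0) ` {x. \<forall>n<i. (\<iota> n ** \<sigma>) *v x = 0}"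
  then obtain x where x: "\<forall>n<i. (\<iota> n ** \<sigma>) *v x = 0" and v: "v = cm (tp (tw w)) (\<lambda>n. \<iota> n ** \<sigma>) 0 *v x"
    by auto
  have "cm (tp (tw w)) (\<lambda>n. \<iota> n ** \<sigma>) 0 *v x \<in> Zs (tw w) i"
  proof (rule Zs_mem[where f = "\<lambda>n. cm (tp (tw w)) (\<lambda>n. \<iota> n ** \<sigma>) n *v x"])
    show "cm (tp (tw w)) (\<lambda>n. \<iota> n ** \<sigma>) n *v x = 0" if "n < 0" for n
      by (simp add: neg[OF that])
    show "cv (tw w) (\<lambda>n. cm (tp (tw w)) (\<lambda>n. \<iota> n ** \<sigma>) n *v x) n = 0" if "n < i" for n
      unfolding cm_vec[symmetric] cm_T_tp using x that by blast
  qed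
  then show "v \<in> Zs (tw w) i" by (simp add: v)
next
  interpret loop_coeffs "tw w" using coeffs[OF w] .
  fix v assume "v \<in> Zs (tw w) i"
  then obtain f where v: "v = f 0" and f: "\<And>n. n < 0 \<Longrightarrow> f n = 0" "\<And>n. n < i \<Longrightarrow> cv (tw w) f n = 0"
    by (auto simp: Zs_def)
  define g where "g = cv (tw w) f"
  have f_eq: "cv (tp (tw w)) g n = f n" for n by (simp add: g_def)
  have g_low: "g n = 0" if "n < -3" for n
    using cv_lower[of 0 f n] f(1) that by (simp add: g_def)
  define x where "x = (\<Sum>n\<in>{-3..3}. transpose (\<iota> n) *v g n)"
  have \<iota>x: "\<iota> m *v x = (if m \<in> {-3..3} then g m else 0)" for m
  proof -
    have "\<iota> m *v x = (\<Sum>n\<in>{-3..3}. if n = m then g m else 0)"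
      unfolding x_def mv_sum by (intro sum.cong refl) (auto simp: matrix_vector_mul_assoc \<iota>_transpose)
    then show ?thesis by simp
  qed
  \<comment> \<open>The discarded tail starts at exponent 4 and \<open>tp\<close> lowers exponents
    by at most 3, so it is felt only from exponent 1 on.\<close>
  have eq: "cv (tp (tw w)) (\<lambda>n. \<iota> n *v x) n = f n" if "n < 1" for n
  proof -
    have "cv (tp (tw w)) (\<lambda>n. g n - \<iota> n *v x) n = 0"
      by (rule cv_lower[of 4]) (use that g_low in \<open>auto simp: \<iota>x\<close>)
    then show ?thesis by (simp add: cv_diff f_eq)
  qed
  have "prW w *v x = x"
    by (rule prW_fixed_vec[OF w]) (simp add: eq f(1))
  then have x: "x = \<sigma> *v x" by (rule fixed)
  have \<iota>\<sigma>x: "(\<iota> n ** \<sigma>) *v x = \<iota> n *v x" for n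
    using x by (simp flip: matrix_vector_mul_assoc)
  have "cm (tp (tw w)) (\<lambda>n. \<iota> n ** \<sigma>) 0 *v x = v"
    unfolding cm_vec \<iota>\<sigma>x by (simp add: eq v)
  moreover have "\<forall>n<i. (\<iota> n ** \<sigma>) *v x = 0"
    unfolding \<iota>\<sigma>x \<iota>x using f(2) by (simp add: g_def)
  ultimately show "v \<in> (*v) (cm (tp (tw w)) (\<lambda>n. \<iota> n ** \<sigma>) 0) ` {x. \<forall>n<i. (\<iota> n ** \<sigma>) *v x = 0}"
    by blast
qed

text \<open>\<open>Zs (tw w) i\<close> is \<open>G L\<close> applied to the kernel of the blocks
  \<open>\<iota> n ** \<sigma>\<close> with n < i. Elimination extends this kernel over
  \<open>w0\<close>, yet \<open>G L\<close> may still drop rank on it; hence the frame is built for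
  the annihilator, with index 1 - i. The shift by \<open>A\<close> is proved here as well, because
  it differentiates the sections produced by the first elimination.\<close>

lemma local_structure:
  assumes w0: "w0 \<in> \<Omega>" and i: "i \<in> {-3..4}"
  obtains r M I where "r > 0" "ball w0 r \<subseteq> \<Omega>" "smooth_on (ball w0 r) M"
    "\<And>w. w \<in> ball w0 r \<Longrightarrow> det (M w) \<noteq> 0" "\<And>w. w \<in> ball w0 r \<Longrightarrow> mzb M w = - (B w ** M w)"
    "\<And>w. w \<in> ball w0 r - {w0} \<Longrightarrow> Zs (tw w) (1 - i) = cspan (M w) I"
    "\<And>w v. w \<in> ball w0 r - {w0} \<Longrightarrow> v \<in> Zs (tw w) i \<Longrightarrow> A w *v v \<in> Zs (tw w) (i + 1)"
proof -
  obtain r \<sigma> G L where r: "r > 0" "ball w0 r \<subseteq> \<Omega>" and \<sigma>: "mholo (ball w0 r) \<sigma>"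
    and G: "smooth_on (ball w0 r) G" and detG: "\<And>w. w \<in> ball w0 r \<Longrightarrow> det (G w) \<noteq> 0"
    and mzbG: "\<And>w. w \<in> ball w0 r \<Longrightarrow> mzb G w = - (B w ** G w)" and L: "mholo (ball w0 r) L"
    and neg: "\<And>w n. w \<in> ball w0 r \<Longrightarrow> n < 0 \<Longrightarrow> cm (tp (tw w)) (\<lambda>n. \<iota> n ** \<sigma> w) n = 0"
    and GL: "\<And>w. w \<in> ball w0 r \<Longrightarrow> cm (tp (tw w)) (\<lambda>n. \<iota> n ** \<sigma> w) 0 = G w ** L w"
    and fixed: "\<And>w x. w \<in> ball w0 r \<Longrightarrow> prW w *v x = x \<Longrightarrow> x = \<sigma> w *v x"
    by (rule flat_frame[OF w0]) (rule that; assumption)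
  define a where "a p w = (\<iota> (fst p) ** \<sigma> w) $ snd p" for p :: "int \<times> 7" and w
  define \<A> where "\<A> = a ` ({-3..<i} \<times> UNIV)"
  have fin: "finite \<A>" by (simp add: \<A>_def)
  have hol: "(\<lambda>w. b w $ k) holomorphic_on ball w0 r" if "b \<in> \<A>" for b k
  proof -
    have "mholo (ball w0 r) (\<lambda>w. \<iota> n ** \<sigma> w)" for n by (intro mholo_mult \<sigma> mholo_const)
    moreover obtain p where "b = a p" using \<open>b \<in> \<A>\<close> unfolding \<A>_def by blast
    ultimately show ?thesis by (simp add: a_def mholo_def del: split_paired_All)
  qed
  obtain r1 Q I where r1: "0 < r1" "r1 \<le> r" and Q: "mholo (ball w0 r1) Q"
    and detQ: "\<And>w. w \<in> ball w0 r1 \<Longrightarrow> det (Q w) \<noteq> 0"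
    and ker: "\<And>w. w \<in> ball w0 r1 - {w0} \<Longrightarrow> cspan (Q w) I = {v. \<forall>b\<in>\<A>. (\<Sum>k\<in>UNIV. b w $ k * v $ k) = 0}"
    by (rule kernel_frameE[OF fin r(1)], erule hol) (rule that; assumption)
  have b1: "ball w0 r1 \<subseteq> ball w0 r" using r1 by auto
  have K: "cspan (Q w) I = {x. \<forall>n<i. (\<iota> n ** \<sigma> w) *v x = 0}" if "w \<in> ball w0 r1 - {w0}" for w
  proof -
    have "(\<forall>b\<in>\<A>. (\<Sum>k\<in>UNIV. b w $ k * x $ k) = 0) \<longleftrightarrow> (\<forall>n<i. (\<iota> n ** \<sigma> w) *v x = 0)" for x
    proof -
      have "(\<forall>b\<in>\<A>. (\<Sum>k\<in>UNIV. b w $ k * x $ k) = 0) \<longleftrightarrow>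
          (\<forall>n\<in>{-3..<i}. \<forall>\<alpha>. ((\<iota> n ** \<sigma> w) *v x) $ \<alpha> = 0)"
        by (simp add: \<A>_def a_def mv_nth ball_simps)
      also have "\<dots> \<longleftrightarrow> (\<forall>n\<in>{-3..<i}. (\<iota> n ** \<sigma> w) *v x = 0)"
        by (simp add: vec_eq_iff)
      also have "\<dots> \<longleftrightarrow> (\<forall>n<i. (\<iota> n ** \<sigma> w) *v x = 0)"
      proof -
        have "(\<iota> n ** \<sigma> w) *v x = 0" if "n < -3" for n
          using \<iota>_outside[of n] that by simp
        then show ?thesis by (metis atLeastLessThan_iff not_less)
      qed
      finally show ?thesis .
    qed
    then show ?thesis using ker[OF that] by simp
  qed
  have Zi: "Zs (tw w) i = (*v) (G w ** L w) ` cspan (Q w) I" if w: "w \<in> ball w0 r1 - {w0}" for w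
  proof -
    have wr: "w \<in> ball w0 r" using w b1 by blast
    then have wO: "w \<in> \<Omega>" using r by blast
    show ?thesis
      unfolding K[OF w] GL[OF wr, symmetric] using i
      by (intro Zs_frame[OF wO neg[OF wr] fixed[OF wr]]) auto
  qed
  have shift: "A w *v v \<in> Zs (tw w) (i + 1)" if w: "w \<in> ball w0 r1 - {w0}" and v: "v \<in> Zs (tw w) i" for w v
  proof -
    have wr1: "w \<in> ball w0 r1" and wr: "w \<in> ball w0 r" using w b1 by blast+
    then have wO: "w \<in> \<Omega>" using r by blast
    interpret loop_coeffs "tw w" using coeffs[OF wO] .
    define V where "V = ball w0 r1 - {w0}"
    have V: "open V" "w \<in> V" using w by (auto simp: V_def)
    obtain y where y: "v = (G w ** L w) *v y" "y \<in> cspan (Q w) I" using v Zi[OF w] by auto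
    then obtain x where x: "y = (Q w ** dmat I) *v x" by (auto simp: cspan_eq_range)
    define f where "f n w = cm (tp (tw w)) (\<lambda>n. \<iota> n ** (\<sigma> w ** (Q w ** dmat I))) n" for n w
    have f_eq: "f n w = cm (tp (tw w)) (\<lambda>n. \<iota> n ** \<sigma> w) n ** (Q w ** dmat I)" for n w
      unfolding f_def cm_mult[symmetric] by (simp add: matrix_mul_assoc)
    have \<sigma>Q: "smooth_on (ball w0 r1) (\<lambda>w. \<sigma> w ** (Q w ** dmat I))"
      by (intro mholo_imp_smooth_on mholo_mult mholo_const mholo_subset[OF \<sigma>] Q b1) auto
    have "smooth_on (ball w0 r1) (f n)" for n
      unfolding f_def[abs_def] using r b1
      by (intro smooth_on_cm[of _ "\<lambda>k w. tp (tw w) k" "\<lambda>n w. \<iota> n ** (\<sigma> w ** (Q w ** dmat I))"] smooth_on_tp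
          smooth_on_subset[OF smooth] smooth_on_matrix_mult[OF _ smooth_on_const \<sigma>Q]) auto
    then have f_diff: "mdiff (f n) w" for n
      by (rule smooth_on_imp_mdiff[OF open_ball _ wr1])
    have f_neg: "f n w' = 0" if "n < 0" "w' \<in> V" for n w'
    proof -
      have "w' \<in> ball w0 r" using that b1 by (auto simp: V_def)
      then show ?thesis using neg[of w' n] that by (simp add: f_eq)
    qed
    \<comment> \<open>The coefficients of \<Phi>^-1 \<lambda> dz (\<Phi> f), where \<Phi> f is a
      family of elements of W in \<lambda>^i H_+ off \<open>w0\<close>. Multiplication by \<lambda>
      absorbs the exponent -1 and raises i by one; what is left as constant term is
      \<open>- (A w ** f 0 w)\<close>.\<close>
    define g where "g n = mz (f (n - 1)) w + (A w ** f (n - 1) w - A w ** f n w)" for n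
    have g: "cm (tw w) g n = 0" if n: "n < i + 1" for n
    proof -
      have "cm (tw w) g n = cm (tw w) (\<lambda>n. g (n + 1)) (n - 1)"
        by (simp add: cm_shift)
      also have "\<dots> = cm (tw w) (\<lambda>n. mz (f n) w + (A w ** f n w - A w ** f (n + 1) w)) (n - 1)"
        by (simp add: g_def)
      also have "\<dots> = mz (\<lambda>w. cm (tw w) (\<lambda>n. f n w) (n - 1)) w"
        by (rule mz_cm[OF wO f_diff, symmetric])
      also have "\<dots> = mz (\<lambda>w. 0 :: complex^(7 \<times> 7)^7) w"
      proof (rule mz_cong[OF V])
        fix w' assume w': "w' \<in> V"
        then have "w' \<in> \<Omega>" using r b1 by (auto simp: V_def)
        then interpret w': loop_coeffs "tw w'" by (rule coeffs)
        have "cm (tw w') (\<lambda>n. f n w') (n - 1) = \<iota> (n - 1) ** (\<sigma> w' ** (Q w' ** dmat I))"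
          by (simp add: f_def)
        also have "\<dots> = 0"
        proof -
          have "(\<iota> (n - 1) ** (\<sigma> w' ** (Q w' ** dmat I))) *v y = 0" for y
          proof -
            have "(Q w' ** dmat I) *v y \<in> cspan (Q w') I" by (auto simp: cspan_eq_range)
            then have "(\<iota> (n - 1) ** \<sigma> w') *v ((Q w' ** dmat I) *v y) = 0"
              using K[of w'] w' n by (auto simp: V_def)
            then show ?thesis by (simp add: matrix_vector_mul_assoc matrix_mul_assoc)
          qed
          then show ?thesis by (simp add: matrix_eq)
        qed
        finally show "cm (tw w') (\<lambda>n. f n w') (n - 1) = 0" .
      qed
      finally show ?thesis by simp
    qed
    have g_neg: "mz (f n) w = 0" if "n < 0" for n
      using mz_cong(1)[OF V, of "f n" "\<lambda>w. 0"] f_neg that by simp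
    have "g 0 *v x \<in> Zs (tw w) (i + 1)"
    proof (rule Zs_mem[where f = "\<lambda>n. g n *v x"])
      show "g n *v x = 0" if "n < 0" for n
        using that f_neg V g_neg by (simp add: g_def)
      show "cv (tw w) (\<lambda>n. g n *v x) n = 0" if "n < i + 1" for n
        unfolding cm_vec[symmetric] by (simp add: g[OF that])
    qed
    moreover have "g 0 = - (A w ** f 0 w)"
      using f_neg[of "-1" w] V g_neg[of "-1"] by (simp add: g_def)
    moreover have "f 0 w *v x = v"
      unfolding f_eq GL[OF wr] by (simp add: y x matrix_vector_mul_assoc matrix_mul_assoc)
    ultimately have "- (A w *v v) \<in> Zs (tw w) (i + 1)"
      by (simp add: minus_mv flip: matrix_vector_mul_assoc)
    then show ?thesis using vec.subspace_neg[OF subspace_Zs] by fastforce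
  qed
  \<comment> \<open>A vector \<open>v\<close> annihilates the image exactly if
    \<open>transpose (G w) *v v\<close> annihilates the columns of \<open>L w ** Q w\<close> indexed
    by \<open>I\<close>. These are holomorphic, so a second elimination applies.\<close>
  define c where "c k w = (\<chi> j. (L w ** Q w) $ j $ k)" for k w
  have fin': "finite (c ` I)" by simp
  have hol': "(\<lambda>w. b w $ k) holomorphic_on ball w0 r1" if "b \<in> c ` I" for b k
  proof -
    have "mholo (ball w0 r1) (\<lambda>w. L w ** Q w)" by (intro mholo_mult Q mholo_subset[OF L] b1)
    then show ?thesis using that by (auto simp: c_def mholo_def)
  qed
  obtain r2 Q' I' where r2: "0 < r2" "r2 \<le> r1" and Q': "mholo (ball w0 r2) Q'"
    and detQ': "\<And>w. w \<in> ball w0 r2 \<Longrightarrow> det (Q' w) \<noteq> 0"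
    and ker': "\<And>w. w \<in> ball w0 r2 - {w0} \<Longrightarrow> cspan (Q' w) I' = {v. \<forall>b\<in>c ` I. (\<Sum>k\<in>UNIV. b w $ k * v $ k) = 0}"
    by (rule kernel_frameE[OF fin' r1(1)], erule hol') (rule that; assumption)
  have "ball w0 r2 \<subseteq> ball w0 r1" using r2 by auto
  then have b2: "ball w0 r2 \<subseteq> ball w0 r1" "ball w0 r2 \<subseteq> ball w0 r" "ball w0 r2 \<subseteq> \<Omega>"
    using b1 r(2) by blast+
  \<comment> \<open>The contragredient frame. From dbar G = - B G and skewness of \<open>B\<close>
    one gets dbar of the transpose as the transpose times \<open>B\<close>, and hence dbar H = - B
    H: annihilators are parallel for the same operator.\<close>
  define H where "H w = matrix_inv (transpose (G w))" for w
  define M where "M w = H w ** Q' w" for w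
  have detGT: "det (transpose (G w)) \<noteq> 0" if "w \<in> ball w0 r" for w
    using detG[OF that] by simp
  have HG: "H w ** transpose (G w) = mat 1" "transpose (G w) ** H w = mat 1" if "w \<in> ball w0 r" for w
    using matrix_inv_mult[OF detGT[OF that]] by (simp_all add: H_def)
  have GT_smooth: "smooth_on (ball w0 r) (\<lambda>w. transpose (G w))" by (intro smooth_on_transpose G open_ball)
  have H_smooth: "smooth_on (ball w0 r) H"
    unfolding H_def[abs_def] by (intro smooth_on_matrix_inv GT_smooth detGT open_ball)
  have M_smooth: "smooth_on (ball w0 r2) M"
    unfolding M_def[abs_def]
    by (intro smooth_on_matrix_mult smooth_on_subset[OF H_smooth] mholo_imp_smooth_on Q' b2 open_ball)
  show thesis
  proof (rule that[of r2 M I'])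
    show "det (M w) \<noteq> 0" if "w \<in> ball w0 r2" for w
    proof -
      have "det (H w) \<noteq> 0" using matrix_inv_unique(2)[OF HG(1)] that b2 by blast
      then show ?thesis using detQ'[OF that] by (simp add: M_def det_mul)
    qed
    show "mzb M w = - (B w ** M w)" if w: "w \<in> ball w0 r2" for w
    proof -
      have wr: "w \<in> ball w0 r" and wO: "w \<in> \<Omega>" using w b2 by blast+
      have dG: "mdiff (\<lambda>w. transpose (G w)) w" by (rule smooth_on_imp_mdiff[OF open_ball GT_smooth wr])
      have dH: "mdiff H w" by (rule smooth_on_imp_mdiff[OF open_ball H_smooth wr])
      have dQ: "mdiff Q' w" by (rule smooth_on_imp_mdiff[OF open_ball mholo_imp_smooth_on[OF open_ball Q'] w])
      have "transpose (- (B w ** G w)) = - (transpose (G w) ** transpose (B w))"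
        by (simp add: vec_eq_iff transpose_def matrix_matrix_mult_def mult.commute)
      also have "\<dots> = transpose (G w) ** B w"
        unfolding skew[OF wO] mult_minus by simp
      finally have GT: "mzb (\<lambda>w. transpose (G w)) w = transpose (G w) ** B w"
        unfolding mz_transpose mzbG[OF wr] .
      have "mzb (\<lambda>w. transpose (G w) ** H w) w = mzb (\<lambda>w. mat 1) w"
        by (rule mz_cong[OF open_ball wr HG(2)])
      then have "transpose (G w) ** B w ** H w + transpose (G w) ** mzb H w = 0"
        by (simp add: mz_mult dG dH GT)
      then have "transpose (G w) ** (B w ** H w + mzb H w) = transpose (G w) ** 0"
        by (simp add: matrix_add_ldistrib matrix_mul_assoc)
      then have "B w ** H w + mzb H w = 0"
        by (rule mult_left_cancel[OF detGT[OF wr]])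
      then have mzbH: "mzb H w = - (B w ** H w)" by (simp add: eq_neg_iff_add_eq_0 add.commute)
      show ?thesis
        unfolding M_def[abs_def] using mholo_imp_mzb_0[OF open_ball Q' w]
        by (simp add: mz_mult dH dQ mzbH minus_mult matrix_mul_assoc)
    qed
    show "Zs (tw w) (1 - i) = cspan (M w) I'" if w: "w \<in> ball w0 r2 - {w0}" for w
    proof -
      have wr: "w \<in> ball w0 r" and wr1: "w \<in> ball w0 r1 - {w0}" and wO: "w \<in> \<Omega>" using w b2 by blast+
      interpret loop_coeffs "tw w" using coeffs[OF wO] .
      have pair: "cdot ((G w ** L w) *v (Q w *v x)) v =
          (\<Sum>k\<in>UNIV. x $ k * (\<Sum>j\<in>UNIV. c k w $ j * (transpose (G w) *v v) $ j))" for x v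
      proof -
        have "(G w ** L w) *v (Q w *v x) = G w *v ((L w ** Q w) *v x)"
          by (simp add: matrix_vector_mul_assoc matrix_mul_assoc)
        then have "cdot ((G w ** L w) *v (Q w *v x)) v = cdot ((L w ** Q w) *v x) (transpose (G w) *v v)"
          by (simp add: cdot_mult_left)
        also have "\<dots> = (\<Sum>j\<in>UNIV. \<Sum>k\<in>UNIV. x $ k * (c k w $ j * (transpose (G w) *v v) $ j))"
          unfolding cdot_def mv_nth[of "L w ** Q w"] c_def vec_lambda_beta
          by (simp add: sum_distrib_left sum_distrib_right mult_ac)
        also have "\<dots> = (\<Sum>k\<in>UNIV. x $ k * (\<Sum>j\<in>UNIV. c k w $ j * (transpose (G w) *v v) $ j))"
          by (subst sum.swap) (simp add: sum_distrib_left)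
        finally show ?thesis .
      qed
      have "v \<in> Zs (tw w) (1 - i) \<longleftrightarrow> transpose (G w) *v v \<in> cspan (Q' w) I'" for v
      proof -
        have "v \<in> Zs (tw w) (1 - i) \<longleftrightarrow> (\<forall>h\<in>Zs (tw w) i. cdot h v = 0)"
          using Zs_polar[of "1 - i"] i by auto
        also have "\<dots> \<longleftrightarrow> (\<forall>x. (\<forall>k. k \<notin> I \<longrightarrow> x $ k = 0) \<longrightarrow> cdot ((G w ** L w) *v (Q w *v x)) v = 0)"
          unfolding Zi[OF wr1] cspan_def by blast
        also have "\<dots> \<longleftrightarrow> (\<forall>k\<in>I. (\<Sum>j\<in>UNIV. c k w $ j * (transpose (G w) *v v) $ j) = 0)"
        proof (intro iffI ballI allI impI)
          fix k assume *: "\<forall>x. (\<forall>k. k \<notin> I \<longrightarrow> x $ k = 0) \<longrightarrow> cdot ((G w ** L w) *v (Q w *v x)) v = 0" and k: "k \<in> I"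
          have "cdot ((G w ** L w) *v (Q w *v axis k 1)) v = 0"
            using k by (intro *[rule_format]) (auto simp: axis_def)
          then have "(\<Sum>l\<in>UNIV. (if l = k then (\<Sum>j\<in>UNIV. c k w $ j * (transpose (G w) *v v) $ j) else 0)) = 0"
            unfolding pair by (simp add: axis_def if_distrib[of "\<lambda>x. x * _"] cong: if_cong)
          then show "(\<Sum>j\<in>UNIV. c k w $ j * (transpose (G w) *v v) $ j) = 0" by simp
        next
          fix x :: "complex^(7 \<times> 7)"
          assume *: "\<forall>k\<in>I. (\<Sum>j\<in>UNIV. c k w $ j * (transpose (G w) *v v) $ j) = 0" "\<forall>k. k \<notin> I \<longrightarrow> x $ k = 0"
          show "cdot ((G w ** L w) *v (Q w *v x)) v = 0"
            unfolding pair
          proof (rule sum.neutral, safe)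
            fix k show "x $ k * (\<Sum>j\<in>UNIV. c k w $ j * (transpose (G w) *v v) $ j) = 0"
              using *(1)[rule_format, of k] *(2)[rule_format, of k] by (cases "k \<in> I") simp_all
          qed
        qed
        also have "\<dots> \<longleftrightarrow> transpose (G w) *v v \<in> cspan (Q' w) I'"
          unfolding ker'[OF w] by simp
        finally show ?thesis .
      qed
      moreover have "transpose (G w) *v v \<in> cspan (Q' w) I' \<longleftrightarrow> v \<in> cspan (M w) I'" for v
      proof
        assume "transpose (G w) *v v \<in> cspan (Q' w) I'"
        then have "H w *v (transpose (G w) *v v) \<in> cspan (M w) I'"
          unfolding M_def cspan_mult by (rule imageI)
        then show "v \<in> cspan (M w) I'" by (simp add: matrix_vector_mul_assoc HG[OF wr])
      next
        assume "v \<in> cspan (M w) I'"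
        then obtain u where "u \<in> cspan (Q' w) I'" "v = H w *v u" by (auto simp: M_def cspan_mult)
        then show "transpose (G w) *v v \<in> cspan (Q' w) I'" by (simp add: matrix_vector_mul_assoc HG[OF wr])
      qed
      ultimately show ?thesis by blast
    qed
    show "A w *v v \<in> Zs (tw w) (i + 1)" if "w \<in> ball w0 r2 - {w0}" "v \<in> Zs (tw w) i" for w v
      using shift that b2 by blast
  qed (use r2 b2 M_smooth in auto)
qed

end

section \<open>Fourier coefficients\<close>

abbreviation circ :: "real measure" where
  "circ \<equiv> lebesgue_on {0..2*pi}"

definition fourier :: "(complex \<Rightarrow> complex) \<Rightarrow> int \<Rightarrow> complex" where
  "fourier h n = (LINT t|circ. cis t powi (- n) * h (cis t))"

lemma finite_measure_circ: "finite_measure circ"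
  by (rule finite_measure_lebesgue_on) simp

lemma integrable_circ_continuous:
  fixes f :: "real \<Rightarrow> 'b::euclidean_space"
  shows "continuous_on UNIV f \<Longrightarrow> integrable circ f"
  by (rule continuous_imp_integrable_real) (auto intro: continuous_on_subset)

lemma measurable_circ_continuous: "continuous_on UNIV f \<Longrightarrow> f \<in> borel_measurable circ"
  by (rule continuous_imp_measurable_on_sets_lebesgue) (auto intro: continuous_on_subset)

lemma continuous_cis_powi [continuous_intros]: "continuous_on S (\<lambda>t. cis t powi n)"
  by (simp add: cis_power_int) (intro continuous_intros)

lemma integral_cis_powi: "(LINT t|circ. cis t powi n) = (if n = 0 then of_real (2 * pi) else 0)"
proof -
  have "(LINT t|circ. cis t powi n) = integral {0..2*pi} (\<lambda>t. cis t powi n)"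
    by (intro lebesgue_integral_eq_integral integrable_circ_continuous continuous_intros) auto
  also have "\<dots> = (if n = 0 then of_real (2 * pi) else 0)"
  proof (cases "n = 0")
    case False
    have der: "((\<lambda>t. cis (of_int n * t) / (\<i> * of_int n)) has_vector_derivative cis t powi n) (at t within S)" for t S
    proof -
      have "((\<lambda>z. exp (\<i> * of_int n * z) / (\<i> * of_int n)) has_field_derivative exp (\<i> * of_int n * of_real t)) (at (of_real t))"
        using False by (auto intro!: derivative_eq_intros)
      from has_vector_derivative_real_field[OF this]
      have "((\<lambda>t. exp (\<i> * of_int n * of_real t) / (\<i> * of_int n)) has_vector_derivative
          exp (\<i> * of_int n * of_real t)) (at t within S)" .
      moreover have "cis (of_int n * t) = exp (\<i> * of_int n * of_real t)" for t
        by (simp add: cis_conv_exp mult.assoc)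
      ultimately show ?thesis by (simp add: cis_power_int)
    qed
    have "((\<lambda>t. cis t powi n) has_integral (cis (of_int n * (2 * pi)) / (\<i> * of_int n) - cis (of_int n * 0) / (\<i> * of_int n))) {0..2*pi}"
      by (rule fundamental_theorem_of_calculus) (use der in auto)
    moreover have "cis (of_int n * (2 * pi)) = 1"
      using cis_multiple_2pi[of "of_int n"] by (simp add: mult.commute)
    ultimately show ?thesis using False by (simp add: integral_unique)
  qed (simp add: scaleR_conv_of_real)
  finally show ?thesis .
qed

lemma fourier_cong:
  "(\<And>l. l \<in> sphere 0 1 \<Longrightarrow> f l = g l) \<Longrightarrow> fourier f n = fourier g n"
  by (simp add: fourier_def)

lemma integrable_powi_mult:
  assumes "integrable circ h"
  shows "integrable circ (\<lambda>t. cis t powi n * h t)"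
proof (rule Bochner_Integration.integrable_bound[OF assms])
  have "(\<lambda>t. cis t powi n) \<in> borel_measurable circ"
    by (intro measurable_circ_continuous continuous_intros)
  then show "(\<lambda>t. cis t powi n * h t) \<in> borel_measurable circ"
    using assms by (intro borel_measurable_times) auto
qed (auto simp: norm_mult norm_power_int)

lemma fourier_sum:
  assumes "\<And>i. i \<in> I \<Longrightarrow> integrable circ (\<lambda>t. h i (cis t))"
  shows "fourier (\<lambda>l. \<Sum>i\<in>I. c i * h i l) n = (\<Sum>i\<in>I. c i * fourier (h i) n)"
proof -
  have "fourier (\<lambda>l. \<Sum>i\<in>I. c i * h i l) n = (LINT t|circ. (\<Sum>i\<in>I. c i * (cis t powi (- n) * h i (cis t))))"
    by (simp add: fourier_def sum_distrib_left mult_ac)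
  also have "\<dots> = (\<Sum>i\<in>I. LINT t|circ. c i * (cis t powi (- n) * h i (cis t)))"
    by (intro Bochner_Integration.integral_sum integrable_mult_right integrable_powi_mult assms)
  also have "\<dots> = (\<Sum>i\<in>I. c i * fourier (h i) n)"
    unfolding fourier_def by (simp only: integral_mult_right_zero)
  finally show ?thesis .
qed

lemma sphere_nz: "l \<in> sphere 0 1 \<Longrightarrow> l \<noteq> (0::complex)"
  by auto

lemma fourier_shift: "fourier (\<lambda>l. l powi k * h l) n = fourier h (n - k)"
  unfolding fourier_def
  by (intro Bochner_Integration.integral_cong refl) (simp add: power_int_add[symmetric] flip: mult.assoc)

lemma fourier_powi: "fourier (\<lambda>l. l powi k) n = (if n = k then of_real (2 * pi) else 0)"
  using fourier_shift[of k "\<lambda>l. 1" n] integral_cis_powi[of "k - n"] by (simp add: fourier_def)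

lemma fourier_trig:
  assumes "finite K" "\<And>l. l \<in> sphere 0 1 \<Longrightarrow> h l = (\<Sum>k\<in>K. c k * l powi k)"
  shows "fourier h n = of_real (2 * pi) * (if n \<in> K then c n else 0)"
proof -
  have "fourier h n = fourier (\<lambda>l. \<Sum>k\<in>K. c k * l powi k) n"
    by (rule fourier_cong[OF assms(2)])
  also have "\<dots> = (\<Sum>k\<in>K. c k * fourier (\<lambda>l. l powi k) n)"
    by (rule fourier_sum) (intro integrable_circ_continuous continuous_intros)
  also have "\<dots> = (\<Sum>k\<in>K. if k = n then of_real (2 * pi) * c n else 0)"
    by (intro sum.cong) (auto simp: fourier_powi)
  finally show ?thesis using assms(1) by simp
qed

lemma laurent_unique:
  assumes "finite K" "\<And>l. l \<in> sphere 0 1 \<Longrightarrow> (\<Sum>k\<in>K. c k * l powi k) = (\<Sum>k\<in>K. d k * l powi k)" "k \<in> K"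
  shows "c k = (d k :: complex)"
proof -
  have "fourier (\<lambda>l. \<Sum>k\<in>K. c k * l powi k) k = of_real (2 * pi) * (if k \<in> K then c k else 0)"
    by (rule fourier_trig[OF assms(1)]) simp
  moreover have "fourier (\<lambda>l. \<Sum>k\<in>K. c k * l powi k) k = of_real (2 * pi) * (if k \<in> K then d k else 0)"
    by (rule fourier_trig[OF assms(1)]) (rule assms(2))
  ultimately show ?thesis using assms(3) by simp
qed

definition coefs :: "(nat \<Rightarrow> complex^7) \<Rightarrow> int \<Rightarrow> complex^7" where
  "coefs v n = (if n < 0 then 0 else v (nat n))"

lemma L2_circle_integrable:
  assumes "f \<in> L2_circle"
  shows "integrable circ (\<lambda>t. f (cis t) $ \<alpha>)"
proof -
  interpret finite_measure circ by (rule finite_measure_circ)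
  have meas: "(\<lambda>t. f (cis t)) \<in> borel_measurable circ" and sq: "integrable circ (\<lambda>t. (norm (f (cis t)))\<^sup>2)"
    using assms by (auto simp: L2_circle_def)
  have "integrable circ (\<lambda>t. 1 + (norm (f (cis t)))\<^sup>2)" using sq by simp
  then show ?thesis
  proof (rule Bochner_Integration.integrable_bound)
    have "(\<lambda>x::complex^7. x $ \<alpha>) \<in> borel_measurable borel"
      by (intro borel_measurable_continuous_onI continuous_intros)
    then show "(\<lambda>t. f (cis t) $ \<alpha>) \<in> borel_measurable circ"
      using measurable_compose[OF meas] by blast
    have "norm (f (cis t) $ \<alpha>) \<le> 1 + (norm (f (cis t)))\<^sup>2" for t
    proof -
      have "norm (f (cis t) $ \<alpha>) \<le> norm (f (cis t))" by (rule Finite_Cartesian_Product.norm_nth_le)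
      also have "\<dots> \<le> 1 + (norm (f (cis t)))\<^sup>2"
        using zero_le_power2[of "norm (f (cis t)) - 1/2"] by (simp add: power2_eq_square algebra_simps)
      finally show ?thesis .
    qed
    then show "AE t in circ. norm (f (cis t) $ \<alpha>) \<le> norm (1 + (norm (f (cis t)))\<^sup>2)"
      by (intro AE_I2) (simp add: add_nonneg_nonneg)
  qed
qed

lemma L2_power_series_diff:
  assumes "L2_power_series f v"
  shows "integrable circ (\<lambda>t. (norm (f (cis t) - (\<Sum>i<n. cis t ^ i *s v i)))\<^sup>2)"
    "(\<lambda>t. f (cis t) - (\<Sum>i<n. cis t ^ i *s v i)) \<in> borel_measurable circ"
proof -
  define g where "g t = (\<Sum>i<n. cis t ^ i *s v i)" for t
  have meas: "(\<lambda>t. f (cis t)) \<in> borel_measurable circ" and sq: "integrable circ (\<lambda>t. (norm (f (cis t)))\<^sup>2)"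
    using assms by (auto simp: L2_power_series_def L2_circle_def)
  have "g = (\<lambda>t. \<chi> \<alpha>. \<Sum>i<n. cis t ^ i * v i $ \<alpha>)"
    by (simp add: g_def vec_eq_iff fun_eq_iff)
  then have g: "continuous_on UNIV g"
    by (simp add: continuous_on_vec_lambda continuous_intros)
  show m: "(\<lambda>t. f (cis t) - (\<Sum>i<n. cis t ^ i *s v i)) \<in> borel_measurable circ"
    using meas measurable_circ_continuous[OF g] unfolding g_def by (rule borel_measurable_diff)
  have "integrable circ (\<lambda>t. 2 * (norm (f (cis t)))\<^sup>2 + 2 * (norm (g t))\<^sup>2)"
  proof (rule Bochner_Integration.integrable_add)
    show "integrable circ (\<lambda>t. 2 * (norm (g t))\<^sup>2)"
      by (intro integrable_circ_continuous continuous_intros g)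
  qed (use sq in simp)
  then show "integrable circ (\<lambda>t. (norm (f (cis t) - (\<Sum>i<n. cis t ^ i *s v i)))\<^sup>2)"
  proof (rule Bochner_Integration.integrable_bound)
    show "(\<lambda>t. (norm (f (cis t) - (\<Sum>i<n. cis t ^ i *s v i)))\<^sup>2) \<in> borel_measurable circ"
      using m by measurable
    have "(norm (a - b))\<^sup>2 \<le> 2 * (norm a)\<^sup>2 + 2 * (norm b)\<^sup>2" for a b :: "complex^7"
    proof -
      have "(norm (a - b))\<^sup>2 \<le> (norm a + norm b)\<^sup>2"
        by (intro power_mono norm_triangle_ineq4) auto
      also have "\<dots> \<le> 2 * (norm a)\<^sup>2 + 2 * (norm b)\<^sup>2"
        using zero_le_power2[of "norm a - norm b"] by (simp add: power2_eq_square algebra_simps)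
      finally show ?thesis .
    qed
    then show "AE t in circ. norm ((norm (f (cis t) - (\<Sum>i<n. cis t ^ i *s v i)))\<^sup>2) \<le> norm (2 * (norm (f (cis t)))\<^sup>2 + 2 * (norm (g t))\<^sup>2)"
      by (intro AE_I2) (simp add: g_def)
  qed
qed

text \<open>L2 convergence of the partial sums forces convergence of each Fourier coefficient.
  Instead of the Cauchy-Schwarz inequality the elementary bound x \<le> \<epsilon> + x^2 /
  \<epsilon> is integrated, with \<epsilon> chosen before the index of the partial sum.\<close>

lemma fourier_L2_power_series:
  assumes f: "L2_power_series f v"
  shows "fourier (\<lambda>l. f l $ \<alpha>) n = of_real (2 * pi) * coefs v n $ \<alpha>"
proof -
  interpret finite_measure circ by (rule finite_measure_circ)
  define S where "S N l = (\<Sum>i<N. l ^ i *s v i)" for N and l :: complex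
  define I where "I N = (LINT t|circ. (norm (f (cis t) - S N (cis t)))\<^sup>2)" for N
  define D where "D N = fourier (\<lambda>l. f l $ \<alpha>) n - fourier (\<lambda>l. S N l $ \<alpha>) n" for N
  have "I = (\<lambda>N. LINT t|circ. (norm (f (cis t) - (\<Sum>i<N. cis t ^ i *s v i)))\<^sup>2)"
    by (simp add: I_def S_def fun_eq_iff)
  then have I0: "I \<longlonglongrightarrow> 0" using f by (simp add: L2_power_series_def)
  have fint: "integrable circ (\<lambda>t. f (cis t) $ \<alpha>)"
    using f by (intro L2_circle_integrable) (simp add: L2_power_series_def)
  have S_eq: "S N l $ \<alpha> = (\<Sum>k\<in>int ` {..<N}. coefs v k $ \<alpha> * l powi k)" for N l
    by (simp add: S_def sum.reindex coefs_def mult.commute)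
  have fS: "fourier (\<lambda>l. S N l $ \<alpha>) n = of_real (2 * pi) * (if n \<in> int ` {..<N} then coefs v n $ \<alpha> else 0)" for N
    by (rule fourier_trig) (auto simp: S_eq)
  have Sint: "integrable circ (\<lambda>t. S N (cis t) $ \<alpha>)" for N
    unfolding S_eq by (intro integrable_circ_continuous continuous_intros)
  have bound: "norm (D N) \<le> 2 * pi * \<epsilon> + I N / \<epsilon>" if "\<epsilon> > 0" for N and \<epsilon> :: real
  proof -
    have sq: "integrable circ (\<lambda>t. (norm (f (cis t) - S N (cis t)))\<^sup>2)"
      using L2_power_series_diff(1)[OF f, of N] by (simp add: S_def)
    have "D N = (LINT t|circ. cis t powi (- n) * (f (cis t) $ \<alpha> - S N (cis t) $ \<alpha>))"
      unfolding D_def fourier_def right_diff_distrib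
      by (rule Bochner_Integration.integral_diff[symmetric]) (intro integrable_powi_mult fint Sint)+
    also have "norm \<dots> \<le> (LINT t|circ. \<epsilon> + (norm (f (cis t) - S N (cis t)))\<^sup>2 / \<epsilon>)"
    proof (rule order.trans[OF integral_norm_bound integral_mono])
      show "integrable circ (\<lambda>t. norm (cis t powi (- n) * (f (cis t) $ \<alpha> - S N (cis t) $ \<alpha>)))"
        by (intro integrable_norm integrable_powi_mult Bochner_Integration.integrable_diff fint Sint)
      show "integrable circ (\<lambda>t. \<epsilon> + (norm (f (cis t) - S N (cis t)))\<^sup>2 / \<epsilon>)"
        using sq by simp
      fix t
      have "norm (cis t powi (- n) * (f (cis t) $ \<alpha> - S N (cis t) $ \<alpha>)) = norm ((f (cis t) - S N (cis t)) $ \<alpha>)"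
        by (simp add: norm_mult norm_power_int)
      also have "\<dots> \<le> norm (f (cis t) - S N (cis t))" by (rule Finite_Cartesian_Product.norm_nth_le)
      also have "\<dots> \<le> \<epsilon> + (norm (f (cis t) - S N (cis t)))\<^sup>2 / \<epsilon>"
      proof -
        have "x \<le> \<epsilon> + x\<^sup>2 / \<epsilon>" for x :: real
        proof -
          have "x * \<epsilon> \<le> \<epsilon>\<^sup>2 + x\<^sup>2"
          proof -
            have "(x - \<epsilon> / 2) * (x - \<epsilon> / 2) = x * x - x * \<epsilon> + \<epsilon> * \<epsilon> / 4"
              by (simp add: field_simps)
            moreover have "0 \<le> (x - \<epsilon> / 2) * (x - \<epsilon> / 2)" "0 \<le> \<epsilon> * \<epsilon>" by simp_all
            ultimately show ?thesis unfolding power2_eq_square by linarith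
          qed
          then show ?thesis using that by (simp add: field_simps power2_eq_square)
        qed
        then show ?thesis .
      qed
      finally show "norm (cis t powi (- n) * (f (cis t) $ \<alpha> - S N (cis t) $ \<alpha>)) \<le> \<epsilon> + (norm (f (cis t) - S N (cis t)))\<^sup>2 / \<epsilon>" .
    qed
    also have "\<dots> = 2 * pi * \<epsilon> + I N / \<epsilon>"
      using sq by (simp add: I_def measure_restrict_space)
    finally show ?thesis .
  qed
  have "D \<longlonglongrightarrow> 0"
  proof (rule LIMSEQ_I)
    fix e :: real assume e: "e > 0"
    define \<epsilon> where "\<epsilon> = e / (4 * pi)"
    have \<epsilon>: "\<epsilon> > 0" using e by (simp add: \<epsilon>_def)
    obtain N0 where N0: "\<And>N. N \<ge> N0 \<Longrightarrow> norm (I N) < e * \<epsilon> / 2"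
      using LIMSEQ_D[OF I0, of "e * \<epsilon> / 2"] e \<epsilon> by auto
    have "norm (D N - 0) < e" if "N \<ge> N0" for N
    proof -
      have "I N / \<epsilon> < e / 2" using N0[OF that] \<epsilon> by (simp add: field_simps)
      moreover have "2 * pi * \<epsilon> = e / 2" by (simp add: \<epsilon>_def)
      ultimately show ?thesis using bound[OF \<epsilon>, of N] unfolding diff_zero by linarith
    qed
    then show "\<exists>N0. \<forall>N\<ge>N0. norm (D N - 0) < e" by blast
  qed
  moreover have "eventually (\<lambda>N. D N = fourier (\<lambda>l. f l $ \<alpha>) n - of_real (2 * pi) * coefs v n $ \<alpha>) sequentially"
    using eventually_gt_at_top[of "nat n"]
  proof eventually_elim
    case (elim N)
    then have "n \<in> int ` {..<N} \<or> n < 0"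
      by (cases "n < 0") (auto simp: image_iff intro!: bexI[of _ "nat n"])
    then show ?case by (auto simp: D_def fS coefs_def)
  qed
  ultimately have "(\<lambda>N::nat. fourier (\<lambda>l. f l $ \<alpha>) n - of_real (2 * pi) * coefs v n $ \<alpha>) \<longlonglongrightarrow> 0"
    by (rule Lim_transform_eventually)
  then show ?thesis
    by (simp add: LIMSEQ_const_iff)
qed

text \<open>Gives a meaning to the definite description in \<open>P0\<close>.\<close>

lemma L2_power_series_unique:
  assumes "L2_power_series f v" "L2_power_series f w"
  shows "v = w"
proof
  fix n
  have "coefs v (int n) $ \<alpha> = coefs w (int n) $ \<alpha>" for \<alpha>
    using fourier_L2_power_series[OF assms(1), of \<alpha> "int n"] fourier_L2_power_series[OF assms(2), of \<alpha> "int n"] by simp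
  then show "v n = w n" by (simp add: vec_eq_iff coefs_def)
qed

lemma L2_power_series_cong:
  assumes "\<And>l. l \<in> sphere 0 1 \<Longrightarrow> f l = g l"
  shows "L2_power_series f v \<longleftrightarrow> L2_power_series g v"
proof -
  have "(\<lambda>t. f (cis t)) = (\<lambda>t. g (cis t))" using assms by auto
  then show ?thesis
    by (simp add: L2_power_series_def L2_circle_def fun_eq_iff)
qed

lemma P0_eq:
  assumes "L2_power_series f v"
  shows "P0 f = v 0"
proof -
  have "(THE v. L2_power_series f v) = v"
    using assms L2_power_series_unique by (intro the_equality) auto
  then show ?thesis by (simp add: P0_def)
qed

section \<open>The fibres of the filtration\<close>

definition laurent :: "(complex \<Rightarrow> complex^7^7) \<Rightarrow> (int \<Rightarrow> complex^7^7) \<Rightarrow> bool" where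
  "laurent \<gamma> T \<longleftrightarrow> (\<forall>l\<in>sphere 0 1. \<gamma> l = (\<Sum>k\<in>{-3..3}. cscale (l powi k) (T k)))"

lemma cscale_nth [simp]: "cscale a M $ i $ j = a * M $ i $ j"
  by (simp add: cscale_def map_matrix_def)

lemma cscale_mv: "cscale a M *v x = a *s (M *v x)"
  by (simp add: vec_eq_iff matrix_vector_mult_def sum_distrib_left mult.assoc)

lemma laurent_mv: "laurent \<gamma> T \<Longrightarrow> l \<in> sphere 0 1 \<Longrightarrow> \<gamma> l *v x = (\<Sum>k\<in>{-3..3}. l powi k *s (T k *v x))"
  by (simp add: laurent_def sum_mv cscale_mv)

text \<open>Polynomials suffice to represent the constant terms occurring in the fibres. They can be
  multiplied, reflected and divided by \<lambda> without any question of convergence.\<close>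

definition polyvec :: "(complex \<Rightarrow> complex^7) \<Rightarrow> bool" where
  "polyvec F \<longleftrightarrow> (\<exists>p. \<forall>l a. F l $ a = poly (p a) l)"

lemma polyvec_sum_monom: "polyvec (\<lambda>l. \<Sum>k\<in>S. l ^ e k *s c k)"
  unfolding polyvec_def
  by (rule exI[of _ "\<lambda>a. \<Sum>k\<in>S. monom (c k $ a) (e k)"]) (simp add: poly_sum poly_monom mult.commute)

lemma polyvec_continuous: "polyvec F \<Longrightarrow> continuous_on UNIV (\<lambda>t. F (cis t))"
proof -
  assume "polyvec F"
  then obtain p where p: "\<And>l a. F l $ a = poly (p a) l" by (auto simp: polyvec_def)
  have eq: "(\<lambda>t. F (cis t)) = (\<lambda>t. \<chi> a. poly (p a) (cis t))"
    by (simp add: vec_eq_iff p fun_eq_iff)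
  show ?thesis unfolding eq
    by (intro continuous_on_vec_lambda continuous_on_poly continuous_on_cis continuous_on_id)
qed

lemma polyvec_L2_power_series:
  assumes "polyvec F"
  obtains v where "L2_power_series F v" "v 0 = F 0"
proof -
  obtain p where p: "\<And>l a. F l $ a = poly (p a) l" using assms by (auto simp: polyvec_def)
  define v where "v n = (\<chi> a. coeff (p a) n)" for n
  define N where "N = Suc (Max (range (\<lambda>a. degree (p a))))"
  have F: "F l = (\<Sum>i<n. l ^ i *s v i)" if "n \<ge> N" for n l
  proof -
    have "poly (p a) l = (\<Sum>i<n. coeff (p a) i * l ^ i)" for a
    proof -
      have "degree (p a) \<le> Max (range (\<lambda>a. degree (p a)))" by (intro Max_ge) auto
      then have "degree (p a) < N" by (simp only: N_def less_Suc_eq_le)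
      then have "degree (p a) < n" using that by simp
      then show ?thesis
        unfolding poly_altdef by (intro sum.mono_neutral_left) (auto simp: coeff_eq_0)
    qed
    then show ?thesis by (simp add: vec_eq_iff p v_def mult.commute)
  qed
  have "F \<in> L2_circle"
    unfolding L2_circle_def using polyvec_continuous[OF assms]
    by (auto intro!: measurable_circ_continuous integrable_circ_continuous continuous_intros)
  moreover have "eventually (\<lambda>n. 0 = (LINT t|circ. (norm (F (cis t) - (\<Sum>i<n. cis t ^ i *s v i)))\<^sup>2)) sequentially"
    using eventually_ge_at_top[of N]
  proof eventually_elim
    case (elim n)
    show ?case by (simp only: F[OF elim, symmetric]) simp
  qed
  then have "(\<lambda>n. LINT t|circ. (norm (F (cis t) - (\<Sum>i<n. cis t ^ i *s v i)))\<^sup>2) \<longlonglongrightarrow> 0"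
    by (rule Lim_transform_eventually[OF tendsto_const])
  ultimately have "L2_power_series F v"
    unfolding L2_power_series_def by (rule conjI)
  moreover have "v 0 = F 0" by (simp add: vec_eq_iff v_def p poly_0_coeff_0)
  ultimately show thesis by (rule that)
qed

lemma fourier_loop:
  assumes \<gamma>: "laurent \<gamma> T" and f: "L2_power_series f v" and g: "\<And>l. l \<in> sphere 0 1 \<Longrightarrow> g l = \<gamma> l *v f l"
  shows "fourier (\<lambda>l. g l $ \<alpha>) n = of_real (2 * pi) * cv T (coefs v) n $ \<alpha>"
proof -
  have fint: "integrable circ (\<lambda>t. f (cis t) $ \<beta>)" for \<beta>
    using f by (intro L2_circle_integrable) (simp add: L2_power_series_def)
  have "fourier (\<lambda>l. g l $ \<alpha>) n =
      fourier (\<lambda>l. \<Sum>q\<in>{-3..3} \<times> UNIV. T (fst q) $ \<alpha> $ snd q * (l powi fst q * f l $ snd q)) n"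
  proof (rule fourier_cong)
    fix l :: complex assume l: "l \<in> sphere 0 1"
    show "g l $ \<alpha> = (\<Sum>q\<in>{-3..3} \<times> UNIV. T (fst q) $ \<alpha> $ snd q * (l powi fst q * f l $ snd q))"
      unfolding g[OF l] laurent_mv[OF \<gamma> l]
      by (simp add: sum.cartesian_product' mv_nth sum_distrib_left mult_ac)
  qed
  also have "\<dots> = (\<Sum>q\<in>{-3..3} \<times> UNIV. T (fst q) $ \<alpha> $ snd q * fourier (\<lambda>l. l powi fst q * f l $ snd q) n)"
    by (rule fourier_sum) (intro integrable_powi_mult fint)
  also have "\<dots> = (\<Sum>q\<in>{-3..3} \<times> UNIV. T (fst q) $ \<alpha> $ snd q * (of_real (2 * pi) * coefs v (n - fst q) $ snd q))"
    by (simp add: fourier_shift fourier_L2_power_series[OF f])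
  also have "\<dots> = of_real (2 * pi) * cv T (coefs v) n $ \<alpha>"
    by (simp add: cv_def mv_nth sum.cartesian_product' sum_distrib_left mult_ac)
  finally show ?thesis .
qed

lemma shift_H_plus_fourier:
  assumes "g \<in> shift_H_plus i" "n < i"
  shows "fourier (\<lambda>l. g l $ \<alpha>) n = 0"
proof -
  obtain h u where u: "L2_power_series h u" and g: "\<And>l. l \<in> sphere 0 1 \<Longrightarrow> g l = l powi i *s h l"
    using assms(1) by (auto simp: shift_H_plus_def H_plus_def)
  have "fourier (\<lambda>l. g l $ \<alpha>) n = fourier (\<lambda>l. l powi i * h l $ \<alpha>) n"
    by (rule fourier_cong) (simp add: g)
  also have "\<dots> = 0" using assms(2) by (simp add: fourier_shift fourier_L2_power_series[OF u] coefs_def)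
  finally show ?thesis .
qed

lemma loop_H_plus_coeff:
  assumes "laurent \<gamma> T" "L2_power_series f v" "g \<in> shift_H_plus i"
    "\<And>l. l \<in> sphere 0 1 \<Longrightarrow> g l = \<gamma> l *v f l" "n < i"
  shows "cv T (coefs v) n = 0"
proof -
  have "cv T (coefs v) n $ \<alpha> = 0" for \<alpha>
    using fourier_loop[OF assms(1,2,4), of \<alpha> n] shift_H_plus_fourier[OF assms(3,5), of \<alpha>] by simp
  then show ?thesis by (simp add: vec_eq_iff)
qed

text \<open>An element of the intersection is \<Phi> f on the circle; its Fourier coefficients are
  given by \<open>cv T\<close>, and membership in \<lambda>^i H_+ makes those below i
  vanish.\<close>

lemma Z_fibre_imp_Zs:
  assumes \<gamma>: "laurent (\<Phi> p) T" and det: "\<And>l. l \<in> sphere 0 1 \<Longrightarrow> det (\<Phi> p l) \<noteq> 0" and v: "v \<in> Z_fibre \<Phi> i p"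
  shows "v \<in> Zs T i"
proof -
  obtain g where v: "v = P0 (\<lambda>l. matrix_inv (\<Phi> p l) *v g l)" and g: "g \<in> loop_H_plus (\<Phi> p)" "g \<in> shift_H_plus i"
    using v by (auto simp: Z_fibre_def)
  obtain f c where f: "L2_power_series f c" and gf: "\<And>l. l \<in> sphere 0 1 \<Longrightarrow> g l = \<Phi> p l *v f l"
    using g(1) by (auto simp: loop_H_plus_def H_plus_def)
  have "L2_power_series (\<lambda>l. matrix_inv (\<Phi> p l) *v g l) c \<longleftrightarrow> L2_power_series f c"
    by (rule L2_power_series_cong) (simp add: gf matrix_vector_mul_assoc matrix_inv_mult det)
  then have "v = coefs c 0" using f P0_eq v by (auto simp: coefs_def)
  moreover have "coefs c 0 \<in> Zs T i"
  proof (rule Zs_mem)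
    show "cv T (coefs c) n = 0" if "n < i" for n
      by (rule loop_H_plus_coeff[OF \<gamma> f g(2) gf that])
  qed (simp add: coefs_def)
  ultimately show ?thesis by simp
qed

lemma poly_imp_Z_fibre:
  assumes det: "\<And>l. l \<in> sphere 0 1 \<Longrightarrow> det (\<Phi> p l) \<noteq> 0" and F: "polyvec F" and H: "polyvec H"
    and FH: "\<And>l. l \<in> sphere 0 1 \<Longrightarrow> \<Phi> p l *v F l = l powi i *s H l"
  shows "F 0 \<in> Z_fibre \<Phi> i p"
proof -
  obtain v where v: "L2_power_series F v" "v 0 = F 0" by (rule polyvec_L2_power_series[OF F])
  obtain u where u: "L2_power_series H u" by (rule polyvec_L2_power_series[OF H])
  define g where "g l = \<Phi> p l *v F l" for l
  have "g \<in> loop_H_plus (\<Phi> p)" using v by (auto simp: loop_H_plus_def H_plus_def g_def)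
  moreover have "g \<in> shift_H_plus i"
    unfolding shift_H_plus_def H_plus_def using u FH by (auto simp: g_def)
  moreover have "P0 (\<lambda>l. matrix_inv (\<Phi> p l) *v g l) = F 0"
  proof -
    have "L2_power_series (\<lambda>l. matrix_inv (\<Phi> p l) *v g l) v \<longleftrightarrow> L2_power_series F v"
      by (rule L2_power_series_cong) (simp add: g_def matrix_vector_mul_assoc matrix_inv_mult det)
    then have "L2_power_series (\<lambda>l. matrix_inv (\<Phi> p l) *v g l) v" using v(1) by blast
    from P0_eq[OF this] show ?thesis using v(2) by simp
  qed
  ultimately show ?thesis
    unfolding Z_fibre_def by (intro image_eqI[where x = g]) auto
qed

lemma Zs_imp_poly:
  assumes \<gamma>: "laurent \<gamma> T" and v: "v \<in> Zs T i"
  obtains F H where "polyvec F" "polyvec H" "F 0 = v" "\<And>l. l \<in> sphere 0 1 \<Longrightarrow> \<gamma> l *v F l = l powi i *s H l"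
proof -
  obtain f where vf: "v = f 0" and f: "\<And>n. n < 0 \<Longrightarrow> f n = 0" "\<And>n. n < i \<Longrightarrow> cv T f n = 0"
    using v by (auto simp: Zs_def)
  \<comment> \<open>Coefficients of \<open>f\<close> from index N on influence \<Phi> f only from
    exponent N - 3 \<ge> i on, so cutting them off preserves the vanishing below i. The minimum 1
    keeps the constant term.\<close>
  define N where "N = max (i + 3) 1"
  define f' where "f' n = (if n < N then f n else 0)" for n
  have f'0: "f' n = 0" if "n \<notin> {0..<N}" for n using that f(1) by (auto simp: f'_def)
  have cvf': "cv T f' n = 0" if "n < i" for n
  proof -
    have "cv T (\<lambda>n. f n - f' n) n = 0"
      by (rule cv_lower[of N]) (use that in \<open>auto simp: f'_def N_def\<close>)
    then show ?thesis using f(2)[OF that] by (simp add: cv_diff)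
  qed
  have cv_hi: "cv T f' n = 0" if "n > N + 3" for n
    by (rule cv_upper[of N]) (use that in \<open>auto simp: f'_def\<close>)
  have cv_lo: "cv T f' n = 0" if "n < -3" for n
    by (rule cv_lower[of 0]) (use that f'0 in auto)
  define F where "F l = (\<Sum>n\<in>{0..<N}. l ^ nat n *s f' n)" for l
  define H where "H l = (\<Sum>k\<in>{0..N+3-i}. l ^ nat k *s cv T f' (k + i))" for l
  show thesis
  proof (rule that[of F H])
    show "polyvec F" "polyvec H" unfolding F_def[abs_def] H_def[abs_def] by (rule polyvec_sum_monom)+
    have "F 0 = (\<Sum>n\<in>{0..<N}. if n = 0 then f 0 else 0)"
      unfolding F_def by (intro sum.cong refl) (auto simp: f'_def N_def)
    then show "F 0 = v" by (simp add: vf N_def)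
    fix l :: complex assume l: "l \<in> sphere 0 1"
    then have l0: "l \<noteq> 0" by (rule sphere_nz)
    have lp: "l ^ nat n = l powi n" if "n \<ge> 0" for n
      using that by (simp add: power_int_def)
    have "\<gamma> l *v F l = (\<Sum>k\<in>{-3..3}. \<Sum>n\<in>{0..<N}. l powi (n + k) *s (T k *v f' (n + k - k)))"
      unfolding laurent_mv[OF \<gamma> l] unfolding F_def mv_sum vec.scale_sum_right
      by (intro sum.cong refl) (simp add: mv_scale lp power_int_add l0 mult.commute)
    also have "\<dots> = (\<Sum>k\<in>{-3..3}. \<Sum>m\<in>{-3..N+3}. l powi m *s (T k *v f' (m - k)))"
    proof (rule sum.cong[OF refl])
      fix k :: int assume k: "k \<in> {-3..3}"
      show "(\<Sum>n\<in>{0..<N}. l powi (n + k) *s (T k *v f' (n + k - k))) = (\<Sum>m\<in>{-3..N+3}. l powi m *s (T k *v f' (m - k)))"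
      proof (rule sum_int_shift[symmetric])
        fix m :: int
        show "l powi m *s (T k *v f' (m - k)) = 0" if "m \<notin> {-3..N+3}"
        proof -
          have "m - k \<notin> {0..<N}" using that k by auto
          then show ?thesis using f'0[of "m - k"] by simp
        qed
        show "l powi m *s (T k *v f' (m - k)) = 0" if "m - k \<notin> {0..<N}"
          using f'0[OF that] by simp
      qed auto
    qed
    also have "\<dots> = (\<Sum>m\<in>{-3..N+3}. l powi m *s cv T f' m)"
      by (subst sum.swap) (simp add: cv_def vec.scale_sum_right)
    also have "\<dots> = (\<Sum>k\<in>{0..N+3-i}. l powi (k + i) *s cv T f' (k + i))"
    proof (rule sum_int_shift)
      fix m :: int
      show "l powi m *s cv T f' m = 0" if "m \<notin> {-3..N+3}"
      proof (cases "m < -3")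
        case False
        then have "m > N + 3" using that by auto
        then show ?thesis by (simp add: cv_hi)
      qed (simp add: cv_lo)
      show "l powi m *s cv T f' m = 0" if "m - i \<notin> {0..N+3-i}"
      proof (cases "m < i")
        case False
        then have "m > N + 3" using that by auto
        then show ?thesis by (simp add: cv_hi)
      qed (simp add: cvf')
    qed auto
    also have "\<dots> = l powi i *s H l"
      unfolding H_def vec.scale_sum_right
      by (intro sum.cong refl) (simp add: lp power_int_add l0 mult.commute)
    finally show "\<gamma> l *v F l = l powi i *s H l" .
  qed
qed

section \<open>Multiplication of power series by polynomial loops\<close>

lemma L2_circle_dominated:
  assumes "g \<in> borel_measurable circ" "integrable circ (\<lambda>t. (norm (f t :: complex^7))\<^sup>2)"
    and "\<And>t. norm (g t :: complex^7) \<le> K * norm (f t)"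
  shows "integrable circ (\<lambda>t. (norm (g t))\<^sup>2)"
    "(LINT t|circ. (norm (g t))\<^sup>2) \<le> K\<^sup>2 * (LINT t|circ. (norm (f t))\<^sup>2)"
proof -
  have le: "(norm (g t))\<^sup>2 \<le> K\<^sup>2 * (norm (f t))\<^sup>2" for t
    using power_mono[OF assms(3)[of t], of 2] by (simp add: power_mult_distrib)
  have int: "integrable circ (\<lambda>t. K\<^sup>2 * (norm (f t))\<^sup>2)" using assms(2) by simp
  show i: "integrable circ (\<lambda>t. (norm (g t))\<^sup>2)"
  proof (rule Bochner_Integration.integrable_bound[OF int])
    show "(\<lambda>t. (norm (g t))\<^sup>2) \<in> borel_measurable circ" using assms(1) by measurable
    show "AE t in circ. norm ((norm (g t))\<^sup>2) \<le> norm (K\<^sup>2 * (norm (f t))\<^sup>2)"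
      using le by (intro AE_I2) simp
  qed
  have "(LINT t|circ. (norm (g t))\<^sup>2) \<le> (LINT t|circ. K\<^sup>2 * (norm (f t))\<^sup>2)"
    by (rule integral_mono[OF i int le])
  then show "(LINT t|circ. (norm (g t))\<^sup>2) \<le> K\<^sup>2 * (LINT t|circ. (norm (f t))\<^sup>2)" by simp
qed

lemma measurable_mv:
  fixes M :: "complex^7^7"
  shows "(f :: real \<Rightarrow> complex^7) \<in> borel_measurable circ \<Longrightarrow> (\<lambda>t. M *v f t) \<in> borel_measurable circ"
proof -
  have "bounded_linear (\<lambda>x::complex^7. M *v x)"
    by (simp add: linear_conv_bounded_linear[symmetric])
  then have "(\<lambda>x::complex^7. M *v x) \<in> borel_measurable borel"
    by (intro borel_measurable_continuous_onI linear_continuous_on)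
  then show "f \<in> borel_measurable circ \<Longrightarrow> (\<lambda>t. M *v f t) \<in> borel_measurable circ"
    using measurable_compose by blast
qed

lemma mv_bound:
  fixes M :: "complex^7^7"
  obtains K where "K > 0" "\<And>x. norm (M *v (x::complex^7)) \<le> K * norm x"
proof -
  have "bounded_linear (\<lambda>x::complex^7. M *v x)"
    by (simp add: linear_conv_bounded_linear[symmetric])
  then obtain K where "K > 0" "\<And>x. norm (M *v x) \<le> norm x * K"
    using bounded_linear.pos_bounded by blast
  then show thesis using that[of K] by (simp add: mult.commute)
qed

lemma L2_power_series_mv:
  assumes f: "L2_power_series f v"
  shows "L2_power_series (\<lambda>l. M *v f l) (\<lambda>n. M *v v n)"
proof -
  obtain K where K: "K > 0" "\<And>x. norm (M *v (x::complex^7)) \<le> K * norm x"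
    using mv_bound[of M] by blast
  have meas: "(\<lambda>t. f (cis t)) \<in> borel_measurable circ" and sq: "integrable circ (\<lambda>t. (norm (f (cis t)))\<^sup>2)"
    using f by (auto simp: L2_power_series_def L2_circle_def)
  have "(\<lambda>l. M *v f l) \<in> L2_circle"
    unfolding L2_circle_def using measurable_mv[OF meas] L2_circle_dominated(1)[OF _ sq K(2)] by blast
  moreover have "(\<lambda>n. LINT t|circ. (norm (M *v f (cis t) - (\<Sum>i<n. cis t ^ i *s (M *v v i))))\<^sup>2) \<longlonglongrightarrow> 0"
  proof (rule tendsto_sandwich[OF _ _ tendsto_const])
    have eq: "M *v f (cis t) - (\<Sum>i<n. cis t ^ i *s (M *v v i)) = M *v (f (cis t) - (\<Sum>i<n. cis t ^ i *s v i))" for t n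
      by (simp add: matrix_vector_mult_diff_distrib mv_sum mv_scale)
    show "eventually (\<lambda>n. (LINT t|circ. (norm (M *v f (cis t) - (\<Sum>i<n. cis t ^ i *s (M *v v i))))\<^sup>2) \<le>
        K\<^sup>2 * (LINT t|circ. (norm (f (cis t) - (\<Sum>i<n. cis t ^ i *s v i)))\<^sup>2)) sequentially"
      unfolding eq
      by (intro always_eventually allI L2_circle_dominated(2) measurable_mv L2_power_series_diff[OF f] K)
    have "(\<lambda>n. LINT t|circ. (norm (f (cis t) - (\<Sum>i<n. cis t ^ i *s v i)))\<^sup>2) \<longlonglongrightarrow> 0"
      using f by (simp add: L2_power_series_def)
    from tendsto_mult_right_zero[OF this]
    show "(\<lambda>n. K\<^sup>2 * (LINT t|circ. (norm (f (cis t) - (\<Sum>i<n. cis t ^ i *s v i)))\<^sup>2)) \<longlonglongrightarrow> 0" .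
  qed (auto intro!: always_eventually)
  ultimately show ?thesis by (simp add: L2_power_series_def)
qed

lemma norm_add_sq: "(norm (a + b))\<^sup>2 \<le> 2 * (norm a)\<^sup>2 + 2 * (norm b)\<^sup>2"
proof -
  have "(norm (a + b))\<^sup>2 \<le> (norm a + norm b)\<^sup>2"
    by (intro power_mono norm_triangle_ineq) auto
  also have "\<dots> \<le> 2 * (norm a)\<^sup>2 + 2 * (norm b)\<^sup>2"
    using zero_le_power2[of "norm a - norm b"] by (simp add: power2_eq_square algebra_simps)
  finally show ?thesis .
qed

lemma L2_sum:
  assumes "f \<in> borel_measurable circ" "integrable circ (\<lambda>t. (norm (f t :: complex^7))\<^sup>2)"
    "g \<in> borel_measurable circ" "integrable circ (\<lambda>t. (norm (g t :: complex^7))\<^sup>2)"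
  shows "integrable circ (\<lambda>t. (norm (f t + g t))\<^sup>2)"
    "(LINT t|circ. (norm (f t + g t))\<^sup>2) \<le> 2 * (LINT t|circ. (norm (f t))\<^sup>2) + 2 * (LINT t|circ. (norm (g t))\<^sup>2)"
proof -
  have int: "integrable circ (\<lambda>t. 2 * (norm (f t))\<^sup>2 + 2 * (norm (g t))\<^sup>2)"
    using assms by simp
  show i: "integrable circ (\<lambda>t. (norm (f t + g t))\<^sup>2)"
  proof (rule Bochner_Integration.integrable_bound[OF int])
    show "(\<lambda>t. (norm (f t + g t))\<^sup>2) \<in> borel_measurable circ"
      using borel_measurable_add[OF assms(1,3)] by measurable
    show "AE t in circ. norm ((norm (f t + g t))\<^sup>2) \<le> norm (2 * (norm (f t))\<^sup>2 + 2 * (norm (g t))\<^sup>2)"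
      using norm_add_sq by (intro AE_I2) (simp add: add_nonneg_nonneg)
  qed
  have "(LINT t|circ. (norm (f t + g t))\<^sup>2) \<le> (LINT t|circ. 2 * (norm (f t))\<^sup>2 + 2 * (norm (g t))\<^sup>2)"
    by (rule integral_mono[OF i int norm_add_sq])
  then show "(LINT t|circ. (norm (f t + g t))\<^sup>2) \<le> 2 * (LINT t|circ. (norm (f t))\<^sup>2) + 2 * (LINT t|circ. (norm (g t))\<^sup>2)"
    using assms by simp
qed

lemma L2_power_series_add:
  assumes f: "L2_power_series f v" and g: "L2_power_series g w"
  shows "L2_power_series (\<lambda>l. f l + g l) (\<lambda>n. v n + w n)"
proof -
  have "(\<lambda>t. f (cis t)) \<in> borel_measurable circ" "integrable circ (\<lambda>t. (norm (f (cis t)))\<^sup>2)"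
    "(\<lambda>t. g (cis t)) \<in> borel_measurable circ" "integrable circ (\<lambda>t. (norm (g (cis t)))\<^sup>2)"
    using f g by (auto simp: L2_power_series_def L2_circle_def)
  from L2_sum(1)[OF this] borel_measurable_add[OF this(1,3)]
  have "(\<lambda>l. f l + g l) \<in> L2_circle" by (simp add: L2_circle_def)
  moreover have "(\<lambda>n. LINT t|circ. (norm (f (cis t) + g (cis t) - (\<Sum>i<n. cis t ^ i *s (v i + w i))))\<^sup>2) \<longlonglongrightarrow> 0"
  proof (rule tendsto_sandwich[OF _ _ tendsto_const])
    have eq: "f (cis t) + g (cis t) - (\<Sum>i<n. cis t ^ i *s (v i + w i)) =
        (f (cis t) - (\<Sum>i<n. cis t ^ i *s v i)) + (g (cis t) - (\<Sum>i<n. cis t ^ i *s w i))" for t n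
      by (simp add: vector_add_ldistrib sum.distrib)
    show "eventually (\<lambda>n. (LINT t|circ. (norm (f (cis t) + g (cis t) - (\<Sum>i<n. cis t ^ i *s (v i + w i))))\<^sup>2) \<le>
        2 * (LINT t|circ. (norm (f (cis t) - (\<Sum>i<n. cis t ^ i *s v i)))\<^sup>2) +
        2 * (LINT t|circ. (norm (g (cis t) - (\<Sum>i<n. cis t ^ i *s w i)))\<^sup>2)) sequentially"
      unfolding eq
      by (intro always_eventually allI L2_sum(2) L2_power_series_diff[OF f] L2_power_series_diff[OF g])
    have "(\<lambda>n. LINT t|circ. (norm (f (cis t) - (\<Sum>i<n. cis t ^ i *s v i)))\<^sup>2) \<longlonglongrightarrow> 0"
      "(\<lambda>n. LINT t|circ. (norm (g (cis t) - (\<Sum>i<n. cis t ^ i *s w i)))\<^sup>2) \<longlonglongrightarrow> 0"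
      using f g by (simp_all add: L2_power_series_def)
    from tendsto_add[OF tendsto_mult_right_zero[OF this(1), of 2] tendsto_mult_right_zero[OF this(2), of 2]]
    show "(\<lambda>n. 2 * (LINT t|circ. (norm (f (cis t) - (\<Sum>i<n. cis t ^ i *s v i)))\<^sup>2) +
        2 * (LINT t|circ. (norm (g (cis t) - (\<Sum>i<n. cis t ^ i *s w i)))\<^sup>2)) \<longlonglongrightarrow> 0"
      by simp
  qed (auto intro!: always_eventually)
  ultimately show ?thesis by (simp add: L2_power_series_def)
qed

lemma L2_power_series_times:
  assumes f: "L2_power_series f v"
  shows "L2_power_series (\<lambda>l. l *s f l) (\<lambda>n. case n of 0 \<Rightarrow> 0 | Suc m \<Rightarrow> v m)"
proof -
  have meas: "(\<lambda>t. f (cis t)) \<in> borel_measurable circ" and sq: "integrable circ (\<lambda>t. (norm (f (cis t)))\<^sup>2)"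
    using f by (auto simp: L2_power_series_def L2_circle_def)
  have norm: "norm (cis t *s x) = norm (x :: complex^7)" for t x
    by (simp add: norm_vec_def L2_set_def norm_mult)
  have "(\<lambda>t. cis t *s f (cis t)) \<in> borel_measurable circ"
  proof -
    have "continuous_on UNIV (\<lambda>q::complex \<times> (complex^7). fst q *s snd q)"
      unfolding vector_scalar_mult_def
      by (intro continuous_on_vec_lambda continuous_intros)
    then have "(\<lambda>q::complex \<times> (complex^7). fst q *s snd q) \<in> borel_measurable borel"
      by (rule borel_measurable_continuous_onI)
    moreover have "(\<lambda>t. (cis t, f (cis t))) \<in> borel_measurable circ"
      by (intro borel_measurable_Pair meas measurable_circ_continuous continuous_on_cis continuous_on_id)
    ultimately have "(\<lambda>t. (\<lambda>q::complex \<times> (complex^7). fst q *s snd q) (cis t, f (cis t))) \<in> borel_measurable circ"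
      by (rule measurable_compose[rotated])
    then show ?thesis by simp
  qed
  then have "(\<lambda>l. l *s f l) \<in> L2_circle" using sq by (simp add: L2_circle_def norm)
  moreover have "(\<lambda>n. LINT t|circ. (norm (cis t *s f (cis t) - (\<Sum>i<n. cis t ^ i *s (case i of 0 \<Rightarrow> 0 | Suc m \<Rightarrow> v m))))\<^sup>2) \<longlonglongrightarrow> 0"
  proof (subst filterlim_sequentially_Suc[symmetric])
    have eq: "cis t *s f (cis t) - (\<Sum>i<Suc n. cis t ^ i *s (case i of 0 \<Rightarrow> 0 | Suc m \<Rightarrow> v m)) =
        cis t *s (f (cis t) - (\<Sum>i<n. cis t ^ i *s v i))" for t n
      unfolding sum.lessThan_Suc_shift by (simp add: vec.scale_sum_right vector_ssub_ldistrib)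
    show "(\<lambda>n. LINT t|circ. (norm (cis t *s f (cis t) - (\<Sum>i<Suc n. cis t ^ i *s (case i of 0 \<Rightarrow> 0 | Suc m \<Rightarrow> v m))))\<^sup>2) \<longlonglongrightarrow> 0"
      unfolding eq norm using f by (simp add: L2_power_series_def)
  qed
  ultimately show ?thesis by (simp add: L2_power_series_def)
qed

lemma H_plus_mv: "f \<in> H_plus \<Longrightarrow> (\<lambda>l. M *v f l) \<in> H_plus"
  unfolding H_plus_def using L2_power_series_mv by blast

lemma H_plus_add: "f \<in> H_plus \<Longrightarrow> g \<in> H_plus \<Longrightarrow> (\<lambda>l. f l + g l) \<in> H_plus"
  unfolding H_plus_def using L2_power_series_add by blast

lemma H_plus_power: "f \<in> H_plus \<Longrightarrow> (\<lambda>l. l ^ n *s f l) \<in> H_plus"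
proof (induction n)
  case (Suc n)
  then obtain v where "L2_power_series (\<lambda>l. l ^ n *s f l) v" by (auto simp: H_plus_def)
  from L2_power_series_times[OF this] show ?case
    by (auto simp: H_plus_def)
qed simp

lemma H_plus_zero: "(\<lambda>l. 0) \<in> H_plus"
proof -
  have "polyvec (\<lambda>l. 0)" unfolding polyvec_def by (rule exI[of _ "\<lambda>a. 0"]) simp
  then obtain v where "L2_power_series (\<lambda>l. 0) v" by (rule polyvec_L2_power_series)
  then show ?thesis unfolding H_plus_def by blast
qed

lemma H_plus_sum: "(\<And>j. j \<in> J \<Longrightarrow> f j \<in> H_plus) \<Longrightarrow> (\<lambda>l. \<Sum>j\<in>J. f j l) \<in> H_plus"
  by (induction J rule: infinite_finite_induct) (auto intro: H_plus_zero H_plus_add)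

text \<open>The factor \<lambda>^s clears the negative exponents of the loop, leaving a finite sum
  of nonnegative powers times constant matrices, under which H_+ is closed.\<close>

lemma H_plus_loop:
  assumes \<gamma>: "laurent \<gamma> T" and T: "\<And>k. \<bar>k\<bar> > s \<Longrightarrow> T k = 0" and f: "f \<in> H_plus"
  obtains h where "h \<in> H_plus" "\<And>l. l \<in> sphere 0 1 \<Longrightarrow> l powi s *s (\<gamma> l *v f l) = h l"
proof
  define h where "h l = (\<Sum>k\<in>{-3..3}. l ^ nat (k + s) *s (T k *v f l))" for l
  show "h \<in> H_plus" unfolding h_def[abs_def] by (intro H_plus_sum H_plus_power H_plus_mv f)
  fix l :: complex assume l: "l \<in> sphere 0 1"
  then have l0: "l \<noteq> 0" by (rule sphere_nz)
  have "l powi s *s (l powi k *s (T k *v f l)) = l ^ nat (k + s) *s (T k *v f l)" for k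
  proof (cases "\<bar>k\<bar> > s")
    case False
    then have "l ^ nat (k + s) = l powi (k + s)" by (simp add: power_int_def)
    then show ?thesis by (simp add: power_int_add l0 mult.commute)
  qed (simp add: T)
  then show "l powi s *s (\<gamma> l *v f l) = h l"
    unfolding laurent_mv[OF \<gamma> l] h_def vec.scale_sum_right by (rule sum.cong[OF refl])
qed

text \<open>Serves to contradict minimality of s. \<open>W_between\<close> speaks of all of H_+, so
  multiplication of arbitrary L2 power series by a loop is required; the lower inclusion uses the
  transposed loop as inverse.\<close>

lemma W_betweenI:
  assumes \<gamma>: "\<And>p. laurent (\<Phi> p) (T p)" and \<gamma>': "\<And>p. laurent (\<lambda>l. transpose (\<Phi> p l)) (tp (T p))"
    and inv: "\<And>p l. l \<in> sphere 0 1 \<Longrightarrow> \<Phi> p l ** transpose (\<Phi> p l) = mat 1"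
    and T: "\<And>p k. \<bar>k\<bar> > s \<Longrightarrow> T p k = 0"
  shows "W_between \<Phi> s"
  unfolding W_between_def
proof (intro allI conjI subsetI)
  fix p g assume "g \<in> shift_H_plus s"
  then obtain f where f: "f \<in> H_plus" and g: "\<And>l. l \<in> sphere 0 1 \<Longrightarrow> g l = l powi s *s f l"
    by (auto simp: shift_H_plus_def)
  have "\<And>k. \<bar>k\<bar> > s \<Longrightarrow> tp (T p) k = 0" using T by (simp add: tp_def transpose_def vec_eq_iff)
  from H_plus_loop[OF \<gamma>' this f]
  obtain h where h: "h \<in> H_plus" "\<And>l. l \<in> sphere 0 1 \<Longrightarrow> l powi s *s (transpose (\<Phi> p l) *v f l) = h l"
    by blast
  have "g l = \<Phi> p l *v h l" if "l \<in> sphere 0 1" for l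
    using inv[OF that] by (simp add: g[OF that] mv_scale matrix_vector_mul_assoc flip: h(2)[OF that])
  then show "g \<in> loop_H_plus (\<Phi> p)" using h(1) by (auto simp: loop_H_plus_def)
next
  fix p g assume "g \<in> loop_H_plus (\<Phi> p)"
  then obtain f where f: "f \<in> H_plus" and g: "\<And>l. l \<in> sphere 0 1 \<Longrightarrow> g l = \<Phi> p l *v f l"
    by (auto simp: loop_H_plus_def)
  obtain h where h: "h \<in> H_plus" "\<And>l. l \<in> sphere 0 1 \<Longrightarrow> l powi s *s (\<Phi> p l *v f l) = h l"
    using H_plus_loop[OF \<gamma> T f] by blast
  have "g l = l powi (- s) *s h l" if "l \<in> sphere 0 1" for l
    using sphere_nz[OF that] by (simp add: g[OF that] power_int_minus flip: h(2)[OF that])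
  then show "g \<in> shift_H_plus (- s)" using h(1) by (auto simp: shift_H_plus_def)
qed

text \<open>Constant vectors belong to H_+, so \<Phi> v lies in \<lambda>^(-s) H_+ for every
  \<open>v\<close>, and its coefficients below -s vanish.\<close>

lemma W_between_coeff:
  assumes W: "W_between \<Phi> s" and "finite K"
    and \<Phi>: "\<And>l. l \<in> sphere 0 1 \<Longrightarrow> \<Phi> p l = (\<Sum>k\<in>K. cscale (l powi k) (T k))"
    and "k \<in> K" "k < - s"
  shows "T k = 0"
proof -
  have "T k *v v = 0" for v
  proof -
    have "polyvec (\<lambda>l. v)" unfolding polyvec_def by (rule exI[of _ "\<lambda>a. [:v $ a:]"]) simp
    then obtain c where "L2_power_series (\<lambda>l. v) c" by (rule polyvec_L2_power_series)
    then have "(\<lambda>l. v) \<in> H_plus" unfolding H_plus_def by blast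
    then have "(\<lambda>l. \<Phi> p l *v v) \<in> loop_H_plus (\<Phi> p)"
      unfolding loop_H_plus_def by (intro CollectI bexI[of _ "\<lambda>l. v"]) auto
    then have mem: "(\<lambda>l. \<Phi> p l *v v) \<in> shift_H_plus (- s)" using W by (auto simp: W_between_def)
    have "(T k *v v) $ \<alpha> = 0" for \<alpha>
    proof -
      have "fourier (\<lambda>l. (\<Phi> p l *v v) $ \<alpha>) k = of_real (2 * pi) * (if k \<in> K then (T k *v v) $ \<alpha> else 0)"
        by (rule fourier_trig[OF assms(2)]) (simp add: \<Phi> sum_mv cscale_mv mult.commute)
      then show ?thesis using shift_H_plus_fourier[OF mem assms(5), of \<alpha>] assms(4) by simp
    qed
    then show ?thesis by (simp add: vec_eq_iff)
  qed
  then show ?thesis by (simp add: matrix_eq)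
qed

section \<open>The group of automorphisms\<close>

lemma cross7_simps:
  "cross7 (u + v) w = cross7 u w + cross7 v w" "cross7 w (u + v) = cross7 w u + cross7 w v"
  "cross7 (c *s u) w = c *s cross7 u w" "cross7 w (c *s u) = c *s cross7 w u"
  by (simp_all add: cross7_def vec_eq_iff algebra_simps)

lemma vcnj_cross7: "vcnj (cross7 v w) = cross7 (vcnj v) (vcnj w)"
  by (simp add: cross7_def vec_eq_iff)

definition cvec :: "real^7 \<Rightarrow> complex^7" where
  "cvec x = (\<chi> i. complex_of_real (x $ i))"

lemma cvec_decomp: "v = cvec (\<chi> i. Re (v $ i)) + \<i> *s cvec (\<chi> i. Im (v $ i))"
  by (simp add: vec_eq_iff cvec_def complex_eq_iff)

lemma cross7_cvec: "cross7 (cvec x) (cvec y) = cvec (cross7 x y)"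
  by (simp add: cross7_def vec_eq_iff cvec_def)

lemma map_matrix_cvec: "map_matrix complex_of_real R *v cvec x = cvec (R *v x)"
  by (simp add: vec_eq_iff cvec_def matrix_vector_mult_def map_matrix_def)

text \<open>An automorphism fixes the unit, so comparing real and imaginary parts of the image of a
  product of imaginary octonions gives orthogonality and compatibility with the vector product
  together. Complex bilinearity extends the latter from real vectors.\<close>

lemma G2_properties:
  assumes "g \<in> G2"
  shows G2_real: "mcnj g = g" and G2_orthogonal: "transpose g ** g = mat 1" "g ** transpose g = mat 1"
    and G2_cross7: "cross7 (g *v v) (g *v w) = g *v cross7 v w"
proof -
  obtain R f where g: "g = map_matrix complex_of_real R" and f: "oct_automorphism f" and fR: "\<And>v. f (0, v) = (0, R *v v)"
    using assms by (auto simp: G2_def)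
  have lin: "linear f" and "bij f" and mult: "\<And>x y. f (oct_mult x y) = oct_mult (f x) (f y)"
    using f by (auto simp: oct_automorphism_def)
  have one: "oct_mult (1, 0) x = x" "oct_mult x (1, 0) = x" for x
    by (auto simp: oct_mult_def prod_eq_iff cross7_def vec_eq_iff)
  have f1: "f (1, 0) = (1, 0)"
  proof -
    obtain x where "f x = (1, 0)" using \<open>bij f\<close> by (metis bij_pointE)
    then show ?thesis using mult[of "(1, 0)" x] by (simp add: one)
  qed
  have prod: "(R *v v) \<bullet> (R *v w) = v \<bullet> w \<and> cross7 (R *v v) (R *v w) = R *v cross7 v w" for v w
  proof -
    have "f (oct_mult (0, v) (0, w)) = f (- (v \<bullet> w) *\<^sub>R (1, 0) + (0, cross7 v w))"
      by (simp add: oct_mult_def)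
    also have "\<dots> = - (v \<bullet> w) *\<^sub>R f (1, 0) + f (0, cross7 v w)"
      using lin by (simp only: linear_add linear_scale)
    also have "\<dots> = (- (v \<bullet> w), R *v cross7 v w)"
      by (simp add: f1 fR)
    finally show ?thesis
      using mult[of "(0, v)" "(0, w)"] by (simp add: fR oct_mult_def)
  qed
  show "mcnj g = g" by (simp add: g vec_eq_iff map_matrix_def)
  have "transpose R ** R = mat 1"
  proof -
    have "(transpose R ** R) $ i $ j = mat 1 $ i $ j" for i j
    proof -
      have "(R *v axis i 1) \<bullet> (R *v axis j 1) = axis i 1 \<bullet> (axis j 1 :: real^7)" using prod by blast
      then have "column i R \<bullet> column j R = (if i = j then 1 else 0)"
        by (simp only: matrix_vector_mult_basis) (simp add: inner_axis_axis)
      then show ?thesis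
        by (simp add: inner_vec_def column_def matrix_matrix_mult_def transpose_def mat_def)
    qed
    then show ?thesis by (simp add: vec_eq_iff)
  qed
  then have "(transpose R ** R) $ i $ j = mat 1 $ i $ j" for i j by simp
  then have "(\<Sum>k\<in>UNIV. R $ k $ i * R $ k $ j) = mat 1 $ i $ j" for i j
    by (simp add: matrix_matrix_mult_def transpose_def)
  then have "(\<Sum>k\<in>UNIV. complex_of_real (R $ k $ i) * complex_of_real (R $ k $ j)) = mat 1 $ i $ j" for i j
    by (simp add: mat_def flip: of_real_mult of_real_sum)
  then show orth: "transpose g ** g = mat 1"
    by (simp add: vec_eq_iff matrix_matrix_mult_def transpose_def g map_matrix_def)
  then show "g ** transpose g = mat 1" by (simp add: matrix_left_right_inverse)
  have real: "cross7 (g *v cvec x) (g *v cvec y) = g *v cross7 (cvec x) (cvec y)" for x y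
    using prod by (simp add: g map_matrix_cvec cross7_cvec)
  have "cross7 (g *v (cvec a + \<i> *s cvec b)) (g *v (cvec c + \<i> *s cvec d)) =
      g *v cross7 (cvec a + \<i> *s cvec b) (cvec c + \<i> *s cvec d)" for a b c d
    by (simp only: matrix_vector_right_distrib mv_scale cross7_simps real)
  from this[of "\<chi> i. Re (v $ i)" "\<chi> i. Im (v $ i)" "\<chi> i. Re (w $ i)" "\<chi> i. Im (w $ i)"]
  show "cross7 (g *v v) (g *v w) = g *v cross7 v w"
    by (simp only: cvec_decomp[symmetric])
qed

text \<open>The octonions have no zero divisors.\<close>

lemma cross7_eq_0_real:
  assumes "cross7 (cvec x) v = 0" "cdot (cvec x) v = 0" "x \<noteq> 0"
  shows "v = 0"
proof -
  define a b where "a = (\<chi> i. Re (v $ i))" and "b = (\<chi> i. Im (v $ i))"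
  have v: "v = cvec a + \<i> *s cvec b" unfolding a_def b_def by (rule cvec_decomp)
  have cd: "cdot (cvec y) (cvec z) = of_real (y \<bullet> z)" for y z
    by (simp add: cdot_def cvec_def inner_vec_def)
  have "cvec (cross7 x a) + \<i> *s cvec (cross7 x b) = 0"
    using assms(1) by (simp add: v cross7_simps cross7_cvec)
  then have "cross7 x a = 0" "cross7 x b = 0"
    by (simp_all add: vec_eq_iff cvec_def complex_eq_iff)
  moreover have "x \<bullet> a = 0" "x \<bullet> b = 0"
    using assms(2) by (simp_all add: v cdot_simps cd complex_eq_iff)
  ultimately have "oct_mult (0, x) (0, a) = 0" "oct_mult (0, x) (0, b) = 0"
    by (simp_all add: oct_mult_def zero_prod_def)
  then have "norm (oct_mult (0, x) (0, a)) = 0" "norm (oct_mult (0, x) (0, b)) = 0" by simp_all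
  then have "norm (0::real, x) * norm (0::real, a) = 0" "norm (0::real, x) * norm (0::real, b) = 0"
    by (simp_all only: norm_oct_mult)
  then have "a = 0" "b = 0" using assms(3) by (simp_all add: zero_prod_def)
  then show ?thesis by (simp add: v cvec_def vec_eq_iff)
qed

section \<open>Loops of automorphisms\<close>

lemma cscale_mult: "cscale a M ** cscale b N = cscale (a * b) (M ** N)"
  by (simp add: vec_eq_iff matrix_matrix_mult_def sum_distrib_left mult_ac)

lemma sum_cscale: "(\<Sum>k\<in>I. cscale a (F k)) = cscale a (\<Sum>k\<in>I. F k)"
  by (simp add: vec_eq_iff sum_distrib_left)

lemma laurent_inverse:
  assumes \<gamma>: "laurent \<gamma> T" "laurent \<gamma>' T'" and inv: "\<And>l. l \<in> sphere 0 1 \<Longrightarrow> \<gamma> l ** \<gamma>' l = mat 1"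
    and T': "\<And>k. k \<notin> {-3..3} \<Longrightarrow> T' k = 0"
  shows "(\<Sum>k\<in>{-3..3}. T k ** T' (c - k)) = (if c = 0 then mat 1 else 0)"
proof (cases "c \<in> {-6..6}")
  case True
  have "(\<Sum>c\<in>{-6..6}. (\<Sum>k\<in>{-3..3}. T k ** T' (c - k)) $ a $ b * l powi c) =
      (\<Sum>c\<in>{-6..6}. (if c = 0 then mat 1 $ a $ b else 0) * l powi c)" if l: "l \<in> sphere 0 1" for l a b
  proof -
    have l0: "l \<noteq> 0" using sphere_nz[OF l] .
    have "mat 1 = (\<Sum>k\<in>{-3..3}. \<Sum>j\<in>{-3..3}. cscale (l powi (j + k)) (T k ** T' (j + k - k)))"
    proof -
      have "mat 1 = (\<Sum>k\<in>{-3..3}. cscale (l powi k) (T k)) ** (\<Sum>k\<in>{-3..3}. cscale (l powi k) (T' k))"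
        using inv[OF l] \<gamma> l by (simp add: laurent_def)
      also have "\<dots> = (\<Sum>k\<in>{-3..3}. \<Sum>j\<in>{-3..3}. cscale (l powi k * l powi j) (T k ** T' j))"
        unfolding sum_mm unfolding mm_sum cscale_mult ..
      finally show ?thesis by (simp add: power_int_add l0 mult.commute)
    qed
    also have "\<dots> = (\<Sum>k\<in>{-3..3}. \<Sum>c\<in>{-6..6}. cscale (l powi c) (T k ** T' (c - k)))"
    proof (rule sum.cong[OF refl])
      fix k :: int assume k: "k \<in> {-3..3}"
      have z: "cscale (l powi c) (T k ** T' (c - k)) = 0" if "c - k \<notin> {-3..3}" for c
        unfolding T'[OF that] times0_right by (simp add: vec_eq_iff)
      show "(\<Sum>j\<in>{-3..3}. cscale (l powi (j + k)) (T k ** T' (j + k - k))) =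
          (\<Sum>c\<in>{-6..6}. cscale (l powi c) (T k ** T' (c - k)))"
      proof (rule sum_int_shift[symmetric])
        show "cscale (l powi c) (T k ** T' (c - k)) = 0" if "c \<notin> {-6..6}" for c
          by (rule z) (use that k in auto)
      qed (use z in auto)
    qed
    also have "\<dots> = (\<Sum>c\<in>{-6..6}. cscale (l powi c) (\<Sum>k\<in>{-3..3}. T k ** T' (c - k)))"
      by (subst sum.swap) (simp add: sum_cscale)
    finally have "mat 1 $ a $ b = (\<Sum>c\<in>{-6..6}. cscale (l powi c) (\<Sum>k\<in>{-3..3}. T k ** T' (c - k))) $ a $ b"
      by simp
    also have "\<dots> = (\<Sum>c\<in>{-6..6}. (\<Sum>k\<in>{-3..3}. T k ** T' (c - k)) $ a $ b * l powi c)"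
      by (simp add: mult.commute)
    also have "mat 1 $ a $ b = (\<Sum>c\<in>{-6..6}. (if c = 0 then mat 1 $ a $ b else 0) * l powi c)"
      by (simp add: if_distrib[of "\<lambda>x. x * _"] cong: if_cong)
    finally show ?thesis by simp
  qed
  from laurent_unique[OF _ this True]
  have "(\<Sum>k\<in>{-3..3}. T k ** T' (c - k)) $ a $ b = (if c = 0 then mat 1 $ a $ b else 0)" for a b
    by simp
  then show ?thesis by (simp only: vec_eq_iff) (auto split: if_splits)
next
  case False
  have "T' (c - k) = 0" if "k \<in> {-3..3}" for k
    by (rule T') (use that False in auto)
  moreover have "c \<noteq> 0" using False by auto
  ultimately show ?thesis by simp
qed

lemma polyvec_mv: "polyvec F \<Longrightarrow> polyvec (\<lambda>l. M *v F l)"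
proof -
  assume "polyvec F"
  then obtain p where p: "\<And>l a. F l $ a = poly (p a) l" by (auto simp: polyvec_def)
  show ?thesis unfolding polyvec_def
    by (rule exI[of _ "\<lambda>a. \<Sum>b\<in>UNIV. smult (M $ a $ b) (p b)"]) (simp add: mv_nth p poly_sum)
qed

lemma polyvec_diff: "polyvec F \<Longrightarrow> polyvec G \<Longrightarrow> polyvec (\<lambda>l. F l - c *s G l)"
proof -
  assume "polyvec F" "polyvec G"
  then obtain p q where "\<And>l a. F l $ a = poly (p a) l" "\<And>l a. G l $ a = poly (q a) l" by (auto simp: polyvec_def)
  then show ?thesis unfolding polyvec_def
    by (intro exI[of _ "\<lambda>a. p a - smult c (q a)"]) simp
qed

lemma polyvec_scale: "polyvec F \<Longrightarrow> polyvec (\<lambda>l. c *s F l)"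
proof -
  assume "polyvec F"
  then obtain p where "\<And>l a. F l $ a = poly (p a) l" by (auto simp: polyvec_def)
  then show ?thesis unfolding polyvec_def by (intro exI[of _ "\<lambda>a. smult c (p a)"]) simp
qed

lemma polyvec_reflect: "polyvec F \<Longrightarrow> polyvec (\<lambda>l. F (- l))"
proof -
  assume "polyvec F"
  then obtain p where "\<And>l a. F l $ a = poly (p a) l" by (auto simp: polyvec_def)
  then show ?thesis unfolding polyvec_def
    by (intro exI[of _ "\<lambda>a. pcompose (p a) [:0, -1:]"]) (simp add: poly_pcompose)
qed

lemma polyvec_cross7: "polyvec F \<Longrightarrow> polyvec G \<Longrightarrow> polyvec (\<lambda>l. cross7 (F l) (G l))"
proof -
  assume "polyvec F" "polyvec G"
  then obtain p q where "\<And>l a. F l $ a = poly (p a) l" "\<And>l a. G l $ a = poly (q a) l" by (auto simp: polyvec_def)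
  then show ?thesis unfolding polyvec_def
    by (intro exI[of _ "\<lambda>k. (p (k+1) * q (k+3) - p (k+3) * q (k+1)) + (p (k+2) * q (k+6) - p (k+6) * q (k+2))
        + (p (k+4) * q (k+5) - p (k+5) * q (k+4))"]) (simp add: cross7_def)
qed

lemma polyvec_divide:
  assumes "polyvec F" "F 0 = 0"
  obtains G where "polyvec G" "\<And>l. F l = l *s G l"
proof -
  obtain p where p: "\<And>l a. F l $ a = poly (p a) l" using assms by (auto simp: polyvec_def)
  have "\<exists>q. p a = [:0, 1:] * q" for a
  proof -
    have "poly (p a) 0 = 0" using assms(2) p[of 0 a] by simp
    then show ?thesis using poly_eq_0_iff_dvd[of "p a" 0] by (auto simp: dvd_def)
  qed
  then obtain q where q: "\<And>a. p a = [:0, 1:] * q a" by metis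
  show thesis
  proof (rule that[of "\<lambda>l. \<chi> a. poly (q a) l"])
    show "polyvec (\<lambda>l. \<chi> a. poly (q a) l)" unfolding polyvec_def by (rule exI[of _ q]) simp
    show "F l = l *s (\<chi> a. poly (q a) l)" for l by (simp add: vec_eq_iff p q)
  qed
qed

section \<open>Loops of automorphisms: reality, products and parity\<close>

locale g2_loop =
  fixes \<gamma> :: "complex \<Rightarrow> complex^7^7" and T :: "int \<Rightarrow> complex^7^7"
  assumes laurent: "laurent \<gamma> T" and supp3: "k \<notin> {-3..3} \<Longrightarrow> T k = 0"
    and G2: "l \<in> sphere 0 1 \<Longrightarrow> \<gamma> l \<in> G2"
begin

lemma laurent_tp: "laurent (\<lambda>l. transpose (\<gamma> l)) (tp T)"
  using laurent by (simp add: laurent_def tp_def vec_eq_iff transpose_def)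

lemma tp_zero: "k \<notin> {-3..3} \<Longrightarrow> tp T k = 0"
  using supp3 by (simp add: tp_def vec_eq_iff transpose_def)

sublocale loop_coeffs T
proof
  show "T k = 0" if "k \<notin> {-3..3}" for k using supp3 that .
  show "(\<Sum>k\<in>{-3..3}. T k ** transpose (T (c - k))) = (if c = 0 then mat 1 else 0)" for c
    using laurent_inverse[OF laurent laurent_tp G2_orthogonal(2)[OF G2] tp_zero, of c] by (simp add: tp_def)
  show "(\<Sum>k\<in>{-3..3}. transpose (T k) ** T (c - k)) = (if c = 0 then mat 1 else 0)" for c
    using laurent_inverse[OF laurent_tp laurent G2_orthogonal(1)[OF G2] supp3, of c] by (simp add: tp_def)
qed

lemma det_loop: "l \<in> sphere 0 1 \<Longrightarrow> det (\<gamma> l) \<noteq> 0"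
  using matrix_inv_unique(2)[OF G2_orthogonal(2)[OF G2]] .

text \<open>On the circle conjugation inverts \<lambda>, so reality of the values exchanges the
  coefficients of \<lambda>^k and \<lambda>^(-k).\<close>

lemma coeff_real: "T (- k) = mcnj (T k)"
proof (cases "k \<in> {-3..3}")
  case True
  have "(\<Sum>k\<in>{-3..3}. cnj (T (- k) $ a $ b) * l powi k) = (\<Sum>k\<in>{-3..3}. T k $ a $ b * l powi k)"
    if l: "l \<in> sphere 0 1" for l a b
  proof -
    have cl: "cnj (l powi k) = l powi (- k)" for k
    proof -
      have "l * cnj l = 1" using l by (simp add: complex_norm_square[symmetric])
      then have "cnj l = inverse l" using sphere_nz[OF l] by (simp add: field_simps)
      then show ?thesis by (simp add: power_int_minus power_int_inverse)
    qed
    have g: "\<gamma> l $ a $ b = (\<Sum>k\<in>{-3..3}. T k $ a $ b * l powi k)"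
      using laurent l by (simp add: laurent_def mult.commute)
    have "\<gamma> l $ a $ b = cnj (\<gamma> l $ a $ b)"
      using G2_real[OF G2[OF l]] by (metis mcnj_nth)
    also have "\<dots> = (\<Sum>k\<in>{-3..3}. cnj (T k $ a $ b) * l powi (- k))"
      unfolding g cnj_sum complex_cnj_mult cl ..
    also have "\<dots> = (\<Sum>k\<in>{-3..3}. cnj (T (- k) $ a $ b) * l powi k)"
      by (rule sum.reindex_bij_witness[of _ uminus uminus]) auto
    finally show ?thesis using g by simp
  qed
  from laurent_unique[OF _ this, of "- k"] True
  have "cnj (T k $ a $ b) = T (- k) $ a $ b" for a b by auto
  then show ?thesis by (simp add: vec_eq_iff)
next
  case False
  then have "T k = 0" "T (- k) = 0" by (auto intro!: supp3)
  then show ?thesis by (simp add: vec_eq_iff)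
qed

lemma poly_imp_Zs:
  assumes "polyvec F" "polyvec H" "\<And>l. l \<in> sphere 0 1 \<Longrightarrow> \<gamma> l *v F l = l powi i *s H l"
  shows "F 0 \<in> Zs T i"
  using Z_fibre_imp_Zs[of "\<lambda>_. \<gamma>" "()" T] poly_imp_Z_fibre[of "\<lambda>_. \<gamma>" "()"] laurent det_loop assms by blast

text \<open>Separates analysis from algebra: fibres defined in L2 become spaces of constant terms of
  finitely constrained sequences, and every such term has a polynomial representative.\<close>

lemma Z_fibre_eq: "\<Phi> p = \<gamma> \<Longrightarrow> Z_fibre \<Phi> i p = Zs T i"
proof
  assume \<Phi>: "\<Phi> p = \<gamma>"
  show "Z_fibre \<Phi> i p \<subseteq> Zs T i"
    using Z_fibre_imp_Zs[of \<Phi> p T] laurent det_loop \<Phi> by blast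
  show "Zs T i \<subseteq> Z_fibre \<Phi> i p"
  proof
    fix v assume "v \<in> Zs T i"
    then obtain F H where "polyvec F" "polyvec H" "F 0 = v" "\<And>l. l \<in> sphere 0 1 \<Longrightarrow> \<gamma> l *v F l = l powi i *s H l"
      using Zs_imp_poly[OF laurent] by blast
    then show "v \<in> Z_fibre \<Phi> i p"
      using poly_imp_Z_fibre[of \<Phi> p F H i] det_loop \<Phi> by auto
  qed
qed

text \<open>The loop commutes with the vector product, so orders in \<lambda> add up under
  multiplication of representatives.\<close>

lemma Zs_cross7:
  assumes "v \<in> Zs T i" "w \<in> Zs T j"
  shows "cross7 v w \<in> Zs T (i + j)"
proof -
  obtain F H where F: "polyvec F" "polyvec H" "F 0 = v" "\<And>l. l \<in> sphere 0 1 \<Longrightarrow> \<gamma> l *v F l = l powi i *s H l"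
    using Zs_imp_poly[OF laurent assms(1)] by blast
  obtain G K where G: "polyvec G" "polyvec K" "G 0 = w" "\<And>l. l \<in> sphere 0 1 \<Longrightarrow> \<gamma> l *v G l = l powi j *s K l"
    using Zs_imp_poly[OF laurent assms(2)] by blast
  have "(\<lambda>l. cross7 (F l) (G l)) 0 \<in> Zs T (i + j)"
  proof (rule poly_imp_Zs[where F = "\<lambda>l. cross7 (F l) (G l)" and H = "\<lambda>l. cross7 (H l) (K l)"])
    fix l :: complex assume l: "l \<in> sphere 0 1"
    have "\<gamma> l *v cross7 (F l) (G l) = cross7 (\<gamma> l *v F l) (\<gamma> l *v G l)"
      by (simp add: G2_cross7[OF G2[OF l]])
    also have "\<dots> = l powi (i + j) *s cross7 (H l) (K l)"
      using sphere_nz[OF l] by (simp add: F(4)[OF l] G(4)[OF l] cross7_simps power_int_add mult.commute)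
    finally show "\<gamma> l *v cross7 (F l) (G l) = l powi (i + j) *s cross7 (H l) (K l)" .
  qed (intro polyvec_cross7 F G)+
  then show ?thesis by (simp add: F G)
qed

text \<open>Substituting -\<lambda> in \<Phi> F = \<lambda>^i H shows that \<Phi> maps \<phi>
  F(-\<lambda>) - (-1)^i F(\<lambda>) to (-1)^i \<lambda>^i (H(-\<lambda>) - H(\<lambda>)). The last
  bracket vanishes at 0, which gains one power of \<lambda>.\<close>

lemma Zs_parity:
  assumes sym: "\<And>l. l \<in> sphere 0 1 \<Longrightarrow> \<gamma> (- l) = \<gamma> l ** \<phi>" and v: "v \<in> Zs T i"
  shows "\<phi> *v v - (-1) powi i *s v \<in> Zs T (i + 1)"
proof -
  obtain F H where F: "polyvec F" "polyvec H" "F 0 = v" "\<And>l. l \<in> sphere 0 1 \<Longrightarrow> \<gamma> l *v F l = l powi i *s H l"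
    using Zs_imp_poly[OF laurent v] by blast
  define D where "D l = (-1) powi i *s H (- l) - (-1) powi i *s H l" for l
  have "polyvec D" unfolding D_def[abs_def]
    by (intro polyvec_diff polyvec_scale polyvec_reflect F)
  moreover have "D 0 = 0" by (simp add: D_def)
  ultimately obtain E where E: "polyvec E" "\<And>l. D l = l *s E l" by (rule polyvec_divide) blast
  have "\<phi> *v F (- 0) - (-1) powi i *s F 0 \<in> Zs T (i + 1)"
  proof (rule poly_imp_Zs[where F = "\<lambda>l. \<phi> *v F (- l) - (-1) powi i *s F l" and H = E])
    show "polyvec (\<lambda>l. \<phi> *v F (- l) - (-1) powi i *s F l)"
      by (intro polyvec_diff polyvec_mv polyvec_reflect F)
    fix l :: complex assume l: "l \<in> sphere 0 1"
    then have ml: "- l \<in> sphere 0 1" by simp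
    have "\<gamma> l *v (\<phi> *v F (- l)) = (- l) powi i *s H (- l)"
      using F(4)[OF ml] by (simp add: matrix_vector_mul_assoc sym[OF l])
    moreover have "(- l) powi i = l powi i * (-1) powi i"
      by (simp flip: power_int_mult_distrib)
    ultimately have "\<gamma> l *v (\<phi> *v F (- l) - (-1) powi i *s F l) = l powi i *s D l"
      by (simp add: matrix_vector_mult_diff_distrib mv_scale F(4)[OF l] D_def vector_ssub_ldistrib mult.commute)
    also have "\<dots> = l powi (i + 1) *s E l"
      using sphere_nz[OF l] by (simp add: E(2) power_int_add mult.commute)
    finally show "\<gamma> l *v (\<phi> *v F (- l) - (-1) powi i *s F l) = l powi (i + 1) *s E l" .
  qed (rule E)
  then show ?thesis by (simp add: F)
qed

lemma Zs_UNIV':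
  assumes T: "\<And>k. k < i \<Longrightarrow> T k = 0"
  shows "Zs T i = UNIV"
proof -
  have "v \<in> Zs T i" for v
  proof -
    have "(\<lambda>n::int. if n = 0 then v else 0) 0 \<in> Zs T i"
    proof (rule Zs_mem[where f = "\<lambda>n. if n = 0 then v else 0"])
      show "cv T (\<lambda>n. if n = 0 then v else 0) n = 0" if "n < i" for n
        unfolding cv_def by (rule sum.neutral) (use that T in auto)
    qed simp
    then show ?thesis by simp
  qed
  then show ?thesis by auto
qed

text \<open>With nothing below i - 1, the coefficient of \<Phi> f at exponent i - 1 is
  \<open>T (i - 1)\<close> applied to the constant term alone, and here the constant term is
  arbitrary.\<close>

lemma Zs_UNIV_imp_coeff:
  assumes T: "\<And>k. k < i - 1 \<Longrightarrow> T k = 0" and U: "Zs T i = UNIV"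
  shows "T (i - 1) = 0"
proof (cases "i - 1 \<in> {-3..3}")
  case True
  have "T (i - 1) *v v = 0" for v
  proof -
    have "v \<in> Zs T i" using U by simp
    then obtain f where v: "v = f 0" and f: "\<And>n. n < 0 \<Longrightarrow> f n = 0" "\<And>n. n < i \<Longrightarrow> cv T f n = 0"
      by (auto simp: Zs_def)
    have "cv T f (i - 1) = (\<Sum>k\<in>{-3..3}. if k = i - 1 then T (i - 1) *v v else 0)"
      unfolding cv_def
    proof (rule sum.cong[OF refl])
      fix k :: int
      show "T k *v f (i - 1 - k) = (if k = i - 1 then T (i - 1) *v v else 0)"
        using T[of k] f(1)[of "i - 1 - k"] v by (cases "k < i - 1") auto
    qed
    then show ?thesis using f(2)[of "i - 1"] True by simp
  qed
  then show ?thesis by (simp add: matrix_eq)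
qed (rule supp3)

end

section \<open>The extended filtration\<close>

lemma fourier_real:
  assumes "\<And>l. l \<in> sphere 0 1 \<Longrightarrow> cnj (h l) = h l"
  shows "fourier h (- n) = cnj (fourier h n)"
proof -
  have "cnj (cis t) powi (- n) = cis t powi n" for t
    by (simp add: cis_cnj cis_power_int)
  then have "cis t powi n * h (cis t) = cnj (cis t powi (- n) * h (cis t))" for t
    using assms[of "cis t"] by simp
  then have "fourier h (- n) = (LINT t|circ. cnj (cis t powi (- n) * h (cis t)))"
    by (simp add: fourier_def)
  then show ?thesis by (simp only: fourier_def Bochner_Integration.integral_cnj)
qed

lemma sum_roots_of_unity:
  assumes "\<bar>n\<bar> \<le> 6"
  shows "(\<Sum>j<7::nat. cis (2 * pi * real j / 7) powi n) = (if n = 0 then 7 else 0)"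
proof (cases "n = 0")
  case False
  define x where "x = cis (2 * pi * of_int n / 7)"
  have pw: "cis (2 * pi * real j / 7) powi n = x ^ j" for j
  proof -
    have "of_int n * (2 * pi * real j / 7) = real j * (2 * pi * of_int n / 7)" by simp
    then show ?thesis by (simp only: x_def cis_power_int Complex.DeMoivre)
  qed
  have "x \<noteq> 1"
  proof
    assume "x = 1"
    then have "cos (2 * pi * of_int n / 7) = 1" by (simp add: x_def complex_eq_iff)
    then obtain m :: int where "2 * pi * of_int n / 7 = of_int m * 2 * pi"
      using cos_one_2pi_int by blast
    then have "of_int n = (7 * of_int m :: real)" by (simp add: field_simps)
    then have "n = 7 * m" by (metis of_int_eq_iff of_int_mult of_int_numeral)
    then show False using assms False by auto
  qed
  moreover have "x ^ 7 = 1"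
  proof -
    have "real 7 * (2 * pi * of_int n / 7) = 2 * pi * of_int n" by simp
    then have "x ^ 7 = cis (2 * pi * of_int n)" by (simp only: x_def Complex.DeMoivre)
    also have "\<dots> = 1" by (rule cis_multiple_2pi) simp
    finally show ?thesis .
  qed
  ultimately show ?thesis
    using False by (simp add: pw sum_gp_strict)
qed simp

text \<open>Seven coefficients are recovered from the values at the seventh roots of unity, since
  differences of exponents are at most 6. Smoothness of the coefficients thus follows from that of
  \<Phi> at seven fixed parameters, without differentiating under an integral.\<close>

lemma laurent_dft:
  assumes "laurent \<gamma> T" "k \<in> {-3..3}"
  shows "T k = (\<Sum>j<7. cscale (cis (2 * pi * real j / 7) powi (- k) / 7) (\<gamma> (cis (2 * pi * real j / 7))))"
proof -
  define \<zeta> where "\<zeta> j = cis (2 * pi * real j / 7)" for j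
  have "\<zeta> j \<in> sphere 0 1" and \<zeta>0: "\<zeta> j \<noteq> 0" for j by (simp_all add: \<zeta>_def)
  then have "(\<Sum>j<7. cscale (\<zeta> j powi (- k) / 7) (\<gamma> (\<zeta> j))) $ a $ b = T k $ a $ b" for a b
  proof -
    have "(\<Sum>j<7. cscale (\<zeta> j powi (- k) / 7) (\<gamma> (\<zeta> j))) $ a $ b =
        (\<Sum>j<7. \<Sum>m\<in>{-3..3}. T m $ a $ b / 7 * \<zeta> j powi (m - k))"
      using assms(1) \<open>\<And>j. \<zeta> j \<in> sphere 0 1\<close>
      by (simp add: laurent_def sum_distrib_left power_int_diff power_int_minus \<zeta>0 field_simps)
    also have "\<dots> = (\<Sum>m\<in>{-3..3}. T m $ a $ b / 7 * (\<Sum>j<7. \<zeta> j powi (m - k)))"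
      by (subst sum.swap) (simp add: sum_distrib_left)
    also have "\<dots> = (\<Sum>m\<in>{-3..3}. if m = k then T k $ a $ b else 0)"
    proof (rule sum.cong[OF refl])
      fix m :: int assume "m \<in> {-3..3}"
      then have "\<bar>m - k\<bar> \<le> 6" using assms(2) by auto
      then show "T m $ a $ b / 7 * (\<Sum>j<7. \<zeta> j powi (m - k)) = (if m = k then T k $ a $ b else 0)"
        using sum_roots_of_unity[of "m - k"] by (simp add: \<zeta>_def)
    qed
    finally show ?thesis using assms(2) by simp
  qed
  then show ?thesis by (simp add: vec_eq_iff \<zeta>_def)
qed

lemma tendsto_matrix_iff: "(F \<longlongrightarrow> (L::complex^'n^'m)) f \<longleftrightarrow> (\<forall>i j. ((\<lambda>x. F x $ i $ j) \<longlongrightarrow> L $ i $ j) f)"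
proof
  assume "(F \<longlongrightarrow> L) f"
  then show "\<forall>i j. ((\<lambda>x. F x $ i $ j) \<longlongrightarrow> L $ i $ j) f"
    by (intro allI tendsto_vec_nth)
next
  assume "\<forall>i j. ((\<lambda>x. F x $ i $ j) \<longlongrightarrow> L $ i $ j) f"
  then show "(F \<longlongrightarrow> L) f"
    by (intro vec_tendstoI) blast
qed

lemma tendsto_mm:
  fixes F :: "'a \<Rightarrow> complex^'n^'m" and G :: "'a \<Rightarrow> complex^'k^'n"
  shows "(F \<longlongrightarrow> A) f \<Longrightarrow> (G \<longlongrightarrow> B) f \<Longrightarrow> ((\<lambda>x. F x ** G x) \<longlongrightarrow> A ** B) f"
  unfolding tendsto_matrix_iff matrix_matrix_mult_def vec_lambda_beta
  by (intro allI tendsto_sum tendsto_mult) blast+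

lemma tendsto_mcnj: "(F \<longlongrightarrow> (A::complex^'n^'m)) f \<Longrightarrow> ((\<lambda>x. mcnj (F x)) \<longlongrightarrow> mcnj A) f"
  unfolding tendsto_matrix_iff by (auto intro!: tendsto_cnj)

lemma tendsto_mv: "(F \<longlongrightarrow> (A::complex^7^7)) f \<Longrightarrow> ((\<lambda>x. F x *v v) \<longlongrightarrow> A *v v) f"
  unfolding tendsto_matrix_iff matrix_vector_mult_def
  by (rule vec_tendstoI, unfold vec_lambda_beta) (intro tendsto_sum tendsto_mult tendsto_const; blast)

lemma tendsto_cross7: "(F \<longlongrightarrow> v) f \<Longrightarrow> (G \<longlongrightarrow> (w::complex^7)) f \<Longrightarrow> ((\<lambda>x. cross7 (F x) (G x)) \<longlongrightarrow> cross7 v w) f"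
  unfolding cross7_def
  by (rule vec_tendstoI, unfold vec_lambda_beta)
    (intro tendsto_add tendsto_diff tendsto_mult tendsto_vec_nth; assumption)

lemma proj_UNIV: "proj UNIV = mat 1"
  by (rule proj_eqI(2)) simp_all

lemma proj_0: "proj {0} = 0"
proof (rule proj_eqI(2))
  show "adj (0 :: complex^7^7) = 0" by (simp add: vec_eq_iff)
  show "v \<in> {0} \<longleftrightarrow> (0 :: complex^7^7) *v v = v" for v
    unfolding matrix_vector_mult_0 singleton_iff by (rule eq_commute)
  show "(0 :: complex^7^7) ** 0 = 0" by (rule times0_left)
qed

section \<open>Charts and limits at points of a Riemann surface\<close>

locale riemann =
  fixes atlas :: "'m::{t2_space,second_countable_topology} chart set"
  assumes riemann_surface: "riemann_surface atlas"
begin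

lemma chart_exists: obtains U z where "(U, z) \<in> atlas" "p \<in> U"
proof -
  have "p \<in> (\<Union>(U, z)\<in>atlas. U)"
    using riemann_surface unfolding riemann_surface_def by (elim conjE) simp
  then obtain c where "c \<in> atlas" "p \<in> fst c" by (auto simp: split_beta)
  then show thesis using that[of "fst c" "snd c"] by simp
qed

lemma chart:
  assumes "(U, z) \<in> atlas"
  shows "open U" "open (z ` U)" "continuous_on U z" "continuous_on (z ` U) (inv_into U z)" "inj_on z U"
proof -
  have *: "open U \<and> open (z ` U) \<and> homeomorphism U (z ` U) z (inv_into U z)"
  proof -
    have "\<forall>(U, z)\<in>atlas. open U \<and> open (z ` U) \<and> homeomorphism U (z ` U) z (inv_into U z)"
      using riemann_surface unfolding riemann_surface_def by (elim conjE) assumption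
    from bspec[OF this assms] show ?thesis by simp
  qed
  then show "open U" "open (z ` U)" by auto
  show "continuous_on U z" "continuous_on (z ` U) (inv_into U z)"
    using * by (auto simp: homeomorphism_def)
  have "\<forall>x\<in>U. inv_into U z (z x) = x" using * by (auto simp: homeomorphism_def)
  then show "inj_on z U" by (intro inj_on_inverseI[of U "inv_into U z"]) blast
qed

lemma chart_inv:
  assumes "(U, z) \<in> atlas"
  shows "p \<in> U \<Longrightarrow> inv_into U z (z p) = p" "w \<in> z ` U \<Longrightarrow> z (inv_into U z w) = w"
    "w \<in> z ` U \<Longrightarrow> inv_into U z w \<in> U"
  using chart(5)[OF assms] by (auto simp: inv_into_into f_inv_into_f)

text \<open>A chart matches punctured neighbourhoods with punctured neighbourhoods, so limits and
  exceptional points can be treated in the coordinate.\<close>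

lemma filtermap_chart:
  assumes c: "(U, z) \<in> atlas" and p: "p \<in> U"
  shows "filtermap (inv_into U z) (at (z p)) = at p"
proof (rule filtermap_fun_inverse)
  have zp: "z p \<in> z ` U" using p by simp
  show "filterlim (inv_into U z) (at p) (at (z p))"
    unfolding filterlim_at
  proof
    have "isCont (inv_into U z) (z p)"
      using chart(2,4)[OF c] p by (simp add: continuous_on_eq_continuous_at)
    then show "(inv_into U z \<longlongrightarrow> p) (at (z p))"
      using chart_inv(1)[OF c p] by (simp add: isCont_def)
    have "eventually (\<lambda>w. w \<in> z ` U) (at (z p))"
      using chart(2)[OF c] zp by (rule eventually_at_in_open')
    then show "eventually (\<lambda>w. inv_into U z w \<in> UNIV \<and> inv_into U z w \<noteq> p) (at (z p))"
      using eventually_neq_at_within[of "z p" "z p" UNIV]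
    proof eventually_elim
      case (elim w)
      then show ?case using chart_inv(2)[OF c, of w] by auto
    qed
  qed
  show "filterlim z (at (z p)) (at p)"
    unfolding filterlim_at
  proof
    have "isCont z p"
      using chart(1,3)[OF c] p by (simp add: continuous_on_eq_continuous_at)
    then show "(z \<longlongrightarrow> z p) (at p)" by (simp add: isCont_def)
    have "eventually (\<lambda>q. q \<in> U) (at p)"
      using chart(1)[OF c] p by (rule eventually_at_in_open')
    then show "eventually (\<lambda>q. z q \<in> UNIV \<and> z q \<noteq> z p) (at p)"
      using eventually_neq_at_within[of p p UNIV]
    proof eventually_elim
      case (elim q)
      then show ?case using chart(5)[OF c] p by (auto simp: inj_on_def)
    qed
  qed
  have "eventually (\<lambda>q. q \<in> U) (at p)"
    using chart(1)[OF c] p by (rule eventually_at_in_open')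
  then show "eventually (\<lambda>q. inv_into U z (z q) = q) (at p)"
    by eventually_elim (rule chart_inv(1)[OF c])
qed

lemma eventually_chart:
  assumes "(U, z) \<in> atlas" "p \<in> U"
  shows "eventually P (at p) \<longleftrightarrow> eventually (\<lambda>w. P (inv_into U z w)) (at (z p))"
  unfolding filtermap_chart[OF assms, symmetric] eventually_filtermap ..

lemma tendsto_chart:
  assumes "(U, z) \<in> atlas" "p \<in> U"
  shows "(h \<longlongrightarrow> L) (at p) \<longleftrightarrow> ((\<lambda>w. h (inv_into U z w)) \<longlongrightarrow> L) (at (z p))"
  unfolding filtermap_chart[OF assms, symmetric] tendsto_def eventually_filtermap ..

lemma at_neq_bot: "at (p::'m) \<noteq> bot"
proof -
  obtain U z where c: "(U, z) \<in> atlas" "p \<in> U" by (rule chart_exists)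
  show ?thesis unfolding filtermap_chart[OF c, symmetric] by (simp add: filtermap_bot_iff)
qed

lemma tendsto_unique_at: "(h \<longlongrightarrow> (L::'b::t2_space)) (at (p::'m)) \<Longrightarrow> (h \<longlongrightarrow> L') (at p) \<Longrightarrow> L = L'"
  by (rule tendsto_unique[OF at_neq_bot])

text \<open>The principle by which identities between fibres are carried to the exceptional points;
  it rests on the surface having no isolated points.\<close>

lemma eventually_eq_imp_eq:
  assumes "eventually (\<lambda>q. F q = G q) (at (p::'m))" "(F \<longlongrightarrow> (A::'b::t2_space)) (at p)" "(G \<longlongrightarrow> B) (at p)"
  shows "A = B"
  using tendsto_unique_at[OF Lim_transform_eventually[OF assms(2,1)] assms(3)] .

lemma except_isolated_iff: "except_isolated P \<longleftrightarrow> (\<forall>p::'m. eventually P (at p))"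
  by (simp add: except_isolated_def islimpt_iff_eventually)

lemma smooth_map_tendsto:
  fixes F :: "'m \<Rightarrow> 'b::real_normed_vector"
  assumes "smooth_map atlas F"
  shows "(F \<longlongrightarrow> F p) (at p)"
proof -
  obtain U z where c: "(U, z) \<in> atlas" "p \<in> U" by (rule chart_exists)
  have "smooth_on (z ` U) (F \<circ> inv_into U z)" using assms c by (auto simp: smooth_map_def)
  then have "isCont (F \<circ> inv_into U z) (z p)"
    using smooth_on_imp_continuous_on chart(2)[OF c(1)] c(2) by (metis continuous_on_eq_continuous_at imageI)
  then show ?thesis
    unfolding tendsto_chart[OF c] using chart_inv(1)[OF c] by (simp add: isCont_def o_def)
qed

end

section \<open>The extended solution and its coefficients in a chart\<close>

locale lift_setup = riemann atlas
  for atlas :: "'m::{t2_space,second_countable_topology} chart set" +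
  fixes \<phi> :: "'m \<Rightarrow> (complex^7) set" and \<Phi> :: "'m \<Rightarrow> complex \<Rightarrow> complex^7^7" and s :: int
  assumes \<phi>_assoc: "\<phi> p \<in> G2_SO4"
    and extended: "extended_solution atlas \<phi> \<Phi>"
    and polynomial: "polynomial_loops \<Phi>"
    and \<Phi>_minus_1: "\<Phi> p (-1) = cartan (\<phi> p)"
    and symmetric: "symmetric_loops \<Phi>"
    and s: "s \<in> {1, 2, 3}"
    and W: "W_between \<Phi> s"
    and minimal: "W_between \<Phi> k \<Longrightarrow> s \<le> k"
    and nondegenerate: "s = 3 \<Longrightarrow> except_isolated (\<lambda>p. Z_fibre \<Phi> 2 p \<noteq> Z_fibre \<Phi> 3 p)"
begin

text \<open>Defined by Fourier integrals, as the witnesses of \<open>polynomial_loops\<close> range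
  over an interval of arbitrary size; the value 0 outside -3..3 matches the loop locale.\<close>

definition Tc :: "'m \<Rightarrow> int \<Rightarrow> complex^7^7" where
  "Tc p k = (if k \<in> {-3..3} then (\<chi> a b. fourier (\<lambda>l. \<Phi> p l $ a $ b) k / of_real (2 * pi)) else 0)"

lemma \<Phi>_G2: "l \<in> sphere 0 1 \<Longrightarrow> \<Phi> p l \<in> G2" and \<Phi>_1: "\<Phi> p 1 = mat 1"
  using extended by (auto simp: extended_solution_def smooth_loop_map_def based_loop_def)

text \<open>The inclusion of W in \<lambda>^(-s) H_+ kills the coefficients below -s, and reality
  reflects this to those above s. As s \<le> 3, only exponents in -3..3 remain.\<close>

lemma laurent_Tc: "laurent (\<Phi> p) (Tc p)" and Tc_zero: "\<bar>k\<bar> > s \<Longrightarrow> Tc p k = 0"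
proof -
  obtain r T where \<Phi>: "\<And>p l. l \<in> sphere 0 1 \<Longrightarrow> \<Phi> p l = (\<Sum>k\<in>{-int r..int r}. cscale (l powi k) (T k p))"
    using polynomial unfolding polynomial_loops_def by blast
  have f: "fourier (\<lambda>l. \<Phi> p l $ a $ b) k = of_real (2 * pi) * (if k \<in> {-int r..int r} then T k p $ a $ b else 0)" for a b k
    by (rule fourier_trig) (simp_all add: \<Phi> mult.commute)
  have low: "T k p = 0" if "k \<in> {-int r..int r}" "k < - s" for k
    by (rule W_between_coeff[OF W _ \<Phi> that]) auto
  have real: "fourier (\<lambda>l. \<Phi> p l $ a $ b) (- k) = cnj (fourier (\<lambda>l. \<Phi> p l $ a $ b) k)" for a b k
    by (rule fourier_real) (metis G2_real \<Phi>_G2 mcnj_nth)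
  have zero: "fourier (\<lambda>l. \<Phi> p l $ a $ b) k = 0" if "\<bar>k\<bar> > s" for a b k
  proof (cases "k < - s")
    case True
    then show ?thesis unfolding f using low[of k] by auto
  next
    case False
    then have "- k < - s" using that by simp
    then have "fourier (\<lambda>l. \<Phi> p l $ a $ b) (- k) = 0" unfolding f using low[of "- k"] by auto
    then show ?thesis using real by simp
  qed
  show "Tc p k = 0" if "\<bar>k\<bar> > s" for k
    using zero[OF that] by (simp add: Tc_def vec_eq_iff)
  show "laurent (\<Phi> p) (Tc p)"
    unfolding laurent_def
  proof
    fix l :: complex assume l: "l \<in> sphere 0 1"
    have T0: "T k p = 0" if "k \<in> {-int r..int r}" "\<bar>k\<bar> > s" for k
      using zero[OF that(2)] that(1) f by (simp add: vec_eq_iff)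
    have eq: "cscale (l powi k) (T k p) = cscale (l powi k) (Tc p k)" if "k \<in> {-int r..int r}" for k
    proof (cases "k \<in> {-3..3}")
      case True
      then show ?thesis using that f by (simp add: Tc_def vec_eq_iff)
    next
      case False
      then have "\<bar>k\<bar> > s" using s by auto
      moreover have "Tc p k = 0" using False by (simp only: Tc_def if_False)
      ultimately show ?thesis using T0[OF that] by simp
    qed
    have "\<Phi> p l = (\<Sum>k\<in>{-int r..int r}. cscale (l powi k) (Tc p k))"
      unfolding \<Phi>[OF l] by (rule sum.cong[OF refl eq])
    also have "\<dots> = (\<Sum>k\<in>{-int r..int r} \<union> {-3..3}. cscale (l powi k) (Tc p k))"
    proof (rule sum.mono_neutral_left)
      show "\<forall>k\<in>{-int r..int r} \<union> {-3..3} - {-int r..int r}. cscale (l powi k) (Tc p k) = 0"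
      proof
        fix k assume "k \<in> {-int r..int r} \<union> {-3..3} - {-int r..int r}"
        then have "k \<notin> {-int r..int r}" by blast
        then have "fourier (\<lambda>l. \<Phi> p l $ a $ b) k = 0" for a b
          unfolding f by (simp only: if_False mult_zero_right)
        then show "cscale (l powi k) (Tc p k) = 0" by (simp add: Tc_def vec_eq_iff)
      qed
    qed auto
    also have "\<dots> = (\<Sum>k\<in>{-3..3}. cscale (l powi k) (Tc p k))"
    proof (rule sum.mono_neutral_right)
      show "\<forall>k\<in>{-int r..int r} \<union> {-3..3} - {-3..3}. cscale (l powi k) (Tc p k) = 0"
      proof
        fix k :: int assume "k \<in> {-int r..int r} \<union> {-3..3} - {-3..3}"
        then have "k \<notin> {-3..3}" by blast
        then have "Tc p k = 0" by (simp only: Tc_def if_False)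
        then show "cscale (l powi k) (Tc p k) = 0" by (simp add: vec_eq_iff)
      qed
    qed auto
    finally show "\<Phi> p l = (\<Sum>k\<in>{-3..3}. cscale (l powi k) (Tc p k))" .
  qed
qed

sublocale loop: g2_loop "\<Phi> p" "Tc p" for p
proof
  show "laurent (\<Phi> p) (Tc p)" by (rule laurent_Tc)
  show "Tc p k = 0" if "k \<notin> {-3..3}" for k using that by (simp only: Tc_def if_False)
  show "\<Phi> p l \<in> G2" if "l \<in> sphere 0 1" for l by (rule \<Phi>_G2[OF that])
qed

abbreviation C :: "'m \<Rightarrow> complex^7^7" where
  "C p \<equiv> cartan (\<phi> p)"

lemma sym: "l \<in> sphere 0 1 \<Longrightarrow> \<Phi> p (- l) = \<Phi> p l ** C p"
  using symmetric by (simp add: symmetric_loops_def \<Phi>_minus_1)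

lemma C_involution: "C p ** C p = mat 1"
  using sym[of "-1" p] by (simp add: \<Phi>_minus_1 \<Phi>_1)

lemma C_G2: "C p \<in> G2"
  using \<Phi>_G2[of "-1" p] by (simp add: \<Phi>_minus_1)

lemma C_transpose: "transpose (C p) = C p"
proof -
  have "transpose (C p) = transpose (C p) ** (C p ** C p)" by (simp add: C_involution)
  also have "\<dots> = C p" by (simp add: matrix_mul_assoc G2_orthogonal[OF C_G2])
  finally show ?thesis .
qed

lemma C_adj: "adj (C p) = C p"
  by (simp add: adj_eq_mcnj_transpose(1) C_transpose G2_real[OF C_G2])

lemma C_inv: "matrix_inv (C p) = C p"
  by (rule matrix_inv_unique(1)[OF C_involution])

lemma smooth_\<Phi>:
  assumes c: "(U, z) \<in> atlas" and l: "l \<in> sphere 0 1"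
  shows "smooth_on (z ` U) (\<lambda>w. \<Phi> (inv_into U z w) l)"
proof -
  obtain t where t: "l = cis t" using l using complex_norm_eq_1_exp[of l] that[of "Arg2pi l"] l by (simp add: cis_conv_exp)
  have "smooth_on (z ` U \<times> (UNIV :: real set)) (\<lambda>(w, t). \<Phi> (inv_into U z w) (cis t))"
    using extended c unfolding extended_solution_def smooth_loop_map_def by blast
  from smooth_on_slice[OF chart(2)[OF c] this, of t] show ?thesis by (simp add: t)
qed

lemma smooth_C:
  assumes "(U, z) \<in> atlas"
  shows "smooth_on (z ` U) (\<lambda>w. C (inv_into U z w))"
  using smooth_\<Phi>[OF assms, of "-1"] by (simp add: \<Phi>_minus_1)

lemma smooth_cscale:
  fixes F :: "complex \<Rightarrow> complex^7^7"
  assumes "open S" "smooth_on S F"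
  shows "smooth_on S (\<lambda>w. cscale a (F w))"
  using assms by (simp add: smooth_on_matrix_iff smooth_on_mult smooth_on_const)

lemma smooth_Tc:
  assumes c: "(U, z) \<in> atlas"
  shows "smooth_on (z ` U) (\<lambda>w. Tc (inv_into U z w) k)"
proof (cases "k \<in> {-3..3}")
  case True
  show ?thesis
    unfolding laurent_dft[OF laurent_Tc True]
    by (intro smooth_on_sum smooth_cscale smooth_\<Phi> c chart(2)[OF c]) auto
next
  case False
  then have "(\<lambda>w. Tc (inv_into U z w) k) = (\<lambda>w. 0)" by (simp only: Tc_def if_False)
  then show ?thesis using smooth_on_const[OF chart(2)[OF c]] by simp
qed

lemma mdiff_cscale: "mdiff F w \<Longrightarrow> mdiff (\<lambda>w. cscale a (F w)) w"
  by (simp add: mdiff_def differentiable_mult)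

lemma mz_cscale:
  assumes "mdiff F w"
  shows "mz (\<lambda>w. cscale a (F w)) w = cscale a (mz F w)" "mzb (\<lambda>w. cscale a (F w)) w = cscale a (mzb F w)"
  using assms by (simp_all add: mdiff_def mz_def mzb_def vec_eq_iff wirtinger_rules wirtinger_const)

text \<open>The parameter \<open>e\<close> covers both equations: e = 1 belongs to the factor 1 -
  \<lambda>^-1 of the z-derivative, e = -1 to the factor 1 - \<lambda> of the conjugate one.\<close>

lemma coefficient_comparison:
  assumes l: "\<And>l. l \<in> sphere 0 1 \<Longrightarrow>
      (\<Sum>k\<in>{-3..3}. cscale (l powi k) (D k)) = (\<Sum>k\<in>{-3..3}. cscale (l powi k) (t k)) ** cscale (1 - l powi (- e)) A"
    and D: "\<And>k. k \<notin> {-3..3} \<Longrightarrow> D k = 0" and t: "\<And>k. k \<notin> {-3..3} \<Longrightarrow> t k = 0" and e: "e \<in> {-1, 1}"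
  shows "D k = t k ** A - t (k + e) ** A"
proof (cases "k \<in> {-4..4}")
  case True
  have "(\<Sum>k\<in>{-4..4}. D k $ a $ b * l powi k) = (\<Sum>k\<in>{-4..4}. (t k ** A - t (k + e) ** A) $ a $ b * l powi k)"
    if ll: "l \<in> sphere 0 1" for l a b
  proof -
    have l0: "l \<noteq> 0" using sphere_nz[OF ll] .
    have tA: "(t k ** A) = 0" if "k \<notin> {-3..3}" for k using t[OF that] by simp
    have "(\<Sum>k\<in>{-4..4}. D k $ a $ b * l powi k) = (\<Sum>k\<in>{-3..3}. D k $ a $ b * l powi k)"
      by (rule sum.mono_neutral_right) (use D in auto)
    also have "\<dots> = ((\<Sum>k\<in>{-3..3}. cscale (l powi k) (t k)) ** cscale (1 - l powi (- e)) A) $ a $ b"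
      unfolding l[OF ll, symmetric] by (simp add: mult.commute)
    also have "\<dots> = (\<Sum>k\<in>{-3..3}. (t k ** A) $ a $ b * l powi k) - (\<Sum>k\<in>{-3..3}. (t k ** A) $ a $ b * l powi (k - e))"
      unfolding sum_mm cscale_mult
      by (simp add: algebra_simps sum_subtractf power_int_diff power_int_minus l0 divide_inverse)
    also have "(\<Sum>k\<in>{-3..3}. (t k ** A) $ a $ b * l powi k) = (\<Sum>k\<in>{-4..4}. (t k ** A) $ a $ b * l powi k)"
      by (rule sum.mono_neutral_left) (use tA in auto)
    also have "(\<Sum>k\<in>{-3..3}. (t k ** A) $ a $ b * l powi (k - e)) =
        (\<Sum>k\<in>{-4..4}. (t (k + e) ** A) $ a $ b * l powi (k + e - e))"
    proof (rule sum_int_shift)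
      show "(t k ** A) $ a $ b * l powi (k - e) = 0" if "k \<notin> {-3..3}" for k
        unfolding tA[OF that] by simp
      show "(t k ** A) $ a $ b * l powi (k - e) = 0" if "k - e \<notin> {-4..4}" for k
      proof -
        have "k \<notin> {-3..3}" using that e by auto
        from tA[OF this] show ?thesis by simp
      qed
    qed auto
    finally show ?thesis by (simp add: sum_subtractf left_diff_distrib)
  qed
  from laurent_unique[OF _ this True] show ?thesis by (simp add: vec_eq_iff)
next
  case False
  then have "D k = 0" "t k = 0" "t (k + e) = 0" using e by (auto intro!: D t)
  then show ?thesis by simp
qed

lemma chart_field:
  assumes c: "(U, z) \<in> atlas"
  shows "loop_field (z ` U) (\<lambda>k w. Tc (inv_into U z w) k)
    (\<lambda>w. A_z (U, z) \<phi> (inv_into U z w)) (\<lambda>w. A_zbar (U, z) \<phi> (inv_into U z w))"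
proof (rule loop_field.intro)
  let ?inv = "inv_into U z"
  show open_\<Omega>: "open (z ` U)" by (rule chart(2)[OF c])
  show "loop_coeffs (\<lambda>k. Tc (?inv w) k)" for w
    using loop.loop_coeffs_axioms[of "?inv w"] .
  show smooth: "smooth_on (z ` U) (\<lambda>w. Tc (?inv w) k)" for k by (rule smooth_Tc[OF c])
  fix w assume w: "w \<in> z ` U"
  have zw: "z (?inv w) = w" and wU: "?inv w \<in> U" using chart_inv[OF c] w by auto
  have dT: "mdiff (\<lambda>w. Tc (?inv w) k) w" for k by (rule smooth_on_imp_mdiff[OF open_\<Omega> smooth w])
  have \<Phi>_eq: "\<Phi> (?inv w) l = (\<Sum>k\<in>{-3..3}. cscale (l powi k) (Tc (?inv w) k))" if "l \<in> sphere 0 1" for l w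
    using laurent_Tc that by (simp add: laurent_def)
  have d: "mz (\<lambda>w. \<Phi> (?inv w) l) w = (\<Sum>k\<in>{-3..3}. cscale (l powi k) (mz (\<lambda>w. Tc (?inv w) k) w))"
    "mzb (\<lambda>w. \<Phi> (?inv w) l) w = (\<Sum>k\<in>{-3..3}. cscale (l powi k) (mzb (\<lambda>w. Tc (?inv w) k) w))"
    if "l \<in> sphere 0 1" for l
    unfolding \<Phi>_eq[OF that] by (simp_all add: mz_sum mdiff_cscale dT mz_cscale)
  have ext: "matrix_inv (\<Phi> (?inv w) l) ** mz (\<lambda>w. \<Phi> (?inv w) l) w = cscale (1 - inverse l) (A_z (U, z) \<phi> (?inv w))"
    "matrix_inv (\<Phi> (?inv w) l) ** mzb (\<lambda>w. \<Phi> (?inv w) l) w = cscale (1 - l) (A_zbar (U, z) \<phi> (?inv w))"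
    if "l \<in> sphere 0 1" for l
  proof -
    have "matrix_inv (\<Phi> p l) ** dz (U, z) (\<lambda>q. \<Phi> q l) p = cscale (1 - inverse l) (A_z (U, z) \<phi> p) \<and>
        matrix_inv (\<Phi> p l) ** dzbar (U, z) (\<lambda>q. \<Phi> q l) p = cscale (1 - l) (A_zbar (U, z) \<phi> p)" if "p \<in> U" for p
      using extended c that \<open>l \<in> sphere 0 1\<close> unfolding extended_solution_def by blast
    from this[OF wU] show "matrix_inv (\<Phi> (?inv w) l) ** mz (\<lambda>w. \<Phi> (?inv w) l) w = cscale (1 - inverse l) (A_z (U, z) \<phi> (?inv w))"
      "matrix_inv (\<Phi> (?inv w) l) ** mzb (\<lambda>w. \<Phi> (?inv w) l) w = cscale (1 - l) (A_zbar (U, z) \<phi> (?inv w))"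
      by (simp_all add: dz_eq_mz dzbar_eq_mzb zw)
  qed
  have cancel: "X = \<Phi> p l ** Y" if "matrix_inv (\<Phi> p l) ** X = Y" "l \<in> sphere 0 1" for p l X Y
  proof -
    have "\<Phi> p l ** (matrix_inv (\<Phi> p l) ** X) = \<Phi> p l ** Y" using that by simp
    then show ?thesis by (simp add: matrix_mul_assoc matrix_inv_mult loop.det_loop[OF that(2)])
  qed
  have zero: "mz (\<lambda>w. Tc (?inv w) k) w = 0" "mzb (\<lambda>w. Tc (?inv w) k) w = 0" if "k \<notin> {-3..3}" for k
    using loop.supp3[OF that] by simp_all
  show "mz (\<lambda>w. Tc (?inv w) k) w = Tc (?inv w) k ** A_z (U, z) \<phi> (?inv w) - Tc (?inv w) (k + 1) ** A_z (U, z) \<phi> (?inv w)" for k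
  proof (rule coefficient_comparison)
    fix l :: complex assume l: "l \<in> sphere 0 1"
    show "(\<Sum>k\<in>{-3..3}. cscale (l powi k) (mz (\<lambda>w. Tc (?inv w) k) w)) =
        (\<Sum>k\<in>{-3..3}. cscale (l powi k) (Tc (?inv w) k)) ** cscale (1 - l powi (- 1)) (A_z (U, z) \<phi> (?inv w))"
      unfolding d(1)[OF l, symmetric] \<Phi>_eq[OF l, symmetric] using cancel[OF ext(1)[OF l] l] by simp
  qed (use zero loop.supp3 in auto)
  have "mzb (\<lambda>w. Tc (?inv w) k) w = Tc (?inv w) k ** A_zbar (U, z) \<phi> (?inv w) - Tc (?inv w) (k + - 1) ** A_zbar (U, z) \<phi> (?inv w)" for k
  proof (rule coefficient_comparison)
    fix l :: complex assume l: "l \<in> sphere 0 1"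
    show "(\<Sum>k\<in>{-3..3}. cscale (l powi k) (mzb (\<lambda>w. Tc (?inv w) k) w)) =
        (\<Sum>k\<in>{-3..3}. cscale (l powi k) (Tc (?inv w) k)) ** cscale (1 - l powi (- (- 1))) (A_zbar (U, z) \<phi> (?inv w))"
      unfolding d(2)[OF l, symmetric] \<Phi>_eq[OF l, symmetric] using cancel[OF ext(2)[OF l] l] by simp
  qed (use zero loop.supp3 in auto)
  then show "mzb (\<lambda>w. Tc (?inv w) k) w = Tc (?inv w) k ** A_zbar (U, z) \<phi> (?inv w) - Tc (?inv w) (k - 1) ** A_zbar (U, z) \<phi> (?inv w)" for k
    by simp
  \<comment> \<open>\<open>C\<close> is a symmetric involution: differentiating C C = 1 makes
    \<open>C\<close> anticommute with its derivative, and transposition reverses their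
    product.\<close>
  show "transpose (A_zbar (U, z) \<phi> (?inv w)) = - A_zbar (U, z) \<phi> (?inv w)"
  proof -
    define F where "F w = C (?inv w)" for w
    have dF: "mdiff F w" unfolding F_def by (rule smooth_on_imp_mdiff[OF open_\<Omega> smooth_C[OF c] w])
    have A: "A_zbar (U, z) \<phi> (?inv w) = (1/2) *\<^sub>R (F w ** mzb F w)"
      by (simp add: A_zbar_def C_inv dzbar_eq_mzb zw F_def[abs_def])
    have "mzb (\<lambda>w. F w ** F w) w = 0" by (simp add: F_def C_involution)
    then have anti: "mzb F w ** F w = - (F w ** mzb F w)"
      using dF by (simp add: mz_mult eq_neg_iff_add_eq_0)
    have tr: "transpose (mzb F w) = mzb F w"
      unfolding mz_transpose(2)[symmetric] by (simp add: F_def[abs_def] C_transpose)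
    have "transpose (F w ** mzb F w) = mzb F w ** F w"
      by (simp add: matrix_transpose_mul tr) (simp add: F_def C_transpose)
    then show ?thesis unfolding A transpose_scalar by (simp add: anti)
  qed
qed

end

lemma tendsto_mv':
  assumes "(F \<longlongrightarrow> (A::complex^7^7)) f" "(g \<longlongrightarrow> v) f"
  shows "((\<lambda>x. F x *v g x) \<longlongrightarrow> A *v v) f"
proof (rule vec_tendstoI)
  fix a
  have "((\<lambda>x. F x $ a $ b) \<longlongrightarrow> A $ a $ b) f" for b using assms(1) by (simp add: tendsto_matrix_iff)
  then show "((\<lambda>x. (F x *v g x) $ a) \<longlongrightarrow> (A *v v) $ a) f"
    unfolding matrix_vector_mult_def vec_lambda_beta
    by (intro tendsto_sum tendsto_mult tendsto_vec_nth[OF assms(2)])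
qed

text \<open>A self-adjoint operator preserving \<open>V\<close> also preserves its orthogonal
  complement.\<close>

lemma symmetric_invariant_commute:
  assumes V: "vec.subspace V" and inv: "\<And>v. v \<in> V \<Longrightarrow> A *v v \<in> V" and A: "adj A = A"
  shows "A ** proj V = proj V ** A"
proof -
  have "proj V *v (A *v (proj V *v v)) = A *v (proj V *v v)" for v
    by (rule proj_id[OF V]) (intro inv proj_in V)
  then have *: "proj V ** A ** proj V = A ** proj V"
    by (simp add: matrix_eq matrix_vector_mul_assoc matrix_mul_assoc)
  then have "adj (proj V ** A ** proj V) = adj (A ** proj V)" by simp
  then have "proj V ** A ** proj V = proj V ** A"
    by (simp add: adj_mult proj_adj[OF V] A matrix_mul_assoc)
  then show ?thesis using * by simp
qed

section \<open>Extension of the filtration over the exceptional points\<close>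

context lift_setup
begin

text \<open>The extension is defined as a limit of projections, independently of charts and frames.
  This also makes it coincide with any other continuous extension.\<close>

definition Zt :: "int \<Rightarrow> 'm \<Rightarrow> (complex^7) set" where
  "Zt i p = (THE V. vec.subspace V \<and> ((\<lambda>q. proj (Z_fibre \<Phi> i q)) \<longlongrightarrow> proj V) (at p))"

abbreviation P :: "int \<Rightarrow> 'm \<Rightarrow> complex^7^7" where
  "P i p \<equiv> proj (Zt i p)"

lemma fibre_eq: "Z_fibre \<Phi> i p = Zs (Tc p) i"
  by (rule loop.Z_fibre_eq) simp

text \<open>The filtration is constant outside -3..4, so the local result for indices in that range
  covers all integers.\<close>

lemma fibre_clamp: "Z_fibre \<Phi> i p = Z_fibre \<Phi> (max (-3) (min 4 i)) p"
proof -
  consider "i < -3" | "i > 4" | "i \<in> {-3..4}" by force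
  then show ?thesis
  proof cases
    case 1
    then show ?thesis by (simp add: fibre_eq Zs_UNIV)
  next
    case 2
    then show ?thesis using loop.Zs_zero[of i p] loop.Zs_zero[of 4 p] by (simp add: fibre_eq)
  next
    case 3
    then have "max (-3) (min 4 i) = i" by auto
    then show ?thesis by simp
  qed
qed

lemma Zt_eqI:
  assumes "vec.subspace V" "((\<lambda>q. proj (Z_fibre \<Phi> i q)) \<longlongrightarrow> proj V) (at p)"
  shows "Zt i p = V"
  unfolding Zt_def
proof (rule the_equality)
  fix W assume W: "vec.subspace W \<and> ((\<lambda>q. proj (Z_fibre \<Phi> i q)) \<longlongrightarrow> proj W) (at p)"
  then have "proj W = proj V" using tendsto_unique_at[OF _ assms(2)] by blast
  then show "W = V" using proj_inject[of W V] W assms(1) by blast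
qed (use assms in blast)

text \<open>Applies the local structure at index 1 - j to obtain a frame of the term j. Since
  \<open>M\<close> is invertible on the whole disc, its selected columns span a continuous family,
  which must be the limit of the fibres at every point, the centre included.\<close>

lemma local_frame:
  assumes c: "(U, z) \<in> atlas" and w0: "w0 \<in> z ` U"
  obtains r M I where "r > 0" "ball w0 r \<subseteq> z ` U" "smooth_on (ball w0 r) M"
    "\<And>w. w \<in> ball w0 r \<Longrightarrow> det (M w) \<noteq> 0"
    "\<And>w. w \<in> ball w0 r \<Longrightarrow> mzb M w = - (A_zbar (U, z) \<phi> (inv_into U z w) ** M w)"
    "\<And>w. w \<in> ball w0 r - {w0} \<Longrightarrow> Z_fibre \<Phi> i (inv_into U z w) = cspan (M w) I"
    "\<And>w. w \<in> ball w0 r \<Longrightarrow> Zt i (inv_into U z w) = cspan (M w) I"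
proof -
  define j where "j = max (-3) (min 4 i)"
  have j: "1 - j \<in> {-3..4}" by (auto simp: j_def)
  obtain r M I where r: "r > 0" "ball w0 r \<subseteq> z ` U" and M: "smooth_on (ball w0 r) M"
    "\<And>w. w \<in> ball w0 r \<Longrightarrow> det (M w) \<noteq> 0"
    "\<And>w. w \<in> ball w0 r \<Longrightarrow> mzb M w = - (A_zbar (U, z) \<phi> (inv_into U z w) ** M w)"
    and Zs: "\<And>w. w \<in> ball w0 r - {w0} \<Longrightarrow> Zs (\<lambda>k. Tc (inv_into U z w) k) (1 - (1 - j)) = cspan (M w) I"
    by (rule loop_field.local_structure[OF chart_field[OF c] w0 j]) (rule that; assumption)
  have X: "Z_fibre \<Phi> i (inv_into U z w) = cspan (M w) I" if "w \<in> ball w0 r - {w0}" for w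
    using Zs[OF that] fibre_clamp[of i "inv_into U z w"] by (simp add: fibre_eq flip: j_def)
  have smooth: "smooth_on (ball w0 r) (\<lambda>w. proj (cspan (M w) I))"
    by (rule smooth_on_proj_cspan(2)[OF open_ball M(1,2)])
  have "Zt i (inv_into U z w1) = cspan (M w1) I" if w1: "w1 \<in> ball w0 r" for w1
  proof (rule Zt_eqI[OF subspace_cspan])
    have pU: "inv_into U z w1 \<in> U" and zp: "z (inv_into U z w1) = w1" using chart_inv[OF c] w1 r by auto
    have "isCont (\<lambda>w. proj (cspan (M w) I)) w1"
      using smooth_on_imp_continuous_on[OF smooth] w1 continuous_on_eq_continuous_at[OF open_ball] by blast
    then have lim: "((\<lambda>w. proj (cspan (M w) I)) \<longlongrightarrow> proj (cspan (M w1) I)) (at w1)"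
      by (simp add: isCont_def)
    have "eventually (\<lambda>w. w \<in> ball w0 r - {w0}) (at w1)"
    proof (cases "w1 = w0")
      case True
      have "eventually (\<lambda>w. w \<in> ball w0 r) (at w1)" by (rule eventually_at_in_open'[OF open_ball w1])
      then show ?thesis using eventually_neq_at_within[of w1 w1 UNIV]
        by eventually_elim (simp add: True)
    next
      case False
      then show ?thesis using w1 by (intro eventually_at_in_open') auto
    qed
    then have "eventually (\<lambda>w. proj (cspan (M w) I) = proj (Z_fibre \<Phi> i (inv_into U z w))) (at w1)"
      by eventually_elim (simp add: X)
    from Lim_transform_eventually[OF lim this]
    show "((\<lambda>q. proj (Z_fibre \<Phi> i q)) \<longlongrightarrow> proj (cspan (M w1) I)) (at (inv_into U z w1))"
      unfolding tendsto_chart[OF c pU] zp .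
  qed
  from that[OF r M X this] show thesis .
qed

lemma subspace_Zt: "vec.subspace (Zt i p)"
proof -
  obtain U z where c: "(U, z) \<in> atlas" "p \<in> U" by (rule chart_exists)
  then have zp: "z p \<in> z ` U" by simp
  obtain r M and I :: "7 set" where "r > 0" "\<And>w. w \<in> ball (z p) r \<Longrightarrow> Zt i (inv_into U z w) = cspan (M w) I"
    by (rule local_frame[OF c(1) zp, of i]) (rule that; assumption)
  then have "Zt i p = cspan (M (z p)) I" using chart_inv(1)[OF c] by (metis centre_in_ball)
  then show ?thesis by (simp add: subspace_cspan)
qed

lemma smooth_map_P: "smooth_map atlas (P i)"
  unfolding smooth_map_def
proof safe
  fix U z assume c: "(U, z) \<in> atlas"
  show "smooth_on (z ` U) (P i \<circ> inv_into U z)"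
  proof (rule smooth_on_local)
    fix w0 assume w0: "w0 \<in> z ` U"
    obtain r M I where r: "r > 0" and M: "smooth_on (ball w0 r) M" "\<And>w. w \<in> ball w0 r \<Longrightarrow> det (M w) \<noteq> 0"
      and Zt: "\<And>w. w \<in> ball w0 r \<Longrightarrow> Zt i (inv_into U z w) = cspan (M w) I"
      by (rule local_frame[OF c w0, of i]) (rule that; assumption)
    have "smooth_on (ball w0 r) (P i \<circ> inv_into U z) \<longleftrightarrow> smooth_on (ball w0 r) (\<lambda>w. proj (cspan (M w) I))"
      by (rule smooth_on_cong[OF open_ball]) (simp add: Zt)
    then have "smooth_on (ball w0 r) (P i \<circ> inv_into U z)"
      using smooth_on_proj_cspan(2)[OF open_ball M] by blast
    then show "\<exists>T. open T \<and> w0 \<in> T \<and> smooth_on T (P i \<circ> inv_into U z)"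
      using r by (intro exI[of _ "ball w0 r"]) simp
  qed
qed

lemma tendsto_P: "(P i \<longlongrightarrow> P i p) (at p)"
  by (rule smooth_map_tendsto[OF smooth_map_P])

lemma Zt_local:
  shows eventually_Zt_eq: "eventually (\<lambda>q. Zt i q = Z_fibre \<Phi> i q) (at p)"
    and eventually_dim_Zt: "eventually (\<lambda>q. vec.dim (Zt i p) = vec.dim (Zt i q)) (at p)"
proof -
  obtain U z where c: "(U, z) \<in> atlas" "p \<in> U" by (rule chart_exists)
  then have zp: "z p \<in> z ` U" by simp
  obtain r M I where r: "r > 0" and det: "\<And>w. w \<in> ball (z p) r \<Longrightarrow> det (M w) \<noteq> 0"
    and X: "\<And>w. w \<in> ball (z p) r - {z p} \<Longrightarrow> Z_fibre \<Phi> i (inv_into U z w) = cspan (M w) I"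
    and Zt: "\<And>w. w \<in> ball (z p) r \<Longrightarrow> Zt i (inv_into U z w) = cspan (M w) I"
    by (rule local_frame[OF c(1) zp, of i]) (rule that; assumption)
  have ev: "eventually (\<lambda>w. w \<in> ball (z p) r) (at (z p))"
    using r by (intro eventually_at_in_open') auto
  show "eventually (\<lambda>q. Zt i q = Z_fibre \<Phi> i q) (at p)"
    unfolding eventually_chart[OF c]
    using ev eventually_neq_at_within[of "z p" "z p" UNIV] by eventually_elim (simp add: X Zt)
  have dim: "vec.dim (Zt i (inv_into U z w)) = card I" if "w \<in> ball (z p) r" for w
    by (simp add: Zt[OF that] dim_cspan[OF det[OF that]])
  have dim0: "vec.dim (Zt i p) = card I" using dim[of "z p"] r chart_inv(1)[OF c] by simp
  show "eventually (\<lambda>q. vec.dim (Zt i p) = vec.dim (Zt i q)) (at p)"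
    unfolding eventually_chart[OF c] using ev by eventually_elim (simp add: dim dim0)
qed

lemma dim_Zt_const: "vec.dim (Zt i p) = vec.dim (Zt i q)"
proof (rule connected_local_const[of UNIV p q "\<lambda>p. vec.dim (Zt i p)"])
  show "connected (UNIV :: 'm set)"
    using riemann_surface unfolding riemann_surface_def by (elim conjE) assumption
qed (use eventually_dim_Zt in auto)

lemma Zt_flat:
  assumes c: "(U, z) \<in> atlas" and w: "w \<in> z ` U"
  shows "(mat 1 - P i (inv_into U z w)) **
    (mzb (\<lambda>w. P i (inv_into U z w)) w + A_zbar (U, z) \<phi> (inv_into U z w) ** P i (inv_into U z w)) = 0"
proof -
  obtain r M I where r: "r > 0" and M: "smooth_on (ball w r) M" "\<And>y. y \<in> ball w r \<Longrightarrow> det (M y) \<noteq> 0"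
    "\<And>y. y \<in> ball w r \<Longrightarrow> mzb M y = - (A_zbar (U, z) \<phi> (inv_into U z y) ** M y)"
    and Zt: "\<And>y. y \<in> ball w r \<Longrightarrow> Zt i (inv_into U z y) = cspan (M y) I"
    by (rule local_frame[OF c w, of i]) (rule that; assumption)
  have wr: "w \<in> ball w r" using r by simp
  have "mzb (\<lambda>w. P i (inv_into U z w)) w = mzb (\<lambda>y. proj (cspan (M y) I)) w"
    by (rule mz_cong[OF open_ball wr]) (simp add: Zt)
  then show ?thesis
    using flat_frame_proj[OF open_ball M wr, of I] by (simp add: Zt[OF wr])
qed

lemma fibre_shift:
  assumes c: "(U, z) \<in> atlas" "p \<in> U"
  shows "eventually (\<lambda>w. \<forall>v\<in>Z_fibre \<Phi> i (inv_into U z w).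
    A_z (U, z) \<phi> (inv_into U z w) *v v \<in> Z_fibre \<Phi> (i + 1) (inv_into U z w)) (at (z p))"
proof (cases "i \<in> {-3..4}")
  case True
  have zp: "z p \<in> z ` U" using c by simp
  obtain r where r: "r > 0" and shift: "\<And>w v. w \<in> ball (z p) r - {z p} \<Longrightarrow> v \<in> Zs (\<lambda>k. Tc (inv_into U z w) k) i \<Longrightarrow>
      A_z (U, z) \<phi> (inv_into U z w) *v v \<in> Zs (\<lambda>k. Tc (inv_into U z w) k) (i + 1)"
    by (rule loop_field.local_structure[OF chart_field[OF c(1)] zp True]) (rule that; assumption)
  have "eventually (\<lambda>w. w \<in> ball (z p) r) (at (z p))"
    using r by (intro eventually_at_in_open') auto
  then show ?thesis
    using eventually_neq_at_within[of "z p" "z p" UNIV]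
    by eventually_elim (use shift in \<open>simp add: fibre_eq\<close>)
next
  case False
  then consider "i < -3" | "i > 4" by force
  then show ?thesis
  proof cases
    case 1
    then show ?thesis by (intro always_eventually) (simp add: fibre_eq Zs_UNIV)
  next
    case 2
    then show ?thesis by (intro always_eventually) (simp add: fibre_eq loop.Zs_zero)
  qed
qed

lemma fibre_subspace: "vec.subspace (Z_fibre \<Phi> i p)"
  by (simp add: fibre_eq subspace_Zs)

lemma fibre_antimono: "i \<le> j \<Longrightarrow> Z_fibre \<Phi> j p \<subseteq> Z_fibre \<Phi> i p"
  by (simp add: fibre_eq Zs_antimono)

lemma fibre_low: "i \<le> - s \<Longrightarrow> Z_fibre \<Phi> i p = UNIV"
  unfolding fibre_eq by (rule loop.Zs_UNIV') (use Tc_zero s in auto)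

text \<open>The annihilator for the bilinear product is the conjugate of the Hermitian complement;
  this turns duality into an identity between projections, which survives limits.\<close>

lemma fibre_polar: "proj (Z_fibre \<Phi> (1 - i) p) = mat 1 - mcnj (proj (Z_fibre \<Phi> i p))"
proof (cases "1 - i \<le> 4")
  case True
  have "Z_fibre \<Phi> (1 - i) p = vcnj ` perp (Z_fibre \<Phi> i p)"
  proof -
    have "v \<in> Zs (Tc p) (1 - i) \<longleftrightarrow> vcnj v \<in> perp (Zs (Tc p) i)" for v
    proof -
      have "v \<in> Zs (Tc p) (1 - i) \<longleftrightarrow> (\<forall>h\<in>Zs (Tc p) i. cdot v h = 0)"
        using loop.Zs_polar[OF True, of p] by (auto simp: cdot_commute)
      also have "\<dots> \<longleftrightarrow> (\<forall>h\<in>Zs (Tc p) i. cdot (vcnj v) (vcnj h) = 0)"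
        by (simp add: cdot_vcnj)
      finally show ?thesis by (simp add: perp_def)
    qed
    then show ?thesis by (auto simp: fibre_eq mem_vcnj_image)
  qed
  then show ?thesis
    by (simp add: proj_vcnj subspace_perp proj_perp_eq fibre_subspace mcnj_diff)
next
  case False
  then show ?thesis
    by (simp add: fibre_eq loop.Zs_zero Zs_UNIV proj_UNIV proj_0)
qed

lemma fibre_high:
  assumes "i > s"
  shows "Z_fibre \<Phi> i p = {0}"
proof -
  have "Z_fibre \<Phi> (1 - i) p = UNIV" using assms by (intro fibre_low) simp
  then have "proj (Z_fibre \<Phi> i p) = 0"
    using fibre_polar[of "1 - i" p] by (simp add: proj_UNIV)
  then show ?thesis
    using proj_inject[OF fibre_subspace, of "{0}" i p] by (simp add: proj_0 vec.subspace_0 vec.subspace_single_0)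
qed

definition sign :: "int \<Rightarrow> complex" where
  "sign i = (-1) powi i"

lemma sign_even: "even i \<Longrightarrow> sign i = 1" and sign_odd: "odd i \<Longrightarrow> sign i = -1"
  by (simp_all add: sign_def power_int_minus_left)

lemma fibre_C_invariant:
  assumes "v \<in> Z_fibre \<Phi> i p"
  shows "C p *v v - sign i *s v \<in> Z_fibre \<Phi> (i + 1) p" "C p *v v \<in> Z_fibre \<Phi> i p"
proof -
  show *: "C p *v v - sign i *s v \<in> Z_fibre \<Phi> (i + 1) p"
    using loop.Zs_parity[OF sym assms[unfolded fibre_eq]] by (simp add: fibre_eq sign_def)
  then have "C p *v v - sign i *s v \<in> Z_fibre \<Phi> i p" using fibre_antimono[of i "i + 1" p] by auto
  from vec.subspace_add[OF fibre_subspace this vec.subspace_scale[OF fibre_subspace assms, of "sign i"]]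
  show "C p *v v \<in> Z_fibre \<Phi> i p" by simp
qed

lemma fibre_C_commute: "C p ** proj (Z_fibre \<Phi> i p) = proj (Z_fibre \<Phi> i p) ** C p"
  by (rule symmetric_invariant_commute[OF fibre_subspace fibre_C_invariant(2) C_adj])

text \<open>Parity holds only modulo the next term \<open>W\<close>. Since \<open>C\<close> commutes
  with the projection onto \<open>W\<close>, it preserves the orthogonal complement of
  \<open>W\<close>, so the error term is both in \<open>W\<close> and orthogonal to it.\<close>

lemma fibre_C_sign:
  "C p ** (proj (Z_fibre \<Phi> i p) - proj (Z_fibre \<Phi> (i + 1) p)) =
    cscale (sign i) (proj (Z_fibre \<Phi> i p) - proj (Z_fibre \<Phi> (i + 1) p))"
proof -
  define V W where "V = Z_fibre \<Phi> i p" and "W = Z_fibre \<Phi> (i + 1) p"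
  have VW: "vec.subspace V" "vec.subspace W" "W \<subseteq> V"
    using fibre_subspace fibre_antimono[of i "i + 1" p] by (auto simp: V_def W_def)
  define Q where "Q = proj V - proj W"
  have "proj V ** proj W = proj W" "proj W ** proj V = proj W"
    using VW proj_subset proj_subset' by blast+
  then have WQ: "proj W ** Q = 0" and VQ: "proj V ** Q = Q"
    by (simp_all add: Q_def matrix_diff_right_distrib proj_idem VW)
  have CW: "C p ** proj W = proj W ** C p" unfolding W_def by (rule fibre_C_commute)
  have "C p *v (Q *v v) = cscale (sign i) Q *v v" for v
  proof -
    have "Q *v v \<in> V" using VQ VW by (simp add: mem_proj_iff matrix_vector_mul_assoc)
    then have "C p *v (Q *v v) - sign i *s (Q *v v) \<in> W"
      unfolding V_def W_def by (rule fibre_C_invariant)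
    then have "proj W *v (C p *v (Q *v v) - sign i *s (Q *v v)) = C p *v (Q *v v) - sign i *s (Q *v v)"
      by (rule proj_id[OF VW(2)])
    moreover have "proj W *v (C p *v (Q *v v)) = 0"
    proof -
      have "proj W *v (C p *v (Q *v v)) = (proj W ** C p ** Q) *v v"
        by (simp add: matrix_vector_mul_assoc matrix_mul_assoc)
      also have "proj W ** C p ** Q = C p ** (proj W ** Q)"
        unfolding CW[symmetric] by (simp add: matrix_mul_assoc)
      finally show ?thesis by (simp add: WQ)
    qed
    moreover have "proj W *v (sign i *s (Q *v v)) = 0"
      by (simp add: mv_scale matrix_vector_mul_assoc WQ)
    ultimately have "C p *v (Q *v v) = sign i *s (Q *v v)"
      by (simp add: matrix_vector_mult_diff_distrib)
    then show ?thesis by (simp add: cscale_mv)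
  qed
  then have "C p ** Q = cscale (sign i) Q" by (simp add: matrix_eq flip: matrix_vector_mul_assoc)
  then show ?thesis by (simp only: Q_def V_def W_def)
qed

lemma eventually_P: "eventually (\<lambda>q. P i q = proj (Z_fibre \<Phi> i q)) (at p)"
  using eventually_Zt_eq[of i p] by eventually_elim simp

lemma tendsto_C: "(C \<longlongrightarrow> C p) (at p)"
proof (rule smooth_map_tendsto)
  show "smooth_map atlas C" using smooth_C by (auto simp: smooth_map_def o_def)
qed

lemma P_antimono: "i \<le> j \<Longrightarrow> P i p ** P j p = P j p"
proof (rule eventually_eq_imp_eq[of "\<lambda>q. P i q ** P j q" "P j"])
  assume "i \<le> j"
  then have *: "proj (Z_fibre \<Phi> i q) ** proj (Z_fibre \<Phi> j q) = proj (Z_fibre \<Phi> j q)" for q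
    using proj_subset[OF fibre_subspace fibre_subspace] fibre_antimono by blast
  show "eventually (\<lambda>q. P i q ** P j q = P j q) (at p)"
    using eventually_P[of i p] eventually_P[of j p] by eventually_elim (simp add: *)
qed (intro tendsto_mm tendsto_P)+

lemma P_antimono': "i \<le> j \<Longrightarrow> P j p ** P i p = P j p"
  by (metis P_antimono adj_mult proj_adj subspace_Zt)

lemma P_low:
  assumes "i \<le> - s"
  shows "P i p = mat 1"
proof (rule eventually_eq_imp_eq[of "P i" "\<lambda>q. mat 1" p])
  show "eventually (\<lambda>q. P i q = mat 1) (at p)"
    using eventually_P[of i p] by eventually_elim (simp add: fibre_low[OF assms] proj_UNIV)
qed (auto intro: tendsto_P)

lemma P_high:
  assumes "i > s"
  shows "P i p = 0"
proof (rule eventually_eq_imp_eq[of "P i" "\<lambda>q. 0" p])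
  show "eventually (\<lambda>q. P i q = 0) (at p)"
    using eventually_P[of i p] by eventually_elim (simp add: fibre_high[OF assms] proj_0)
qed (auto intro: tendsto_P)

lemma P_polar: "P (1 - i) p = mat 1 - mcnj (P i p)"
proof (rule eventually_eq_imp_eq[of "P (1 - i)" "\<lambda>q. mat 1 - mcnj (P i q)" p])
  show "eventually (\<lambda>q. P (1 - i) q = mat 1 - mcnj (P i q)) (at p)"
    using eventually_P[of i p] eventually_P[of "1 - i" p] by eventually_elim (simp add: fibre_polar)
qed (intro tendsto_P tendsto_diff tendsto_const tendsto_mcnj)+

lemma P_C_commute: "C p ** P i p = P i p ** C p"
proof (rule eventually_eq_imp_eq[of "\<lambda>q. C q ** P i q" "\<lambda>q. P i q ** C q" p])
  show "eventually (\<lambda>q. C q ** P i q = P i q ** C q) (at p)"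
    using eventually_P[of i p] by eventually_elim (simp add: fibre_C_commute)
qed (intro tendsto_P tendsto_C tendsto_mm)+

lemma tendsto_cscale: "(F \<longlongrightarrow> (A::complex^7^7)) f \<Longrightarrow> ((\<lambda>x. cscale c (F x)) \<longlongrightarrow> cscale c A) f"
  unfolding tendsto_matrix_iff by (auto intro!: tendsto_mult)

definition Q :: "int \<Rightarrow> 'm \<Rightarrow> complex^7^7" where
  "Q i p = P i p - P (i + 1) p"

lemma tendsto_Q: "(Q i \<longlongrightarrow> Q i p) (at p)"
  unfolding Q_def[abs_def] by (intro tendsto_diff tendsto_P)

lemma C_Q: "C p ** Q i p = cscale (sign i) (Q i p)"
proof (rule eventually_eq_imp_eq[of "\<lambda>q. C q ** Q i q" "\<lambda>q. cscale (sign i) (Q i q)" p])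
  show "eventually (\<lambda>q. C q ** Q i q = cscale (sign i) (Q i q)) (at p)"
    using eventually_P[of i p] eventually_P[of "i + 1" p]
    by eventually_elim (simp add: Q_def fibre_C_sign)
qed (intro tendsto_Q tendsto_C tendsto_mm tendsto_cscale)+

lemma Zt_cross7:
  assumes v: "v \<in> Zt i p" and w: "w \<in> Zt j p"
  shows "cross7 v w \<in> Zt (i + j) p"
proof -
  \<comment> \<open>The vectors are carried to neighbouring fibres by the projections
    \<open>P i q\<close>, giving continuous sections through \<open>v\<close> and \<open>w\<close>
    whose product is known to lie in the right fibre off \<open>p\<close>.\<close>
  define F where "F q = cross7 (P i q *v v) (P j q *v w)" for q
  have F: "(F \<longlongrightarrow> F p) (at p)"
    unfolding F_def[abs_def] by (intro tendsto_cross7 tendsto_mv tendsto_P)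
  have "P (i + j) p *v F p = F p"
  proof (rule eventually_eq_imp_eq[of "\<lambda>q. P (i + j) q *v F q" F p])
    show "eventually (\<lambda>q. P (i + j) q *v F q = F q) (at p)"
      using eventually_Zt_eq[of i p] eventually_Zt_eq[of j p] eventually_Zt_eq[of "i + j" p]
    proof eventually_elim
      case (elim q)
      have "F q \<in> Zt (i + j) q"
        unfolding F_def elim fibre_eq
        by (rule loop.Zs_cross7) (rule proj_in[OF subspace_Zs])+
      then show ?case by (rule proj_id[OF subspace_Zt])
    qed
  qed (intro tendsto_mv' tendsto_P F)+
  moreover have "F p = cross7 v w" using v w by (simp add: F_def proj_id subspace_Zt)
  ultimately show ?thesis using mem_proj_iff[OF subspace_Zt] by metis
qed

text \<open>The shift is known for fibres near \<open>p\<close>; \<open>A_z\<close> is continuous,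
  being built from \<open>C\<close> and its derivative, so the inclusion passes to the
  limit.\<close>

lemma Zt_shift:
  assumes c: "(U, z) \<in> atlas" "p \<in> U" and v: "v \<in> Zt i p"
  shows "A_z (U, z) \<phi> p *v v \<in> Zt (i + 1) p"
proof -
  let ?inv = "inv_into U z"
  have zp: "z p \<in> z ` U" and inv: "?inv (z p) = p" using c chart_inv(1)[OF c] by auto
  define F where "F w = C (?inv w)" for w
  define A where "A w = A_z (U, z) \<phi> (?inv w)" for w
  have A: "A w = (1/2) *\<^sub>R (F w ** mz F w)" if "w \<in> z ` U" for w
    using chart_inv(2)[OF c(1) that] by (simp add: A_def A_z_def C_inv dz_eq_mz F_def[abs_def])
  have F: "smooth_on (z ` U) F" unfolding F_def[abs_def] by (rule smooth_C[OF c(1)])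
  have mzF: "smooth_on (z ` U) (mz F)"
  proof -
    have "smooth_on (z ` U) (\<lambda>w. F w $ a $ b)" for a b
      using F by (simp add: smooth_on_matrix_iff[OF chart(2)[OF c(1)]])
    then have "smooth_on (z ` U) (\<lambda>w. (frechet_derivative (\<lambda>w. F w $ a $ b) (at w) 1 -
        \<i> * frechet_derivative (\<lambda>w. F w $ a $ b) (at w) \<i>) / 2)" for a b
      by (intro smooth_on_divide smooth_on_diff smooth_on_mult smooth_on_const smooth_on_frechet_derivative
          chart(2)[OF c(1)]) auto
    then show ?thesis
      unfolding smooth_on_matrix_iff[OF chart(2)[OF c(1)]] by (simp add: mz_def wirtinger_dz_def)
  qed
  have "smooth_on (z ` U) A"
  proof (subst smooth_on_cong[OF chart(2)[OF c(1)] A])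
    show "smooth_on (z ` U) (\<lambda>w. (1/2) *\<^sub>R (F w ** mz F w))"
      by (intro smooth_on_bounded_linear[OF bounded_linear_scaleR_right] smooth_on_matrix_mult F mzF chart(2)[OF c(1)])
  qed
  then have "isCont A (z p)"
    using smooth_on_imp_continuous_on zp continuous_on_eq_continuous_at[OF chart(2)[OF c(1)]] by blast
  then have limA: "(A \<longlongrightarrow> A (z p)) (at (z p))" by (simp add: isCont_def)
  have limP: "((\<lambda>w. P j (?inv w)) \<longlongrightarrow> P j p) (at (z p))" for j
    using tendsto_P[of j p] unfolding tendsto_chart[OF c] .
  define G where "G w = A w *v (P i (?inv w) *v v)" for w
  have G: "(G \<longlongrightarrow> G (z p)) (at (z p))"
    unfolding G_def[abs_def] inv by (intro tendsto_mv' limA limP tendsto_mv)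
  have ev: "eventually (\<lambda>w. P (i + 1) (?inv w) *v G w = G w) (at (z p))"
    using fibre_shift[OF c, of i] eventually_Zt_eq[of i p, unfolded eventually_chart[OF c]]
      eventually_Zt_eq[of "i + 1" p, unfolded eventually_chart[OF c]]
  proof eventually_elim
    case (elim w)
    have "G w \<in> Zt (i + 1) (?inv w)"
      using elim proj_in[OF subspace_Zt, of i "?inv w" v] by (simp add: G_def A_def)
    then show ?case by (rule proj_id[OF subspace_Zt])
  qed
  have "((\<lambda>w. P (i + 1) (?inv w) *v G w) \<longlongrightarrow> P (i + 1) p *v G (z p)) (at (z p))"
    by (rule tendsto_mv'[OF limP G])
  from tendsto_unique[OF _ Lim_transform_eventually[OF this ev] G]
  have "P (i + 1) p *v G (z p) = G (z p)" by simp
  moreover have "G (z p) = A_z (U, z) \<phi> p *v v"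
    using proj_id[OF subspace_Zt v] by (simp add: G_def A_def inv)
  ultimately show ?thesis by (simp add: mem_proj_iff[OF subspace_Zt, of _ "i + 1" p])
qed

end

section \<open>Rank of the complexified associative subspaces\<close>

lemma complexification_eq: "complexification V = {cvec x + \<i> *s cvec y | x y. x \<in> V \<and> y \<in> V}"
proof -
  have "(\<chi> i. Complex (x $ i) (y $ i)) = cvec x + \<i> *s cvec y" for x y
    by (simp add: vec_eq_iff cvec_def complex_eq_iff)
  then show ?thesis by (simp only: complexification_def)
qed

lemma subspace_complexification:
  assumes V: "subspace V"
  shows "vec.subspace (complexification V)"
proof (rule vec.subspaceI)
  have "cvec 0 + \<i> *s cvec 0 = 0" by (simp add: vec_eq_iff cvec_def)
  then show "0 \<in> complexification V"
    using subspace_0[OF V] unfolding complexification_eq by (auto intro!: exI[of _ 0])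
next
  fix u v assume "u \<in> complexification V" "v \<in> complexification V"
  then obtain x y x' y' where u: "u = cvec x + \<i> *s cvec y" "v = cvec x' + \<i> *s cvec y'"
    and xy: "x \<in> V" "y \<in> V" "x' \<in> V" "y' \<in> V"
    unfolding complexification_eq by auto
  have "u + v = cvec (x + x') + \<i> *s cvec (y + y')"
    by (simp add: u vec_eq_iff cvec_def algebra_simps)
  then show "u + v \<in> complexification V"
    unfolding complexification_eq using xy subspace_add[OF V] by blast
next
  fix c u assume "u \<in> complexification V"
  then obtain x y where u: "u = cvec x + \<i> *s cvec y" and xy: "x \<in> V" "y \<in> V"
    unfolding complexification_eq by auto
  have "c *s u = cvec (Re c *\<^sub>R x - Im c *\<^sub>R y) + \<i> *s cvec (Im c *\<^sub>R x + Re c *\<^sub>R y)"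
    by (simp add: u vec_eq_iff cvec_def complex_eq_iff)
  moreover have "Re c *\<^sub>R x - Im c *\<^sub>R y \<in> V" "Im c *\<^sub>R x + Re c *\<^sub>R y \<in> V"
    using xy by (simp_all add: subspace_add subspace_diff subspace_scale V)
  ultimately show "c *s u \<in> complexification V"
    unfolding complexification_eq by blast
qed

text \<open>A real basis stays a basis over the complex numbers: real and imaginary parts of a
  complex relation are two real relations.\<close>

lemma dim_complexification:
  assumes V: "subspace V"
  shows "vec.dim (complexification V) = dim V"
proof -
  obtain B where B: "B \<subseteq> V" "independent B" "V \<subseteq> span B" "card B = dim V"
    by (rule basis_exists)
  have finB: "finite B" using B(2) independent_imp_finite by blast
  have inj: "inj_on cvec S" for S by (rule inj_onI) (simp add: vec_eq_iff cvec_def)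
  have zero: "u (cvec b) = 0" if "(\<Sum>v\<in>cvec ` B. u v *s v) = 0" "b \<in> B" for u b
  proof -
    have *: "(\<Sum>b\<in>B. u (cvec b) *s cvec b) = 0" using that(1) by (simp add: sum.reindex[OF inj])
    then have "(\<Sum>b\<in>B. u (cvec b) * of_real (b $ i)) = 0" for i
      by (simp add: vec_eq_iff cvec_def)
    then have "Re (\<Sum>b\<in>B. u (cvec b) * of_real (b $ i)) = 0" "Im (\<Sum>b\<in>B. u (cvec b) * of_real (b $ i)) = 0" for i
      by simp_all
    then have "(\<Sum>b\<in>B. Re (u (cvec b)) *\<^sub>R b) = 0" "(\<Sum>b\<in>B. Im (u (cvec b)) *\<^sub>R b) = 0"
      by (simp_all add: vec_eq_iff)
    then have "Re (u (cvec b)) = 0" "Im (u (cvec b)) = 0"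
      using independentD[OF B(2) finB subset_refl _ that(2), where u = "\<lambda>b. Re (u (cvec b))"]
        independentD[OF B(2) finB subset_refl _ that(2), where u = "\<lambda>b. Im (u (cvec b))"] by simp_all
    then show ?thesis by (simp add: complex_eq_iff)
  qed
  have "vec.independent (cvec ` B)"
    unfolding vec.dependent_finite[OF finite_imageI[OF finB]] using zero by blast
  moreover have "cvec ` B \<subseteq> complexification V"
  proof safe
    fix b assume "b \<in> B"
    moreover have "cvec b = cvec b + \<i> *s cvec 0" by (simp add: vec_eq_iff cvec_def)
    ultimately show "cvec b \<in> complexification V"
      unfolding complexification_eq using B(1) subspace_0[OF V] by blast
  qed
  moreover have "complexification V \<subseteq> vec.span (cvec ` B)"
  proof -
    have cvec: "cvec x \<in> vec.span (cvec ` B)" if "x \<in> V" for x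
    proof -
      have "x \<in> range (\<lambda>c. \<Sum>b\<in>B. c b *\<^sub>R b)"
        using B(3) that unfolding span_finite[OF finB] by (rule subsetD)
      then obtain c where x: "x = (\<Sum>b\<in>B. c b *\<^sub>R b)" by (rule imageE)
      have "cvec x = (\<Sum>b\<in>B. of_real (c b) *s cvec b)"
        by (simp add: x vec_eq_iff cvec_def)
      then show ?thesis
        using vec.span_sum[of B "\<lambda>b. of_real (c b) *s cvec b" "cvec ` B"]
          vec.span_scale[OF vec.span_base, of _ "cvec ` B"] by simp
    qed
    then show ?thesis
      unfolding complexification_eq by (auto intro!: vec.span_add vec.span_scale)
  qed
  ultimately show ?thesis
    using B(4) card_image[OF inj, of B] by (intro vec.dim_unique[of "cvec ` B"]) auto
qed

section \<open>The legs and their flag properties\<close>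

context lift_setup
begin

lemma subspace_\<phi>: "vec.subspace (\<phi> p)" and dim_\<phi>: "vec.dim (\<phi> p) = 3"
proof -
  obtain V where "associative_subspace V" "\<phi> p = complexification V"
    using \<phi>_assoc[of p] by (auto simp: G2_SO4_def)
  then show "vec.subspace (\<phi> p)" "vec.dim (\<phi> p) = 3"
    by (simp_all add: associative_subspace_def subspace_complexification dim_complexification)
qed

definition N :: "int \<Rightarrow> 'm \<Rightarrow> (complex^7) set" where
  "N i p = ominus (Zt i p) (Zt (i + 1) p)"

lemma Zt_antimono: "i \<le> j \<Longrightarrow> Zt j p \<subseteq> Zt i p"
  using proj_subset[OF subspace_Zt subspace_Zt] P_antimono by blast

lemma subspace_N: "vec.subspace (N i p)"
  by (simp add: N_def subspace_ominus subspace_Zt)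

lemma proj_N: "proj (N i p) = Q i p"
  by (simp add: N_def Q_def proj_ominus subspace_Zt Zt_antimono)

lemma mem_N: "v \<in> N i p \<longleftrightarrow> Q i p *v v = v"
  using mem_proj_iff[OF subspace_N] by (simp add: proj_N)

lemma Q_in_N: "Q i p *v v \<in> N i p"
  using proj_in[OF subspace_N, of i p v] by (simp add: proj_N)

lemma N_eqI: "Q i p = proj V \<Longrightarrow> vec.subspace V \<Longrightarrow> N i p = V"
  using proj_inject[OF subspace_N, of V i p] by (simp add: proj_N)

lemma Q_adj: "adj (Q i p) = Q i p"
  using proj_adj[OF subspace_N, of i p] by (simp add: proj_N)

lemma P_Q: "P i p ** Q j p = (if i \<le> j then Q j p else 0)"
  and Q_P: "Q j p ** P i p = (if i \<le> j then Q j p else 0)"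
proof -
  show *: "P i p ** Q j p = (if i \<le> j then Q j p else 0)" for i j
    by (auto simp: Q_def matrix_diff_right_distrib P_antimono P_antimono')
  have "adj (P i p ** Q j p) = Q j p ** P i p"
    by (simp add: adj_mult Q_adj proj_adj subspace_Zt)
  moreover have "adj (if i \<le> j then Q j p else 0) = (if i \<le> j then Q j p else 0)"
    by (simp add: Q_adj) (simp add: vec_eq_iff)
  ultimately show "Q j p ** P i p = (if i \<le> j then Q j p else 0)" by (simp add: *)
qed

lemma Q_Q: "Q i p ** Q j p = (if i = j then Q j p else 0)"
proof -
  have "Q i p ** Q j p = (if i \<le> j then Q j p else 0) - (if i + 1 \<le> j then Q j p else 0)"
    unfolding Q_def[of i] by (simp only: matrix_diff_left_distrib P_Q)
  then show ?thesis by auto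
qed

lemma Q_outside: "\<bar>i\<bar> > s \<Longrightarrow> Q i p = 0"
  using s by (cases "i < 0") (auto simp: Q_def P_low P_high)

lemma N_outside: "\<bar>i\<bar> > s \<Longrightarrow> N i p = {0}"
  by (rule N_eqI) (simp_all add: Q_outside proj_0 vec.subspace_single_0)

lemma sum_Q: "(\<Sum>i\<in>{-3..3}. Q i p) = mat 1"
proof -
  have "{-3..3::int} = {-3, -2, -1, 0, 1, 2, 3}" by auto
  moreover have "P (- 3) p = mat 1" using s by (intro P_low) auto
  moreover have "P 4 p = 0" using s by (intro P_high) auto
  ultimately show ?thesis by (simp add: Q_def)
qed

lemma vector_decomposition: "v = (\<Sum>i\<in>{-3..3}. Q i p *v v)"
  by (simp add: sum_Q flip: sum_mv)

lemma mcnj_Q: "mcnj (Q i p) = Q (- i) p"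
  using P_polar[of i p] P_polar[of "i + 1" p] by (simp add: Q_def mcnj_diff)

lemma N_vcnj: "N (- i) p = vcnj ` N i p"
  by (rule N_eqI) (simp_all add: proj_vcnj subspace_N proj_N mcnj_Q subspace_vcnj)

lemma N_perp:
  assumes "i \<noteq> j"
  shows "N i p \<subseteq> perp (N j p)"
proof
  fix v assume "v \<in> N i p"
  then have v: "Q i p *v v = v" by (simp add: mem_N)
  have "Q j p *v (Q i p *v v) = 0" using assms by (simp add: matrix_vector_mul_assoc Q_Q)
  then show "v \<in> perp (N j p)" by (simp add: perp_iff subspace_N proj_N v)
qed

text \<open>That the product lies in the term i + j is the filtered statement. Orthogonality to the
  next term comes from the conjugate vectors, which lie in the legs -i and -j: their product lies in
  the term -(i + j), and conjugating back this is the complement of the term i + j + 1.\<close>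

lemma N_cross7:
  assumes v: "v \<in> N i p" and w: "w \<in> N j p"
  shows "cross7 v w \<in> N (i + j) p"
proof -
  have Zt: "u \<in> Zt k p" if "u \<in> N k p" for u k using that by (simp add: N_def ominus_def)
  have 1: "P (i + j) p *v cross7 v w = cross7 v w"
    by (rule proj_id[OF subspace_Zt Zt_cross7[OF Zt[OF v] Zt[OF w]]])
  have "vcnj v \<in> N (- i) p" "vcnj w \<in> N (- j) p" using v w by (simp_all add: N_vcnj)
  then have "vcnj (cross7 v w) \<in> Zt (- i + - j) p"
    unfolding vcnj_cross7 by (intro Zt_cross7 Zt)
  then have "P (- (i + j)) p *v vcnj (cross7 v w) = vcnj (cross7 v w)"
    by (simp add: proj_id subspace_Zt)
  then have "vcnj (P (- (i + j)) p *v vcnj (cross7 v w)) = vcnj (vcnj (cross7 v w))" by (rule arg_cong)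
  then have "mcnj (P (- (i + j)) p) *v cross7 v w = cross7 v w" by (simp add: vcnj_mult)
  moreover have "P (i + j + 1) p = mat 1 - mcnj (P (- (i + j)) p)"
    using P_polar[of "- (i + j)" p] by (simp only: diff_minus_eq_add add.commute[of 1])
  ultimately have "P (i + j + 1) p *v cross7 v w = 0"
    by (simp only: matrix_vector_mult_diff_rdistrib matrix_vector_mul_lid diff_self)
  then show ?thesis by (simp add: mem_N Q_def matrix_vector_mult_diff_rdistrib 1)
qed

lemma span_N: "vec.span (\<Union>i. N i p) = UNIV"
proof -
  have "v \<in> vec.span (\<Union>i. N i p)" for v
    by (subst vector_decomposition[of v p]) (rule vec.span_sum, rule vec.span_base, rule UN_I[where B = "\<lambda>i. N i p", OF UNIV_I Q_in_N])
  then show ?thesis by blast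
qed

lemma C_Q': "C p ** Q i p = (if even i then Q i p else - Q i p)"
  and Q_C: "Q i p ** C p = (if even i then Q i p else - Q i p)"
proof -
  show *: "C p ** Q i p = (if even i then Q i p else - Q i p)"
    by (simp add: C_Q sign_even sign_odd vec_eq_iff cscale_nth)
  have "adj (C p ** Q i p) = Q i p ** C p" by (simp add: adj_mult C_adj Q_adj)
  moreover have "adj (if even i then Q i p else - Q i p) = (if even i then Q i p else - Q i p)"
    using Q_adj[of i p] by (simp add: vec_eq_iff)
  ultimately show "Q i p ** C p = (if even i then Q i p else - Q i p)" by (simp add: *)
qed

text \<open>\<open>C\<close> is twice the projection onto \<open>\<phi>\<close> minus the identity,
  so its eigenvalues 1 and -1 on the legs become 1 and 0.\<close>

lemma proj_\<phi>_Q: "proj (\<phi> p) ** Q i p = (if even i then Q i p else 0)"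
proof -
  have "proj (\<phi> p) ** Q i p + proj (\<phi> p) ** Q i p - Q i p = (if even i then Q i p else - Q i p)"
    using C_Q'[of p i]
    by (simp only: cartan_eq[OF subspace_\<phi>] matrix_diff_left_distrib matrix_add_rdistrib matrix_mul_lid)
  then have "(proj (\<phi> p) ** Q i p) $ a $ b + (proj (\<phi> p) ** Q i p) $ a $ b - Q i p $ a $ b =
      (if even i then Q i p else - Q i p) $ a $ b" for a b
    by (simp only: flip: vector_add_component vector_minus_component)
  then show ?thesis by (cases "even i") (simp_all add: vec_eq_iff)
qed

lemma proj_\<phi>: "proj (\<phi> p) = Q (-2) p + Q 0 p + Q 2 p"
proof -
  have "proj (\<phi> p) = (\<Sum>i\<in>{-3..3}. proj (\<phi> p) ** Q i p)"
    by (simp add: sum_Q flip: mm_sum)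
  moreover have "{-3..3::int} = {-3, -2, -1, 0, 1, 2, 3}" by auto
  ultimately show ?thesis by (simp add: proj_\<phi>_Q)
qed

lemma span_even: "vec.span (\<Union>i\<in>{i. even i}. N i p) = \<phi> p"
proof
  have "N i p \<subseteq> \<phi> p" if "even i" for i
    using proj_subset[OF subspace_N subspace_\<phi>] that by (simp add: proj_N proj_\<phi>_Q)
  then show "vec.span (\<Union>i\<in>{i. even i}. N i p) \<subseteq> \<phi> p"
    by (intro vec.span_minimal subspace_\<phi>) blast
  show "\<phi> p \<subseteq> vec.span (\<Union>i\<in>{i. even i}. N i p)"
  proof
    fix v assume "v \<in> \<phi> p"
    then have "v = Q (-2) p *v v + Q 0 p *v v + Q 2 p *v v"
      using proj_id[OF subspace_\<phi>, of v p] by (simp add: proj_\<phi> matrix_vector_mult_add_rdistrib)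
    moreover have "Q i p *v v \<in> vec.span (\<Union>i\<in>{i. even i}. N i p)" if "even i" for i
      using that Q_in_N by (intro vec.span_base) auto
    ultimately show "v \<in> vec.span (\<Union>i\<in>{i. even i}. N i p)"
      by (metis vec.span_add even_zero even_numeral even_minus)
  qed
qed

section \<open>Dimensions of the legs\<close>

abbreviation d :: "int \<Rightarrow> 'm \<Rightarrow> nat" where
  "d i p \<equiv> vec.dim (N i p)"

lemma d_telescope: "d i p + vec.dim (Zt (i + 1) p) = vec.dim (Zt i p)"
  unfolding N_def by (rule dim_ominus) (simp_all add: subspace_Zt Zt_antimono)

lemma d_minus: "d (- i) p = d i p"
  by (simp add: N_vcnj dim_vcnj)

lemma d_outside: "\<bar>i\<bar> > s \<Longrightarrow> d i p = 0"
  by (simp add: N_outside)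

lemma Zt_low: "i \<le> - s \<Longrightarrow> Zt i p = UNIV"
  using proj_inject[OF subspace_Zt, of UNIV i p] by (simp add: P_low proj_UNIV)

lemma Zt_high: "i > s \<Longrightarrow> Zt i p = {0}"
  using proj_inject[OF subspace_Zt, of "{0}" i p] by (simp add: P_high proj_0 vec.subspace_single_0)

lemma d_total: "d 0 p + 2 * d 1 p + 2 * d 2 p + 2 * d 3 p = 7"
proof -
  have "vec.dim (Zt (- 3) p) = 7" using s by (subst Zt_low) (auto simp: vec_dim_card simp del: vec.dim_UNIV)
  moreover have "vec.dim (Zt 4 p) = 0" using s by (subst Zt_high) auto
  ultimately show ?thesis
    using d_telescope[of "-3" p] d_telescope[of "-2" p] d_telescope[of "-1" p] d_telescope[of 0 p]
      d_telescope[of 1 p] d_telescope[of 2 p] d_telescope[of 3 p]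
      d_minus[of 1 p] d_minus[of 2 p] d_minus[of 3 p]
    by (simp del: vec.dim_eq_0)
qed

lemma d_even: "d 0 p + 2 * d 2 p = 3"
proof -
  define V where "V = ominus (\<phi> p) (N 0 p)"
  have 0: "N 0 p \<subseteq> \<phi> p" by (simp add: proj_subset subspace_N subspace_\<phi> proj_N proj_\<phi>_Q)
  have V: "vec.subspace V" "proj V = Q (-2) p + Q 2 p"
    by (simp_all add: V_def subspace_ominus subspace_\<phi> proj_ominus subspace_N 0 proj_N proj_\<phi>)
  have 2: "N 2 p \<subseteq> V"
    by (simp add: proj_subset subspace_N V proj_N matrix_add_rdistrib Q_Q)
  have "N (-2) p = ominus V (N 2 p)"
    by (rule N_eqI) (simp_all add: V subspace_ominus proj_ominus subspace_N 2 proj_N)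
  then have "d (-2) p + d 2 p = vec.dim V" using dim_ominus[OF V(1) subspace_N 2] by simp
  moreover have "vec.dim V + d 0 p = 3"
    using dim_ominus[OF subspace_\<phi> subspace_N 0] by (simp add: V_def dim_\<phi>)
  ultimately show ?thesis using d_minus[of 2 p] by simp
qed

lemma d_zero_iff: "d i p = 0 \<longleftrightarrow> Q i p = 0"
proof
  assume "d i p = 0"
  then have "N i p \<subseteq> {0}" by simp
  then have "N i p = {0}" using vec.subspace_0[OF subspace_N, of i p] by blast
  then show "Q i p = 0" using proj_N[of i p] by (simp add: proj_0)
next
  assume "Q i p = 0"
  then have "N i p = {0}" by (intro N_eqI) (simp_all add: proj_0 vec.subspace_single_0)
  then show "d i p = 0" by simp
qed

lemma d_const: "d i p = d i q"
  using d_telescope[of i p] d_telescope[of i q] dim_Zt_const[of i p q] dim_Zt_const[of "i + 1" p q]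
  by simp

text \<open>If the top leg vanished, duality would make the term 1 - s the whole space, hence the
  coefficient at -s zero off isolated points and, by continuity, everywhere. Reality removes the
  coefficient at s, and W would fit between the bounds for s - 1.\<close>

lemma d_top: "d s p \<noteq> 0"
proof
  assume "d s p = 0"
  then have "Q s q = 0" for q using d_const[of s p q] d_zero_iff[of s q] by simp
  then have "P s q = 0" for q using P_high[of "s + 1" q] by (simp add: Q_def)
  then have "P (1 - s) q = mat 1" for q
    using P_polar[of s q] by (simp add: vec_eq_iff)
  then have Zt: "Zt (1 - s) q = UNIV" for q
    using proj_inject[OF subspace_Zt, of UNIV "1 - s" q] by (simp add: proj_UNIV)
  have low: "Tc p (- s) = 0" for p
  proof (rule eventually_eq_imp_eq[of "\<lambda>q. Tc q (- s)" "\<lambda>q. 0" p])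
    show "eventually (\<lambda>q. Tc q (- s) = 0) (at p)"
      using eventually_Zt_eq[of "1 - s" p]
    proof eventually_elim
      case (elim q)
      then have U: "Zs (Tc q) (1 - s) = UNIV" by (simp add: Zt fibre_eq)
      have "Tc q (1 - s - 1) = 0"
        by (rule loop.Zs_UNIV_imp_coeff[OF _ U]) (rule Tc_zero, use s in auto)
      then show ?case by simp
    qed
    have "smooth_map atlas (\<lambda>q. Tc q (- s))" by (auto simp: smooth_map_def o_def smooth_Tc)
    then show "((\<lambda>q. Tc q (- s)) \<longlongrightarrow> Tc p (- s)) (at p)" by (rule smooth_map_tendsto)
  qed auto
  have high: "Tc p s = 0" for p
    using loop.coeff_real[of p "- s"] low[of p] by (simp add: vec_eq_iff)
  have "W_between \<Phi> (s - 1)"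
  proof (rule W_betweenI[OF laurent_Tc loop.laurent_tp])
    show "\<Phi> p l ** transpose (\<Phi> p l) = mat 1" if "l \<in> sphere 0 1" for p l
      using G2_orthogonal[OF \<Phi>_G2[OF that]] matrix_left_right_inverse by blast
    show "Tc p k = 0" if "\<bar>k\<bar> > s - 1" for p k
    proof -
      consider "\<bar>k\<bar> > s" | "k = s" | "k = - s" using \<open>\<bar>k\<bar> > s - 1\<close> by linarith
      then show ?thesis by cases (auto simp: Tc_zero low high)
    qed
  qed
  from minimal[OF this] show False by simp
qed

lemma d_second:
  assumes "s = 3"
  shows "d 2 p \<noteq> 0"
proof
  assume "d 2 p = 0"
  then have "Q 2 q = 0" for q using d_const[of 2 p q] d_zero_iff[of 2 q] by simp
  then have "P 2 q = P 3 q" for q by (simp add: Q_def)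
  then have Zt: "Zt 2 q = Zt 3 q" for q
    using proj_inject[OF subspace_Zt subspace_Zt, of 2 q 3 q] by simp
  have "eventually (\<lambda>q. Z_fibre \<Phi> 2 q \<noteq> Z_fibre \<Phi> 3 q) (at p)"
    using nondegenerate[OF assms] unfolding except_isolated_iff by blast
  then have "eventually (\<lambda>q. False) (at p)"
    using eventually_Zt_eq[of 2 p] eventually_Zt_eq[of 3 p] by eventually_elim (simp add: Zt)
  then show False using at_neq_bot by (simp add: eventually_False)
qed

lemma d_first:
  assumes "s = 3"
  shows "d 1 p \<noteq> 0"
proof
  assume "d 1 p = 0"
  then have Q1: "Q 1 p = 0" by (rule d_zero_iff[THEN iffD1])
  then have N1: "N 1 p = {0}" by (intro N_eqI) (simp_all add: proj_0 vec.subspace_single_0)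
  have nonzero: "\<exists>v\<in>N i p. v \<noteq> 0" if "d i p \<noteq> 0" for i
  proof (rule ccontr)
    assume "\<not> (\<exists>v\<in>N i p. v \<noteq> 0)"
    then have "N i p \<subseteq> {0}" by blast
    then show False using that by simp
  qed
  obtain y where y: "y \<in> N 3 p" "y \<noteq> 0" using nonzero[of 3] d_top[of p] assms by auto
  obtain v where v: "v \<in> N 2 p" "v \<noteq> 0" using nonzero[of 2] d_second[OF assms] by auto
  have y': "vcnj y \<in> N (-3) p" using y(1) N_vcnj[of 3 p] by simp
  have "cross7 y v \<in> N 5 p" using N_cross7[OF y(1) v(1)] by simp
  then have 1: "cross7 y v = 0" using N_outside[of 5 p] assms by simp
  have "cross7 (vcnj y) v \<in> N (- 1) p" using N_cross7[OF y' v(1)] by simp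
  then have 2: "cross7 (vcnj y) v = 0" using N_vcnj[of 1 p] N1 by simp
  have "v \<in> perp (N 3 p)" "v \<in> perp (N (-3) p)" using N_perp[of 2 3 p] N_perp[of 2 "-3" p] v(1) by auto
  then have 3: "cdot v (vcnj y) = 0" "cdot v y = 0" using y(1) y' unfolding perp_def by force+
  \<comment> \<open>Twice the real part of \<open>y\<close>, so that its complexification is
    \<open>y + vcnj y\<close>. It is nonzero because the summands lie in the different legs 3 and
    -3.\<close>
  define x where "x = (\<chi> i. 2 * Re (y $ i))"
  have x: "cvec x = y + vcnj y" by (simp add: x_def cvec_def vec_eq_iff complex_eq_iff)
  have "x \<noteq> 0"
  proof
    assume "x = 0"
    then have "y + vcnj y = 0" unfolding x[symmetric] by (simp add: cvec_def vec_eq_iff)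
    then have "y = - vcnj y" by (simp add: eq_neg_iff_add_eq_0)
    moreover have "- vcnj y \<in> N (-3) p" using vec.subspace_neg[OF subspace_N y'] .
    ultimately have "y \<in> N (-3) p" by simp
    then have "Q 3 p *v y = y" "Q (-3) p *v y = y" using y(1) by (simp_all add: mem_N)
    then have "y = (Q 3 p ** Q (-3) p) *v y" by (simp flip: matrix_vector_mul_assoc)
    then show False using y(2) by (simp add: Q_Q)
  qed
  have "v = 0"
  proof (rule cross7_eq_0_real[OF _ _ \<open>x \<noteq> 0\<close>])
    show "cross7 (cvec x) v = 0" by (simp add: x cross7_simps 1 2)
    show "cdot (cvec x) v = 0" using 3 by (simp add: x cdot_simps cdot_commute)
  qed
  then show False using v(2) by simp
qed

text \<open>The two counts give d0 + 2 d2 = 3 and d1 + d3 = 2, so d2 is 0 or 1. The legs beyond s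
  vanish and those known to be nonzero then fix all dimensions.\<close>

lemma N_G2_flag: "(\<lambda>i. N i p) \<in> G2_flags s"
proof -
  have dims: "s = 1 \<and> d 0 p = 3 \<and> d 1 p = 2 \<or> s = 2 \<and> d 0 p = 1 \<and> d 1 p = 2 \<and> d 2 p = 1 \<or>
      s = 3 \<and> d 0 p = 1 \<and> d 1 p = 1 \<and> d 2 p = 1 \<and> d 3 p = 1"
  proof -
    consider "s = 1" | "s = 2" | "s = 3" using s by blast
    then show ?thesis
    proof cases
      case 1
      then have "d 2 p = 0" "d 3 p = 0" by (intro d_outside; simp)+
      then show ?thesis using 1 d_even[of p] d_total[of p] by linarith
    next
      case 2
      then have "d 3 p = 0" "d 2 p \<noteq> 0" using d_outside[of 3 p] d_top[of p] by simp_all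
      moreover have "d 2 p = 1" using calculation d_even[of p] by linarith
      ultimately have "d 0 p = 1" "d 1 p = 2" "d 2 p = 1" using d_even[of p] d_total[of p] by linarith+
      then show ?thesis using 2 by blast
    next
      case 3
      then have "d 3 p \<noteq> 0" "d 2 p \<noteq> 0" "d 1 p \<noteq> 0" using d_top[of p] d_second d_first by auto
      moreover have "d 2 p = 1" using calculation d_even[of p] by linarith
      ultimately have "d 0 p = 1" "d 1 p = 1" "d 2 p = 1" "d 3 p = 1"
        using d_even[of p] d_total[of p] by linarith+
      then show ?thesis using 3 by blast
    qed
  qed
  show ?thesis
    unfolding G2_flags_def flags_def mem_Collect_eq
    by (intro conjI allI impI ballI subspace_N N_outside N_perp span_N N_vcnj dims N_cross7; assumption)
qed

end

section \<open>Uniqueness of the lift and its J2-holomorphy\<close>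

lemma mz_adj:
  assumes "mdiff F w"
  shows "mz (\<lambda>w. adj (F w)) w = adj (mzb F w)"
  using mdiff_transpose[OF assms] by (simp add: adj_eq_mcnj_transpose(1) mz_mcnj mz_transpose)

lemma neg_self_eq_0: "X = - X \<Longrightarrow> X = (0 :: complex^'n^'m)"
  unfolding vec_eq_iff by simp

context lift_setup
begin

lemma canonical_lift_N: "canonical_lift atlas \<Phi> s N"
  unfolding canonical_lift_def
proof (intro exI[of _ Zt] conjI ballI allI)
  show "smooth_subbundle atlas (Zt i)" for i
    unfolding smooth_subbundle_def using subspace_Zt smooth_map_P dim_Zt_const by blast
  show "except_isolated (\<lambda>p. Zt i p = Z_fibre \<Phi> i p)" for i
    unfolding except_isolated_iff using eventually_Zt_eq by blast
  show "N i p = (if \<bar>i\<bar> \<le> s then ominus (Zt i p) (Zt (i + 1) p) else {0})" for i p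
    using N_outside[of i p] by (simp add: N_def)
qed

text \<open>A smooth subbundle agreeing with the fibres off isolated points has as projection the
  limit of theirs, which determines it.\<close>

lemma canonical_lift_unique:
  assumes "canonical_lift atlas \<Phi> s \<psi>"
  shows "\<psi> = N"
proof (intro ext)
  fix i p
  obtain Z where Z: "\<forall>i\<in>{-s..s+1}. smooth_subbundle atlas (Z i) \<and> except_isolated (\<lambda>p. Z i p = Z_fibre \<Phi> i p)"
    and \<psi>: "\<forall>i p. \<psi> i p = (if \<bar>i\<bar> \<le> s then ominus (Z i p) (Z (i + 1) p) else {0})"
    using assms unfolding canonical_lift_def by (elim exE conjE)
  have Zt: "Zt j p = Z j p" if "j \<in> {-s..s+1}" for j
  proof (rule Zt_eqI)
    have sb: "smooth_subbundle atlas (Z j)" and ei: "except_isolated (\<lambda>p. Z j p = Z_fibre \<Phi> j p)"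
      using bspec[OF Z that] by auto
    show "vec.subspace (Z j p)" using sb by (simp add: smooth_subbundle_def)
    have "((\<lambda>q. proj (Z j q)) \<longlongrightarrow> proj (Z j p)) (at p)"
      using sb smooth_map_tendsto[of "\<lambda>q. proj (Z j q)"] by (simp add: smooth_subbundle_def)
    moreover have "eventually (\<lambda>q. proj (Z j q) = proj (Z_fibre \<Phi> j q)) (at p)"
      using ei[unfolded except_isolated_iff, rule_format, of p] by eventually_elim simp
    ultimately show "((\<lambda>q. proj (Z_fibre \<Phi> j q)) \<longlongrightarrow> proj (Z j p)) (at p)"
      by (rule Lim_transform_eventually)
  qed
  show "\<psi> i p = N i p"
  proof (cases "\<bar>i\<bar> \<le> s")
    case True
    then have "i \<in> {-s..s+1}" "i + 1 \<in> {-s..s+1}" by auto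
    then show ?thesis using True \<psi> by (simp add: N_def Zt)
  next
    case False
    then show ?thesis using \<psi> N_outside[of i p] by simp
  qed
qed

lemma smooth_map_Q: "smooth_map atlas (Q i)"
  unfolding smooth_map_def
proof safe
  fix U z assume c: "(U, z) \<in> atlas"
  have P: "smooth_on (z ` U) (\<lambda>w. P i (inv_into U z w))" for i
    using smooth_map_P[of i] c by (auto simp: smooth_map_def o_def)
  then show "smooth_on (z ` U) (Q i \<circ> inv_into U z)"
    unfolding Q_def[abs_def] o_def by (intro smooth_on_diff chart(2)[OF c])
qed

text \<open>With \<open>P\<^sub>i\<close> the projection onto the filtration and \<open>A = A\<^sub>z\<close>, the derivative of \<open>P\<^sub>i\<close> is constrained by
  \<open>P\<^sub>i\<^sup>2 = P\<^sub>i\<close>, by the adjoint of flatness, \<open>(\<partial>P\<^sub>i - P\<^sub>i A) (1 - P\<^sub>i) = 0\<close>, and by \<open>C P\<^sub>i = P\<^sub>i C\<close>.\<close>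

lemma derivative_components:
  assumes c: "(U, z) \<in> atlas" "p \<in> U" and "i \<noteq> j" "\<not> J2_type10 i j"
  shows "Q j p ** dz (U, z) (Q i) p ** Q i p = 0"
proof -
  let ?inv = "inv_into U z"
  define w where "w = z p"
  have w: "w \<in> z ` U" and inv: "?inv w = p" using c chart_inv(1)[OF c] by (auto simp: w_def)
  note \<Omega> = chart(2)[OF c(1)]
  define D where "D k = mz (\<lambda>w. P k (?inv w)) w" for k
  define A where "A = A_z (U, z) \<phi> p"
  define B where "B = A_zbar (U, z) \<phi> p"
  define F where "F w = C (?inv w)" for w
  define Cz where "Cz = mz F w"
  have Fw: "F w = C p" by (simp add: F_def inv)
  have dP: "mdiff (\<lambda>w. P k (?inv w)) w" for k
    using smooth_map_P[of k] c w by (intro smooth_on_imp_mdiff[OF \<Omega>]) (auto simp: smooth_map_def o_def)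
  have dF: "mdiff F w" unfolding F_def[abs_def] by (rule smooth_on_imp_mdiff[OF \<Omega> smooth_C[OF c(1)] w])
  have A: "A = (1/2) *\<^sub>R (C p ** Cz)" and B: "B = (1/2) *\<^sub>R (C p ** mzb F w)"
    by (simp_all add: A_def A_z_def B_def A_zbar_def C_inv dz_eq_mz dzbar_eq_mzb Cz_def F_def[abs_def] w_def)
  have FF: "Cz ** C p + C p ** Cz = 0"
  proof -
    have "mz (\<lambda>w. F w ** F w) w = 0" by (simp add: F_def C_involution)
    then show ?thesis using mz_mult(1)[OF dF dF] by (simp add: Fw Cz_def)
  qed
  have CzA: "C p ** Cz = A + A"
    by (simp add: A vec_eq_iff)
  have AC: "A ** C p = - (C p ** A)"
  proof -
    have "Cz ** C p = - (C p ** Cz)" using FF by (simp add: eq_neg_iff_add_eq_0)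
    then have "(C p ** Cz) ** C p = - (C p ** (C p ** Cz))"
      by (simp only: matrix_mul_assoc[symmetric] mult_minus)
    then have "A ** C p + A ** C p = - (C p ** A) + - (C p ** A)"
      by (simp only: CzA matrix_add_rdistrib matrix_add_ldistrib minus_add_distrib)
    then have "(A ** C p + A ** C p) $ a $ b = (- (C p ** A) + - (C p ** A)) $ a $ b" for a b by simp
    then show ?thesis by (simp add: vec_eq_iff)
  qed
  \<comment> \<open>\<open>A\<close> anticommutes with \<open>C\<close>, hence exchanges the
    eigenspaces of \<open>C\<close> and has no component between legs of equal parity.\<close>
  have parity: "Q j p ** A ** Q i p = 0" if "even (i - j)"
  proof -
    have "Q j p ** (A ** C p) ** Q i p = - (Q j p ** (C p ** A) ** Q i p)"
      by (simp add: AC mult_minus minus_mult)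
    moreover have "Q j p ** (A ** C p) ** Q i p = Q j p ** A ** (C p ** Q i p)"
      "Q j p ** (C p ** A) ** Q i p = (Q j p ** C p) ** A ** Q i p"
      by (simp_all only: matrix_mul_assoc)
    ultimately have e: "Q j p ** A ** (C p ** Q i p) = - ((Q j p ** C p) ** A ** Q i p)" by (simp only:)
    show ?thesis
    proof (cases "even i")
      case True
      then have "C p ** Q i p = Q i p" "Q j p ** C p = Q j p" using that by (simp_all add: C_Q' Q_C)
      from neg_self_eq_0[OF e[unfolded this]] show ?thesis .
    next
      case False
      then have "C p ** Q i p = - Q i p" "Q j p ** C p = - Q j p" using that by (simp_all add: C_Q' Q_C)
      from neg_self_eq_0[OF e[unfolded this mult_minus minus_mult minus_minus, symmetric]] show ?thesis .
    qed
  qed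
  \<comment> \<open>The adjoint exchanges dz and dbar and reverses the product C (dbar C);
    anticommutation of \<open>C\<close> with its derivative supplies the sign.\<close>
  have adjB: "adj B = - A"
  proof -
    have "adj B = (1/2) *\<^sub>R adj (C p ** mzb F w)" by (simp add: B vec_eq_iff)
    also have "adj (C p ** mzb F w) = Cz ** C p"
      using mz_adj[OF dF] by (simp add: adj_mult C_adj Cz_def F_def[abs_def])
    also have "\<dots> = - (C p ** Cz)" using FF by (simp add: eq_neg_iff_add_eq_0)
    finally show ?thesis by (simp add: A)
  qed
  have idem: "D k ** P k p + P k p ** D k = D k" for k
    using mz_mult(1)[OF dP dP, of k k] by (simp add: D_def inv proj_idem subspace_Zt)
  have flat: "D k ** (mat 1 - P k p) = P k p ** A ** (mat 1 - P k p)" for k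
  proof -
    have "(mat 1 - P k p) ** (mzb (\<lambda>w. P k (?inv w)) w + B ** P k p) = 0"
      using Zt_flat[OF c(1) w, of k] by (simp add: inv B_def)
    then have "adj ((mat 1 - P k p) ** (mzb (\<lambda>w. P k (?inv w)) w + B ** P k p)) = adj 0" by simp
    moreover have "adj (0 :: complex^7^7) = 0" by (simp add: vec_eq_iff)
    moreover have "adj (mzb (\<lambda>w. P k (?inv w)) w) = D k"
      using mz_adj[OF dP[of k]] by (simp add: D_def proj_adj subspace_Zt)
    ultimately have "(D k - P k p ** A) ** (mat 1 - P k p) = 0"
      by (simp add: adj_mult adj_add adj_diff proj_adj subspace_Zt adjB mult_minus)
    then show ?thesis by (simp add: matrix_diff_left_distrib)
  qed
  \<comment> \<open>The derivative of C P = P C, multiplied by \<open>C\<close> from the left, with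
    C (dz C) replaced by 2 A.\<close>
  have comm: "C p ** D k ** C p + (P k p ** A + P k p ** A) = (A ** P k p + A ** P k p) + D k" for k
  proof -
    have "mz (\<lambda>w. F w ** P k (?inv w)) w = mz (\<lambda>w. P k (?inv w) ** F w) w"
      by (simp add: F_def P_C_commute)
    then have "Cz ** P k p + C p ** D k = D k ** C p + P k p ** Cz"
      using mz_mult(1)[OF dF dP[of k]] mz_mult(1)[OF dP[of k] dF] by (simp add: Cz_def D_def Fw inv)
    then have "C p ** (Cz ** P k p + C p ** D k) = C p ** (D k ** C p + P k p ** Cz)" by simp
    then have "(C p ** Cz) ** P k p + (C p ** C p) ** D k = C p ** D k ** C p + (C p ** P k p) ** Cz"
      by (simp only: matrix_add_ldistrib matrix_mul_assoc)
    also have "(C p ** P k p) ** Cz = P k p ** (C p ** Cz)"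
      by (simp only: P_C_commute matrix_mul_assoc)
    finally show ?thesis
      by (simp only: CzA C_involution matrix_add_ldistrib matrix_add_rdistrib matrix_mul_lid)
  qed
  \<comment> \<open>\<open>A\<close> raises the filtration, so it carries the leg i into the term i
    + 1, which every \<open>Q j p\<close> with j \<le> i annihilates.\<close>
  have shift: "Q j p ** A ** Q i p = 0" if "j \<le> i"
  proof -
    have "A ** P i p = P (i + 1) p ** (A ** P i p)"
    proof -
      have "A *v (P i p *v v) = P (i + 1) p *v (A *v (P i p *v v))" for v
        by (rule proj_id[OF subspace_Zt, symmetric])
          (unfold A_def, rule Zt_shift[OF c proj_in[OF subspace_Zt]])
      then show ?thesis by (simp add: matrix_eq flip: matrix_vector_mul_assoc)
    qed
    moreover have "Q j p ** A ** Q i p = Q j p ** (A ** P i p) ** Q i p"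
      by (simp add: P_Q flip: matrix_mul_assoc)
    ultimately have "Q j p ** A ** Q i p = Q j p ** (P (i + 1) p ** (A ** P i p)) ** Q i p" by (simp only:)
    also have "\<dots> = (Q j p ** P (i + 1) p) ** (A ** P i p) ** Q i p" by (simp only: matrix_mul_assoc)
    also have "Q j p ** P (i + 1) p = 0" using that by (simp add: Q_P)
    finally show ?thesis by simp
  qed
  \<comment> \<open>The leg i lies in the kernel of \<open>P (i + 1) p\<close>, and on this kernel
    flatness gives the derivative of the projection explicitly.\<close>
  have next_: "Q j p ** D (i + 1) ** Q i p = Q j p ** P (i + 1) p ** A ** Q i p"
  proof -
    have Q: "(mat 1 - P (i + 1) p) ** Q i p = Q i p"
      by (simp add: matrix_diff_left_distrib P_Q)
    have "Q j p ** D (i + 1) ** Q i p = Q j p ** (D (i + 1) ** (mat 1 - P (i + 1) p)) ** Q i p"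
      using Q by (simp flip: matrix_mul_assoc)
    also have "\<dots> = Q j p ** (P (i + 1) p ** A ** (mat 1 - P (i + 1) p)) ** Q i p" by (simp only: flat)
    also have "\<dots> = Q j p ** P (i + 1) p ** A ** ((mat 1 - P (i + 1) p) ** Q i p)"
      by (simp only: matrix_mul_assoc)
    finally show ?thesis by (simp only: Q)
  qed
  have dzQ: "dz (U, z) (Q i) p = D i - D (i + 1)"
    unfolding dz_eq_mz Q_def w_def[symmetric] D_def by (rule mz_add(3)[OF dP dP])
  \<comment> \<open>Of the forbidden components, those with i < j have even difference: both legs
    lie in the range of \<open>P i p\<close>, where differentiating an idempotent gives no
    component, and the other term is a component of \<open>A\<close> excluded by parity. Those with
    j < i have odd difference: modulo components excluded by the shift, conjugation by
    \<open>C\<close> reproduces the component and also reverses its sign.\<close>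
  have "Q j p ** D i ** Q i p = 0 \<and> Q j p ** D (i + 1) ** Q i p = 0"
  proof (cases "i < j")
    case True
    then have even: "even (i - j)" using assms(4) by (auto simp: J2_type10_def)
    have PP: "P i p ** (P i p ** X) = P i p ** X" for X
      by (simp add: matrix_mul_assoc proj_idem subspace_Zt)
    have "P i p ** (D i ** P i p + P i p ** D i) ** P i p = P i p ** D i ** P i p" by (simp only: idem)
    then have PDP: "P i p ** D i ** P i p = 0"
      by (simp add: matrix_add_ldistrib matrix_add_rdistrib PP proj_idem subspace_Zt flip: matrix_mul_assoc)
    have "Q j p ** D i ** Q i p = (Q j p ** P i p) ** D i ** (P i p ** Q i p)"
      using True by (simp add: Q_P P_Q)
    also have "\<dots> = Q j p ** (P i p ** D i ** P i p) ** Q i p" by (simp only: matrix_mul_assoc)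
    finally have "Q j p ** D i ** Q i p = 0" by (simp add: PDP)
    moreover have "Q j p ** P (i + 1) p = Q j p" using True by (simp add: Q_P)
    ultimately show ?thesis using next_ parity[OF even] by simp
  next
    case False
    then have ij: "j < i" "odd (i - j)" using assms(3,4) by (auto simp: J2_type10_def)
    have "Q j p ** P (i + 1) p = 0" using ij by (simp add: Q_P)
    then have 1: "Q j p ** D (i + 1) ** Q i p = 0" using next_ by simp
    have QP: "Q j p ** P i p = 0" and PQ: "P i p ** Q i p = Q i p" using ij by (simp_all add: Q_P P_Q)
    have "Q j p ** (C p ** D i ** C p + (P i p ** A + P i p ** A)) ** Q i p =
        Q j p ** ((A ** P i p + A ** P i p) + D i) ** Q i p" by (simp only: comm)
    then have "(Q j p ** C p) ** D i ** (C p ** Q i p) + ((Q j p ** P i p) ** A ** Q i p + (Q j p ** P i p) ** A ** Q i p) =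
        (Q j p ** A ** (P i p ** Q i p) + Q j p ** A ** (P i p ** Q i p)) + Q j p ** D i ** Q i p"
      by (simp only: matrix_add_ldistrib matrix_add_rdistrib matrix_mul_assoc)
    then have e: "(Q j p ** C p) ** D i ** (C p ** Q i p) = Q j p ** D i ** Q i p"
      using shift ij(1) by (simp add: QP PQ)
    have "Q j p ** D i ** Q i p = 0"
    proof (cases "even i")
      case True
      then have "C p ** Q i p = Q i p" "Q j p ** C p = - Q j p" using ij(2) by (simp_all add: C_Q' Q_C)
      from neg_self_eq_0[OF e[unfolded this mult_minus minus_mult, symmetric]] show ?thesis .
    next
      case False
      then have "C p ** Q i p = - Q i p" "Q j p ** C p = Q j p" using ij(2) by (simp_all add: C_Q' Q_C)
      from neg_self_eq_0[OF e[unfolded this mult_minus minus_mult, symmetric]] show ?thesis .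
    qed
    then show ?thesis using 1 by simp
  qed
  then show ?thesis
    by (simp add: dzQ matrix_diff_left_distrib matrix_diff_right_distrib)
qed

lemma J2_holomorphic_lift_N: "J2_holomorphic_lift atlas s \<phi> N"
  unfolding J2_holomorphic_lift_def J2_holomorphic_def proj_N
  using N_G2_flag smooth_map_Q derivative_components span_even by (auto simp: split_beta)

section \<open>Nilpotency of A_z\<close>

lemma A_power:
  assumes c: "(U, z) \<in> atlas" "p \<in> U" and v: "v \<in> Zt i p"
  shows "(((*v) (A_z (U, z) \<phi> p)) ^^ n) v \<in> Zt (i + int n) p"
proof (induction n)
  case (Suc n)
  from Zt_shift[OF c Suc] show ?case by (simp add: ac_simps)
qed (simp add: v)

lemma nilconformal: "nilconformal atlas \<phi>"
  unfolding nilconformal_def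
\<comment> \<open>Seven steps lead from the term -3, which is everything, to the term 4, which is
  zero.\<close>
proof (intro exI[of _ 7], safe)
  fix U z p v assume c: "(U, z) \<in> atlas" "p \<in> U"
  have "v \<in> Zt (-3) p" using s by (subst Zt_low) auto
  from A_power[OF c this, of 7] have "(((*v) (A_z (U, z) \<phi> p)) ^^ 7) v \<in> Zt 4 p" by simp
  moreover have "Zt 4 p = {0}" using s by (intro Zt_high) auto
  ultimately show "(((*v) (A_z (U, z) \<phi> p)) ^^ 7) v = 0" by simp
qed

text \<open>The bundle named in \<open>s_number\<close> is the sum of the legs of parity opposite to
  s, so it misses the leg -s and lies in the term 1 - s. From there 2 s applications of A_z reach
  the term s + 1, which is zero.\<close>

lemma s_number_le: "int (s_number atlas \<phi>) \<le> s"
proof -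
  have nat: "int (nat s) = s" "0 < nat s" "odd (nat s) \<longleftrightarrow> odd s" using s by (auto simp: even_nat_iff)
  have "(((*v) (A_z (U, z) \<phi> p)) ^^ (2 * nat s)) v = 0"
    if c: "(U, z) \<in> atlas" "p \<in> U" and v: "v \<in> (if odd s then \<phi> p else perp (\<phi> p))" for U z p v
  proof -
    have "Q (- s) p *v v = 0"
    proof (cases "odd s")
      case True
      then have "Q (- s) p ** proj (\<phi> p) = 0"
        using arg_cong[OF proj_\<phi>_Q[of p "- s"], of adj]
        by (simp add: adj_mult Q_adj proj_adj subspace_\<phi>) (simp add: vec_eq_iff)
      moreover have "proj (\<phi> p) *v v = v" using v True by (simp add: proj_id subspace_\<phi>)
      ultimately show ?thesis by (metis matrix_vector_mul_assoc matrix_vector_mult_0)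
    next
      case False
      then have "adj (proj (\<phi> p) ** Q (- s) p) = adj (Q (- s) p)" by (simp add: proj_\<phi>_Q)
      then have "Q (- s) p ** proj (\<phi> p) = Q (- s) p"
        by (simp add: adj_mult Q_adj proj_adj subspace_\<phi>)
      moreover have "proj (\<phi> p) *v v = 0" using v False by (simp add: proj_zero subspace_\<phi>)
      ultimately show ?thesis by (metis matrix_vector_mul_assoc matrix_vector_mult_0_right)
    qed
    then have "P (1 - s) p *v v = v"
      by (simp add: Q_def P_low matrix_vector_mult_diff_rdistrib)
    then have "v \<in> Zt (1 - s) p" by (simp add: mem_proj_iff subspace_Zt)
    from A_power[OF c this, of "2 * nat s"]
    have "(((*v) (A_z (U, z) \<phi> p)) ^^ (2 * nat s)) v \<in> Zt (s + 1) p" using nat by simp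
    then show ?thesis by (simp add: Zt_high)
  qed
  then have "s_number atlas \<phi> \<le> nat s"
    unfolding s_number_def by (intro Least_le) (use nat in \<open>auto simp: split_beta\<close>)
  then show ?thesis using nat by linarith
qed

end

theorem theorem6p1:
  fixes atlas :: "'m::{t2_space,second_countable_topology} chart set"
    and \<phi> :: "'m \<Rightarrow> (complex^7) set"
    and \<Phi> :: "'m \<Rightarrow> complex \<Rightarrow> complex^7^7"
    and s :: int
  assumes "riemann_surface atlas"
    and "harmonic_map atlas \<phi>"
    and "finite_uniton_number atlas \<phi>"
    and "extended_solution atlas \<phi> \<Phi>"
    and "polynomial_loops \<Phi>"
    and "\<forall>p. \<Phi> p (-1) = cartan (\<phi> p)"
    and symmetric: "symmetric_loops \<Phi>"
    and "s \<in> {1, 2, 3}"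
    and "W_between \<Phi> s"
    and "\<forall>k. W_between \<Phi> k \<longrightarrow> s \<le> k"
    and nondegenerate: "s = 3 \<Longrightarrow> except_isolated (\<lambda>p. Z_fibre \<Phi> 2 p \<noteq> Z_fibre \<Phi> 3 p)"
  shows "(\<exists>!\<psi>. canonical_lift atlas \<Phi> s \<psi>) \<and>
         (\<forall>\<psi>. canonical_lift atlas \<Phi> s \<psi> \<longrightarrow> J2_holomorphic_lift atlas s \<phi> \<psi>) \<and>
         nilconformal atlas \<phi> \<and> int (s_number atlas \<phi>) \<le> s"
proof -
  interpret lift_setup atlas \<phi> \<Phi> s
  proof (rule lift_setup.intro)
    show "riemann atlas" by (rule riemann.intro) (rule assms(1))
    show "lift_setup_axioms atlas \<phi> \<Phi> s"
    proof (rule lift_setup_axioms.intro)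
      show "\<phi> p \<in> G2_SO4" for p using assms(2) by (simp add: harmonic_map_def)
    qed (use assms in auto)
  qed
  have "\<exists>!\<psi>. canonical_lift atlas \<Phi> s \<psi>"
    using canonical_lift_N canonical_lift_unique by (rule ex1I)
  moreover have "J2_holomorphic_lift atlas s \<phi> \<psi>" if "canonical_lift atlas \<Phi> s \<psi>" for \<psi>
    using J2_holomorphic_lift_N by (simp only: canonical_lift_unique[OF that])
  ultimately show ?thesis using nilconformal s_number_le by blast
qed

end
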